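(* Let $X$ be a K3-surface of one of the following types: $X_4=\{f_4=0\}\subset\mathbb{CP}^3$, $X_{32}=\{f_3=g_2=0\}\subset\mathbb{CP}^4$, or $X_{222}=\{f_2=g_2=h_2=0\}\subset\mathbb{CP}^5$ (complete intersections of homogeneous polynomials, subscripts denoting degrees). Let $p:\mathcal{O}_X\times\mathcal{O}_X\to\mathcal{O}_X$ be the global bilinear mapping given by the normalized Jacobian determinants described in the context. Then $p$ is a global Poisson bracket on $X$. The first obstruction vanishes for this bracket, i.e. $\mathrm{ob}^0(p)=0$ in $\Gamma(X,\mathcal{T}^2(\mathcal{O}_X))$ and $\mathrm{ob}^1(p)=0$ in $H^1(X,\mathcal{Q}_X)$.
   Context: K3-surface: a compact complex analytic 2-manifold with trivial canonical bundle (in the sense of Kodaira's classification). The mapping $p$. Let $X\subset\mathbb{CP}^N$ be defined by homogeneous polynomials $F_1,\dots,F_r$, where $(N;F_1,\dots,F_r)$ is $(3;f_4)$, $(4;f_3,g_2)$ or $(5;f_2,g_2,h_2)$, so $r=N-2$. Let $z_0,\dots,z_N$ be homogeneous coordinates. Local sections $a,b$ of $\mathcal{O}_X$ are represented by local holomorphic functions of $z$ homogeneous of degree $0$. For a permutation $(i_1,\dots,i_N,m)$ of $(0,1,\dots,N)$ with sign $\varepsilon$, on the domain $z_m\ne 0$ of $X$ the mapping is $$p(a,b)=\varepsilon\, z_m^{-1}\,\frac{\partial(F_1,\dots,F_r,a,b)}{\partial(z_{i_1},\dots,z_{i_N})}\Big|_X .$$ These expressions agree on the common domains and define the global mapping $p$.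 A Poisson bracket on $X$ is a $\mathbb{C}$-bilinear skew-symmetric (locally bounded) mapping $p:\mathcal{O}_X\times\mathcal{O}_X\to\mathcal{O}_X$ satisfying the Hochschild cocycle equation $ap(b,c)-p(ab,c)+p(a,bc)-p(a,b)c=0$ and the Jacobi identity $p(p(a,b),c)+p(p(b,c),a)+p(p(c,a),b)=0$. $\mathcal{Q}_X$ is the sheaf of germs of skew-symmetric bounded Hochschild 2-cocycles $\mathcal{O}_X\times\mathcal{O}_X\to\mathcal{O}_X$; on a complex manifold it is $\wedge^2$ of the holomorphic tangent sheaf. Obstructions. $\mathcal{T}^2(\mathcal{O}_X)$ is the coherent sheaf with stalks $T^2(\mathcal{O}_{X,x})$, where $T^2(A)$ is the second Tyurina cohomology of the analytic algebra $A$: if $R^*=R_n[e_1,e_2,\dots]$ is a free graded commutative algebra over the convergent power series algebra $R_n$, with finitely many generators in each degree, all of positive degree, with a derivation $\rho$ of degree $-1$, $\rho^2=0$, whose homology is $A$ in degree $0$ and zero otherwise, then $T^i(A)=H^i(\mathrm{Der}(R^*,A))$. One has $T^2(A)\cong\mathrm{Harr}^3(A,A)$, the analytic Harrison cohomology. With $[p,p](a,b,c)=p(p(a,b),c)-p(a,p(b,c))$ and $e_1$ the projector $(e_1h)(a,b,c)=\frac16[2h(a,b,c)-2h(c,b,a)+h(a,c,b)-h(b,c,a)+h(b,a,c)-h(c,a,b)]$, $\mathrm{ob}^0(p)$ is the section of $\mathcal{T}^2(\mathcal{O}_X)$ given by the class of $e_1[p,p]$. When $\mathrm{ob}^0(p)=0$,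 $\mathrm{ob}^1(p)\in H^1(X,\mathcal{Q}_X)$ is the Čech class of the differences $p_{2\alpha}-p_{2\beta}$ of local bounded bilinear solutions $p_{2\alpha}$, on the members of a sufficiently fine open covering, of $[p,p]=\partial p_{2\alpha}$, where $\partial p_2(a,b,c)=ap_2(b,c)-p_2(ab,c)+p_2(a,bc)-p_2(a,b)c$. *)

theory Defs
  imports
    "HOL-Analysis.Analysis"
    "HOL-Combinatorics.Permutations"
    "HOL-Algebra.Module"
    "HOL-Algebra.Coset"
    "Jordan_Normal_Form.Determinant"
begin

section \<open>Projective complete intersections and their structure sheaf\<close>

definition homogeneous_poly :: "nat \<Rightarrow> (complex^'n \<Rightarrow> complex) \<Rightarrow> bool" where
  "homogeneous_poly d f \<longleftrightarrow>
     (\<exists>c :: ('n \<Rightarrow> nat) \<Rightarrow> complex. \<forall>z.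
        f z = (\<Sum>\<alpha> | (\<Sum>i\<in>UNIV. \<alpha> i) = d. c \<alpha> * (\<Prod>i\<in>UNIV. vec_nth z i ^ \<alpha> i)))"

definition holo_on :: "(complex^'n \<Rightarrow> complex) \<Rightarrow> (complex^'n) set \<Rightarrow> bool" where
  "holo_on f W \<longleftrightarrow> open W \<and>
     (\<forall>z\<in>W. \<exists>f'. (f has_derivative f') (at z) \<and> (\<forall>c v. f' (c *s v) = c * f' v))"

definition pd :: "(complex^'n \<Rightarrow> complex) \<Rightarrow> 'n \<Rightarrow> complex^'n \<Rightarrow> complex" where
  "pd f i z = deriv (\<lambda>t. f (z + axis i t)) 0"

definition conic :: "(complex^'n) set \<Rightarrow> bool" where
  "conic U \<longleftrightarrow> (\<forall>z\<in>U. \<forall>c. c \<noteq> 0 \<longrightarrow> c *s z \<in> U)"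

definition homogeneous0_on :: "(complex^'n) set \<Rightarrow> (complex^'n \<Rightarrow> complex) \<Rightarrow> bool" where
  "homogeneous0_on U f \<longleftrightarrow> (\<forall>z\<in>U. \<forall>c. c \<noteq> 0 \<longrightarrow> f (c *s z) = f z)"

text \<open>A subset of projective space is represented throughout by its punctured cone: the set of all
  vectors of homogeneous coordinates of its points.\<close>

definition proj_zero_set :: "(complex^'n \<Rightarrow> complex) list \<Rightarrow> (complex^'n) set" where
  "proj_zero_set Fs = {z. z \<noteq> 0 \<and> (\<forall>F\<in>set Fs. F z = 0)}"

definition openX :: "(complex^'n) set \<Rightarrow> (complex^'n) set \<Rightarrow> bool" where
  "openX X U \<longleftrightarrow> openin (top_of_set X) U \<and> conic U"

definition local_rep ::
  "(complex^'n) set \<Rightarrow> (complex^'n \<Rightarrow> complex) \<Rightarrow> complex^'n \<Rightarrow> (complex^'n \<Rightarrow> complex) \<Rightarrow> bool" where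
  "local_rep U a z A \<longleftrightarrow>
     (\<exists>W. z \<in> W \<and> conic W \<and> holo_on A W \<and> homogeneous0_on W A \<and> (\<forall>x\<in>W \<inter> U. A x = a x))"

text \<open>The sections of the structure sheaf over \<open>U\<close>, as functions of the homogeneous coordinates.
  A section is extended by \<open>0\<close> outside \<open>U\<close>, so that equality of sections is equality of functions
  and restriction is \<open>restr\<close>.\<close>

definition sections :: "(complex^'n) set \<Rightarrow> (complex^'n \<Rightarrow> complex) set" where
  "sections U = {a. (\<forall>z. z \<notin> U \<longrightarrow> a z = 0) \<and> homogeneous0_on U a \<and> (\<forall>z\<in>U. \<exists>A. local_rep U a z A)}"

definition restr :: "(complex^'n) set \<Rightarrow> (complex^'n \<Rightarrow> complex) \<Rightarrow> (complex^'n \<Rightarrow> complex)" where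
  "restr V a = (\<lambda>z. if z \<in> V then a z else 0)"

text \<open>Bounded sets of sections. A compact subset of \<open>U / \<complex>\<^sup>*\<close> is the image of a compact set of
  coordinate vectors (normalise the vectors to norm one), so it suffices to let \<open>K\<close> range over
  compact subsets of the cone.\<close>

definition bounded_sections :: "(complex^'n) set \<Rightarrow> (complex^'n \<Rightarrow> complex) set \<Rightarrow> bool" where
  "bounded_sections U B \<longleftrightarrow> B \<subseteq> sections U \<and>
     (\<forall>K. compact K \<and> K \<subseteq> U \<longrightarrow> (\<exists>M. \<forall>a\<in>B. \<forall>z\<in>K. cmod (a z) \<le> M))"


section \<open>K3-surfaces\<close>

text \<open>Linear independence of the differentials of the equations along the zero set: the analytic
  space defined by \<open>Fs\<close> is then reduced, and a complex manifold of codimension \<open>length Fs\<close>.\<close>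

definition smooth_complete_intersection :: "(complex^'n \<Rightarrow> complex) list \<Rightarrow> bool" where
  "smooth_complete_intersection Fs \<longleftrightarrow>
     (\<forall>z\<in>proj_zero_set Fs. \<forall>c.
        (\<forall>i. (\<Sum>j<length Fs. c j * pd (Fs ! j) i z) = 0) \<longrightarrow> (\<forall>j<length Fs. c j = 0))"

text \<open>The tangent space at \<open>z\<close> of the punctured cone; it contains the radial direction \<open>z\<close>.\<close>

definition tangent_space :: "(complex^'n \<Rightarrow> complex) list \<Rightarrow> complex^'n \<Rightarrow> (complex^'n) set" where
  "tangent_space Fs z = {v. \<forall>F\<in>set Fs. (\<Sum>i\<in>UNIV. pd F i z * vec_nth v i) = 0}"

text \<open>Holomorphic 2-forms on the projective variety, as their pull-backs to the punctured cone:
  those holomorphic 2-forms of the cone which are invariant under the scalars and annihilate the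
  radial direction.\<close>

definition holo_2form ::
  "(complex^'n \<Rightarrow> complex) list \<Rightarrow> (complex^'n \<Rightarrow> complex^'n \<Rightarrow> complex^'n \<Rightarrow> complex) \<Rightarrow> bool" where
  "holo_2form Fs \<omega> \<longleftrightarrow>
     (\<forall>z\<in>proj_zero_set Fs. \<exists>W g. z \<in> W \<and> (\<forall>i j. holo_on (g i j) W) \<and>
        (\<forall>x\<in>W \<inter> proj_zero_set Fs. \<forall>v\<in>tangent_space Fs x. \<forall>w\<in>tangent_space Fs x.
           \<omega> x v w = (\<Sum>i\<in>UNIV. \<Sum>j\<in>UNIV.
              g i j x * (vec_nth v i * vec_nth w j - vec_nth v j * vec_nth w i)))) \<and>
     (\<forall>z\<in>proj_zero_set Fs. \<forall>w\<in>tangent_space Fs z. \<omega> z z w = 0) \<and>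
     (\<forall>z\<in>proj_zero_set Fs. \<forall>c. c \<noteq> 0 \<longrightarrow>
        (\<forall>v\<in>tangent_space Fs z. \<forall>w\<in>tangent_space Fs z. \<omega> (c *s z) (c *s v) (c *s w) = \<omega> z v w))"

definition trivial_canonical_bundle :: "(complex^'n \<Rightarrow> complex) list \<Rightarrow> bool" where
  "trivial_canonical_bundle Fs \<longleftrightarrow>
     (\<exists>\<omega>. holo_2form Fs \<omega> \<and>
        (\<forall>z\<in>proj_zero_set Fs. \<exists>v\<in>tangent_space Fs z. \<exists>w\<in>tangent_space Fs z. \<omega> z v w \<noteq> 0))"

text \<open>The dimension is two: \<open>CARD('n)\<close> homogeneous coordinates and \<open>CARD('n) - 3\<close> equations.
  Compactness is automatic.\<close>

definition K3_complete_intersection :: "(complex^'n \<Rightarrow> complex) list \<Rightarrow> bool" where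
  "K3_complete_intersection Fs \<longleftrightarrow>
     CARD('n) = length Fs + 3 \<and> smooth_complete_intersection Fs \<and> trivial_canonical_bundle Fs"


section \<open>Bilinear mappings of the structure sheaf\<close>

text \<open>A mapping \<open>\<O> \<times> \<O> \<rightarrow> \<O>\<close> of sheaves is given by its action \<open>q U\<close> on the sections
  over every open \<open>U\<close>.\<close>

type_synonym 'n sheaf_map =
  "(complex^'n) set \<Rightarrow> (complex^'n \<Rightarrow> complex) \<Rightarrow> (complex^'n \<Rightarrow> complex) \<Rightarrow> (complex^'n \<Rightarrow> complex)"

text \<open>Bounded bilinear mappings of the structure sheaf of the open set \<open>S\<close>.\<close>

definition bilinear_map_on :: "(complex^'n) set \<Rightarrow> (complex^'n) set \<Rightarrow> 'n sheaf_map \<Rightarrow> bool" where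
  "bilinear_map_on X S q \<longleftrightarrow>
     (\<forall>U. openX X U \<and> U \<subseteq> S \<longrightarrow>
        (\<forall>a\<in>sections U. \<forall>b\<in>sections U.
           q U a b \<in> sections U \<and>
           (\<forall>V. openX X V \<and> V \<subseteq> U \<longrightarrow> q V (restr V a) (restr V b) = restr V (q U a b)) \<and>
           (\<forall>c. \<forall>a'\<in>sections U.
              q U (\<lambda>z. c * a z + a' z) b = (\<lambda>z. c * q U a b z + q U a' b z) \<and>
              q U b (\<lambda>z. c * a z + a' z) = (\<lambda>z. c * q U b a z + q U b a' z))) \<and>
        (\<forall>B C. bounded_sections U B \<and> bounded_sections U C \<longrightarrow>
           bounded_sections U {q U a b | a b. a \<in> B \<and> b \<in> C}))"

definition skew_on :: "(complex^'n) set \<Rightarrow> (complex^'n) set \<Rightarrow> 'n sheaf_map \<Rightarrow> bool" where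
  "skew_on X S q \<longleftrightarrow>
     (\<forall>U. openX X U \<and> U \<subseteq> S \<longrightarrow>
        (\<forall>a\<in>sections U. \<forall>b\<in>sections U. q U a b = (\<lambda>z. - q U b a z)))"

definition hochschild_d :: "'n sheaf_map \<Rightarrow> (complex^'n) set \<Rightarrow> (complex^'n \<Rightarrow> complex) \<Rightarrow>
    (complex^'n \<Rightarrow> complex) \<Rightarrow> (complex^'n \<Rightarrow> complex) \<Rightarrow> (complex^'n \<Rightarrow> complex)" where
  "hochschild_d q U a b c = (\<lambda>z. a z * q U b c z - q U (\<lambda>x. a x * b x) c z
      + q U a (\<lambda>x. b x * c x) z - q U a b z * c z)"

definition hochschild_cocycle_on :: "(complex^'n) set \<Rightarrow> (complex^'n) set \<Rightarrow> 'n sheaf_map \<Rightarrow> bool" where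
  "hochschild_cocycle_on X S q \<longleftrightarrow>
     (\<forall>U. openX X U \<and> U \<subseteq> S \<longrightarrow>
        (\<forall>a\<in>sections U. \<forall>b\<in>sections U. \<forall>c\<in>sections U. hochschild_d q U a b c = (\<lambda>_. 0)))"

definition poisson_bracket :: "(complex^'n) set \<Rightarrow> 'n sheaf_map \<Rightarrow> bool" where
  "poisson_bracket X p \<longleftrightarrow>
     bilinear_map_on X X p \<and> skew_on X X p \<and> hochschild_cocycle_on X X p \<and>
     (\<forall>U. openX X U \<longrightarrow>
        (\<forall>a\<in>sections U. \<forall>b\<in>sections U. \<forall>c\<in>sections U. \<forall>z.
           p U (p U a b) c z + p U (p U b c) a z + p U (p U c a) b z = 0))"


section \<open>The bracket given by normalized Jacobian determinants\<close>

text \<open>The homogeneous coordinates are \<open>z\<^sub>k = vec_nth z (\<iota> k)\<close>, \<open>k \<le> N = length Fs + 2\<close>, for a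
  bijection \<open>\<iota>\<close>, and the permutation \<open>(i\<^sub>1, \<dots>, i\<^sub>N, m)\<close> is \<open>(\<sigma> 0, \<dots>, \<sigma> (N-1), \<sigma> N)\<close>.\<close>

definition jacobian_expr :: "(nat \<Rightarrow> 'n) \<Rightarrow> (complex^'n \<Rightarrow> complex) list \<Rightarrow> (nat \<Rightarrow> nat) \<Rightarrow>
    (complex^'n \<Rightarrow> complex) \<Rightarrow> (complex^'n \<Rightarrow> complex) \<Rightarrow> complex^'n \<Rightarrow> complex" where
  "jacobian_expr \<iota> Fs \<sigma> A B z = (let N = length Fs + 2 in
     of_int (sign \<sigma>) * inverse (vec_nth z (\<iota> (\<sigma> N))) *
     Determinant.det (Matrix.mat N N (\<lambda>(k, l). pd ((Fs @ [A, B]) ! k) (\<iota> (\<sigma> l)) z)))"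

text \<open>The common value of the expressions for all admissible permutations and all local
  representatives of the two sections.\<close>

definition jacobian_bracket :: "(nat \<Rightarrow> 'n) \<Rightarrow> (complex^'n \<Rightarrow> complex) list \<Rightarrow> 'n sheaf_map" where
  "jacobian_bracket \<iota> Fs U a b = restr U (\<lambda>z. THE v.
     \<forall>\<sigma> A B. \<sigma> permutes {..length Fs + 2} \<and> vec_nth z (\<iota> (\<sigma> (length Fs + 2))) \<noteq> 0 \<and>
        local_rep U a z A \<and> local_rep U b z B \<longrightarrow> v = jacobian_expr \<iota> Fs \<sigma> A B z)"


section \<open>Analytic Harrison cohomology\<close>

text \<open>Commutative complex algebras together with a family of bounded sets.\<close>

record 'b born_algebra = "(complex, 'b) module" +
  bornology :: "'b set set"

definition cube :: "('b, 'm) ring_scheme \<Rightarrow> ('b \<times> 'b \<times> 'b) set" where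
  "cube A = carrier A \<times> carrier A \<times> carrier A"

context
  fixes A :: "('b, 'm) born_algebra_scheme" (structure)
begin

definition linear_in :: "('b \<Rightarrow> 'b) \<Rightarrow> bool" where
  "linear_in f \<longleftrightarrow> (\<forall>x\<in>carrier A. \<forall>y\<in>carrier A. \<forall>t.
     f x \<in> carrier A \<and> f ((t \<odot> x) \<oplus> y) = (t \<odot> f x) \<oplus> f y)"

definition bilinear_cochain :: "('b \<Rightarrow> 'b \<Rightarrow> 'b) \<Rightarrow> bool" where
  "bilinear_cochain h \<longleftrightarrow>
     (\<forall>a\<in>carrier A. linear_in (\<lambda>x. h a x) \<and> linear_in (\<lambda>x. h x a)) \<and>
     (\<forall>B\<in>bornology A. \<forall>C\<in>bornology A. {h b c | b c. b \<in> B \<and> c \<in> C} \<in> bornology A)"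

definition trilinear_cochain :: "('b \<times> 'b \<times> 'b \<Rightarrow> 'b) \<Rightarrow> bool" where
  "trilinear_cochain f \<longleftrightarrow> f \<in> extensional (cube A) \<and>
     (\<forall>a\<in>carrier A. \<forall>b\<in>carrier A.
        linear_in (\<lambda>x. f (x, a, b)) \<and> linear_in (\<lambda>x. f (a, x, b)) \<and> linear_in (\<lambda>x. f (a, b, x))) \<and>
     (\<forall>B\<in>bornology A. \<forall>C\<in>bornology A. \<forall>D\<in>bornology A.
        {f (b, c, d) | b c d. b \<in> B \<and> c \<in> C \<and> d \<in> D} \<in> bornology A)"

definition hoch_d2 :: "('b \<Rightarrow> 'b \<Rightarrow> 'b) \<Rightarrow> 'b \<times> 'b \<times> 'b \<Rightarrow> 'b" where
  "hoch_d2 h = restrict (\<lambda>(a, b, c).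
     a \<otimes> h b c \<ominus> h (a \<otimes> b) c \<oplus> h a (b \<otimes> c) \<ominus> h a b \<otimes> c) (cube A)"

definition hoch_d3_zero :: "('b \<times> 'b \<times> 'b \<Rightarrow> 'b) \<Rightarrow> bool" where
  "hoch_d3_zero f \<longleftrightarrow> (\<forall>a\<in>carrier A. \<forall>b\<in>carrier A. \<forall>c\<in>carrier A. \<forall>d\<in>carrier A.
     a \<otimes> f (b, c, d) \<ominus> f (a \<otimes> b, c, d) \<oplus> f (a, b \<otimes> c, d) \<ominus> f (a, b, c \<otimes> d) \<oplus> f (a, b, c) \<otimes> d
       = \<zero>)"

definition harr_e1 :: "('b \<times> 'b \<times> 'b \<Rightarrow> 'b) \<Rightarrow> 'b \<times> 'b \<times> 'b \<Rightarrow> 'b" where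
  "harr_e1 h = restrict (\<lambda>(a, b, c). (1/6) \<odot>
     ((2 \<odot> h (a, b, c)) \<ominus> (2 \<odot> h (c, b, a)) \<oplus> h (a, c, b) \<ominus> h (b, c, a) \<oplus> h (b, a, c) \<ominus> h (c, a, b)))
     (cube A)"

text \<open>Harrison cochains are the images of the projectors \<open>e\<^sub>1\<close>; in degree two these are the
  symmetric cochains.\<close>

definition harr_Z3 :: "('b \<times> 'b \<times> 'b \<Rightarrow> 'b) monoid" where
  "harr_Z3 = \<lparr> carrier = {f. trilinear_cochain f \<and> harr_e1 f = f \<and> hoch_d3_zero f},
     mult = (\<lambda>f g. restrict (\<lambda>t. f t \<oplus> g t) (cube A)), one = restrict (\<lambda>t. \<zero>) (cube A) \<rparr>"

definition harr_B3 :: "('b \<times> 'b \<times> 'b \<Rightarrow> 'b) set" where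
  "harr_B3 = {hoch_d2 h | h. bilinear_cochain h \<and>
     (\<forall>a\<in>carrier A. \<forall>b\<in>carrier A. h a b = h b a)}"

definition Harr3 :: "('b \<times> 'b \<times> 'b \<Rightarrow> 'b) set monoid" where
  "Harr3 = harr_Z3 Mod harr_B3"

definition gerstenhaber_square :: "('b \<Rightarrow> 'b \<Rightarrow> 'b) \<Rightarrow> 'b \<times> 'b \<times> 'b \<Rightarrow> 'b" where
  "gerstenhaber_square q = restrict (\<lambda>(a, b, c). q (q a b) c \<ominus> q a (q b c)) (cube A)"

text \<open>The class of \<open>e\<^sub>1[q,q]\<close>.\<close>

definition harrison_obstruction :: "('b \<Rightarrow> 'b \<Rightarrow> 'b) \<Rightarrow> ('b \<times> 'b \<times> 'b \<Rightarrow> 'b) set" where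
  "harrison_obstruction q = harr_B3 #>\<^bsub>harr_Z3\<^esub> harr_e1 (gerstenhaber_square q)"

end


section \<open>Tyurina cohomology\<close>

text \<open>An element of the free graded commutative algebra \<open>R\<^sub>n[e\<^sub>1, e\<^sub>2, \<dots>]\<close> maps the exponent of a
  monomial in the generators to its coefficient, a power series in \<open>n\<close> variables, which in turn
  maps exponents to complex numbers.\<close>

type_synonym tyu_elem = "(nat \<Rightarrow> nat) \<Rightarrow> (nat \<Rightarrow> nat) \<Rightarrow> complex"

record 'b tyurina_data =
  nvars :: nat
  gens :: "nat set"
  gdeg :: "nat \<Rightarrow> nat"
  rho :: "tyu_elem \<Rightarrow> tyu_elem"
  aug :: "tyu_elem \<Rightarrow> 'b"

definition convergent_series :: "nat \<Rightarrow> ((nat \<Rightarrow> nat) \<Rightarrow> complex) set" where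
  "convergent_series n = {c. (\<forall>\<alpha>. c \<alpha> \<noteq> 0 \<longrightarrow> (\<forall>i\<ge>n. \<alpha> i = 0)) \<and>
     (\<exists>r>0. \<exists>M. \<forall>\<alpha>. cmod (c \<alpha>) * r ^ (\<Sum>i<n. \<alpha> i) \<le> M)}"

definition series_mult ::
  "((nat \<Rightarrow> nat) \<Rightarrow> complex) \<Rightarrow> ((nat \<Rightarrow> nat) \<Rightarrow> complex) \<Rightarrow> (nat \<Rightarrow> nat) \<Rightarrow> complex" where
  "series_mult c d \<gamma> = (\<Sum>(\<alpha>, \<beta>) | (\<lambda>i. \<alpha> i + \<beta> i) = \<gamma>. c \<alpha> * d \<beta>)"

definition gen_monomials :: "'b tyurina_data \<Rightarrow> (nat \<Rightarrow> nat) set" where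
  "gen_monomials R = {\<mu>. finite {i. \<mu> i \<noteq> 0} \<and> {i. \<mu> i \<noteq> 0} \<subseteq> gens R \<and>
     (\<forall>i. odd (gdeg R i) \<longrightarrow> \<mu> i \<le> 1)}"

definition monomial_deg :: "'b tyurina_data \<Rightarrow> (nat \<Rightarrow> nat) \<Rightarrow> nat" where
  "monomial_deg R \<mu> = (\<Sum>i | \<mu> i \<noteq> 0. \<mu> i * gdeg R i)"

definition tyu_carrier :: "'b tyurina_data \<Rightarrow> tyu_elem set" where
  "tyu_carrier R = {x. finite {\<mu>. x \<mu> \<noteq> (\<lambda>_. 0)} \<and> {\<mu>. x \<mu> \<noteq> (\<lambda>_. 0)} \<subseteq> gen_monomials R \<and>
     (\<forall>\<mu>. x \<mu> \<in> convergent_series (nvars R))}"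

definition tyu_part :: "'b tyurina_data \<Rightarrow> nat \<Rightarrow> tyu_elem set" where
  "tyu_part R k = {x \<in> tyu_carrier R. \<forall>\<mu>. x \<mu> \<noteq> (\<lambda>_. 0) \<longrightarrow> monomial_deg R \<mu> = k}"

text \<open>Monomials are ordered by increasing index of the generators; the sign counts the
  transpositions of odd generators needed to sort a product.\<close>

definition koszul_sign :: "'b tyurina_data \<Rightarrow> (nat \<Rightarrow> nat) \<Rightarrow> (nat \<Rightarrow> nat) \<Rightarrow> complex" where
  "koszul_sign R \<mu> \<nu> =
     (-1) ^ card {(i, j). j < i \<and> odd (gdeg R i) \<and> odd (gdeg R j) \<and> \<mu> i \<noteq> 0 \<and> \<nu> j \<noteq> 0}"

definition tyu_mult :: "'b tyurina_data \<Rightarrow> tyu_elem \<Rightarrow> tyu_elem \<Rightarrow> tyu_elem" where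
  "tyu_mult R x y \<mu> \<gamma> = (if \<mu> \<in> gen_monomials R
     then \<Sum>(\<mu>\<^sub>1, \<mu>\<^sub>2) | (\<lambda>i. \<mu>\<^sub>1 i + \<mu>\<^sub>2 i) = \<mu>. koszul_sign R \<mu>\<^sub>1 \<mu>\<^sub>2 * series_mult (x \<mu>\<^sub>1) (y \<mu>\<^sub>2) \<gamma>
     else 0)"

definition tyu_one :: tyu_elem where
  "tyu_one \<mu> \<alpha> = (if \<mu> = (\<lambda>_. 0) \<and> \<alpha> = (\<lambda>_. 0) then 1 else 0)"

definition tyu_lin :: "complex \<Rightarrow> tyu_elem \<Rightarrow> tyu_elem \<Rightarrow> tyu_elem" where
  "tyu_lin t x y = (\<lambda>\<mu> \<alpha>. t * x \<mu> \<alpha> + y \<mu> \<alpha>)"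

context
  fixes A :: "('b, 'm) born_algebra_scheme" (structure)
begin

text \<open>\<open>R\<close> with the differential \<open>rho\<close> is a free resolution of the algebra \<open>A\<close>, the isomorphism of
  the homology in degree zero with \<open>A\<close> being induced by \<open>aug\<close>.\<close>

definition tyurina_resolution :: "'b tyurina_data \<Rightarrow> bool" where
  "tyurina_resolution R \<longleftrightarrow>
     (\<forall>i\<in>gens R. gdeg R i > 0) \<and> (\<forall>k. finite {i \<in> gens R. gdeg R i = k}) \<and>
     (\<forall>x\<in>tyu_carrier R. \<forall>y\<in>tyu_carrier R. \<forall>t.
        rho R (tyu_lin t x y) = tyu_lin t (rho R x) (rho R y)) \<and>
     (\<forall>x\<in>tyu_part R 0. rho R x = (\<lambda>_ _. 0)) \<and>
     (\<forall>k. \<forall>x\<in>tyu_part R (Suc k). rho R x \<in> tyu_part R k) \<and>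
     (\<forall>k. \<forall>x\<in>tyu_part R k. \<forall>y\<in>tyu_carrier R.
        rho R (tyu_mult R x y) = tyu_lin ((-1) ^ k) (tyu_mult R x (rho R y)) (tyu_mult R (rho R x) y)) \<and>
     (\<forall>x\<in>tyu_carrier R. rho R (rho R x) = (\<lambda>_ _. 0)) \<and>
     (\<forall>k. \<forall>x\<in>tyu_part R (Suc k). rho R x = (\<lambda>_ _. 0) \<longrightarrow> x \<in> rho R ` tyu_part R (Suc (Suc k))) \<and>
     (\<forall>x\<in>tyu_carrier R. \<forall>y\<in>tyu_carrier R. \<forall>t.
        aug R (tyu_lin t x y) = (t \<odot> aug R x) \<oplus> aug R y \<and>
        aug R (tyu_mult R x y) = aug R x \<otimes> aug R y) \<and>
     aug R tyu_one = \<one> \<and>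
     (\<forall>k. \<forall>x\<in>tyu_part R (Suc k). aug R x = \<zero>) \<and>
     aug R ` tyu_part R 0 = carrier A \<and>
     {x \<in> tyu_part R 0. aug R x = \<zero>} = rho R ` tyu_part R 1"

text \<open>Homogeneous derivations \<open>R \<rightarrow> A\<close> of cohomological degree \<open>i\<close>, i.e. of degree \<open>-i\<close>. The sign
  \<open>(-1)\<^bsup>i|x|\<^esup>\<close> of the second term of the Leibniz rule is immaterial, as \<open>aug\<close> vanishes in positive
  degrees.\<close>

definition tyu_der :: "'b tyurina_data \<Rightarrow> nat \<Rightarrow> (tyu_elem \<Rightarrow> 'b) set" where
  "tyu_der R i = {D \<in> tyu_carrier R \<rightarrow>\<^sub>E carrier A.
     (\<forall>k. k \<noteq> i \<longrightarrow> (\<forall>x\<in>tyu_part R k. D x = \<zero>)) \<and>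
     (\<forall>x\<in>tyu_carrier R. \<forall>y\<in>tyu_carrier R. \<forall>t.
        D (tyu_lin t x y) = (t \<odot> D x) \<oplus> D y \<and>
        D (tyu_mult R x y) = (D x \<otimes> aug R y) \<oplus> (aug R x \<otimes> D y))}"

definition tyu_Z2 :: "'b tyurina_data \<Rightarrow> (tyu_elem \<Rightarrow> 'b) monoid" where
  "tyu_Z2 R = \<lparr> carrier = {D \<in> tyu_der R 2. \<forall>x\<in>tyu_carrier R. D (rho R x) = \<zero>},
     mult = (\<lambda>D E. restrict (\<lambda>x. D x \<oplus> E x) (tyu_carrier R)),
     one = restrict (\<lambda>x. \<zero>) (tyu_carrier R) \<rparr>"

definition tyu_B2 :: "'b tyurina_data \<Rightarrow> (tyu_elem \<Rightarrow> 'b) set" where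
  "tyu_B2 R = {restrict (\<lambda>x. D (rho R x)) (tyu_carrier R) | D. D \<in> tyu_der R 1}"

definition Tyurina2 :: "'b tyurina_data \<Rightarrow> (tyu_elem \<Rightarrow> 'b) set monoid" where
  "Tyurina2 R = tyu_Z2 R Mod tyu_B2 R"

end


section \<open>The obstruction in the second Tyurina cohomology sheaf\<close>

definition germ :: "(complex^'n) set \<Rightarrow> complex^'n \<Rightarrow> (complex^'n \<Rightarrow> complex) \<Rightarrow> (complex^'n \<Rightarrow> complex) set" where
  "germ X x f = {g. \<exists>V. openX X V \<and> x \<in> V \<and> (\<forall>z\<in>V. g z = f z)}"

text \<open>The bounded subsets of a stalk are those which are represented by a uniformly bounded set of
  sections over a common neighbourhood.\<close>

definition stalk :: "(complex^'n) set \<Rightarrow> complex^'n \<Rightarrow> (complex^'n \<Rightarrow> complex) set born_algebra" where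
  "stalk X x = \<lparr>
     carrier = {germ X x f | f U. openX X U \<and> x \<in> U \<and> f \<in> sections U},
     mult = (\<lambda>a b. \<Union>f\<in>a. \<Union>g\<in>b. germ X x (\<lambda>z. f z * g z)),
     one = germ X x (\<lambda>_. 1),
     zero = germ X x (\<lambda>_. 0),
     add = (\<lambda>a b. \<Union>f\<in>a. \<Union>g\<in>b. germ X x (\<lambda>z. f z + g z)),
     smult = (\<lambda>t a. \<Union>f\<in>a. germ X x (\<lambda>z. t * f z)),
     bornology = {germ X x ` B | B. \<exists>U M. openX X U \<and> x \<in> U \<and> B \<subseteq> sections U \<and>
        (\<forall>f\<in>B. \<forall>z\<in>U. cmod (f z) \<le> M)} \<rparr>"

definition stalk_map :: "(complex^'n) set \<Rightarrow> 'n sheaf_map \<Rightarrow> complex^'n \<Rightarrow>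
    (complex^'n \<Rightarrow> complex) set \<Rightarrow> (complex^'n \<Rightarrow> complex) set \<Rightarrow> (complex^'n \<Rightarrow> complex) set" where
  "stalk_map X q x a b =
     \<Union> {germ X x (q U f g) | U f g. openX X U \<and> x \<in> U \<and> f \<in> sections U \<inter> a \<and> g \<in> sections U \<inter> b}"

text \<open>The germs of \<open>ob\<^sup>0(p)\<close>, in the Harrison model of the stalks of the second Tyurina cohomology
  sheaf.\<close>

definition ob0 :: "(complex^'n) set \<Rightarrow> 'n sheaf_map \<Rightarrow> complex^'n \<Rightarrow>
    ((complex^'n \<Rightarrow> complex) set \<times> (complex^'n \<Rightarrow> complex) set \<times> (complex^'n \<Rightarrow> complex) set
       \<Rightarrow> (complex^'n \<Rightarrow> complex) set) set" where
  "ob0 X p x = harrison_obstruction (stalk X x) (stalk_map X p x)"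

text \<open>A section of a sheaf is zero iff all its germs are. The second clause transports the germs to
  the stalks \<open>T\<^sup>2\<close> defined by resolutions; it refers to all identifications of \<open>T\<^sup>2\<close> with \<open>Harr\<^sup>3\<close>,
  so that no particular one needs to be chosen.\<close>

definition ob0_vanishes :: "(complex^'n) set \<Rightarrow> 'n sheaf_map \<Rightarrow> bool" where
  "ob0_vanishes X p \<longleftrightarrow> (\<forall>x\<in>X.
     ob0 X p x = one (Harr3 (stalk X x)) \<and>
     (\<forall>R \<Phi>. tyurina_resolution (stalk X x) R \<and> \<Phi> \<in> iso (Harr3 (stalk X x)) (Tyurina2 (stalk X x) R) \<longrightarrow>
        \<Phi> (ob0 X p x) = one (Tyurina2 (stalk X x) R)))"


section \<open>The obstruction in the first cohomology of the sheaf of bivectors\<close>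

text \<open>\<open>Q X S\<close> are the sections over \<open>S\<close> of the sheaf of skew-symmetric bounded 2-cocycles. Two of
  its elements are the same section if they are equal in the sense of \<open>eq_on\<close>.\<close>

definition Q :: "(complex^'n) set \<Rightarrow> (complex^'n) set \<Rightarrow> 'n sheaf_map set" where
  "Q X S = {q. bilinear_map_on X S q \<and> skew_on X S q \<and> hochschild_cocycle_on X S q}"

definition eq_on :: "(complex^'n) set \<Rightarrow> (complex^'n) set \<Rightarrow> 'n sheaf_map \<Rightarrow> 'n sheaf_map \<Rightarrow> bool" where
  "eq_on X S q r \<longleftrightarrow>
     (\<forall>U. openX X U \<and> U \<subseteq> S \<longrightarrow> (\<forall>a\<in>sections U. \<forall>b\<in>sections U. q U a b = r U a b))"

definition sm_add :: "'n sheaf_map \<Rightarrow> 'n sheaf_map \<Rightarrow> 'n sheaf_map" where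
  "sm_add q r = (\<lambda>U a b z. q U a b z + r U a b z)"

definition sm_diff :: "'n sheaf_map \<Rightarrow> 'n sheaf_map \<Rightarrow> 'n sheaf_map" where
  "sm_diff q r = (\<lambda>U a b z. q U a b z - r U a b z)"

definition skew_part :: "'n sheaf_map \<Rightarrow> 'n sheaf_map" where
  "skew_part q = (\<lambda>U a b z. (q U a b z - q U b a z) / 2)"

definition open_cover :: "(complex^'n) set \<Rightarrow> (complex^'n) set set \<Rightarrow> bool" where
  "open_cover X \<U> \<longleftrightarrow> (\<forall>U\<in>\<U>. openX X U) \<and> \<Union>\<U> = X"

type_synonym 'n cech_cochain =
  "(complex^'n) set set \<times> ((complex^'n) set \<Rightarrow> (complex^'n) set \<Rightarrow> 'n sheaf_map)"

definition cech_Z1 :: "(complex^'n) set \<Rightarrow> 'n cech_cochain set" where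
  "cech_Z1 X = {(\<U>, q). open_cover X \<U> \<and>
     (\<forall>U\<in>\<U>. \<forall>V\<in>\<U>. q U V \<in> Q X (U \<inter> V)) \<and>
     (\<forall>U\<in>\<U>. \<forall>V\<in>\<U>. \<forall>W\<in>\<U>. eq_on X (U \<inter> V \<inter> W) (q U W) (sm_add (q U V) (q V W)))}"

text \<open>Two cocycles are identified if they become cohomologous on a common refinement, so that
  \<open>cech_H1\<close> is the direct limit over all open coverings.\<close>

definition cech_rel :: "(complex^'n) set \<Rightarrow> ('n cech_cochain \<times> 'n cech_cochain) set" where
  "cech_rel X = {((\<U>, q), (\<V>, r)). (\<U>, q) \<in> cech_Z1 X \<and> (\<V>, r) \<in> cech_Z1 X \<and>
     (\<exists>\<W> \<sigma> \<tau> s. open_cover X \<W> \<and>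
        (\<forall>W\<in>\<W>. \<sigma> W \<in> \<U> \<and> W \<subseteq> \<sigma> W \<and> \<tau> W \<in> \<V> \<and> W \<subseteq> \<tau> W \<and> s W \<in> Q X W) \<and>
        (\<forall>W\<in>\<W>. \<forall>W'\<in>\<W>. eq_on X (W \<inter> W')
           (sm_diff (q (\<sigma> W) (\<sigma> W')) (r (\<tau> W) (\<tau> W'))) (sm_diff (s W) (s W'))))}"

definition cech_H1 :: "(complex^'n) set \<Rightarrow> 'n cech_cochain set set" where
  "cech_H1 X = cech_Z1 X // cech_rel X"

definition cech_H1_zero :: "(complex^'n) set \<Rightarrow> 'n cech_cochain set" where
  "cech_H1_zero X = cech_rel X `` {({X}, \<lambda>_ _ _ _ _ _. 0)}"

definition local_solution :: "(complex^'n) set \<Rightarrow> 'n sheaf_map \<Rightarrow> (complex^'n) set \<Rightarrow> 'n sheaf_map \<Rightarrow> bool" where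
  "local_solution X p S p2 \<longleftrightarrow> bilinear_map_on X S p2 \<and>
     (\<forall>U. openX X U \<and> U \<subseteq> S \<longrightarrow>
        (\<forall>a\<in>sections U. \<forall>b\<in>sections U. \<forall>c\<in>sections U. \<forall>z.
           p U (p U a b) c z - p U a (p U b c) z = hochschild_d p2 U a b c z))"

text \<open>The difference of two local solutions is a bounded 2-cocycle. It determines a section of \<open>Q\<close>
  through its class in the Hochschild cohomology sheaf, which on a manifold is \<open>Q\<close>: symmetric
  cocycles are locally coboundaries, so this section is the skew-symmetric part of the cocycle.
  The union over all systems of local solutions is the class of any of them; it is empty if there
  is no system of local solutions, and then not a class at all.\<close>

definition ob1 :: "(complex^'n) set \<Rightarrow> 'n sheaf_map \<Rightarrow> 'n cech_cochain set" where
  "ob1 X p = cech_rel X `` {(\<U>, \<lambda>U V. skew_part (sm_diff (p2 U) (p2 V))) | \<U> p2.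
     open_cover X \<U> \<and> (\<forall>U\<in>\<U>. local_solution X p U (p2 U))}"

end

theory Submission
  imports Defs "HOL-Complex_Analysis.Complex_Analysis"
begin

text \<open>
  The equations of \<open>X\<close> being independent, \<open>X\<close> contains holomorphic discs in all tangent directions.
  Hence the differentials of two local representatives of a section agree on tangent vectors, so that
  the Jacobian expression is well defined, and Cauchy's estimate along the discs makes the bracket
  bounded. Near every point two quotients \<open>u\<close>, \<open>v\<close> of homogeneous coordinates are local coordinates of
  the surface, and \<open>p(a,b) = w (D\<^sub>1a D\<^sub>2b - D\<^sub>2a D\<^sub>1b)\<close> with \<open>w = p(u,v)\<close> and the commuting derivations
  \<open>D\<^sub>1 = p(\<cdot>,v)/w\<close>, \<open>D\<^sub>2 = p(u,\<cdot>)/w\<close>; this gives the Jacobi identity. The second-order term of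
  Kontsevich's star product is a \<^emph>\<open>symmetric\<close> local solution of \<open>[p,p] = \<partial>p\<^sub>2\<close>. Symmetric cochains are
  Harrison cochains, so \<open>ob\<^sup>0(p) = 0\<close>; and since the skew-symmetric parts of the symmetric solutions
  vanish, the cocycle given by any system of local solutions is the coboundary of the skew parts of
  that system.\<close>

text \<open>A section is a function on the cone over \<open>X\<close>; in the ambient space it has
  only local representatives, and their gradients are arbitrary in normal directions. Gradients are
  therefore used through tangent vectors alone: either the determinant is bordered with the
  differentials of the equations, or the section is restricted to a disc inside the zero set. The
  permutation in the Jacobian expression is absorbed by adding the covector of the normalising
  coordinate as a last row, which leaves an alternating function of three covectors modulo the
  equations. It is homogeneous of degree 0 because the degrees of the equations add up to the number
  of coordinates. As \<open>X\<close> has dimension two, one reference pair of covectors determines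
  the bracket through a Pluecker relation. On the Harrison side the Jacobi identity turns
  \<open>[p,p](a,b,c)\<close> into the bracket of \<open>p(a,c)\<close> with \<open>b\<close>, which
  the projector fixes. The identification with Tyurina cohomology is never computed: any isomorphism
  sends the neutral element to the neutral element.\<close>

no_notation vec_index (infixl \<open>$\<close> 100)
no_notation fps_nth (infixl \<open>$\<close> 75)

lemmas fvec_eq_iff = Finite_Cartesian_Product.vec_eq_iff

section \<open>Holomorphic functions of several variables\<close>

definition grad :: "(complex^'n \<Rightarrow> complex) \<Rightarrow> complex^'n \<Rightarrow> complex^'n" where
  "grad f z = (\<chi> i. pd f i z)"

text \<open>Complex bilinear, not Hermitian: \<open>cdot (grad f z)\<close> is then the differential
  of a holomorphic \<open>f\<close>, complex linear in the vector.\<close>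

definition cdot :: "complex^'n \<Rightarrow> complex^'n \<Rightarrow> complex" where
  "cdot a v = (\<Sum>i\<in>UNIV. a $ i * v $ i)"

lemma cdot_add_left: "cdot (a + b) v = cdot a v + cdot b v"
  and cdot_add_right: "cdot v (a + b) = cdot v a + cdot v b"
  and cdot_scale_left: "cdot (c *s a) v = c * cdot a v"
  and cdot_scale_right: "cdot a (c *s v) = c * cdot a v"
  and cdot_diff_left: "cdot (a - b) v = cdot a v - cdot b v"
  and cdot_diff_right: "cdot v (a - b) = cdot v a - cdot v b"
  and cdot_zero_left [simp]: "cdot 0 v = 0"
  and cdot_zero_right [simp]: "cdot v 0 = 0"
  and cdot_scaleR_right: "cdot a (t *\<^sub>R v) = t *\<^sub>R cdot a v"
  by (simp_all add: cdot_def algebra_simps sum.distrib sum_distrib_left sum_subtractf scaleR_sum_right)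

lemma cdot_minus_left: "cdot (- a) v = - cdot a v"
  by (simp add: cdot_def sum_negf)

lemma axis_zero [simp]: "axis i 0 = 0"
  by simp

lemma cdot_commute: "cdot a b = cdot b a"
  by (simp add: cdot_def mult.commute)

lemma cdot_axis [simp]: "cdot (axis i 1) v = v $ i" "cdot v (axis i 1) = v $ i"
  by (simp_all add: cdot_def axis_def if_distrib[of "\<lambda>x. x * _"] if_distrib[of "\<lambda>x. _ * x"] cong: if_cong)

lemma cdot_sum_left: "cdot (\<Sum>i\<in>I. f i) v = (\<Sum>i\<in>I. cdot (f i) v)"
  by (induction I rule: infinite_finite_induct) (simp_all add: cdot_add_left)

lemma cdot_sum_right: "cdot v (\<Sum>i\<in>I. f i) = (\<Sum>i\<in>I. cdot v (f i))"
  by (induction I rule: infinite_finite_induct) (simp_all add: cdot_add_right)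

lemma bounded_linear_cdot: "bounded_linear (cdot a)"
proof -
  have "linear (cdot a)"
    by (rule linearI) (simp_all add: cdot_add_right cdot_scaleR_right)
  then show ?thesis by (rule linear_conv_bounded_linear[THEN iffD1])
qed

lemma axis_scale: "axis i t = t *s axis i (1::complex)"
  by (simp add: fvec_eq_iff axis_def)

lemma sum_axis_scale: "v = (\<Sum>i\<in>UNIV. v $ i *s axis i (1::complex))"
  by (simp add: fvec_eq_iff axis_def if_distrib[of "\<lambda>x. _ * x"] sum.delta cong: if_cong)

lemma grad_nth [simp]: "grad f z $ i = pd f i z"
  by (simp add: grad_def)

text \<open>\<open>pd\<close> is a one-variable derivative along a coordinate line, so it can be
  read off from any total derivative given by a covector. The sum and product rules for gradients
  below come in this way from rules for \<open>has_derivative\<close>.\<close>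

lemma grad_eqI:
  assumes "(f has_derivative cdot g) (at z)"
  shows "grad f z = g"
proof -
  have "pd f i z = g $ i" for i
  proof -
    have "((\<lambda>t::complex. z + axis i t) has_derivative (\<lambda>t. axis i t)) (at 0)"
    proof -
      have "bounded_linear (\<lambda>t::complex. axis i t :: complex^'a)"
        by (rule linear_conv_bounded_linear[THEN iffD1], rule linearI)
           (simp_all add: fvec_eq_iff axis_def)
      then show ?thesis
        by (auto intro!: derivative_eq_intros bounded_linear_imp_has_derivative)
    qed
    from has_derivative_compose[OF this, of f "cdot g"] assms
    have "((\<lambda>t. f (z + axis i t)) has_derivative (\<lambda>t. cdot g (axis i t))) (at 0)"
      by simp
    moreover have "cdot g (axis i t) = g $ i * t" for t
      by (subst axis_scale) (simp only: cdot_scale_right cdot_axis mult.commute)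
    ultimately have "((\<lambda>t. f (z + axis i t)) has_field_derivative g $ i) (at 0)"
      by (simp add: has_field_derivative_def)
    then show ?thesis
      unfolding pd_def by (rule DERIV_imp_deriv)
  qed
  then show ?thesis by (simp add: fvec_eq_iff)
qed

lemma holo_on_open: "holo_on f W \<Longrightarrow> open W"
  by (simp add: holo_on_def)

text \<open>The derivative in \<open>holo_on\<close> is real linear and complex homogeneous, hence
  it is the pairing with the covector of its values on unit vectors; by \<open>grad_eqI\<close> this
  covector is the gradient.\<close>

lemma holo_on_grad:
  assumes "holo_on f W" "z \<in> W"
  shows "(f has_derivative cdot (grad f z)) (at z)"
proof -
  from assms obtain f' where f': "(f has_derivative f') (at z)" "\<And>c v. f' (c *s v) = c * f' v"
    unfolding holo_on_def by blast
  define g where "g = (\<chi> i. f' (axis i 1))"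
  have lin: "linear f'" using f'(1) has_derivative_linear by blast
  have "f' v = cdot g v" for v
  proof -
    have "f' v = f' (\<Sum>i\<in>UNIV. v $ i *s axis i 1)"
      using sum_axis_scale[of v] by simp
    also have "\<dots> = (\<Sum>i\<in>UNIV. f' (v $ i *s axis i 1))"
      by (rule linear_sum[OF lin])
    also have "\<dots> = cdot g v"
      by (simp add: f'(2) g_def cdot_def mult.commute)
    finally show ?thesis .
  qed
  then have "f' = cdot g" by (rule ext)
  then have "(f has_derivative cdot g) (at z)" using f'(1) by simp
  with grad_eqI[OF this] show ?thesis by simp
qed

lemma holo_onI:
  assumes "open W" "\<And>z. z \<in> W \<Longrightarrow> \<exists>g. (f has_derivative cdot g) (at z)"
  shows "holo_on f W"
  unfolding holo_on_def using assms
  by (metis cdot_scale_right)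

lemma holo_on_subset: "holo_on f W \<Longrightarrow> open V \<Longrightarrow> V \<subseteq> W \<Longrightarrow> holo_on f V"
  unfolding holo_on_def by blast

lemma holo_on_continuous:
  assumes "holo_on f W" shows "continuous_on W f"
  by (intro continuous_at_imp_continuous_on ballI has_derivative_continuous)
     (rule holo_on_grad[OF assms])

lemma grad_cong:
  assumes "open W" "z \<in> W" "\<And>y. y \<in> W \<Longrightarrow> f y = g y"
  shows "grad f z = grad g z"
proof -
  have "pd f i z = pd g i z" for i
    unfolding pd_def
  proof (rule deriv_cong_ev)
    have "((\<lambda>t::complex. z + axis i t) \<longlongrightarrow> z + axis i 0) (nhds 0)"
    proof -
      have "bounded_linear (\<lambda>t::complex. axis i t :: complex^'a)"
        by (rule linear_conv_bounded_linear[THEN iffD1], rule linearI)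
           (simp_all add: fvec_eq_iff axis_def)
      then have "isCont (\<lambda>t::complex. z + axis i t) 0"
        by (intro continuous_intros linear_continuous_at)
      then show ?thesis
        by (simp add: continuous_at tendsto_nhds_iff)
    qed
    then have "\<forall>\<^sub>F t in nhds 0. z + axis i t \<in> W"
      using topological_tendstoD[OF _ assms(1)] assms(2) by auto
    then show "\<forall>\<^sub>F t in nhds 0. f (z + axis i t) = g (z + axis i t)"
      by eventually_elim (rule assms(3))
  qed simp
  then show ?thesis by (simp add: fvec_eq_iff)
qed

lemma deriv_const: "((\<lambda>z :: complex^'n. c) has_derivative cdot 0) (at z)"
proof -
  have "cdot (0 :: complex^'n) = (\<lambda>v. 0)" by (rule ext) simp
  then show ?thesis by simp
qed

lemma deriv_nth: "((\<lambda>z. z $ i) has_derivative cdot (axis i 1)) (at z)"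
proof -
  have "(\<lambda>v. v $ i) = cdot (axis i 1)" by (simp add: fun_eq_iff)
  then show ?thesis
    by (metis bounded_linear_cdot bounded_linear_imp_has_derivative)
qed

lemma deriv_add:
  assumes "(f has_derivative cdot a) (at z)" "(g has_derivative cdot b) (at z)"
  shows "((\<lambda>z. f z + g z) has_derivative cdot (a + b)) (at z)"
proof -
  have "cdot (a + b) = (\<lambda>v. cdot a v + cdot b v)"
    by (rule ext) (rule cdot_add_left)
  then show ?thesis using has_derivative_add[OF assms] by simp
qed

lemma deriv_mult:
  assumes "(f has_derivative cdot a) (at z)" "(g has_derivative cdot b) (at z)"
  shows "((\<lambda>z. f z * g z) has_derivative cdot (f z *s b + g z *s a)) (at z)"
proof -
  have "cdot (f z *s b + g z *s a) = (\<lambda>v. f z * cdot b v + cdot a v * g z)"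
    by (simp add: fun_eq_iff cdot_add_left cdot_scale_left)
  then show ?thesis using has_derivative_mult[OF assms] by simp
qed

lemma deriv_inverse:
  assumes "(f has_derivative cdot a) (at z)" "f z \<noteq> 0"
  shows "((\<lambda>z. inverse (f z)) has_derivative cdot ((- (inverse (f z) ^ 2)) *s a)) (at z)"
proof -
  have "cdot ((- (inverse (f z) ^ 2)) *s a) = (\<lambda>v. - (inverse (f z) * cdot a v * inverse (f z)))"
    by (simp add: fun_eq_iff cdot_scale_left cdot_minus_left power2_eq_square)
  then show ?thesis using Deriv.has_derivative_inverse[OF assms(2) assms(1)] by simp
qed

lemma holo_on_const [simp]: "open W \<Longrightarrow> holo_on (\<lambda>z. c) W"
  and holo_on_nth: "open W \<Longrightarrow> holo_on (\<lambda>z. z $ i) W"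
  by (rule holo_onI; blast intro: deriv_const deriv_nth)+

lemma holo_on_add: "holo_on f W \<Longrightarrow> holo_on g W \<Longrightarrow> holo_on (\<lambda>z. f z + g z) W"
  and holo_on_mult: "holo_on f W \<Longrightarrow> holo_on g W \<Longrightarrow> holo_on (\<lambda>z. f z * g z) W"
  by (rule holo_onI; blast intro: deriv_add deriv_mult holo_on_grad holo_on_open)+

lemma holo_on_inverse:
  "holo_on f W \<Longrightarrow> (\<And>z. z \<in> W \<Longrightarrow> f z \<noteq> 0) \<Longrightarrow> holo_on (\<lambda>z. inverse (f z)) W"
  by (rule holo_onI; blast intro: deriv_inverse holo_on_grad holo_on_open)

lemma holo_on_uminus: "holo_on f W \<Longrightarrow> holo_on (\<lambda>z. - f z) W"
  using holo_on_mult[of "\<lambda>_. -1" W f] holo_on_open by force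

lemma holo_on_diff: "holo_on f W \<Longrightarrow> holo_on g W \<Longrightarrow> holo_on (\<lambda>z. f z - g z) W"
  using holo_on_add[OF _ holo_on_uminus, of f W g] by simp

lemma holo_on_sum:
  "open W \<Longrightarrow> (\<And>i. i \<in> I \<Longrightarrow> holo_on (f i) W) \<Longrightarrow> holo_on (\<lambda>z. \<Sum>i\<in>I. f i z) W"
  by (induction I rule: infinite_finite_induct) (simp_all add: holo_on_add)

lemma holo_on_prod:
  "open W \<Longrightarrow> (\<And>i. i \<in> I \<Longrightarrow> holo_on (f i) W) \<Longrightarrow> holo_on (\<lambda>z. \<Prod>i\<in>I. f i z) W"
  by (induction I rule: infinite_finite_induct) (simp_all add: holo_on_mult)

lemma holo_on_power: "holo_on f W \<Longrightarrow> holo_on (\<lambda>z. f z ^ k) W"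
  using holo_on_prod[of W "{..<k}" "\<lambda>_. f"] holo_on_open by force

lemma grad_const [simp]: "grad (\<lambda>z. c) z = 0"
  by (rule grad_eqI[OF deriv_const])

lemma grad_coord [simp]: "grad (\<lambda>z. z $ i) z = axis i 1"
  by (rule grad_eqI[OF deriv_nth])

lemma grad_add:
  "holo_on f W \<Longrightarrow> holo_on g W \<Longrightarrow> z \<in> W \<Longrightarrow> grad (\<lambda>z. f z + g z) z = grad f z + grad g z"
  and grad_mult:
  "holo_on f W \<Longrightarrow> holo_on g W \<Longrightarrow> z \<in> W \<Longrightarrow>
    grad (\<lambda>z. f z * g z) z = f z *s grad g z + g z *s grad f z"
  by (rule grad_eqI; blast intro: deriv_add deriv_mult holo_on_grad)+

lemma grad_scale:
  "holo_on f W \<Longrightarrow> z \<in> W \<Longrightarrow> grad (\<lambda>z. c * f z) z = c *s grad f z"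
  using grad_mult[of "\<lambda>_. c" W f z] holo_on_open by fastforce

lemma grad_sum:
  "finite I \<Longrightarrow> open W \<Longrightarrow> (\<And>i. i \<in> I \<Longrightarrow> holo_on (f i) W) \<Longrightarrow> z \<in> W \<Longrightarrow>
    grad (\<lambda>z. \<Sum>i\<in>I. f i z) z = (\<Sum>i\<in>I. grad (f i) z)"
proof (induction I rule: finite_induct)
  case (insert i I)
  then show ?case
    using grad_add[of "f i" W "\<lambda>z. \<Sum>i\<in>I. f i z" z] holo_on_sum[of W I f] by simp
qed simp

text \<open>The derivative of the curve is asked for coordinatewise because the discs used later are
  delivered in this form.\<close>

lemma holo_on_compose_curve:
  assumes "holo_on f W" "\<gamma> t \<in> W" "\<And>i. ((\<lambda>t. \<gamma> t $ i) has_field_derivative d $ i) (at t)"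
  shows "((\<lambda>t. f (\<gamma> t)) has_field_derivative cdot (grad f (\<gamma> t)) d) (at t)"
proof -
  have "(\<gamma> has_derivative (\<lambda>h. h *s d)) (at t)"
  proof (subst has_derivative_componentwise_within, rule ballI)
    fix b :: "complex^'a" assume "b \<in> Basis"
    then obtain i u where b: "b = axis i u" by (auto simp: Basis_vec_def)
    have "((\<lambda>t. \<gamma> t $ i) has_derivative (\<lambda>h. h * d $ i)) (at t)"
    proof -
      have "(*) (d $ i) = (\<lambda>h. h * d $ i)" by (rule ext) (rule mult.commute)
      then show ?thesis using assms(3)[of i] by (simp add: has_field_derivative_def)
    qed
    from has_derivative_inner_left[OF this, of u]
    show "((\<lambda>t. inner (\<gamma> t) b) has_derivative (\<lambda>h. inner (h *s d) b)) (at t)"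
      by (simp add: b inner_axis)
  qed
  from has_derivative_compose[OF this holo_on_grad[OF assms(1,2)]]
  have "((\<lambda>t. f (\<gamma> t)) has_derivative (\<lambda>h. cdot (grad f (\<gamma> t)) (h *s d))) (at t)" .
  moreover have "(\<lambda>h. cdot (grad f (\<gamma> t)) (h *s d)) = (*) (cdot (grad f (\<gamma> t)) d)"
    by (rule ext) (simp add: cdot_scale_right mult.commute)
  ultimately show ?thesis by (simp add: has_field_derivative_def)
qed


section \<open>Cauchy's formula on coordinate lines and the regularity of partial
  derivatives\<close>

lemma norm_axis: "norm (axis i (c :: complex)) = norm c"
proof -
  have "(norm (axis i c $ j))\<^sup>2 = (if j = i then (norm c)\<^sup>2 else 0)" for j
    by (simp add: axis_def)
  then show ?thesis by (simp add: norm_vec_def L2_set_def)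
qed

lemma bounded_linear_axis: "bounded_linear (\<lambda>t::complex. axis i t :: complex^'n)"
  by (rule linear_conv_bounded_linear[THEN iffD1], rule linearI) (simp_all add: fvec_eq_iff axis_def)

text \<open>Cauchy's formula for the derivative at the centre with the parametrised circle inserted:
  the factor 2 pi i cancels, and the average of \<open>g u / u\<close> over the parameter interval
  remains. This form suits differentiation under the integral sign.\<close>

lemma deriv_circle_integral:
  assumes g: "g holomorphic_on ball 0 R" and r: "0 < r" "r < R"
  shows "((\<lambda>t. g (circlepath 0 r t) / circlepath 0 r t) has_integral deriv g 0) {0..1}"
proof -
  let ?I = "contour_integral (circlepath 0 r) (\<lambda>u. g u / (u - 0)\<^sup>2)"
  have sub: "cball 0 r \<subseteq> ball (0::complex) R" using r by auto
  have g1: "continuous_on (cball 0 r) g" "g holomorphic_on ball 0 r"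
    using g sub by (meson holomorphic_on_imp_continuous_on holomorphic_on_subset ball_subset_cball order_trans)+
  have 0: "0 \<in> ball (0::complex) r" using r by simp
  note C = Cauchy_derivative_integral_circlepath[OF g1 0]
  have "((\<lambda>u. g u / (u - 0)\<^sup>2) has_contour_integral ?I) (circlepath 0 r)"
    by (rule has_contour_integral_integral[OF C(1)])
  then have "((\<lambda>t. g (circlepath 0 r t) / (circlepath 0 r t)\<^sup>2 *
      vector_derivative (circlepath 0 r) (at t)) has_integral ?I) {0..1}"
    by (simp add: has_contour_integral)
  moreover have "g (circlepath 0 r t) / (circlepath 0 r t)\<^sup>2 * vector_derivative (circlepath 0 r) (at t)
      = (2 * of_real pi * \<i>) * (g (circlepath 0 r t) / circlepath 0 r t)" for t
    unfolding vector_derivative_circlepath using r by (simp add: circlepath power2_eq_square field_simps)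
  ultimately have "((\<lambda>t. (2 * of_real pi * \<i>) * (g (circlepath 0 r t) / circlepath 0 r t)) has_integral ?I) {0..1}"
    by simp
  from has_integral_mult_right[OF this, of "1 / (2 * of_real pi * \<i>)"]
  have "((\<lambda>t. g (circlepath 0 r t) / circlepath 0 r t) has_integral 1 / (2 * of_real pi * \<i>) * ?I) {0..1}"
    by simp
  with C(2) show ?thesis by (metis DERIV_imp_deriv)
qed

lemma holo_on_line:
  assumes "holo_on f W" "\<And>\<zeta>. \<zeta> \<in> ball 0 R \<Longrightarrow> z + axis i \<zeta> \<in> W"
  shows "(\<lambda>\<zeta>. f (z + axis i \<zeta>)) holomorphic_on ball 0 R"
proof (rule holomorphic_onI)
  fix \<zeta> :: complex assume \<zeta>: "\<zeta> \<in> ball 0 R"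
  define \<gamma> where "\<gamma> \<zeta> = z + axis i \<zeta>" for \<zeta>
  have "((\<lambda>\<zeta>. z $ j + axis i 1 $ j * \<zeta>) has_field_derivative axis i 1 $ j) (at \<zeta>)" for j
    by (rule derivative_eq_intros refl | simp)+
  moreover have "(\<lambda>\<zeta>. \<gamma> \<zeta> $ j) = (\<lambda>\<zeta>. z $ j + axis i 1 $ j * \<zeta>)" for j
    by (simp add: \<gamma>_def axis_def fun_eq_iff)
  ultimately have "((\<lambda>\<zeta>. \<gamma> \<zeta> $ j) has_field_derivative axis i 1 $ j) (at \<zeta>)" for j
    by simp
  moreover have "\<gamma> \<zeta> \<in> W" using assms(2)[OF \<zeta>] by (simp add: \<gamma>_def)
  ultimately have "((\<lambda>\<zeta>. f (\<gamma> \<zeta>)) has_field_derivative cdot (grad f (\<gamma> \<zeta>)) (axis i 1)) (at \<zeta>)"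
    by (rule holo_on_compose_curve[OF assms(1), of \<gamma> \<zeta>, rotated])
  then show "(\<lambda>\<zeta>. f (z + axis i \<zeta>)) field_differentiable at \<zeta> within ball 0 R"
    unfolding \<gamma>_def field_differentiable_def by (blast intro: has_field_derivative_at_within)
qed

lemma pd_has_integral:
  assumes "holo_on f W" "\<And>\<zeta>. \<zeta> \<in> ball 0 R \<Longrightarrow> z + axis i \<zeta> \<in> W" "0 < r" "r < R"
  shows "((\<lambda>t. f (z + axis i (circlepath 0 r t)) / circlepath 0 r t) has_integral pd f i z) {0..1}"
  unfolding pd_def by (rule deriv_circle_integral[OF holo_on_line[OF assms(1,2)] assms(3,4)])

context
  fixes f :: "complex^'n \<Rightarrow> complex" and W and z0 :: "complex^'n" and R r :: real
  assumes f: "holo_on f W" and R: "ball z0 (2 * R) \<subseteq> W" and r: "0 < r" "r < R"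
begin

text \<open>The assumption is made for twice the radius: one \<open>R\<close> is used up by the
  distance of \<open>z\<close> from \<open>z0\<close>, the other by the circle around
  \<open>z\<close>.\<close>

lemma circle_in_W: "z \<in> ball z0 R \<Longrightarrow> \<zeta> \<in> ball 0 R \<Longrightarrow> z + axis i \<zeta> \<in> W"
  apply (rule subsetD[OF R])
  using norm_triangle_ineq[of "z - z0" "axis i \<zeta>"]
  by (simp add: dist_norm norm_minus_commute norm_axis algebra_simps)

lemma circlepath_ball: "circlepath 0 r t \<in> ball 0 R" "circlepath 0 r t \<noteq> 0"
  using r by (simp_all add: circlepath norm_mult)

lemma continuous_circle_shift:
  assumes "continuous_on W h"
  shows "continuous_on (ball z0 R \<times> cbox 0 1)
    (\<lambda>(z, t). h (z + axis i (circlepath 0 r t)) / circlepath 0 r t)"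
proof -
  have c: "continuous_on S (\<lambda>t. circlepath 0 r (snd t))" for S :: "((complex^'n) \<times> real) set"
    unfolding circlepath by (intro continuous_intros)
  have "continuous_on (ball z0 R \<times> cbox 0 1) (\<lambda>p. fst p + axis i (circlepath 0 r (snd p)))"
    by (intro continuous_intros continuous_on_compose2[OF linear_continuous_on[OF bounded_linear_axis, of UNIV] c]) auto
  moreover have "fst p + axis i (circlepath 0 r (snd p)) \<in> W" if "p \<in> ball z0 R \<times> cbox 0 1" for p
    using circle_in_W[OF _ circlepath_ball(1)] that by auto
  ultimately have "continuous_on (ball z0 R \<times> cbox 0 1) (\<lambda>p. h (fst p + axis i (circlepath 0 r (snd p))))"
    by (intro continuous_on_compose2[OF assms]) auto
  then show ?thesis
    unfolding case_prod_beta
    by (intro continuous_on_divide c) (use circlepath_ball in auto)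
qed

lemma pd_integral:
  assumes "z \<in> ball z0 R"
  shows "pd f i z = integral (cbox 0 1) (\<lambda>t. f (z + axis i (circlepath 0 r t)) / circlepath 0 r t)"
  using pd_has_integral[OF f circle_in_W[OF assms] r, where i = i] by (simp add: integral_unique)

lemma continuous_on_pd_ball: "continuous_on (ball z0 R) (pd f i)"
  using integral_continuous_on_param[OF continuous_circle_shift[OF holo_on_continuous[OF f]], of i]
  by (rule continuous_on_eq) (simp add: pd_integral)

end

lemma holo_on_ball:
  assumes "holo_on f W" "z \<in> W"
  obtains R where "0 < R" "ball z (2 * R) \<subseteq> W"
proof -
  obtain e where "e > 0" "ball z e \<subseteq> W" using assms holo_on_open open_contains_ball by metis
  then show ?thesis using that[of "e / 2"] by simp
qed

text \<open>\<open>holo_on\<close> asks only for a derivative at each point. Continuity of the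
  derivative is the first gain from the integral formula, and differentiation under the integral
  sign relies on it afterwards.\<close>

lemma continuous_on_pd:
  assumes "holo_on f W" shows "continuous_on W (pd f i)"
proof (intro continuous_at_imp_continuous_on ballI)
  fix z assume "z \<in> W"
  with assms obtain R where R: "0 < R" "ball z (2 * R) \<subseteq> W" by (rule holo_on_ball)
  have "continuous_on (ball z R) (pd f i)"
    by (rule continuous_on_pd_ball[OF assms R(2), of "R / 2"]) (use R in auto)
  then show "isCont (pd f i) z" using R by (simp add: continuous_on_eq_continuous_at)
qed

text \<open>Cauchy's formula is differentiated in the centre. The derivative of the integrand
  involves first partial derivatives only, and these are continuous by
  \<open>continuous_on_pd\<close>.\<close>

lemma pd_has_derivative:
  assumes f: "holo_on f W" and R: "ball z0 (2 * R) \<subseteq> W" and r: "0 < r" "r < R"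
  shows "(pd f i has_derivative (\<lambda>v. integral {0..1}
    (\<lambda>t. cdot (grad f (z0 + axis i (circlepath 0 r t))) v / circlepath 0 r t))) (at z0)"
proof -
  let ?c = "circlepath 0 r"
  define F where "F z t = f (z + axis i (?c t)) / ?c t" for z t
  define F' where "F' z t v = cdot (grad f (z + axis i (?c t))) v / ?c t" for z t v
  have bl: "bounded_linear (F' z t)" for z t
    unfolding F'_def by (rule bounded_linear_compose[OF bounded_linear_divide bounded_linear_cdot])
  have ap: "blinfun_apply (Blinfun (F' z t)) = F' z t" for z t
    by (rule bounded_linear_Blinfun_apply[OF bl])
  have gc: "continuous_on W (\<lambda>z. cdot (grad f z) v)" for v
    unfolding cdot_def grad_nth by (intro continuous_intros continuous_on_pd[OF f])
  have "((\<lambda>z. integral (cbox 0 1) (F z)) has_derivative blinfun_apply (integral (cbox 0 1) (\<lambda>t. Blinfun (F' z0 t))))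
     (at z0 within ball z0 R)"
  proof (rule leibniz_rule)
    fix z and t :: real assume z: "z \<in> ball z0 R"
    then have "z + axis i (?c t) \<in> W"
      by (rule circle_in_W[OF f R r, OF _ circlepath_ball(1)[OF f R r]])
    have "((\<lambda>z. z + axis i (?c t)) has_derivative (\<lambda>v. v)) (at z)"
      by (auto intro!: derivative_eq_intros)
    from has_derivative_compose[OF this holo_on_grad[OF f \<open>z + axis i (?c t) \<in> W\<close>]]
    have "((\<lambda>z. f (z + axis i (?c t))) has_derivative cdot (grad f (z + axis i (?c t)))) (at z)" .
    from has_derivative_divide'[OF this has_derivative_const, of "?c t"]
    have "((\<lambda>z. F z t) has_derivative F' z t) (at z)"
      using circlepath_ball(2)[OF f R r] unfolding F_def F'_def by simp
    then show "((\<lambda>z. F z t) has_derivative blinfun_apply (Blinfun (F' z t))) (at z within ball z0 R)"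
      unfolding ap by (rule has_derivative_at_withinI)
  next
    show "F z integrable_on cbox 0 1" if "z \<in> ball z0 R" for z
      using pd_has_integral[OF f circle_in_W[OF f R r that] r, where i = i]
      unfolding F_def[abs_def] by (auto simp: integrable_on_def)
  next
    show "continuous_on (ball z0 R \<times> cbox 0 1) (\<lambda>(z, t). Blinfun (F' z t))"
    proof (rule continuous_on_blinfun_componentwise)
      fix v :: "complex^'a" assume "v \<in> Basis"
      show "continuous_on (ball z0 R \<times> cbox 0 1) (\<lambda>x. blinfun_apply (case x of (z, t) \<Rightarrow> Blinfun (F' z t)) v)"
        using continuous_circle_shift[OF f R r gc, of i v] unfolding F'_def[abs_def] ap case_prod_beta
        by (simp add: ap[unfolded F'_def[abs_def]])
    qed
  qed (use r in auto)
  then have "((\<lambda>z. integral (cbox 0 1) (F z)) has_derivative blinfun_apply (integral (cbox 0 1) (\<lambda>t. Blinfun (F' z0 t)))) (at z0)"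
    using at_within_open[of z0 "ball z0 R"] r by simp
  then have "(pd f i has_derivative blinfun_apply (integral (cbox 0 1) (\<lambda>t. Blinfun (F' z0 t)))) (at z0)"
    by (rule has_derivative_transform_within_open[of _ _ _ _ "ball z0 R"])
       (use r in \<open>simp_all add: F_def[abs_def] pd_integral[OF f R r]\<close>)
  moreover have "blinfun_apply (integral (cbox 0 1) (\<lambda>t. Blinfun (F' z0 t))) v = integral {0..1} (\<lambda>t. F' z0 t v)" for v
  proof -
    have "continuous_on (cbox 0 1) (\<lambda>t. Blinfun (F' z0 t))"
    proof (rule continuous_on_blinfun_componentwise)
      fix v :: "complex^'a" assume "v \<in> Basis"
      have "continuous_on ((\<lambda>t. (z0, t)) ` cbox 0 1) (\<lambda>(z, t). F' z t v)"
        by (rule continuous_on_subset[OF continuous_circle_shift[OF f R r gc, of i v, folded F'_def]])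
           (use r in auto)
      from continuous_on_compose[OF _ this]
      show "continuous_on (cbox 0 1) (\<lambda>t. blinfun_apply (Blinfun (F' z0 t)) v)"
        unfolding ap by (simp add: o_def continuous_intros)
    qed
    then have "(\<lambda>t. Blinfun (F' z0 t)) integrable_on cbox 0 1" by (rule integrable_continuous)
    from integral_linear[OF this blinfun.bounded_linear_left, of v]
    show ?thesis by (simp add: o_def ap)
  qed
  then have "blinfun_apply (integral (cbox 0 1) (\<lambda>t. Blinfun (F' z0 t))) = (\<lambda>v. integral {0..1} (\<lambda>t. F' z0 t v))"
    by (rule ext)
  ultimately show ?thesis
    unfolding F'_def by simp
qed

theorem holo_on_pd:
  assumes "holo_on f W" shows "holo_on (pd f i) W"
  unfolding holo_on_def
proof (intro conjI ballI)
  show "open W" using assms by (rule holo_on_open)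
  fix z assume "z \<in> W"
  with assms obtain R where R: "0 < R" "ball z (2 * R) \<subseteq> W" by (rule holo_on_ball)
  let ?f' = "\<lambda>v. integral {0..1} (\<lambda>t. cdot (grad f (z + axis i (circlepath 0 (R/2) t))) v / circlepath 0 (R/2) t)"
  have "(pd f i has_derivative ?f') (at z)"
    by (rule pd_has_derivative[OF assms R(2)]) (use R in auto)
  \<comment> \<open>Complex homogeneity, which \<open>has_derivative\<close> does not contain, is
    visible on the integral formula: the scalar comes out of the integrand.\<close>
  moreover have "?f' (c *s v) = c * ?f' v" for c v
    unfolding cdot_scale_right times_divide_eq_right[symmetric] by (rule integral_mult_right)
  ultimately show "\<exists>f'. (pd f i has_derivative f') (at z) \<and> (\<forall>c v. f' (c *s v) = c * f' v)" by blast
qed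

text \<open>In direction \<open>j\<close> the derivative of \<open>pd f i\<close> is the circle
  integral of \<open>pd f j\<close> along the \<open>i\<close>-th axis, and this is Cauchy's formula
  for the \<open>i\<close>-th derivative of \<open>pd f j\<close>.\<close>

theorem pd_symmetric:
  assumes "holo_on f W" "z \<in> W" shows "pd (pd f i) j z = pd (pd f j) i z"
proof -
  from assms obtain R where R: "0 < R" "ball z (2 * R) \<subseteq> W" by (rule holo_on_ball)
  let ?f' = "\<lambda>v. integral {0..1} (\<lambda>t. cdot (grad f (z + axis i (circlepath 0 (R/2) t))) v / circlepath 0 (R/2) t)"
  have "(pd f i has_derivative ?f') (at z)"
    by (rule pd_has_derivative[OF assms(1) R(2)]) (use R in auto)
  moreover have "(pd f i has_derivative cdot (grad (pd f i) z)) (at z)"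
    by (rule holo_on_grad[OF holo_on_pd[OF assms(1)] assms(2)])
  ultimately have "?f' = cdot (grad (pd f i) z)" by (rule has_derivative_unique)
  then have "cdot (grad (pd f i) z) (axis j 1) = ?f' (axis j 1)"
    by (rule fun_cong[OF sym])
  also have "\<dots> = pd (pd f j) i z"
    unfolding cdot_axis grad_nth
    using pd_integral[OF holo_on_pd[OF assms(1)] R(2), where r = "R/2" and z = z and i = i] R
    by simp
  finally show ?thesis by simp
qed

section \<open>Determinants of covectors\<close>

text \<open>Rows are covectors and column \<open>l\<close> is the coordinate
  \<open>\<iota> l\<close>. A list of rows fits the later use, where the equations, the two
  arguments and a coordinate supply them.\<close>

definition jdet :: "(nat \<Rightarrow> 'n) \<Rightarrow> (complex^'n) list \<Rightarrow> complex" where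
  "jdet \<iota> rs = Determinant.det (Matrix.mat (length rs) (length rs) (\<lambda>(k, l). rs ! k $ \<iota> l))"

text \<open>Laplace expansion along row \<open>k\<close>: the cofactors do not see that row, so they
  can be computed with it replaced by 0.\<close>

lemma jdet_row_linear:
  assumes k: "k < length rs"
  shows "\<exists>C. \<forall>a. jdet \<iota> (rs[k := a]) = (\<Sum>l<length rs. a $ \<iota> l * C l)"
proof -
  let ?n = "length rs"
  let ?A = "\<lambda>a. Matrix.mat ?n ?n (\<lambda>(i, l). rs[k := a] ! i $ \<iota> l)"
  have del: "mat_delete (?A a) k l = mat_delete (?A 0) k l" for a l
    by (rule eq_matI) (use k in \<open>auto simp: mat_delete_def nth_list_update\<close>)
  have cof: "cofactor (?A a) k l = cofactor (?A 0) k l" for a l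
    unfolding cofactor_def by (rule arg_cong[OF del])
  have "jdet \<iota> (rs[k := a]) = (\<Sum>l<?n. a $ \<iota> l * cofactor (?A 0) k l)" for a
  proof -
    have "jdet \<iota> (rs[k := a]) = (\<Sum>l<?n. ?A a $$ (k, l) * cofactor (?A a) k l)"
      unfolding jdet_def length_list_update by (rule laplace_expansion_row[OF _ k]) simp
    then show ?thesis unfolding cof[of a] using k by simp
  qed
  then show ?thesis by blast
qed

lemma jdet_row_add: "k < length rs \<Longrightarrow>
    jdet \<iota> (rs[k := a + b]) = jdet \<iota> (rs[k := a]) + jdet \<iota> (rs[k := b])"
  and jdet_row_scale: "k < length rs \<Longrightarrow> jdet \<iota> (rs[k := c *s a]) = c * jdet \<iota> (rs[k := a])"
  by (frule jdet_row_linear[of _ _ \<iota>]; auto simp: algebra_simps sum.distrib sum_distrib_left)+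

lemma jdet_row_zero: "k < length rs \<Longrightarrow> jdet \<iota> (rs[k := 0]) = 0"
  using jdet_row_scale[of k rs \<iota> 0 0] by simp

text \<open>As a function of one row the determinant is the pairing with a fixed vector. Dual
  vectors and tangent vectors are obtained from this.\<close>

lemma jdet_row_expand:
  assumes "k < length rs"
  shows "jdet \<iota> (rs[k := a]) = cdot (\<chi> i. jdet \<iota> (rs[k := axis i 1])) a"
proof -
  have S: "finite I \<Longrightarrow> jdet \<iota> (rs[k := (\<Sum>i\<in>I. f i)]) = (\<Sum>i\<in>I. jdet \<iota> (rs[k := f i]))" for I :: "'a set" and f
    by (induction I rule: finite_induct) (simp_all add: jdet_row_zero jdet_row_add assms)
  have "jdet \<iota> (rs[k := a]) = jdet \<iota> (rs[k := (\<Sum>i\<in>UNIV. a $ i *s axis i 1)])"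
    using sum_axis_scale[of a] by simp
  also have "\<dots> = (\<Sum>i\<in>UNIV. a $ i * jdet \<iota> (rs[k := axis i 1]))"
    by (simp add: S jdet_row_scale assms)
  finally show ?thesis by (simp add: cdot_def mult.commute)
qed

lemma jdet_identical:
  assumes "j < length rs" "k < length rs" "j \<noteq> k" "rs ! j = rs ! k"
  shows "jdet \<iota> rs = 0"
  unfolding jdet_def
  by (rule det_identical_rows[of _ "length rs" j k]) (use assms in \<open>auto intro!: eq_vecI\<close>)

lemma jdet_null_vector:
  fixes v :: "complex^'n"
  assumes \<iota>: "bij_betw \<iota> {..<length rs} UNIV"
    and v: "v \<noteq> 0" "\<And>r. r \<in> set rs \<Longrightarrow> cdot r v = 0"
  shows "jdet \<iota> rs = 0"
proof -
  let ?n = "length rs"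
  let ?A = "Matrix.mat ?n ?n (\<lambda>(k, l). rs ! k $ \<iota> l)" and ?v = "Matrix.vec ?n (\<lambda>l. v $ \<iota> l)"
  obtain i where i: "v $ i \<noteq> 0" using v(1) by (auto simp: fvec_eq_iff)
  then obtain l where l: "l < ?n" "\<iota> l = i" using \<iota> unfolding bij_betw_def by (metis imageE lessThan_iff UNIV_I)
  have "vec_index ?v l \<noteq> vec_index (0\<^sub>v ?n) l" using i l by simp
  then have "?v \<noteq> 0\<^sub>v ?n" by metis
  moreover have "?A *\<^sub>v ?v = 0\<^sub>v ?n"
  proof (rule eq_vecI)
    fix k assume "k < dim_vec (0\<^sub>v ?n :: complex Matrix.vec)"
    then have k: "k < ?n" by simp
    have "vec_index (?A *\<^sub>v ?v) k = (\<Sum>l<?n. rs ! k $ \<iota> l * v $ \<iota> l)"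
      using k by (simp add: scalar_prod_def lessThan_atLeast0)
    also have "\<dots> = cdot (rs ! k) v"
      unfolding cdot_def by (rule sum.reindex_bij_betw[OF \<iota>])
    finally show "vec_index (?A *\<^sub>v ?v) k = vec_index (0\<^sub>v ?n) k" using k v(2) by simp
  qed simp
  ultimately show ?thesis
    unfolding jdet_def by (subst det_0_iff_vec_prod_zero[of _ ?n]) (auto intro!: exI[of _ ?v])
qed

text \<open>Governs the change of the Jacobian when \<open>z\<close> is replaced by
  \<open>c *s z\<close> and each row acquires a power of \<open>c\<close>.\<close>

lemma jdet_scale_rows:
  assumes "length cs = length rs"
  shows "jdet \<iota> (map2 (*s) cs rs) = prod_list cs * jdet \<iota> rs"
proof -
  have "prod_list cs = (\<Prod>i = 0..<length rs. cs ! i)"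
    using assms by (metis prod.list_conv_set_nth)
  moreover have "jdet \<iota> (map2 (*s) cs rs) = (\<Sum>p | p permutes {0..<length rs}.
      of_int (sign p) * (\<Prod>i = 0..<length rs. cs ! i * rs ! i $ \<iota> (p i)))"
    unfolding jdet_def using assms
    by (subst det_def'[of _ "length rs"]) (auto intro!: sum.cong prod.cong simp: permutes_in_image)
  moreover have "jdet \<iota> rs = (\<Sum>p | p permutes {0..<length rs}.
      of_int (sign p) * (\<Prod>i = 0..<length rs. rs ! i $ \<iota> (p i)))"
    unfolding jdet_def
    by (subst det_def'[of _ "length rs"]) (auto intro!: sum.cong prod.cong simp: permutes_in_image)
  ultimately show ?thesis
    by (simp add: prod.distrib sum_distrib_left mult.left_commute)
qed

text \<open>The minor without the column of one coordinate is the full determinant bordered by the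
  unit covector of that coordinate. Sorting the columns absorbs the sign, so only the coordinate
  \<open>\<iota> (\<sigma> (length rs))\<close> survives of the permutation.\<close>

lemma jdet_permute:
  fixes \<iota> :: "nat \<Rightarrow> 'n::finite"
  assumes \<iota>: "inj_on \<iota> {..length rs}" and \<sigma>: "\<sigma> permutes {..length rs}"
  shows "of_int (sign \<sigma>) * Determinant.det (Matrix.mat (length rs) (length rs) (\<lambda>(k, l). rs ! k $ \<iota> (\<sigma> l)))
    = jdet \<iota> (rs @ [axis (\<iota> (\<sigma> (length rs))) 1])"
proof -
  let ?N = "length rs" and ?rs = "rs @ [axis (\<iota> (\<sigma> (length rs))) 1]"
  let ?A = "Matrix.mat (Suc ?N) (Suc ?N) (\<lambda>(k, l). ?rs ! k $ \<iota> l)"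
  let ?B = "Matrix.mat (Suc ?N) (Suc ?N) (\<lambda>(k, l). ?rs ! k $ \<iota> (\<sigma> l))"
  have \<sigma>': "\<sigma> permutes {0..<Suc ?N}" using \<sigma> by (simp add: atLeast0LessThan lessThan_Suc_atMost)
  have less: "\<sigma> l < Suc ?N" if "l < Suc ?N" for l using \<sigma>' that permutes_in_image[OF \<sigma>'] by simp
  have "Determinant.det ?B = Determinant.det (transpose_mat ?B)"
    by (rule det_transpose[of _ "Suc ?N", symmetric]) simp
  also have "transpose_mat ?B = Matrix.mat (Suc ?N) (Suc ?N) (\<lambda>(i, j). transpose_mat ?A $$ (\<sigma> i, j))"
    by (rule eq_matI) (use less in auto)
  also have "Determinant.det \<dots> = of_int (sign \<sigma>) * Determinant.det (transpose_mat ?A)"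
    by (rule det_permute_rows[OF _ \<sigma>']) simp
  also have "Determinant.det (transpose_mat ?A) = Determinant.det ?A"
    by (rule det_transpose[of _ "Suc ?N"]) simp
  also have "\<dots> = jdet \<iota> ?rs" by (simp add: jdet_def)
  finally have 1: "Determinant.det ?B = of_int (sign \<sigma>) * jdet \<iota> ?rs" .
  \<comment> \<open>Expansion along the added row: its only nonzero entry is in the last column,
    where row and column index agree and the cofactor has sign 1.\<close>
  have "Determinant.det ?B = (\<Sum>l<Suc ?N. ?B $$ (?N, l) * cofactor ?B ?N l)"
    by (rule laplace_expansion_row) auto
  also have "\<dots> = (\<Sum>l<Suc ?N. (if l = ?N then cofactor ?B ?N l else 0))"
  proof (rule sum.cong[OF refl])
    fix l assume l: "l \<in> {..<Suc ?N}"
    have "\<iota> (\<sigma> l) = \<iota> (\<sigma> ?N) \<longleftrightarrow> \<sigma> l = \<sigma> ?N"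
      using inj_on_eq_iff[OF \<iota>] less[of l] less[of ?N] l by (simp add: less_Suc_eq_le)
    also have "\<dots> \<longleftrightarrow> l = ?N" using permutes_inj[OF \<sigma>] by (simp add: inj_eq)
    finally show "?B $$ (?N, l) * cofactor ?B ?N l = (if l = ?N then cofactor ?B ?N l else 0)"
      using l by (auto simp: axis_def)
  qed
  also have "\<dots> = Determinant.det (mat_delete ?B ?N ?N)" by (simp add: cofactor_def)
  also have "mat_delete ?B ?N ?N = Matrix.mat ?N ?N (\<lambda>(k, l). rs ! k $ \<iota> (\<sigma> l))"
    by (rule eq_matI) (auto simp: mat_delete_def nth_append)
  finally have "Determinant.det ?B = Determinant.det (Matrix.mat ?N ?N (\<lambda>(k, l). rs ! k $ \<iota> (\<sigma> l)))" .
  \<comment> \<open>Multiplication by the sign of the permutation, whose square is 1.\<close>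
  with 1 show ?thesis
    by (simp flip: mult.assoc of_int_mult)
qed

lemma holo_on_jdet:
  assumes "open W" "\<And>r i. r \<in> set rs \<Longrightarrow> holo_on (\<lambda>z. r z $ i) W"
  shows "holo_on (\<lambda>z. jdet \<iota> (map (\<lambda>r. r z) rs)) W"
proof -
  have "holo_on (\<lambda>z. \<Sum>p | p permutes {0..<length rs}. of_int (sign p) * (\<Prod>i = 0..<length rs. (rs ! i) z $ \<iota> (p i))) W"
    by (intro holo_on_sum holo_on_mult holo_on_prod holo_on_const assms) auto
  moreover have "jdet \<iota> (map (\<lambda>r. r z) rs) = (\<Sum>p | p permutes {0..<length rs}. of_int (sign p) * (\<Prod>i = 0..<length rs. (rs ! i) z $ \<iota> (p i)))" for z
    unfolding jdet_def length_map
    by (subst det_def'[of _ "length rs"]) (auto intro!: sum.cong prod.cong simp: permutes_in_image)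
  ultimately show ?thesis by simp
qed

section \<open>Determinants with three free rows, modulo fixed covectors\<close>

context
  fixes \<iota> :: "nat \<Rightarrow> 'n::finite" and Gs :: "(complex^'n) list"
  assumes \<iota>: "bij_betw \<iota> {..<length Gs + 3} UNIV"
begin

text \<open>\<open>Gs\<close> stands for the differentials of the equations at a point. They fill
  all rows but three: two for the arguments of the bracket and one for a coordinate.\<close>

abbreviation (input) D3 :: "complex^'n \<Rightarrow> complex^'n \<Rightarrow> complex^'n \<Rightarrow> complex" where
  "D3 a b c \<equiv> jdet \<iota> (Gs @ [a, b, c])"

lemma D3_add: "D3 (a + a') b c = D3 a b c + D3 a' b c" "D3 a (b + b') c = D3 a b c + D3 a b' c"
    "D3 a b (c + c') = D3 a b c + D3 a b c'"
  using jdet_row_add[of "length Gs" "Gs @ [0, b, c]" \<iota> a a']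
    jdet_row_add[of "Suc (length Gs)" "Gs @ [a, 0, c]" \<iota> b b']
    jdet_row_add[of "Suc (Suc (length Gs))" "Gs @ [a, b, 0]" \<iota> c c']
  by (simp_all add: list_update_append)

lemma D3_scale: "D3 (t *s a) b c = t * D3 a b c" "D3 a (t *s b) c = t * D3 a b c"
    "D3 a b (t *s c) = t * D3 a b c"
  using jdet_row_scale[of "length Gs" "Gs @ [0, b, c]" \<iota> t a]
    jdet_row_scale[of "Suc (length Gs)" "Gs @ [a, 0, c]" \<iota> t b]
    jdet_row_scale[of "Suc (Suc (length Gs))" "Gs @ [a, b, 0]" \<iota> t c]
  by (simp_all add: list_update_append)

lemma D3_minus: "D3 (- a) b c = - D3 a b c" "D3 a (- b) c = - D3 a b c" "D3 a b (- c) = - D3 a b c"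
  using D3_scale(1)[of "-1" a b c] D3_scale(2)[of a "-1" b c] D3_scale(3)[of a b "-1" c] by simp_all

lemma D3_diff: "D3 (a - a') b c = D3 a b c - D3 a' b c" "D3 a (b - b') c = D3 a b c - D3 a b' c"
    "D3 a b (c - c') = D3 a b c - D3 a b c'"
  using D3_add D3_minus by (metis (no_types, lifting) add_uminus_conv_diff)+

lemma D3_same [simp]: "D3 a a c = 0" "D3 a b b = 0" "D3 a b a = 0"
proof -
  show "D3 a a c = 0"
    by (rule jdet_identical[of "length Gs" _ "Suc (length Gs)"]) (simp_all add: nth_append)
  show "D3 a b b = 0"
    by (rule jdet_identical[of "Suc (length Gs)" _ "Suc (Suc (length Gs))"]) (simp_all add: nth_append)
  show "D3 a b a = 0"
    by (rule jdet_identical[of "length Gs" _ "Suc (Suc (length Gs))"]) (simp_all add: nth_append)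
qed

text \<open>Two equal rows. Hence the free rows count only modulo the span of \<open>Gs\<close>,
  that is, as covectors on the tangent space of the cone.\<close>

lemma D3_mem:
  assumes "g \<in> set Gs" shows "D3 g b c = 0" "D3 a g c = 0" "D3 a b g = 0"
proof -
  obtain k where k: "k < length Gs" "Gs ! k = g" using assms by (auto simp: in_set_conv_nth)
  show "D3 g b c = 0"
    by (rule jdet_identical[of k _ "length Gs"]) (use k in \<open>simp_all add: nth_append\<close>)
  show "D3 a g c = 0"
    by (rule jdet_identical[of k _ "Suc (length Gs)"]) (use k in \<open>simp_all add: nth_append\<close>)
  show "D3 a b g = 0"
    by (rule jdet_identical[of k _ "Suc (Suc (length Gs))"]) (use k in \<open>simp_all add: nth_append\<close>)
qed

lemma D3_skew: "D3 b a c = - D3 a b c"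
proof -
  have "D3 b a c + D3 a b c = 0"
    using D3_same(1)[of "a + b" c] unfolding D3_add by (simp add: add.commute)
  then show ?thesis by (simp add: eq_neg_iff_add_eq_0)
qed

text \<open>A generalised cross product of \<open>Gs\<close>, \<open>b\<close> and \<open>c\<close>:
  by \<open>D3_tang\<close> and the vanishing for equal rows it is annihilated by all of them, so it
  is a tangent vector.\<close>

definition cross_vec :: "complex^'n \<Rightarrow> complex^'n \<Rightarrow> complex^'n" where
  "cross_vec b c = (\<chi> i. D3 (axis i 1) b c)"

lemma D3_tang: "D3 a b c = cdot (cross_vec b c) a"
  using jdet_row_expand[of "length Gs" "Gs @ [0, b, c]" \<iota> a]
  by (simp add: list_update_append cross_vec_def)

lemma D3_null:
  assumes "v \<noteq> 0" "\<And>g. g \<in> set Gs \<Longrightarrow> cdot g v = 0" "cdot a v = 0" "cdot b v = 0" "cdot c v = 0"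
  shows "D3 a b c = 0"
  by (rule jdet_null_vector) (use assms \<iota> in \<open>auto simp: numeral_3_eq_3\<close>)

text \<open>The exchanged row is paired only with the tangent vector \<open>cross_vec b c\<close>.
  This makes the bracket independent of the representatives of a section.\<close>

lemma D3_tangent_cong:
  assumes "\<And>\<xi>. (\<And>g. g \<in> set Gs \<Longrightarrow> cdot g \<xi> = 0) \<Longrightarrow> cdot a \<xi> = cdot a' \<xi>"
  shows "D3 a b c = D3 a' b c" "D3 b a c = D3 b a' c"
proof -
  have "cdot a (cross_vec b c) = cdot a' (cross_vec b c)"
    by (rule assms) (simp add: cdot_commute[of _ "cross_vec b c"] D3_mem flip: D3_tang)
  then show "D3 a b c = D3 a' b c" by (simp add: D3_tang cdot_commute)
  then show "D3 b a c = D3 b a' c" by (simp add: D3_skew[of _ b])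
qed

text \<open>For fixed \<open>c\<close> the form lives on covectors modulo \<open>Gs\<close> and
  \<open>c\<close>, a space of dimension two with basis \<open>u\<close>, \<open>v\<close>; the
  identity expresses this area form in coordinates with respect to the basis.\<close>

lemma D3_pluecker:
  assumes "D3 u v c \<noteq> 0"
  shows "D3 u v c * D3 a b c = D3 a v c * D3 u b c - D3 b v c * D3 u a c"
proof -
  \<comment> \<open>Cramer's combination: \<open>D3 u a' c\<close> and \<open>D3 v a' c\<close>
    vanish. Nondegeneracy then forces \<open>D3 b a' c = 0\<close>, which is the claim when written
    out.\<close>
  define a' where "a' = D3 u v c *s a - D3 a v c *s u - D3 u a c *s v"
  have t: "cdot r (cross_vec a' c) = D3 r a' c" for r
    by (simp add: D3_tang cdot_commute)
  have "cross_vec a' c = 0"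
  proof (rule ccontr)
    assume "cross_vec a' c \<noteq> 0"
    then have "D3 u v c = 0"
    proof (rule D3_null)
      show "cdot u (cross_vec a' c) = 0" "cdot v (cross_vec a' c) = 0"
        unfolding t unfolding a'_def by (simp_all add: D3_diff D3_scale D3_skew[of v u] D3_skew[of v a])
    qed (simp_all add: t D3_mem)
    with assms show False by contradiction
  qed
  then have "D3 b a' c = 0" using t[of b] by simp
  then have "D3 u v c * D3 b a c = D3 a v c * D3 b u c + D3 u a c * D3 b v c"
    unfolding a'_def D3_diff D3_scale by (simp add: algebra_simps)
  then show ?thesis by (simp add: D3_skew[of b a] D3_skew[of b u] algebra_simps)
qed

text \<open>The covector \<open>z $ m' *s axis m 1 - z $ m *s axis m' 1\<close> annihilates
  \<open>z\<close>, as the other rows do, so \<open>z\<close> is a null vector. Together with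
  Euler's relation this makes the Jacobian expression independent of the normalising
  coordinate.\<close>

lemma D3_swap_last:
  assumes "\<And>g. g \<in> set Gs \<Longrightarrow> cdot g z = 0" "cdot a z = 0" "cdot b z = 0" "z \<noteq> 0"
  shows "z $ m' * D3 a b (axis m 1) = z $ m * D3 a b (axis m' 1)"
proof -
  have "D3 a b (z $ m' *s axis m 1 - z $ m *s axis m' 1) = 0"
    by (rule D3_null[of z]) (use assms in \<open>simp_all add: cdot_diff_left cdot_scale_left\<close>)
  then show ?thesis by (simp add: D3_diff D3_scale)
qed

end

text \<open>A null vector of the transposed matrix is a linear relation between the rows.\<close>

lemma jdet_independent:
  fixes rs :: "(complex^'n) list"
  assumes \<iota>: "bij_betw \<iota> {..<length rs} UNIV" and d: "distinct rs" and i: "vec.independent (set rs)"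
  shows "jdet \<iota> rs \<noteq> 0"
proof
  let ?n = "length rs"
  let ?A = "Matrix.mat ?n ?n (\<lambda>(k, l). rs ! k $ \<iota> l)"
  assume "jdet \<iota> rs = 0"
  then have "Determinant.det (transpose_mat ?A) = 0" by (subst det_transpose[of _ ?n]) (simp_all add: jdet_def)
  then obtain v where v: "v \<in> carrier_vec ?n" "v \<noteq> 0\<^sub>v ?n" "transpose_mat ?A *\<^sub>v v = 0\<^sub>v ?n"
    by (subst (asm) det_0_iff_vec_prod_zero[of _ ?n]) auto
  have bij: "bij_betw ((!) rs) {..<?n} (set rs)" by (rule bij_betw_nth[OF d]) auto
  define u where "u r = vec_index v (the_inv_into {..<?n} ((!) rs) r)" for r
  have u: "u (rs ! k) = vec_index v k" if "k < ?n" for k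
    unfolding u_def using that bij by (simp add: the_inv_into_f_f bij_betw_def)
  have "(\<Sum>r\<in>set rs. u r *s r) = (\<Sum>k<?n. vec_index v k *s rs ! k)"
    by (subst sum.reindex_bij_betw[OF bij, symmetric]) (simp add: u)
  also have "\<dots> = 0"
  proof (subst fvec_eq_iff, rule allI)
    fix j
    obtain l where l: "l < ?n" "\<iota> l = j" using \<iota> unfolding bij_betw_def by (metis imageE lessThan_iff UNIV_I)
    have "vec_index (transpose_mat ?A *\<^sub>v v) l = (\<Sum>k<?n. rs ! k $ j * vec_index v k)"
      using l v(1) by (simp add: scalar_prod_def lessThan_atLeast0)
    then show "(\<Sum>k<?n. vec_index v k *s rs ! k) $ j = (0 :: complex^'n) $ j"
      using v(3) l by (simp add: mult.commute)
  qed
  finally have "u r = 0" if "r \<in> set rs" for r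
    using i that by (auto simp: vec.dependent_finite)
  then have "vec_index v k = 0" if "k < ?n" for k using u that by (metis nth_mem)
  with v(1,2) show False by (auto intro!: eq_vecI)
qed

text \<open>Exchange argument: the covectors in \<open>Gs\<close> together with
  \<open>axis m 1\<close> are independent and can be completed to a basis by unit covectors; the
  count leaves room for exactly two.\<close>

lemma jdet_complete:
  fixes Gs :: "(complex^'n) list"
  assumes \<iota>: "bij_betw \<iota> {..<length Gs + 3} UNIV"
    and indep: "\<And>c. (\<Sum>k<length Gs. c k *s Gs ! k) = 0 \<Longrightarrow> \<forall>k<length Gs. c k = 0"
    and z: "\<And>g. g \<in> set Gs \<Longrightarrow> cdot g z = 0" "z $ m \<noteq> 0"
  shows "\<exists>i j. jdet \<iota> (Gs @ [axis i 1, axis j 1, axis m 1]) \<noteq> 0"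
proof -
  let ?e = "axis m 1 :: complex^'n" and ?r = "length Gs"
  have e: "?e \<notin> set Gs" using z by (metis cdot_axis(1))
  \<comment> \<open>Independence of a set says nothing about repetitions in a list; a repetition
    would be a relation with coefficients 1 and -1.\<close>
  have d: "distinct Gs"
    unfolding distinct_conv_nth
  proof (intro allI impI notI)
    fix j k assume jk: "j < ?r" "k < ?r" "j \<noteq> k" "Gs ! j = Gs ! k"
    have "(\<Sum>l<?r. (if l = j then 1 else if l = k then -1 else 0) *s Gs ! l)
      = (\<Sum>l<?r. (if l = j then Gs ! j else 0) - (if l = k then Gs ! k else 0))"
      using jk(3) by (intro sum.cong) auto
    also have "\<dots> = 0" using jk by (simp add: sum_subtractf)
    finally show False using indep[of "\<lambda>l. if l = j then 1 else if l = k then -1 else 0"] jk by auto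
  qed
  have bij: "bij_betw ((!) Gs) {..<?r} (set Gs)" by (rule bij_betw_nth[OF d]) auto
  let ?S = "insert ?e (set Gs)"
  have ind: "vec.independent ?S"
  proof -
    have "u v = 0" if s: "(\<Sum>v\<in>?S. u v *s v) = 0" and v: "v \<in> ?S" for u v
    proof -
      \<comment> \<open>Pairing with \<open>z\<close> kills \<open>Gs\<close> and isolates the
        coefficient of \<open>?e\<close>, because \<open>z $ m\<close> is not zero.\<close>
      have "cdot (\<Sum>v\<in>?S. u v *s v) z = u ?e * z $ m"
        using e z(1) by (simp add: cdot_add_left cdot_scale_left cdot_sum_left)
      with s z(2) have ue: "u ?e = 0" by simp
      then have "(\<Sum>v\<in>set Gs. u v *s v) = 0" using s e by simp
      then have "(\<Sum>k<?r. u (Gs ! k) *s Gs ! k) = 0"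
        by (subst (asm) sum.reindex_bij_betw[OF bij, symmetric]) simp
      from indep[OF this] ue v show ?thesis by (auto simp: in_set_conv_nth)
    qed
    then show ?thesis by (auto simp: vec.dependent_finite)
  qed
  obtain B where B: "?S \<subseteq> B" "B \<subseteq> ?S \<union> cart_basis" "vec.independent B" "?S \<union> cart_basis \<subseteq> vec.span B"
    using vec.maximal_independent_subset_extend[OF _ ind, of "?S \<union> cart_basis"] by blast
  have "vec.span B = vec.span UNIV"
  proof -
    have "vec.span cart_basis \<subseteq> vec.span B" using B(4) by (intro vec.span_minimal) auto
    then show ?thesis by auto
  qed
  then have "card B = vec.dim (UNIV :: (complex^'n) set)"
    using vec.dim_eq_card[OF _ B(3)] by metis
  also have "\<dots> = ?r + 3"
    using \<iota> bij_betw_same_card[OF \<iota>] by (simp add: vec_dim_card card_cart_basis)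
  finally have cB: "card B = ?r + 3" .
  have fB: "finite B" using cB card.infinite by fastforce
  have "card ?S = ?r + 1" using e d by (simp add: distinct_card)
  then have "card (B - ?S) = 2" using cB card_Diff_subset[of ?S B] B(1) by simp
  then obtain x y where xy: "B - ?S = {x, y}" "x \<noteq> y" by (auto simp: card_2_iff)
  have "x \<in> cart_basis" "y \<in> cart_basis" using xy B(2) by blast+
  then obtain i j where ij: "x = axis i 1" "y = axis j 1" unfolding cart_basis_def by auto
  let ?rs = "Gs @ [axis i 1, axis j 1, axis m 1]"
  have "set ?rs = B" using xy ij B(1) by auto
  moreover have "distinct ?rs" using xy ij d e by (auto simp: insert_Diff_if)
  ultimately have "jdet \<iota> ?rs \<noteq> 0"
    using jdet_independent[of \<iota> ?rs] \<iota> B(3) by (simp add: numeral_3_eq_3)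
  then show ?thesis by blast
qed

section \<open>Holomorphic discs in a smooth cone\<close>

lemma homogeneous_poly_holo:
  assumes "homogeneous_poly d f" shows "holo_on f UNIV"
proof -
  obtain c where c: "f = (\<lambda>z. \<Sum>\<alpha> | (\<Sum>i\<in>UNIV. \<alpha> i) = d. c \<alpha> * (\<Prod>i\<in>UNIV. z $ i ^ \<alpha> i))"
    using assms unfolding homogeneous_poly_def by blast
  show ?thesis
    unfolding c by (intro holo_on_sum holo_on_mult holo_on_const holo_on_prod holo_on_power holo_on_nth open_UNIV)
qed

lemma homogeneous_poly_scale:
  assumes "homogeneous_poly d f" shows "f (c *s z) = c ^ d * f z"
proof -
  obtain k where f: "\<And>z. f z = (\<Sum>\<alpha> | (\<Sum>i\<in>UNIV. \<alpha> i) = d. k \<alpha> * (\<Prod>i\<in>UNIV. z $ i ^ \<alpha> i))"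
    using assms unfolding homogeneous_poly_def by blast
  show ?thesis
    unfolding f sum_distrib_left
    by (intro sum.cong refl) (auto simp: power_mult_distrib prod.distrib power_sum[symmetric])
qed

lemma scale_conic: "z \<in> W \<Longrightarrow> conic W \<Longrightarrow> c \<noteq> 0 \<Longrightarrow> c *s z \<in> W"
  by (simp add: conic_def)

text \<open>The chain rule for scaling. The factor \<open>k\<close> is left open to cover equations
  (\<open>k = c ^ d\<close>) and representatives of sections (\<open>k = 1\<close>).\<close>

lemma grad_homogeneous:
  assumes f: "holo_on f W" and W: "conic W" "z \<in> W" and c: "c \<noteq> 0"
    and h: "\<And>y. y \<in> W \<Longrightarrow> f (c *s y) = k * f y"
  shows "c *s grad f (c *s z) = k *s grad f z"
proof -
  have "bounded_linear (\<lambda>y::complex^'a. c *s y)"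
    by (rule linear_conv_bounded_linear[THEN iffD1], rule linearI) (simp_all add: fvec_eq_iff algebra_simps)
  then have "((\<lambda>y. c *s y) has_derivative (\<lambda>v. c *s v)) (at z)"
    by (rule bounded_linear_imp_has_derivative)
  from has_derivative_compose[OF this holo_on_grad[OF f scale_conic[OF W(2,1) c]]]
  have "((\<lambda>y. f (c *s y)) has_derivative (\<lambda>v. cdot (grad f (c *s z)) (c *s v))) (at z)" .
  moreover have "(\<lambda>v. cdot (grad f (c *s z)) (c *s v)) = cdot (c *s grad f (c *s z))"
    by (simp add: fun_eq_iff cdot_scale_left cdot_scale_right)
  ultimately have "grad (\<lambda>y. f (c *s y)) z = c *s grad f (c *s z)"
    by (intro grad_eqI) simp
  moreover have "grad (\<lambda>y. f (c *s y)) z = grad (\<lambda>y. k * f y) z"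
    by (rule grad_cong[OF holo_on_open[OF f] W(2) h])
  ultimately show ?thesis by (simp add: grad_scale[OF f W(2)])
qed

text \<open>\<open>f\<close> is differentiated along \<open>(1 + t) *s z\<close> at
  \<open>t = 0\<close>.\<close>

lemma euler_homogeneous:
  assumes f: "holo_on f W" and z: "z \<in> W" and h: "\<And>c. c \<noteq> 0 \<Longrightarrow> f (c *s z) = c ^ d * f z"
  shows "cdot (grad f z) z = of_nat d * f z"
proof -
  define \<gamma> where "\<gamma> t = (1 + t) *s z" for t
  have \<gamma>0: "\<gamma> 0 = z" by (simp add: \<gamma>_def)
  have "((\<lambda>t. \<gamma> t $ i) has_field_derivative z $ i) (at 0)" for i
    unfolding \<gamma>_def vector_smult_component by (auto intro!: derivative_eq_intros)
  from holo_on_compose_curve[OF f _ this] z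
  have 1: "((\<lambda>t. f (\<gamma> t)) has_field_derivative cdot (grad f z) z) (at 0)"
    by (simp add: \<gamma>0)
  have "((\<lambda>t. (1 + t) ^ d * f z) has_field_derivative of_nat d * f z) (at 0)"
    by (auto intro!: derivative_eq_intros)
  then have 2: "((\<lambda>t. f (\<gamma> t)) has_field_derivative of_nat d * f z) (at 0)"
  proof (rule has_field_derivative_transform_within_open[of _ _ _ "ball 0 1"])
    \<comment> \<open>The unit disc excludes \<open>t = -1\<close>, where the scalar would be 0 and
      homogeneity is not assumed.\<close>
    fix t :: complex assume "t \<in> ball 0 1"
    then have "1 + t \<noteq> 0" by (metis add_eq_0_iff2 mem_ball_0 norm_minus_cancel norm_one less_irrefl add.commute)
    then show "(1 + t) ^ d * f z = f (\<gamma> t)" unfolding \<gamma>_def by (rule h[symmetric])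
  qed auto
  from 1 2 show ?thesis by (rule DERIV_unique)
qed

text \<open>The \<open>k\<close>-th vector consists of the cofactors of row \<open>k\<close> divided
  by the determinant, a column of the inverse matrix: pairing it with row \<open>j\<close> amounts
  to replacing row \<open>k\<close> by row \<open>j\<close>.\<close>

lemma dual_vectors:
  fixes \<iota> :: "nat \<Rightarrow> 'n::finite"
  assumes "jdet \<iota> rs \<noteq> 0"
  obtains u :: "nat \<Rightarrow> complex^'n"
  where "\<And>j k. j < length rs \<Longrightarrow> k < length rs \<Longrightarrow> cdot (rs ! j) (u k) = (if j = k then 1 else 0)"
proof
  fix j k assume jk: "j < length rs" "k < length rs"
  define C where "C k = (\<chi> i. jdet \<iota> (rs[k := axis i 1]))" for k
  have "cdot (C k) (rs ! j) = jdet \<iota> (rs[k := rs ! j])"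
    unfolding C_def by (rule jdet_row_expand[OF jk(2), symmetric])
  also have "\<dots> = (if j = k then jdet \<iota> rs else 0)"
    using jdet_identical[of j "rs[k := rs ! j]" k \<iota>] jk by auto
  finally show "cdot (rs ! j) (inverse (jdet \<iota> rs) *s (\<chi> i. jdet \<iota> (rs[k := axis i 1]))) = (if j = k then 1 else 0)"
    using assms by (simp add: cdot_scale_right cdot_commute C_def)
qed

text \<open>The inverse function theorem yields a real linear derivative; the complex linearity that
  holomorphic discs need is recovered here.\<close>

lemma inv_complex_linear:
  fixes f :: "complex^'n \<Rightarrow> complex^'n"
  assumes "bij f" "\<And>c v. f (c *s v) = c *s f v"
  shows "inv_into UNIV f (c *s v) = c *s inv_into UNIV f v"
  by (metis assms bij_inv_eq_iff)

text \<open>\<open>\<Phi>(y) = y + \<Sum>\<^sub>j (F\<^sub>j(y) - dF\<^sub>j(z\<^sub>0)(y - z\<^sub>0)) u\<^sub>j\<close> with \<open>dF\<^sub>i(u\<^sub>j) = \<delta>\<^sub>i\<^sub>j\<close> straightens the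
  zero set near \<open>z\<^sub>0\<close>; the discs are the preimages of complex lines in tangent directions.\<close>

lemma tangent_discs:
  fixes Fs :: "(complex^'n \<Rightarrow> complex) list" and u :: "nat \<Rightarrow> complex^'n"
  assumes holo: "\<And>F. F \<in> set Fs \<Longrightarrow> holo_on F UNIV"
    and zero: "\<And>F. F \<in> set Fs \<Longrightarrow> F z0 = 0"
    and dual: "\<And>j k. j < length Fs \<Longrightarrow> k < length Fs \<Longrightarrow>
      cdot (grad (Fs ! j) z0) (u k) = (if j = k then 1 else 0)"
    and N: "open N" "z0 \<in> N"
  obtains \<epsilon> r :: real where "\<epsilon> > 0" "r > 0"
    "\<And>z \<xi>. \<lbrakk>z \<in> ball z0 \<epsilon>; \<And>F. F \<in> set Fs \<Longrightarrow> F z = 0; norm \<xi> \<le> 1;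
        \<And>F. F \<in> set Fs \<Longrightarrow> cdot (grad F z) \<xi> = 0\<rbrakk> \<Longrightarrow>
      \<exists>\<gamma> :: complex \<Rightarrow> complex^'n. \<gamma> 0 = z \<and>
        (\<forall>t\<in>ball 0 r. \<gamma> t \<in> N \<and> (\<forall>F\<in>set Fs. F (\<gamma> t) = 0) \<and>
          (\<exists>d. (\<forall>i. ((\<lambda>t. \<gamma> t $ i) has_field_derivative d $ i) (at t)) \<and> (t = 0 \<longrightarrow> d = \<xi>)))"
proof -
  let ?r = "length Fs"
  define g where "g j = grad (Fs ! j) z0" for j
  have holo': "holo_on (Fs ! j) UNIV" if "j < ?r" for j using holo that by simp
  define \<Phi> where "\<Phi> y = y + (\<Sum>j<?r. ((Fs ! j) y - cdot (g j) (y - z0)) *s u j)" for y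
  \<comment> \<open>The derivative of \<open>\<Phi>\<close> at \<open>y\<close>. At
    \<open>z0\<close> it is the identity, because \<open>g j\<close> is the gradient there.\<close>
  define \<Phi>' where "\<Phi>' y v = v + (\<Sum>j<?r. cdot (grad (Fs ! j) y - g j) v *s u j)" for y v
  have lin: "bounded_linear (\<Phi>' y)" for y
    by (rule linear_conv_bounded_linear[THEN iffD1], rule linearI)
       (simp_all add: \<Phi>'_def fvec_eq_iff cdot_add_right cdot_scaleR_right algebra_simps sum.distrib scaleR_sum_right)
  have ap: "blinfun_apply (Blinfun (\<Phi>' y)) = \<Phi>' y" for y
    by (rule bounded_linear_Blinfun_apply[OF lin])
  have clin: "\<Phi>' y (c *s v) = c *s \<Phi>' y v" for y c v
    by (simp add: \<Phi>'_def fvec_eq_iff cdot_scale_right algebra_simps sum_distrib_left)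
  have cont: "continuous_on UNIV (\<lambda>y. Blinfun (\<Phi>' y))"
  proof (rule continuous_on_blinfun_componentwise)
    fix v :: "complex^'n" assume "v \<in> Basis"
    show "continuous_on UNIV (\<lambda>y. blinfun_apply (Blinfun (\<Phi>' y)) v)"
      unfolding ap \<Phi>'_def cdot_def vector_scalar_mult_def vector_minus_component grad_nth
      by (intro continuous_intros continuous_on_pd[OF holo']) auto
  qed
  have der: "(\<Phi> has_derivative \<Phi>' y) (at y)" for y
  proof -
    have 1: "((\<lambda>y. ((Fs ! j) y - cdot (g j) (y - z0)) *s u j) has_derivative
      (\<lambda>v. cdot (grad (Fs ! j) y - g j) v *s u j)) (at y)" if j: "j < ?r" for j
    proof -
      have a: "((\<lambda>y. cdot (g j) (y - z0)) has_derivative cdot (g j)) (at y)"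
        unfolding cdot_diff_right
        by (rule derivative_eq_intros bounded_linear_imp_has_derivative[OF bounded_linear_cdot] | simp)+
      have "((\<lambda>y. (Fs ! j) y - cdot (g j) (y - z0)) has_derivative (\<lambda>v. cdot (grad (Fs ! j) y - g j) v)) (at y)"
        unfolding cdot_diff_left by (intro has_derivative_diff holo_on_grad[OF holo'[OF j]] a) auto
      moreover have "bounded_linear (\<lambda>c. c *s u j)"
        by (rule linear_conv_bounded_linear[THEN iffD1], rule linearI) (simp_all add: fvec_eq_iff algebra_simps)
      ultimately show ?thesis by (rule bounded_linear.has_derivative[rotated])
    qed
    show ?thesis
      unfolding \<Phi>_def[abs_def] \<Phi>'_def[abs_def]
      by (intro has_derivative_add has_derivative_ident has_derivative_sum 1) auto
  qed
  have gu: "cdot (g i) (\<Sum>j<?r. c j *s u j) = c i" if "i < ?r" for i c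
    using that dual by (simp add: cdot_sum_right cdot_scale_right g_def if_distrib[of "\<lambda>x. _ * x"] cong: if_cong)
  \<comment> \<open>The coordinate \<open>g i\<close> of \<open>\<Phi> y - z0\<close> is the value
    of the \<open>i\<close>-th equation at \<open>y\<close>, so \<open>\<Phi>\<close> maps the zero
    set into an affine subspace.\<close>
  have g\<Phi>: "cdot (g i) (\<Phi> y - z0) = (Fs ! i) y" if "i < ?r" for i y
  proof -
    have "\<Phi> y - z0 = (y - z0) + (\<Sum>j<?r. ((Fs ! j) y - cdot (g j) (y - z0)) *s u j)"
      by (simp add: \<Phi>_def)
    then have "cdot (g i) (\<Phi> y - z0) = cdot (g i) (y - z0) + ((Fs ! i) y - cdot (g i) (y - z0))"
      by (simp only: cdot_add_right gu[OF that])
    then show ?thesis by simp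
  qed
  have g\<Phi>': "cdot (g i) (\<Phi>' y v) = cdot (grad (Fs ! i) y) v" if "i < ?r" for i y v
    unfolding \<Phi>'_def cdot_add_right gu[OF that] cdot_diff_left by simp
  have \<Phi>z0: "\<Phi> z0 = z0" using zero by (auto simp: \<Phi>_def intro!: sum.neutral)
  have idf: "id_blinfun o\<^sub>L Blinfun (\<Phi>' z0) = id_blinfun"
    by (rule blinfun_eqI) (simp add: ap \<Phi>'_def g_def)
  have der': "(\<Phi> has_derivative blinfun_apply (Blinfun (\<Phi>' y))) (at y)" for y
    unfolding ap by (rule der)
  obtain U' V \<Psi> \<Psi>' where IFT: "open U'" "U' \<subseteq> N" "z0 \<in> U'" "open V" "\<Phi> z0 \<in> V" "homeomorphism U' V \<Phi> \<Psi>"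
    "\<And>y. y \<in> V \<Longrightarrow> (\<Psi> has_derivative \<Psi>' y) (at y)"
    "\<And>y. y \<in> V \<Longrightarrow> \<Psi>' y = inv_into UNIV (\<Phi>' (\<Psi> y))" "\<And>y. y \<in> V \<Longrightarrow> bij (\<Phi>' (\<Psi> y))"
    by (rule inverse_function_theorem[OF N(1) der' continuous_on_subset[OF cont subset_UNIV] N(2) idf, unfolded ap])
       (rule that; assumption)
  obtain \<rho> where \<rho>: "\<rho> > 0" "ball z0 (2 * \<rho>) \<subseteq> V"
  proof -
    obtain e where "e > 0" "ball z0 e \<subseteq> V" using IFT(4,5) \<Phi>z0 open_contains_ball by metis
    then show ?thesis using that[of "e / 2"] by simp
  qed
  \<comment> \<open>A bound for the derivative near \<open>z0\<close> bounds the speed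
    \<open>w\<close> of all discs with \<open>norm \<xi> \<le> 1\<close>, whence the common radius
    \<open>\<rho> / M\<close>. Adding 1 leaves room for a strict inequality nearby.\<close>
  define M where "M = norm (Blinfun (\<Phi>' z0)) + 1"
  have M: "M > 0" unfolding M_def by (simp add: add_nonneg_pos)
  have "isCont \<Phi> z0" using der has_derivative_continuous by blast
  then have "(\<Phi> \<longlongrightarrow> z0) (nhds z0)" by (simp add: continuous_at tendsto_nhds_iff \<Phi>z0)
  then have "\<forall>\<^sub>F z in nhds z0. \<Phi> z \<in> ball z0 \<rho>"
    by (rule topological_tendstoD) (use \<rho>(1) in auto)
  moreover have "\<forall>\<^sub>F z in nhds z0. norm (Blinfun (\<Phi>' z)) < M"
  proof -
    have "isCont (\<lambda>y. norm (Blinfun (\<Phi>' y))) z0"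
      using cont by (intro continuous_intros) (simp add: continuous_on_eq_continuous_at)
    then have "((\<lambda>y. norm (Blinfun (\<Phi>' y))) \<longlongrightarrow> norm (Blinfun (\<Phi>' z0))) (nhds z0)"
      by (simp add: continuous_at tendsto_nhds_iff)
    then show ?thesis by (rule order_tendstoD(2)) (simp add: M_def)
  qed
  moreover have "\<forall>\<^sub>F z in nhds z0. z \<in> U'" using IFT(1,3) by (rule eventually_nhds_in_open)
  ultimately have "\<forall>\<^sub>F z in nhds z0. \<Phi> z \<in> ball z0 \<rho> \<and> norm (Blinfun (\<Phi>' z)) < M \<and> z \<in> U'"
    by eventually_elim simp
  then obtain \<epsilon> where \<epsilon>: "\<epsilon> > 0" "\<And>z. dist z z0 < \<epsilon> \<Longrightarrow> \<Phi> z \<in> ball z0 \<rho> \<and> norm (Blinfun (\<Phi>' z)) < M \<and> z \<in> U'"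
    unfolding eventually_nhds_metric by blast
  show thesis
  proof (rule that[of \<epsilon> "\<rho> / M"])
    fix z \<xi>
    assume z: "z \<in> ball z0 \<epsilon>" and Fz: "\<And>F. F \<in> set Fs \<Longrightarrow> F z = 0" and \<xi>: "norm \<xi> \<le> 1"
      and T: "\<And>F. F \<in> set Fs \<Longrightarrow> cdot (grad F z) \<xi> = 0"
    have z': "\<Phi> z \<in> ball z0 \<rho>" "norm (Blinfun (\<Phi>' z)) < M" "z \<in> U'" using \<epsilon>(2)[of z] z by (auto simp: dist_commute)
    define w where "w = \<Phi>' z \<xi>"
    have w: "norm w \<le> M"
    proof -
      have "norm w \<le> norm (Blinfun (\<Phi>' z)) * norm \<xi>" unfolding w_def using norm_blinfun[of "Blinfun (\<Phi>' z)" \<xi>] by (simp add: ap)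
      also have "\<dots> \<le> M * 1" using \<xi> z'(2) M by (intro mult_mono) auto
      finally show ?thesis by simp
    qed
    define c where "c t = \<Phi> z + t *s w" for t :: complex
    define \<gamma> where "\<gamma> t = \<Psi> (c t)" for t
    have norm_scale: "norm (t *s w) = cmod t * norm w" for t
    proof -
      have "(\<Sum>i\<in>UNIV. (norm ((t *s w) $ i))\<^sup>2) = (cmod t)\<^sup>2 * (\<Sum>i\<in>UNIV. (norm (w $ i))\<^sup>2)"
        by (simp add: norm_mult power_mult_distrib sum_distrib_left)
      then show ?thesis by (simp add: norm_vec_def L2_set_def real_sqrt_mult)
    qed
    have cV: "c t \<in> V" if "t \<in> ball 0 (\<rho> / M)" for t
    proof -
      have "cmod t * norm w \<le> cmod t * M" using w by (intro mult_left_mono) auto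
      also have "\<dots> < \<rho>" using that M by (simp add: pos_less_divide_eq)
      finally have "norm (t *s w) < \<rho>" by (simp add: norm_scale)
      moreover have "dist z0 (c t) \<le> dist z0 (\<Phi> z) + norm (t *s w)"
        using norm_triangle_ineq4[of "z0 - \<Phi> z" "t *s w"] by (simp add: c_def dist_norm algebra_simps)
      ultimately have "c t \<in> ball z0 (2 * \<rho>)" using z'(1) by simp
      then show ?thesis using \<rho>(2) by blast
    qed
    have \<Psi>\<Phi>: "\<Psi> (\<Phi> z) = z" using homeomorphism_apply1[OF IFT(6) z'(3)] .
    have lc: "\<Psi>' y (a *s v) = a *s \<Psi>' y v" if "y \<in> V" for y a v
      unfolding IFT(8)[OF that] by (rule inv_complex_linear[OF IFT(9)[OF that] clin])
    show "\<exists>\<gamma> :: complex \<Rightarrow> complex^'n. \<gamma> 0 = z \<and>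
        (\<forall>t\<in>ball 0 (\<rho> / M). \<gamma> t \<in> N \<and> (\<forall>F\<in>set Fs. F (\<gamma> t) = 0) \<and>
          (\<exists>d. (\<forall>i. ((\<lambda>t. \<gamma> t $ i) has_field_derivative d $ i) (at t)) \<and> (t = 0 \<longrightarrow> d = \<xi>)))"
    proof (intro exI[of _ \<gamma>] conjI ballI)
      show \<gamma>0: "\<gamma> 0 = z" by (simp add: \<gamma>_def c_def \<Psi>\<Phi>)
      fix t :: complex assume t: "t \<in> ball 0 (\<rho> / M)"
      have \<gamma>U: "\<gamma> t \<in> U'" unfolding \<gamma>_def using cV[OF t] IFT(6) homeomorphism_image2 by blast
      then show "\<gamma> t \<in> N" using IFT(2) by blast
      have \<Phi>\<gamma>: "\<Phi> (\<gamma> t) = c t" unfolding \<gamma>_def using homeomorphism_apply2[OF IFT(6) cV[OF t]] .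
      show "F (\<gamma> t) = 0" if F: "F \<in> set Fs" for F
      proof -
        obtain i where i: "i < ?r" "Fs ! i = F" using F by (auto simp: in_set_conv_nth)
        have "F (\<gamma> t) = cdot (g i) (c t - z0)" using g\<Phi>[OF i(1), of "\<gamma> t"] i(2) \<Phi>\<gamma> by simp
        \<comment> \<open>Along the line the equation is affine in \<open>t\<close>: its constant
          term is \<open>F z\<close> and its slope the derivative of \<open>F\<close> in direction
          \<xi>, both zero.\<close>
        also have "c t - z0 = (\<Phi> z - z0) + t *s w" by (simp add: c_def)
        also have "cdot (g i) \<dots> = F z + t * cdot (grad F z) \<xi>"
          unfolding cdot_add_right cdot_scale_right w_def g\<Phi>[OF i(1)] g\<Phi>'[OF i(1)] i(2) ..
        finally show ?thesis using Fz T F by simp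
      qed
      show "\<exists>d. (\<forall>i. ((\<lambda>t. \<gamma> t $ i) has_field_derivative d $ i) (at t)) \<and> (t = 0 \<longrightarrow> d = \<xi>)"
      proof (intro exI[of _ "\<Psi>' (c t) w"] conjI allI impI)
        fix i
        have "bounded_linear (\<lambda>h::complex. h *s w)"
          by (rule linear_conv_bounded_linear[THEN iffD1], rule linearI) (simp_all add: fvec_eq_iff algebra_simps)
        then have "(c has_derivative (\<lambda>h. h *s w)) (at t)"
          unfolding c_def[abs_def] by (auto intro!: derivative_eq_intros bounded_linear_imp_has_derivative)
        from has_derivative_compose[OF this IFT(7)[OF cV[OF t]]]
        have "(\<gamma> has_derivative (\<lambda>h. h *s \<Psi>' (c t) w)) (at t)"
          unfolding \<gamma>_def[abs_def] lc[OF cV[OF t]] .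
        from bounded_linear.has_derivative[OF bounded_linear_vec_nth this, of i]
        have "((\<lambda>t. \<gamma> t $ i) has_derivative (\<lambda>h. h * \<Psi>' (c t) w $ i)) (at t)" by simp
        moreover have "(\<lambda>h. h * \<Psi>' (c t) w $ i) = (*) (\<Psi>' (c t) w $ i)" by (rule ext) (rule mult.commute)
        ultimately show "((\<lambda>t. \<gamma> t $ i) has_field_derivative \<Psi>' (c t) w $ i) (at t)"
          by (simp add: has_field_derivative_def)
      next
        assume "t = 0"
        then have ct: "c t = \<Phi> z" by (simp add: c_def)
        have "\<Phi> z \<in> V" using cV[OF t] ct by simp
        then show "\<Psi>' (c t) w = \<xi>"
          unfolding ct w_def using IFT(8,9)[of "\<Phi> z"] by (simp add: \<Psi>\<Phi> bij_inv_eq_iff inv_f_f bij_is_inj)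
      qed
    qed
  qed (use \<epsilon>(1) \<rho>(1) M in auto)
qed

section \<open>Sections of the structure sheaf\<close>

text \<open>The function on the left knows only the section, the derivative on the right only a
  representative. The parameters at which the curve is in the domain of the representative form an
  open set, and the derivative at \<open>t\<close> is decided there.\<close>

lemma local_rep_curve:
  assumes T: "open T" "t \<in> T" "\<And>s. s \<in> T \<Longrightarrow> \<gamma> s \<in> U" "continuous_on T \<gamma>"
    and A: "local_rep U a (\<gamma> t) A" and d: "\<And>i. ((\<lambda>s. \<gamma> s $ i) has_field_derivative d $ i) (at t)"
  shows "((\<lambda>s. a (\<gamma> s)) has_field_derivative cdot (grad A (\<gamma> t)) d) (at t)"
proof -
  obtain W where W: "\<gamma> t \<in> W" "holo_on A W" "\<And>x. x \<in> W \<inter> U \<Longrightarrow> A x = a x"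
    using A unfolding local_rep_def by blast
  have "((\<lambda>s. A (\<gamma> s)) has_field_derivative cdot (grad A (\<gamma> t)) d) (at t)"
    by (rule holo_on_compose_curve[OF W(2,1) d])
  moreover have "open (T \<inter> \<gamma> -` W)"
    by (rule continuous_open_preimage[OF T(4,1) holo_on_open[OF W(2)]])
  ultimately show ?thesis
    by (rule has_field_derivative_transform_within_open) (use T W in auto)
qed

lemma local_rep_conic:
  assumes "local_rep U a z A"
  obtains W where "z \<in> W" "conic W" "holo_on A W" "homogeneous0_on W A" "\<And>x. x \<in> W \<inter> U \<Longrightarrow> A x = a x"
  using assms unfolding local_rep_def by blast

lemma local_rep_value: "local_rep U a z A \<Longrightarrow> z \<in> U \<Longrightarrow> A z = a z"
  unfolding local_rep_def by blast

text \<open>Euler's relation in degree 0: the radial direction is annihilated, which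
  \<open>D3_swap_last\<close> requires of both arguments.\<close>

lemma local_rep_euler:
  assumes "local_rep U a z A" shows "cdot (grad A z) z = 0"
proof -
  obtain W where W: "z \<in> W" "conic W" "holo_on A W" "homogeneous0_on W A"
    using assms by (rule local_rep_conic)
  then show ?thesis
    using euler_homogeneous[OF W(3,1), of 0] by (simp add: homogeneous0_on_def)
qed

lemma local_rep_restr:
  assumes "local_rep U a z A" "V \<subseteq> U" shows "local_rep V (restr V a) z A"
  using assms unfolding local_rep_def restr_def by (metis (no_types, lifting) IntD1 IntD2 IntI subsetD)

lemma conic_Int: "conic A \<Longrightarrow> conic B \<Longrightarrow> conic (A \<inter> B)"
  by (simp add: conic_def)

lemma conic_UNIV: "conic UNIV"
  by (simp add: conic_def)

lemma conic_coord: "conic {z. z $ m \<noteq> 0}"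
  by (auto simp: conic_def)

lemma open_coord: "open {z :: complex^'n. z $ m \<noteq> 0}"
  by (intro open_Collect_neq continuous_intros)

lemma local_rep_const: "local_rep U (\<lambda>z. c) z (\<lambda>z. c)"
  unfolding local_rep_def by (rule exI[of _ UNIV]) (simp add: conic_UNIV homogeneous0_on_def)

lemma local_rep_op:
  assumes a: "local_rep U a z A" and b: "local_rep U b z B"
    and h: "\<And>W. holo_on A W \<Longrightarrow> holo_on B W \<Longrightarrow> holo_on (\<lambda>z. f (A z) (B z)) W"
  shows "local_rep U (\<lambda>z. f (a z) (b z)) z (\<lambda>z. f (A z) (B z))"
proof -
  obtain V where V: "z \<in> V" "conic V" "holo_on A V" "homogeneous0_on V A" "\<And>x. x \<in> V \<inter> U \<Longrightarrow> A x = a x"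
    using a by (rule local_rep_conic) blast
  obtain W where W: "z \<in> W" "conic W" "holo_on B W" "homogeneous0_on W B" "\<And>x. x \<in> W \<inter> U \<Longrightarrow> B x = b x"
    using b by (rule local_rep_conic) blast
  have "open (V \<inter> W)" using V(3) W(3) holo_on_open by blast
  then have "holo_on (\<lambda>z. f (A z) (B z)) (V \<inter> W)"
    by (intro h holo_on_subset[OF V(3)] holo_on_subset[OF W(3)]) auto
  then show ?thesis
    unfolding local_rep_def using V W
    by (intro exI[of _ "V \<inter> W"]) (auto simp: conic_def homogeneous0_on_def)
qed

lemmas local_rep_add = local_rep_op[where f = "(+)", OF _ _ holo_on_add]
  and local_rep_mult = local_rep_op[where f = "(*)", OF _ _ holo_on_mult]

lemma local_rep_inverse:
  assumes a: "local_rep U a z A" and z: "z \<in> U" "a z \<noteq> 0"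
  shows "local_rep U (\<lambda>z. inverse (a z)) z (\<lambda>z. inverse (A z))"
proof -
  obtain V where V: "z \<in> V" "conic V" "holo_on A V" "homogeneous0_on V A" "\<And>x. x \<in> V \<inter> U \<Longrightarrow> A x = a x"
    using a by (rule local_rep_conic) blast
  have o: "open (V \<inter> A -` (- {0}))"
    by (rule continuous_open_preimage[OF holo_on_continuous[OF V(3)] holo_on_open[OF V(3)]]) auto
  have "holo_on (\<lambda>z. inverse (A z)) (V \<inter> A -` (- {0}))"
    by (intro holo_on_inverse holo_on_subset[OF V(3)] o) auto
  moreover have "A z \<noteq> 0" using V(5)[of z] V(1) z by simp
  ultimately show ?thesis
    unfolding local_rep_def using V
    by (intro exI[of _ "V \<inter> A -` (- {0})"]) (auto simp: conic_def homogeneous0_on_def)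
qed

lemma sectionsI:
  assumes "\<And>z. z \<notin> U \<Longrightarrow> a z = 0" "homogeneous0_on U a" "\<And>z. z \<in> U \<Longrightarrow> \<exists>A. local_rep U a z A"
  shows "a \<in> sections U"
  using assms by (simp add: sections_def)

lemma sections_outside: "a \<in> sections U \<Longrightarrow> z \<notin> U \<Longrightarrow> a z = 0"
  and sections_hom: "a \<in> sections U \<Longrightarrow> homogeneous0_on U a"
  and sections_rep: "a \<in> sections U \<Longrightarrow> z \<in> U \<Longrightarrow> \<exists>A. local_rep U a z A"
  by (auto simp: sections_def)

text \<open>The condition \<open>f 0 0 = 0\<close> respects the convention that a section is 0
  outside its domain.\<close>

lemma sections_op:
  fixes U :: "(complex^'n) set"
  assumes a: "a \<in> sections U" and b: "b \<in> sections U" and 0: "f 0 0 = 0"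
    and h: "\<And>(W :: (complex^'n) set) A B. holo_on A W \<Longrightarrow> holo_on B W \<Longrightarrow> holo_on (\<lambda>z. f (A z) (B z)) W"
  shows "(\<lambda>z. f (a z) (b z)) \<in> sections U"
proof (rule sectionsI)
  show "f (a z) (b z) = 0" if "z \<notin> U" for z using that sections_outside a b 0 by metis
  show "homogeneous0_on U (\<lambda>z. f (a z) (b z))"
    using sections_hom[OF a] sections_hom[OF b] by (simp add: homogeneous0_on_def)
  show "\<exists>A. local_rep U (\<lambda>z. f (a z) (b z)) z A" if z: "z \<in> U" for z
  proof -
    obtain A B where AB: "local_rep U a z A" "local_rep U b z B"
      using sections_rep[OF a z] sections_rep[OF b z] by blast
    show ?thesis using local_rep_op[where f = f, OF AB] h by blast
  qed
qed

lemma sections_zero: "(\<lambda>z. 0) \<in> sections U"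
  by (rule sectionsI) (auto simp: homogeneous0_on_def intro: local_rep_const)

lemma sections_add: "a \<in> sections U \<Longrightarrow> b \<in> sections U \<Longrightarrow> (\<lambda>z. a z + b z) \<in> sections U"
  by (rule sections_op[where f = "(+)"]) (simp_all add: holo_on_add)

lemma sections_diff: "a \<in> sections U \<Longrightarrow> b \<in> sections U \<Longrightarrow> (\<lambda>z. a z - b z) \<in> sections U"
  by (rule sections_op[where f = "(-)"]) (simp_all add: holo_on_diff)

lemma sections_mult: "a \<in> sections U \<Longrightarrow> b \<in> sections U \<Longrightarrow> (\<lambda>z. a z * b z) \<in> sections U"
  by (rule sections_op[where f = "(*)"]) (simp_all add: holo_on_mult)

lemma sections_lin: "a \<in> sections U \<Longrightarrow> b \<in> sections U \<Longrightarrow> (\<lambda>z. c * a z + b z) \<in> sections U"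
  by (rule sections_op[where f = "\<lambda>x y. c * x + y"])
     (simp_all add: holo_on_add holo_on_mult holo_on_open)

lemma sections_scale: "a \<in> sections U \<Longrightarrow> (\<lambda>z. c * a z) \<in> sections U"
  using sections_lin[OF _ sections_zero, of a U c] by simp

lemma sections_uminus: "a \<in> sections U \<Longrightarrow> (\<lambda>z. - a z) \<in> sections U"
  using sections_scale[of a U "-1"] by simp

lemma sections_restr:
  assumes "a \<in> sections U" "V \<subseteq> U" "conic V" shows "restr V a \<in> sections V"
proof (rule sectionsI)
  show "restr V a z = 0" if "z \<notin> V" for z using that by (simp add: restr_def)
  show "\<exists>A. local_rep V (restr V a) z A" if "z \<in> V" for z
    using sections_rep[OF assms(1)] local_rep_restr assms(2) that by blast
  show "homogeneous0_on V (restr V a)"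
    using sections_hom[OF assms(1)] assms(2,3) by (auto simp: homogeneous0_on_def restr_def conic_def)
qed

text \<open>Outside \<open>U\<close> the convention \<open>inverse 0 = 0\<close> gives the required
  value.\<close>

lemma sections_inverse:
  assumes a: "a \<in> sections U" and nz: "\<And>z. z \<in> U \<Longrightarrow> a z \<noteq> 0"
  shows "(\<lambda>z. inverse (a z)) \<in> sections U"
proof (rule sectionsI)
  show "inverse (a z) = 0" if "z \<notin> U" for z using sections_outside[OF a that] by simp
  show "homogeneous0_on U (\<lambda>z. inverse (a z))" using sections_hom[OF a] by (simp add: homogeneous0_on_def)
  show "\<exists>A. local_rep U (\<lambda>z. inverse (a z)) z A" if z: "z \<in> U" for z
  proof -
    obtain A where "local_rep U a z A" using sections_rep[OF a z] by blast
    from local_rep_inverse[OF this z nz[OF z]] show ?thesis by blast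
  qed
qed

lemma restr_restr [simp]: "restr V (restr U a) = restr (V \<inter> U) a"
  by (auto simp: restr_def)

lemma restr_apply: "z \<in> V \<Longrightarrow> restr V a z = a z"
  by (simp add: restr_def)

lemma openX_Int: "openX X U \<Longrightarrow> openX X V \<Longrightarrow> openX X (U \<inter> V)"
  by (auto simp: openX_def conic_Int)

lemma openX_subset: "openX X U \<Longrightarrow> U \<subseteq> X"
  using openin_subset[of "top_of_set X" U] by (simp add: openX_def)

lemma openX_conic: "openX X U \<Longrightarrow> conic U"
  by (simp add: openX_def)


text \<open>There are \<open>length Fs + 3\<close> homogeneous coordinates, so the condition on
  \<open>sum_list degs\<close> is the one under which adjunction gives a trivial canonical bundle.
  Here it acts through the homogeneity of the bracket.\<close>

locale jacobian_variety =
  fixes Fs :: "(complex^'n::finite \<Rightarrow> complex) list" and degs :: "nat list" and \<iota> :: "nat \<Rightarrow> 'n"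
  assumes card: "CARD('n) = length Fs + 3"
    and coords: "bij_betw \<iota> {..<CARD('n)} UNIV"
    and polys: "list_all2 homogeneous_poly degs Fs"
    and degs: "sum_list degs = length Fs + 3" "\<And>d. d \<in> set degs \<Longrightarrow> d \<ge> 1"
    and smooth: "smooth_complete_intersection Fs"
begin

abbreviation X where "X \<equiv> proj_zero_set Fs"

abbreviation grads :: "complex^'n \<Rightarrow> (complex^'n) list" where
  "grads z \<equiv> map (\<lambda>F. grad F z) Fs"

lemma bij: "bij_betw \<iota> {..<length (grads z) + 3} UNIV"
  using coords card by simp

lemma len_degs: "length degs = length Fs"
  using polys by (rule list_all2_lengthD)

lemma F_poly: "F \<in> set Fs \<Longrightarrow> \<exists>d\<in>set degs. homogeneous_poly d F"
  using polys by (metis in_set_conv_nth list_all2_conv_all_nth)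

lemma F_holo: "F \<in> set Fs \<Longrightarrow> holo_on F UNIV"
  using F_poly homogeneous_poly_holo by blast

lemma X_conic: "conic X"
proof -
  have "F (c *s z) = 0" if "F \<in> set Fs" "F z = 0" for F c z
    using F_poly[OF that(1)] homogeneous_poly_scale that(2) by fastforce
  then show ?thesis by (auto simp: conic_def proj_zero_set_def)
qed

lemma openX_X: "openX X X"
  by (simp add: openX_def X_conic)

lemma X_zero: "z \<in> X \<Longrightarrow> F \<in> set Fs \<Longrightarrow> F z = 0"
  and X_nonzero: "z \<in> X \<Longrightarrow> z \<noteq> 0"
  by (auto simp: proj_zero_set_def)

lemma X_coord: "z \<in> X \<Longrightarrow> \<exists>m. z $ m \<noteq> 0"
  using X_nonzero by (auto simp: fvec_eq_iff)

lemma grads_euler: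
  assumes "z \<in> X" "g \<in> set (grads z)" shows "cdot g z = 0"
proof -
  obtain F where F: "F \<in> set Fs" "g = grad F z" using assms(2) by auto
  obtain d where d: "homogeneous_poly d F" using F_poly[OF F(1)] by blast
  have "cdot g z = of_nat d * F z"
    unfolding F(2) by (rule euler_homogeneous[OF F_holo[OF F(1)]]) (simp_all add: homogeneous_poly_scale[OF d])
  then show ?thesis using X_zero[OF assms(1) F(1)] by simp
qed

lemma nondegenerate:
  assumes "z \<in> X" "z $ m \<noteq> 0"
  shows "\<exists>i j. jdet \<iota> (grads z @ [axis i 1, axis j 1, axis m 1]) \<noteq> 0"
proof (rule jdet_complete[OF bij])
  fix c assume c: "(\<Sum>k<length (grads z). c k *s grads z ! k) = 0"
  have "(\<Sum>k<length Fs. c k * pd (Fs ! k) i z) = 0" for i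
    using arg_cong[OF c, of "\<lambda>v. v $ i"] by simp
  then show "\<forall>k<length (grads z). c k = 0"
    using smooth assms(1) unfolding smooth_complete_intersection_def by simp
qed (use assms grads_euler in auto)

lemma dual_grads:
  assumes "z \<in> X"
  obtains u :: "nat \<Rightarrow> complex^'n" where "\<And>j k. j < length Fs \<Longrightarrow> k < length Fs \<Longrightarrow>
      cdot (grad (Fs ! j) z) (u k) = (if j = k then 1 else 0)"
proof -
  obtain m where "z $ m \<noteq> 0" using X_coord assms by blast
  then obtain p q where "jdet \<iota> (grads z @ [axis p 1, axis q 1, axis m 1]) \<noteq> 0"
    using nondegenerate[OF assms] by blast
  from dual_vectors[OF this] obtain u :: "nat \<Rightarrow> complex^'n" where u:
    "\<And>j k. j < length (grads z @ [axis p 1, axis q 1, axis m 1]) \<Longrightarrow>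
      k < length (grads z @ [axis p 1, axis q 1, axis m 1]) \<Longrightarrow>
       cdot ((grads z @ [axis p 1, axis q 1, axis m 1]) ! j) (u k) = (if j = k then 1 else 0)"
    by blast
  show ?thesis
  proof (rule that[of u])
    fix j k assume "j < length Fs" "k < length Fs"
    with u[of j k] show "cdot (grad (Fs ! j) z) (u k) = (if j = k then 1 else 0)"
      by (simp add: nth_append)
  qed
qed

section \<open>Tangent vectors, discs and Cauchy estimates on the variety\<close>

definition tangent :: "complex^'n \<Rightarrow> complex^'n \<Rightarrow> bool" where
  "tangent z \<xi> \<longleftrightarrow> (\<forall>F\<in>set Fs. cdot (grad F z) \<xi> = 0)"

text \<open>The cone \<open>X\<close> lacks its vertex and is not closed. A ball of radius at most
  half of \<open>norm z0\<close> avoids the vertex, and inside it \<open>X\<close> is a closed zero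
  set.\<close>

lemma openX_cball:
  assumes U: "openX X U" and z: "z0 \<in> U"
  obtains \<delta> where "\<delta> > 0" "compact (cball z0 \<delta> \<inter> X)" "cball z0 \<delta> \<inter> X \<subseteq> U"
proof -
  have zX: "z0 \<in> X" using U z openX_subset by blast
  obtain T where T: "open T" "U = X \<inter> T" using U unfolding openX_def openin_open by blast
  obtain e where e: "e > 0" "cball z0 e \<subseteq> T" using T z open_contains_cball by blast
  define \<delta> where "\<delta> = min e (norm z0 / 2)"
  have n: "norm z0 > 0" using X_nonzero[OF zX] by simp
  have "cball z0 \<delta> \<inter> X = cball z0 \<delta> \<inter> (\<Inter>F\<in>set Fs. {z. F z = 0})"
  proof -
    have "\<delta> \<le> norm z0 / 2" by (simp add: \<delta>_def)
    then have "\<not> norm z0 \<le> \<delta>" using n by linarith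
    then have "0 \<notin> cball z0 \<delta>" by simp
    then show ?thesis by (auto simp: proj_zero_set_def)
  qed
  moreover have "closed (\<Inter>F\<in>set Fs. {z. F z = 0})"
    by (intro closed_INT ballI closed_Collect_eq holo_on_continuous F_holo continuous_intros)
  ultimately have "compact (cball z0 \<delta> \<inter> X)" by (simp add: compact_Int_closed)
  moreover have "cball z0 \<delta> \<inter> X \<subseteq> U" using e(2) T by (auto simp: \<delta>_def)
  moreover have "\<delta> > 0" using e n by (simp add: \<delta>_def)
  ultimately show ?thesis using that by blast
qed

text \<open>One radius \<open>r\<close> and one compact set \<open>K\<close> serve all points near
  \<open>z0\<close> and all tangent directions of norm at most 1; the uniform Cauchy estimate
  depends on this.\<close>

lemma discs:
  assumes U: "openX X U" and z0: "z0 \<in> U"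
  obtains \<epsilon> r :: real and K where "\<epsilon> > 0" "r > 0" "compact K" "K \<subseteq> U"
    "\<And>z \<xi>. \<lbrakk>z \<in> ball z0 \<epsilon>; z \<in> X; norm \<xi> \<le> 1; tangent z \<xi>\<rbrakk> \<Longrightarrow>
      \<exists>\<gamma> :: complex \<Rightarrow> complex^'n. \<gamma> 0 = z \<and>
        (\<forall>t\<in>ball 0 r. \<gamma> t \<in> K \<and>
          (\<exists>d. (\<forall>i. ((\<lambda>t. \<gamma> t $ i) has_field_derivative d $ i) (at t)) \<and> (t = 0 \<longrightarrow> d = \<xi>)))"
proof -
  have zX: "z0 \<in> X" using U z0 openX_subset by blast
  obtain \<delta> where \<delta>: "\<delta> > 0" "compact (cball z0 \<delta> \<inter> X)" "cball z0 \<delta> \<inter> X \<subseteq> U"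
    using openX_cball[OF U z0] by blast
  \<comment> \<open>An open ball of radius at most \<open>norm z0\<close> around \<open>z0\<close>
    does not contain 0, so zeros of the equations in it are points of \<open>X\<close>.\<close>
  define \<delta>' where "\<delta>' = min \<delta> (norm z0)"
  have \<delta>': "\<delta>' > 0" using X_nonzero[OF zX] \<delta> by (simp add: \<delta>'_def)
  obtain u :: "nat \<Rightarrow> complex^'n" where u: "\<And>j k. j < length Fs \<Longrightarrow> k < length Fs \<Longrightarrow>
      cdot (grad (Fs ! j) z0) (u k) = (if j = k then 1 else 0)"
    using dual_grads[OF zX] by blast
  obtain \<epsilon> r :: real where \<epsilon>: "\<epsilon> > 0" "r > 0" and discs:
    "\<And>z \<xi>. \<lbrakk>z \<in> ball z0 \<epsilon>; \<And>F. F \<in> set Fs \<Longrightarrow> F z = 0; norm \<xi> \<le> 1;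
        \<And>F. F \<in> set Fs \<Longrightarrow> cdot (grad F z) \<xi> = 0\<rbrakk> \<Longrightarrow>
      \<exists>\<gamma> :: complex \<Rightarrow> complex^'n. \<gamma> 0 = z \<and>
        (\<forall>t\<in>ball 0 r. \<gamma> t \<in> ball z0 \<delta>' \<and> (\<forall>F\<in>set Fs. F (\<gamma> t) = 0) \<and>
          (\<exists>d. (\<forall>i. ((\<lambda>t. \<gamma> t $ i) has_field_derivative d $ i) (at t)) \<and> (t = 0 \<longrightarrow> d = \<xi>)))"
    by (rule tangent_discs[of Fs z0 u "ball z0 \<delta>'"])
       (assumption | erule F_holo X_zero[OF zX] | rule u open_ball that | simp add: \<delta>')+
  have K: "y \<in> cball z0 \<delta> \<inter> X" if "y \<in> ball z0 \<delta>'" "\<forall>F\<in>set Fs. F y = 0" for y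
  proof -
    have "y \<noteq> 0" using that(1) by (auto simp: \<delta>'_def)
    then show ?thesis using that by (auto simp: proj_zero_set_def \<delta>'_def)
  qed
  show ?thesis
  proof (rule that[OF \<epsilon> \<delta>(2,3)])
    fix z \<xi> assume h: "z \<in> ball z0 \<epsilon>" "z \<in> X" "norm \<xi> \<le> 1" "tangent z \<xi>"
    have "\<exists>\<gamma> :: complex \<Rightarrow> complex^'n. \<gamma> 0 = z \<and>
        (\<forall>t\<in>ball 0 r. \<gamma> t \<in> ball z0 \<delta>' \<and> (\<forall>F\<in>set Fs. F (\<gamma> t) = 0) \<and>
          (\<exists>d. (\<forall>i. ((\<lambda>t. \<gamma> t $ i) has_field_derivative d $ i) (at t)) \<and> (t = 0 \<longrightarrow> d = \<xi>)))"
      by (rule discs) (use h X_zero in \<open>auto simp: tangent_def\<close>)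
    then obtain \<gamma> :: "complex \<Rightarrow> complex^'n" where \<gamma>: "\<gamma> 0 = z"
        "\<forall>t\<in>ball 0 r. \<gamma> t \<in> ball z0 \<delta>' \<and> (\<forall>F\<in>set Fs. F (\<gamma> t) = 0) \<and>
          (\<exists>d. (\<forall>i. ((\<lambda>t. \<gamma> t $ i) has_field_derivative d $ i) (at t)) \<and> (t = 0 \<longrightarrow> d = \<xi>))" by blast
    show "\<exists>\<gamma> :: complex \<Rightarrow> complex^'n. \<gamma> 0 = z \<and>
        (\<forall>t\<in>ball 0 r. \<gamma> t \<in> cball z0 \<delta> \<inter> X \<and>
          (\<exists>d. (\<forall>i. ((\<lambda>t. \<gamma> t $ i) has_field_derivative d $ i) (at t)) \<and> (t = 0 \<longrightarrow> d = \<xi>)))"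
      by (intro exI[of _ \<gamma>] conjI[OF \<gamma>(1)] ballI conjI[OF K]) (use \<gamma>(2) in blast)+
  qed
qed

lemma curve_continuous:
  fixes \<gamma> :: "complex \<Rightarrow> complex^'n"
  assumes "\<And>t. t \<in> T \<Longrightarrow> \<exists>d. \<forall>i. ((\<lambda>t. \<gamma> t $ i) has_field_derivative d $ i) (at t)"
  shows "continuous_on T \<gamma>"
proof -
  have "continuous_on T (\<lambda>t. \<chi> i. \<gamma> t $ i)"
    by (intro continuous_on_vec_lambda continuous_at_imp_continuous_on ballI)
       (use assms DERIV_isCont in blast)
  then show ?thesis by simp
qed

text \<open>Cauchy's inequality for the section restricted to a disc. The bound uses values of the
  section on \<open>K\<close>, never those of the representative, whose domain may shrink as the
  section varies.\<close>

lemma cauchy_estimate: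
  assumes U: "openX X U" and z0: "z0 \<in> U"
  obtains \<epsilon> C :: real and K where "\<epsilon> > 0" "C > 0" "compact K" "K \<subseteq> U"
    "\<And>z \<xi> a A B. \<lbrakk>z \<in> ball z0 \<epsilon>; z \<in> X; tangent z \<xi>; a \<in> sections U; local_rep U a z A;
        \<And>y. y \<in> K \<Longrightarrow> cmod (a y) \<le> B\<rbrakk> \<Longrightarrow> cmod (cdot (grad A z) \<xi>) \<le> C * B * norm \<xi>"
proof -
  obtain \<epsilon> r :: real and K where D: "\<epsilon> > 0" "r > 0" "compact K" "K \<subseteq> U"
    "\<And>z \<xi>. \<lbrakk>z \<in> ball z0 \<epsilon>; z \<in> X; norm \<xi> \<le> 1; tangent z \<xi>\<rbrakk> \<Longrightarrow>
      \<exists>\<gamma> :: complex \<Rightarrow> complex^'n. \<gamma> 0 = z \<and>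
        (\<forall>t\<in>ball 0 r. \<gamma> t \<in> K \<and>
          (\<exists>d. (\<forall>i. ((\<lambda>t. \<gamma> t $ i) has_field_derivative d $ i) (at t)) \<and> (t = 0 \<longrightarrow> d = \<xi>)))"
    using discs[OF U z0] by blast
  have unit: "cmod (cdot (grad A z) \<xi>) \<le> 2 / r * B"
    if z: "z \<in> ball z0 \<epsilon>" "z \<in> X" and \<xi>: "norm \<xi> \<le> 1" "tangent z \<xi>" and a: "a \<in> sections U"
      and A: "local_rep U a z A" and B: "\<And>y. y \<in> K \<Longrightarrow> cmod (a y) \<le> B" for z \<xi> a A B
  proof -
    obtain \<gamma> :: "complex \<Rightarrow> complex^'n" where \<gamma>: "\<gamma> 0 = z" "\<And>t. t \<in> ball 0 r \<Longrightarrow> \<gamma> t \<in> K"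
      "\<And>t. t \<in> ball 0 r \<Longrightarrow> \<exists>d. (\<forall>i. ((\<lambda>t. \<gamma> t $ i) has_field_derivative d $ i) (at t)) \<and> (t = 0 \<longrightarrow> d = \<xi>)"
      using D(5)[OF z \<xi>] by blast
    have c: "continuous_on (ball 0 r) \<gamma>" by (rule curve_continuous) (use \<gamma>(3) in blast)
    have \<gamma>U: "\<gamma> t \<in> U" if "t \<in> ball 0 r" for t using \<gamma>(2)[OF that] D(4) by blast
    note curve = local_rep_curve[OF open_ball _ \<gamma>U c]
    have hol: "(\<lambda>t. a (\<gamma> t)) holomorphic_on ball 0 r"
    proof (rule holomorphic_onI)
      fix t :: complex assume t: "t \<in> ball 0 r"
      obtain A' where "local_rep U a (\<gamma> t) A'" using sections_rep[OF a \<gamma>U[OF t]] by blast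
      with curve[OF t _ this] \<gamma>(3)[OF t]
      show "(\<lambda>t. a (\<gamma> t)) field_differentiable at t within ball 0 r"
        unfolding field_differentiable_def by (blast intro: has_field_derivative_at_within)
    qed
    have 0: "0 \<in> ball (0::complex) r" using D(2) by simp
    have "((\<lambda>t. a (\<gamma> t)) has_field_derivative cdot (grad A z) \<xi>) (at 0)"
      using curve[OF 0 _ A[folded \<gamma>(1)], of \<xi>] \<gamma>(1) \<gamma>(3)[OF 0] by auto
    then have "cdot (grad A z) \<xi> = (deriv ^^ 1) (\<lambda>t. a (\<gamma> t)) 0" by (simp add: DERIV_imp_deriv)
    \<comment> \<open>Half the radius keeps the closed disc inside the domain of the curve; this is
      the origin of the constant \<open>2 / r\<close>.\<close>
    also have "cmod \<dots> \<le> fact 1 * B / (r / 2) ^ 1"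
    proof (rule Cauchy_inequality)
      show "(\<lambda>t. a (\<gamma> t)) holomorphic_on ball 0 (r / 2)"
        by (rule holomorphic_on_subset[OF hol]) (use D(2) in auto)
      show "continuous_on (cball 0 (r / 2)) (\<lambda>t. a (\<gamma> t))"
        by (rule continuous_on_subset[OF holomorphic_on_imp_continuous_on[OF hol]]) (use D(2) in auto)
      fix x :: complex assume "norm (0 - x) = r / 2"
      then show "norm (a (\<gamma> x)) \<le> B" using D(2) by (intro B \<gamma>(2)) simp
    qed (use D(2) in simp)
    finally show ?thesis by (simp add: field_simps)
  qed
  show ?thesis
  proof (rule that[OF D(1) _ D(3,4), of "2 / r"])
    fix z \<xi> a A B
    assume h: "z \<in> ball z0 \<epsilon>" "z \<in> X" "tangent z \<xi>" "a \<in> sections U" "local_rep U a z A"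
        "\<And>y. y \<in> K \<Longrightarrow> cmod (a y) \<le> B"
    show "cmod (cdot (grad A z) \<xi>) \<le> 2 / r * B * norm \<xi>"
    proof (cases "\<xi> = 0")
      case False
      define c where "c = complex_of_real (1 / norm \<xi>)"
      have sc: "c *s \<xi> = (1 / norm \<xi>) *\<^sub>R \<xi>"
        by (simp add: c_def fvec_eq_iff) (simp add: scaleR_conv_of_real divide_inverse mult.commute)
      have "cmod (cdot (grad A z) (c *s \<xi>)) \<le> 2 / r * B"
        by (rule unit) (use h False in \<open>auto simp: sc tangent_def cdot_scaleR_right\<close>)
      moreover have "cmod (cdot (grad A z) (c *s \<xi>)) = cmod (cdot (grad A z) \<xi>) / norm \<xi>"
        by (simp add: sc cdot_scaleR_right divide_inverse mult.commute)
      ultimately have "cmod (cdot (grad A z) \<xi>) / norm \<xi> \<le> 2 / r * B" by simp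
      moreover have "norm \<xi> > 0" using False by simp
      ultimately show ?thesis by (metis pos_divide_le_eq)
    qed simp
  qed (use D(2) in simp)
qed

text \<open>Two representatives agree on \<open>X\<close> only and may differ in normal directions.
  Along a disc inside \<open>X\<close> both compute the derivative of the same function. The
  direction is normalised first, since discs are available for norm at most 1.\<close>

lemma local_rep_unique:
  assumes U: "openX X U" and z: "z \<in> U" and A: "local_rep U a z A" "local_rep U a z A'"
    and \<xi>: "tangent z \<xi>"
  shows "cdot (grad A z) \<xi> = cdot (grad A' z) \<xi>"
proof (cases "\<xi> = 0")
  case False
  define c where "c = complex_of_real (1 / norm \<xi>)"
  have sc: "c *s \<xi> = (1 / norm \<xi>) *\<^sub>R \<xi>"
    by (simp add: c_def fvec_eq_iff) (simp add: scaleR_conv_of_real divide_inverse mult.commute)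
  have c: "norm (c *s \<xi>) \<le> 1" "tangent z (c *s \<xi>)" using \<xi> False by (auto simp: sc tangent_def cdot_scaleR_right)
  obtain \<epsilon> r :: real and K where D: "\<epsilon> > 0" "r > 0" "compact K" "K \<subseteq> U"
    "\<And>z' \<xi>. \<lbrakk>z' \<in> ball z \<epsilon>; z' \<in> X; norm \<xi> \<le> 1; tangent z' \<xi>\<rbrakk> \<Longrightarrow>
      \<exists>\<gamma> :: complex \<Rightarrow> complex^'n. \<gamma> 0 = z' \<and>
        (\<forall>t\<in>ball 0 r. \<gamma> t \<in> K \<and>
          (\<exists>d. (\<forall>i. ((\<lambda>t. \<gamma> t $ i) has_field_derivative d $ i) (at t)) \<and> (t = 0 \<longrightarrow> d = \<xi>)))"
    using discs[OF U z] by blast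
  obtain \<gamma> :: "complex \<Rightarrow> complex^'n" where \<gamma>: "\<gamma> 0 = z" "\<And>t. t \<in> ball 0 r \<Longrightarrow> \<gamma> t \<in> K"
      "\<And>t. t \<in> ball 0 r \<Longrightarrow> \<exists>d. (\<forall>i. ((\<lambda>t. \<gamma> t $ i) has_field_derivative d $ i) (at t)) \<and> (t = 0 \<longrightarrow> d = c *s \<xi>)"
  proof -
    have "z \<in> ball z \<epsilon>" "z \<in> X" using D(1) z openX_subset[OF U] by auto
    from D(5)[OF this c] that show ?thesis by blast
  qed
  have co: "continuous_on (ball 0 r) \<gamma>" by (rule curve_continuous) (use \<gamma>(3) in blast)
  have \<gamma>U: "\<gamma> t \<in> U" if "t \<in> ball 0 r" for t using \<gamma>(2)[OF that] D(4) by blast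
  have 0: "0 \<in> ball (0::complex) r" using D(2) by simp
  have "((\<lambda>t. a (\<gamma> t)) has_field_derivative cdot (grad B z) (c *s \<xi>)) (at 0)" if "local_rep U a z B" for B
    using local_rep_curve[OF open_ball 0 \<gamma>U co that[folded \<gamma>(1)], of "c *s \<xi>"] \<gamma>(1) \<gamma>(3)[OF 0] by auto
  from DERIV_unique[OF this[OF A(1)] this[OF A(2)]] False
  show ?thesis by (simp add: sc cdot_scaleR_right)
qed simp

end

section \<open>The Jacobian bracket\<close>

lemma local_rep_nearby:
  assumes "local_rep U a z A"
  obtains W where "z \<in> W" "conic W" "holo_on A W" "homogeneous0_on W A"
    "\<And>x. x \<in> W \<Longrightarrow> local_rep U a x A"
proof -
  obtain W where W: "z \<in> W" "conic W" "holo_on A W" "homogeneous0_on W A" "\<And>x. x \<in> W \<inter> U \<Longrightarrow> A x = a x"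
    using assms by (rule local_rep_conic) blast
  then have "local_rep U a x A" if "x \<in> W" for x
    unfolding local_rep_def using that by blast
  with W show ?thesis using that by blast
qed

lemma local_rep_holo2:
  assumes "local_rep U a z A" "local_rep U b z B"
  obtains W where "z \<in> W" "conic W" "holo_on A W" "holo_on B W" "homogeneous0_on W A" "homogeneous0_on W B"
    "\<And>x. x \<in> W \<Longrightarrow> local_rep U a x A" "\<And>x. x \<in> W \<Longrightarrow> local_rep U b x B"
proof -
  obtain V where V: "z \<in> V" "conic V" "holo_on A V" "homogeneous0_on V A"
    "\<And>x. x \<in> V \<Longrightarrow> local_rep U a x A" using assms(1) by (rule local_rep_nearby) blast
  obtain W where W: "z \<in> W" "conic W" "holo_on B W" "homogeneous0_on W B"
    "\<And>x. x \<in> W \<Longrightarrow> local_rep U b x B" using assms(2) by (rule local_rep_nearby) blast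
  have "open (V \<inter> W)" using V(3) W(3) holo_on_open by blast
  then have "holo_on A (V \<inter> W)" "holo_on B (V \<inter> W)"
    using holo_on_subset[OF V(3)] holo_on_subset[OF W(3)] by auto
  then show ?thesis
    using V W by (intro that[of "V \<inter> W"] conic_Int) (auto simp: homogeneous0_on_def)
qed

section \<open>Well-definedness, homogeneity and algebraic rules of the bracket\<close>

context jacobian_variety
begin

abbreviation P :: "'n sheaf_map" where "P \<equiv> jacobian_bracket \<iota> Fs"

text \<open>The shape of the Jacobian expression after \<open>jdet_permute\<close>: of the
  permutation only the normalising coordinate is left.\<close>

definition jac :: "'n \<Rightarrow> (complex^'n \<Rightarrow> complex) \<Rightarrow> (complex^'n \<Rightarrow> complex) \<Rightarrow> complex^'n \<Rightarrow> complex" where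
  "jac m A B z = inverse (z $ m) * jdet \<iota> (grads z @ [grad A z, grad B z, axis m 1])"

lemma jacobian_expr_jac:
  assumes \<sigma>: "\<sigma> permutes {..length Fs + 2}"
  shows "jacobian_expr \<iota> Fs \<sigma> A B z = jac (\<iota> (\<sigma> (length Fs + 2))) A B z"
proof -
  let ?rs = "map (\<lambda>F. grad F z) (Fs @ [A, B])"
  have "{..length ?rs} = {..<CARD('n)}" by (auto simp: card)
  then have "inj_on \<iota> {..length ?rs}" using coords by (simp add: bij_betw_def)
  from jdet_permute[OF this, of \<sigma>] \<sigma>
  have "of_int (sign \<sigma>) * Determinant.det (Matrix.mat (length ?rs) (length ?rs) (\<lambda>(k, l). ?rs ! k $ \<iota> (\<sigma> l)))
    = jdet \<iota> (?rs @ [axis (\<iota> (\<sigma> (length ?rs))) 1])" by simp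
  moreover have "Matrix.mat (length ?rs) (length ?rs) (\<lambda>(k, l). ?rs ! k $ \<iota> (\<sigma> l))
      = Matrix.mat (length Fs + 2) (length Fs + 2) (\<lambda>(k, l). pd ((Fs @ [A, B]) ! k) (\<iota> (\<sigma> l)) z)"
    by (rule eq_matI) (auto simp del: map_append simp: nth_map)
  ultimately show ?thesis by (simp add: jacobian_expr_def jac_def Let_def)
qed

lemma jac_coord:
  assumes "z \<in> X" "z $ m \<noteq> 0" "z $ m' \<noteq> 0" "cdot (grad A z) z = 0" "cdot (grad B z) z = 0"
  shows "jac m A B z = jac m' A B z"
  using D3_swap_last[OF bij, where z = z and a = "grad A z" and b = "grad B z" and m = m and m' = m'] assms grads_euler[OF assms(1)] X_nonzero[OF assms(1)]
  by (auto simp: jac_def field_simps)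

lemma jac_cong:
  assumes U: "openX X U" "z \<in> U"
    and A: "local_rep U a z A" "local_rep U a z A'" and B: "local_rep U b z B" "local_rep U b z B'"
  shows "jac m A B z = jac m A' B' z"
proof -
  have "tangent z \<xi>" if "\<And>g. g \<in> set (grads z) \<Longrightarrow> cdot g \<xi> = 0" for \<xi>
    using that by (simp add: tangent_def)
  then have "jdet \<iota> (grads z @ [grad A z, grad B z, axis m 1]) = jdet \<iota> (grads z @ [grad A' z, grad B z, axis m 1])"
    "jdet \<iota> (grads z @ [grad A' z, grad B z, axis m 1]) = jdet \<iota> (grads z @ [grad A' z, grad B' z, axis m 1])"
    using D3_tangent_cong(1)[OF bij local_rep_unique[OF U A]] D3_tangent_cong(2)[OF bij local_rep_unique[OF U B]] by blast+
  then show ?thesis by (simp add: jac_def)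
qed

text \<open>All competing values agree by \<open>jac_coord\<close> and \<open>jac_cong\<close>. For
  the description to single out a value there must also be an admissible permutation, since
  otherwise the condition would be vacuous.\<close>

lemma bracket_eq:
  assumes U: "openX X U" "z \<in> U" and m: "z $ m \<noteq> 0"
    and A: "local_rep U a z A" and B: "local_rep U b z B"
  shows "P U a b z = jac m A B z"
proof -
  let ?N = "length Fs + 2"
  have zX: "z \<in> X" using U openX_subset by blast
  have "jacobian_expr \<iota> Fs \<sigma> A' B' z = jac m A B z"
    if "\<sigma> permutes {..?N}" "z $ \<iota> (\<sigma> ?N) \<noteq> 0" "local_rep U a z A'" "local_rep U b z B'" for \<sigma> A' B'
    unfolding jacobian_expr_jac[OF that(1)]
    using jac_coord[OF zX m that(2) local_rep_euler[OF A] local_rep_euler[OF B]] jac_cong[OF U A that(3) B that(4)]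
    by simp
  moreover have ex: "\<exists>\<sigma>. \<sigma> permutes {..?N} \<and> \<iota> (\<sigma> ?N) = m"
  proof -
    obtain k where k: "k < CARD('n)" "\<iota> k = m" using coords unfolding bij_betw_def by (metis imageE lessThan_iff UNIV_I)
    \<comment> \<open>The transposition of \<open>k\<close> with the last index \<open>?N\<close>
      puts the coordinate \<open>m\<close> into the last place.\<close>
    have "Transposition.transpose k ?N permutes {..?N}" using k card by (intro permutes_swap_id) auto
    then show ?thesis using k by (intro exI[of _ "Transposition.transpose k ?N"]) simp
  qed
  ultimately have "(THE v. \<forall>\<sigma> A B. \<sigma> permutes {..?N} \<and> z $ \<iota> (\<sigma> ?N) \<noteq> 0 \<and>
        local_rep U a z A \<and> local_rep U b z B \<longrightarrow> v = jacobian_expr \<iota> Fs \<sigma> A B z) = jac m A B z"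
  proof (intro the_equality allI impI, goal_cases)
    case (1 \<sigma> A' B')
    then show ?case by simp
  next
    case (2 v)
    from ex obtain \<sigma> where "\<sigma> permutes {..?N}" "\<iota> (\<sigma> ?N) = m" by blast
    then have "v = jacobian_expr \<iota> Fs \<sigma> A B z"
      by (intro 2[rule_format]) (use m A B in simp)
    with \<open>\<sigma> permutes {..?N}\<close> \<open>\<iota> (\<sigma> ?N) = m\<close> show ?case by (simp add: jacobian_expr_jac)
  qed
  then show ?thesis using U(2) by (simp add: jacobian_bracket_def restr_def)
qed

lemma jac_holo:
  assumes "holo_on A W" "holo_on B W"
  shows "holo_on (jac m A B) (W \<inter> {z. z $ m \<noteq> 0})"
proof -
  have o: "open (W \<inter> {z. z $ m \<noteq> 0})" using holo_on_open[OF assms(1)] open_coord by blast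
  let ?rs = "map grad Fs @ [grad A, grad B, \<lambda>z. axis m 1]"
  have "holo_on (\<lambda>z. jdet \<iota> (map (\<lambda>r. r z) ?rs)) (W \<inter> {z. z $ m \<noteq> 0})"
  proof (rule holo_on_jdet[OF o])
    fix r i assume "r \<in> set ?rs"
    then consider F where "r = grad F" "holo_on F W" | "r = (\<lambda>z. axis m 1)"
      using assms holo_on_subset[OF F_holo holo_on_open[OF assms(1)]] by auto
    then show "holo_on (\<lambda>z. r z $ i) (W \<inter> {z. z $ m \<noteq> 0})"
    proof cases
      case 1
      show ?thesis unfolding 1(1) grad_nth by (rule holo_on_subset[OF holo_on_pd[OF 1(2)] o]) blast
    next
      case 2
      show ?thesis unfolding 2 by (rule holo_on_const[OF o])
    qed
  qed
  then have "holo_on (\<lambda>z. jdet \<iota> (grads z @ [grad A z, grad B z, axis m 1])) (W \<inter> {z. z $ m \<noteq> 0})"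
    by (simp add: comp_def)
  moreover have "holo_on (\<lambda>z. inverse (z $ m)) (W \<inter> {z. z $ m \<noteq> 0})"
    by (rule holo_on_inverse[OF holo_on_nth[OF o]]) simp
  ultimately have "holo_on (\<lambda>z. inverse (z $ m) * jdet \<iota> (grads z @ [grad A z, grad B z, axis m 1])) (W \<inter> {z. z $ m \<noteq> 0})"
    by (intro holo_on_mult)
  then show ?thesis by (simp add: jac_def[abs_def])
qed

text \<open>The derivative of a form of degree \<open>d\<close> has degree \<open>d - 1\<close>;
  with \<open>d \<ge> 1\<close> the truncated subtraction is the true one.\<close>

lemma grads_scale:
  assumes c: "c \<noteq> 0"
  shows "grads (c *s z) = map2 (*s) (map (\<lambda>d. c ^ (d - 1)) degs) (grads z)"
proof (rule nth_equalityI)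
  fix k assume "k < length (grads (c *s z))"
  then have k: "k < length Fs" by simp
  have d: "homogeneous_poly (degs ! k) (Fs ! k)" using polys k by (simp add: list_all2_conv_all_nth)
  have dk: "degs ! k \<ge> 1" using degs(2) k len_degs by simp
  have "c *s grad (Fs ! k) (c *s z) = c ^ (degs ! k) *s grad (Fs ! k) z"
    by (rule grad_homogeneous[where W = UNIV])
       (use F_holo k c in \<open>auto simp: conic_UNIV homogeneous_poly_scale[OF d]\<close>)
  moreover have "c ^ (degs ! k) = c * c ^ (degs ! k - 1)" using dk by (simp flip: power_Suc)
  ultimately show "grads (c *s z) ! k = map2 (*s) (map (\<lambda>d. c ^ (d - 1)) degs) (grads z) ! k"
    using k c len_degs by (simp add: fvec_eq_iff)
qed (simp add: len_degs)

text \<open>The exponents \<open>d - 1\<close> add up to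
  \<open>length Fs + 3 - length Fs = 3\<close>, whatever the number of equations.\<close>

lemma degs_prod: "prod_list (map (\<lambda>d. c ^ (d - 1)) degs) = (c :: complex) ^ 3"
proof -
  have "sum_list (map (\<lambda>d. d - 1) ds) + length ds = sum_list ds" if "\<And>d. d \<in> set ds \<Longrightarrow> d \<ge> 1" for ds :: "nat list"
    using that
  proof (induction ds)
    case (Cons d ds)
    then have "sum_list (map (\<lambda>d. d - 1) ds) + length ds = sum_list ds" "d \<ge> 1" by auto
    then show ?case by simp
  qed simp
  from this[of degs] have "sum_list (map (\<lambda>d. d - 1) degs) = 3" using degs len_degs by simp
  moreover have "prod_list (map (\<lambda>d. c ^ (d - 1)) ds) = c ^ sum_list (map (\<lambda>d. d - 1) ds)" for ds
    by (induction ds) (simp_all add: power_add)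
  ultimately show "prod_list (map (\<lambda>d. c ^ (d - 1)) degs) = c ^ 3" by metis
qed

text \<open>The weights cancel: 3 from the equations, -1 from each of the gradients of the two
  functions of degree 0, and -1 from \<open>inverse (z $ m)\<close>.\<close>

lemma jac_hom:
  assumes W: "holo_on A W" "holo_on B W" "conic W" "homogeneous0_on W A" "homogeneous0_on W B" "z \<in> W"
    and c: "c \<noteq> 0"
  shows "jac m A B (c *s z) = jac m A B z"
proof -
  have g: "grad f (c *s z) = inverse c *s grad f z" if "holo_on f W" "homogeneous0_on W f" for f
    using grad_homogeneous[OF that(1) W(3,6) c, of 1] that(2) c
    by (simp add: homogeneous0_on_def fvec_eq_iff field_simps)
  have pr: "prod_list (map (\<lambda>d. c ^ (d - 1)) degs) = c ^ 3" by (rule degs_prod)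
  have "grads (c *s z) @ [grad A (c *s z), grad B (c *s z), axis m 1]
    = map2 (*s) (map (\<lambda>d. c ^ (d - 1)) degs @ [inverse c, inverse c, 1]) (grads z @ [grad A z, grad B z, axis m 1])"
    unfolding grads_scale[OF c] g[OF W(1,4)] g[OF W(2,5)] by (simp add: len_degs)
  then have "jdet \<iota> (grads (c *s z) @ [grad A (c *s z), grad B (c *s z), axis m 1])
    = c ^ 3 * (inverse c * inverse c) * jdet \<iota> (grads z @ [grad A z, grad B z, axis m 1])"
    using jdet_scale_rows[of "map (\<lambda>d. c ^ (d - 1)) degs @ [inverse c, inverse c, 1]"
        "grads z @ [grad A z, grad B z, axis m 1]" \<iota>] by (simp add: len_degs pr[unfolded One_nat_def])
  then show ?thesis using c by (simp add: jac_def power3_eq_cube field_simps)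
qed

text \<open>One formula represents the bracket on a whole neighbourhood, so brackets can be
  iterated. That \<open>jac m A B\<close> is holomorphic again rests on
  \<open>holo_on_pd\<close>.\<close>

lemma bracket_rep:
  assumes U: "openX X U" "z \<in> U" and m: "z $ m \<noteq> 0"
    and A: "local_rep U a z A" and B: "local_rep U b z B"
  shows "local_rep U (P U a b) z (jac m A B)"
proof -
  obtain W where W: "z \<in> W" "conic W" "holo_on A W" "holo_on B W" "homogeneous0_on W A" "homogeneous0_on W B"
    "\<And>x. x \<in> W \<Longrightarrow> local_rep U a x A" "\<And>x. x \<in> W \<Longrightarrow> local_rep U b x B"
    using local_rep_holo2[OF A B] by blast
  show ?thesis
    unfolding local_rep_def
  proof (intro exI[of _ "W \<inter> {z. z $ m \<noteq> 0}"] conjI ballI)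
    show "conic (W \<inter> {z. z $ m \<noteq> 0})" by (intro conic_Int W(2) conic_coord)
    show "holo_on (jac m A B) (W \<inter> {z. z $ m \<noteq> 0})" by (rule jac_holo[OF W(3,4)])
    show "homogeneous0_on (W \<inter> {z. z $ m \<noteq> 0}) (jac m A B)"
      unfolding homogeneous0_on_def using jac_hom[OF W(3,4,2,5,6)] by blast
    show "jac m A B x = P U a b x" if "x \<in> W \<inter> {z. z $ m \<noteq> 0} \<inter> U" for x
      by (rule bracket_eq[OF U(1) _ _ W(7,8), symmetric]) (use that in auto)
  qed (use W m in auto)
qed

lemma bracket_outside: "z \<notin> U \<Longrightarrow> P U a b z = 0"
  by (simp add: jacobian_bracket_def restr_def)

lemma bracket_sections:
  assumes U: "openX X U" and a: "a \<in> sections U" and b: "b \<in> sections U"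
  shows "P U a b \<in> sections U"
proof (rule sectionsI)
  show "P U a b z = 0" if "z \<notin> U" for z using bracket_outside[OF that] .
  have rep: "\<exists>C. local_rep U (P U a b) z C" if z: "z \<in> U" for z
  proof -
    obtain A B where "local_rep U a z A" "local_rep U b z B" using sections_rep a b z by metis
    moreover obtain m where "z $ m \<noteq> 0" using X_coord openX_subset[OF U] z by blast
    ultimately show ?thesis using bracket_rep[OF U z] by blast
  qed
  then show "\<exists>C. local_rep U (P U a b) z C" if "z \<in> U" for z using that .
  show "homogeneous0_on U (P U a b)"
    unfolding homogeneous0_on_def
  proof (intro ballI allI impI)
    fix z and c :: complex assume z: "z \<in> U" and c: "c \<noteq> 0"
    obtain C where C: "local_rep U (P U a b) z C" using rep[OF z] by blast
    then obtain W where W: "z \<in> W" "conic W" "homogeneous0_on W C" "\<And>x. x \<in> W \<inter> U \<Longrightarrow> C x = P U a b x"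
      by (rule local_rep_conic) blast
    have "c *s z \<in> W \<inter> U" using scale_conic[OF _ _ c] z W(1,2) openX_conic[OF U] by blast
    then have "P U a b (c *s z) = C (c *s z)" by (rule W(4)[symmetric])
    also have "\<dots> = C z" using W(1,3) c by (simp add: homogeneous0_on_def)
    also have "\<dots> = P U a b z" using W(1,4) z by simp
    finally show "P U a b (c *s z) = P U a b z" .
  qed
qed

lemma bracket_restr:
  assumes U: "openX X U" and V: "openX X V" "V \<subseteq> U" and a: "a \<in> sections U" and b: "b \<in> sections U"
  shows "P V (restr V a) (restr V b) = restr V (P U a b)"
proof
  fix z
  show "P V (restr V a) (restr V b) z = restr V (P U a b) z"
  proof (cases "z \<in> V")
    case z: True
    then have zU: "z \<in> U" using V by blast
    obtain A B where AB: "local_rep U a z A" "local_rep U b z B" using sections_rep a b zU by metis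
    obtain m where m: "z $ m \<noteq> 0" using X_coord openX_subset[OF U] zU by blast
    show ?thesis
      using bracket_eq[OF U zU m AB] bracket_eq[OF V(1) z m local_rep_restr[OF AB(1) V(2)] local_rep_restr[OF AB(2) V(2)]] z
      by (simp add: restr_def)
  qed (simp add: bracket_outside restr_def)
qed

lemma bracket_pointwise:
  assumes U: "openX X U" and z: "z \<in> U" and a: "a \<in> sections U" and b: "b \<in> sections U"
  obtains m A B where "z $ m \<noteq> 0" "local_rep U a z A" "local_rep U b z B" "P U a b z = jac m A B z"
proof -
  obtain A B where AB: "local_rep U a z A" "local_rep U b z B" using sections_rep a b z by metis
  obtain m where m: "z $ m \<noteq> 0" using X_coord openX_subset[OF U] z by blast
  show ?thesis using that[OF m AB bracket_eq[OF U z m AB]] .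
qed

lemma jac_skew: "jac m B A z = - jac m A B z"
  unfolding jac_def by (subst D3_skew[OF bij]) simp

lemma bracket_skew:
  assumes U: "openX X U" and a: "a \<in> sections U" and b: "b \<in> sections U"
  shows "P U a b = (\<lambda>z. - P U b a z)"
proof
  fix z show "P U a b z = - P U b a z"
  proof (cases "z \<in> U")
    case True
    obtain m A B where r: "z $ m \<noteq> 0" "local_rep U a z A" "local_rep U b z B" "P U a b z = jac m A B z"
      by (rule bracket_pointwise[OF U True a b])
    have "P U b a z = jac m B A z" by (rule bracket_eq[OF U True r(1,3,2)])
    with r(4) show ?thesis by (simp add: jac_skew[of m B A])
  qed (simp add: bracket_outside)
qed

lemma bracket_lin:
  assumes U: "openX X U" and a: "a \<in> sections U" "a' \<in> sections U" and b: "b \<in> sections U"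
  shows "P U (\<lambda>z. c * a z + a' z) b = (\<lambda>z. c * P U a b z + P U a' b z)"
proof
  fix z show "P U (\<lambda>z. c * a z + a' z) b z = c * P U a b z + P U a' b z"
  proof (cases "z \<in> U")
    case z: True
    obtain m A B where r: "z $ m \<noteq> 0" "local_rep U a z A" "local_rep U b z B" "P U a b z = jac m A B z"
      by (rule bracket_pointwise[OF U z a(1) b])
    obtain A' where A': "local_rep U a' z A'" using sections_rep[OF a(2) z] by blast
    obtain W where W: "z \<in> W" "holo_on A W" "holo_on A' W" by (rule local_rep_holo2[OF r(2) A'])
    have "local_rep U (\<lambda>z. c * a z + a' z) z (\<lambda>z. c * A z + A' z)"
      by (intro local_rep_add local_rep_mult local_rep_const r(2) A')
    then have 1: "P U (\<lambda>z. c * a z + a' z) b z = jac m (\<lambda>z. c * A z + A' z) B z"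
      by (rule bracket_eq[OF U z r(1) _ r(3)])
    have "holo_on (\<lambda>z. c * A z) W" by (rule holo_on_mult[OF holo_on_const[OF holo_on_open[OF W(2)]] W(2)])
    from grad_add[OF this W(3,1)]
    have "grad (\<lambda>z. c * A z + A' z) z = c *s grad A z + grad A' z" by (simp add: grad_scale[OF W(2,1)])
    then have 2: "jac m (\<lambda>z. c * A z + A' z) B z = c * jac m A B z + jac m A' B z"
      by (simp add: jac_def D3_add[OF bij] D3_scale[OF bij] algebra_simps)
    show ?thesis unfolding 1 2 r(4) bracket_eq[OF U z r(1) A' r(3)] ..
  qed (simp add: bracket_outside)
qed

lemma bracket_derivation:
  assumes U: "openX X U" and a: "a \<in> sections U" "a' \<in> sections U" and b: "b \<in> sections U"
  shows "P U (\<lambda>z. a z * a' z) b = (\<lambda>z. a z * P U a' b z + a' z * P U a b z)"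
proof
  fix z show "P U (\<lambda>z. a z * a' z) b z = a z * P U a' b z + a' z * P U a b z"
  proof (cases "z \<in> U")
    case z: True
    obtain m A B where r: "z $ m \<noteq> 0" "local_rep U a z A" "local_rep U b z B" "P U a b z = jac m A B z"
      by (rule bracket_pointwise[OF U z a(1) b])
    obtain A' where A': "local_rep U a' z A'" using sections_rep[OF a(2) z] by blast
    obtain W where W: "z \<in> W" "holo_on A W" "holo_on A' W" by (rule local_rep_holo2[OF r(2) A'])
    have v: "A z = a z" "A' z = a' z" using local_rep_value r(2) A' z by blast+
    have 1: "P U (\<lambda>z. a z * a' z) b z = jac m (\<lambda>z. A z * A' z) B z"
      by (rule bracket_eq[OF U z r(1) local_rep_mult[OF r(2) A'] r(3)])
    have 2: "jac m (\<lambda>z. A z * A' z) B z = A z * jac m A' B z + A' z * jac m A B z"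
      unfolding jac_def grad_mult[OF W(2,3,1)] D3_add[OF bij] D3_scale[OF bij] by (simp add: algebra_simps)
    show ?thesis unfolding 1 2 r(4) v bracket_eq[OF U z r(1) A' r(3)] ..
  qed (simp add: bracket_outside)
qed

end

section \<open>Bounded sets of sections and boundedness of the bracket\<close>

lemma sections_continuous:
  assumes "a \<in> sections U" shows "continuous_on U a"
  unfolding continuous_on_def
proof
  fix z assume z: "z \<in> U"
  obtain A where "local_rep U a z A" using sections_rep[OF assms z] by blast
  then obtain W where W: "z \<in> W" "holo_on A W" "\<And>x. x \<in> W \<inter> U \<Longrightarrow> A x = a x"
    by (rule local_rep_conic) blast
  have o: "open W" using holo_on_open[OF W(2)] .
  have "(A \<longlongrightarrow> A z) (at z within U)"
    using holo_on_continuous[OF W(2)] W(1) o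
    by (meson continuous_on_eq_continuous_at continuous_at tendsto_within_subset top_greatest)
  moreover have "\<forall>\<^sub>F x in at z within U. A x = a x"
    unfolding eventually_at_topological using o W by blast
  ultimately show "(a \<longlongrightarrow> a z) (at z within U)"
    using W(1,3) z by (metis (mono_tags, lifting) IntI tendsto_cong)
qed

lemma bounded_sections_single:
  assumes "a \<in> sections U" shows "bounded_sections U {a}"
proof -
  have "\<exists>M. \<forall>z\<in>K. cmod (a z) \<le> M" if "compact K" "K \<subseteq> U" for K
  proof -
    have "compact (a ` K)"
      using that sections_continuous[OF assms] compact_continuous_image continuous_on_subset by blast
    then show ?thesis using compact_imp_bounded bounded_iff by (metis imageI)
  qed
  then show ?thesis using assms by (simp add: bounded_sections_def)
qed

lemma bounded_sections_op:
  assumes B: "bounded_sections U B" and C: "bounded_sections U C"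
    and s: "\<And>a b. a \<in> B \<Longrightarrow> b \<in> C \<Longrightarrow> f a b \<in> sections U"
    and g: "\<And>a b z. a \<in> B \<Longrightarrow> b \<in> C \<Longrightarrow> z \<in> U \<Longrightarrow> cmod (f a b z) \<le> g (cmod (a z)) (cmod (b z))"
    and mono: "\<And>x y x' y'. 0 \<le> x \<Longrightarrow> x \<le> x' \<Longrightarrow> 0 \<le> y \<Longrightarrow> y \<le> y' \<Longrightarrow> g x y \<le> g x' y'"
  shows "bounded_sections U {f a b | a b. a \<in> B \<and> b \<in> C}"
  unfolding bounded_sections_def
proof (intro conjI allI impI)
  show "{f a b | a b. a \<in> B \<and> b \<in> C} \<subseteq> sections U" using s by blast
  fix K assume K: "compact K \<and> K \<subseteq> U"
  obtain M N where M: "\<And>a z. a \<in> B \<Longrightarrow> z \<in> K \<Longrightarrow> cmod (a z) \<le> M" and N: "\<And>a z. a \<in> C \<Longrightarrow> z \<in> K \<Longrightarrow> cmod (a z) \<le> N"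
    using B C K unfolding bounded_sections_def by metis
  have "cmod (f a b z) \<le> g M N" if "a \<in> B" "b \<in> C" "z \<in> K" for a b z
    using g[OF that(1,2), of z] mono[OF _ M[OF that(1,3)] _ N[OF that(2,3)]] K that by fastforce
  then show "\<exists>M. \<forall>a\<in>{f a b | a b. a \<in> B \<and> b \<in> C}. \<forall>z\<in>K. cmod (a z) \<le> M" by blast
qed

lemma bounded_sections_mult:
  "bounded_sections U B \<Longrightarrow> bounded_sections U C \<Longrightarrow> bounded_sections U {\<lambda>z. a z * b z | a b. a \<in> B \<and> b \<in> C}"
  by (rule bounded_sections_op[where f = "\<lambda>a b z. a z * b z" and g = "(*)"])
     (auto simp: norm_mult bounded_sections_def intro: sections_mult mult_mono)

lemma bounded_sections_add:
  "bounded_sections U B \<Longrightarrow> bounded_sections U C \<Longrightarrow> bounded_sections U {\<lambda>z. a z + b z | a b. a \<in> B \<and> b \<in> C}"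
  by (rule bounded_sections_op[where f = "\<lambda>a b z. a z + b z" and g = "(+)"])
     (auto simp: bounded_sections_def intro: sections_add norm_triangle_ineq)

lemma bounded_sections_subset: "bounded_sections U B \<Longrightarrow> C \<subseteq> B \<Longrightarrow> bounded_sections U C"
  unfolding bounded_sections_def by (meson subset_iff)

context jacobian_variety
begin

text \<open>For distinct indices this is, up to sign, the minor of the Jacobi matrix of the
  equations without the columns \<open>i\<close>, \<open>j\<close>, \<open>m\<close>. At a point of
  \<open>X\<close> where it is nonzero, these three coordinates are local coordinates of the
  cone.\<close>

definition minor :: "'n \<Rightarrow> 'n \<Rightarrow> 'n \<Rightarrow> complex^'n \<Rightarrow> complex" where
  "minor i j m z = jdet \<iota> (grads z @ [axis i 1, axis j 1, axis m 1])"

lemma minor_holo: "holo_on (minor i j m) UNIV"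
proof -
  let ?rs = "map grad Fs @ [\<lambda>z. axis i 1, \<lambda>z. axis j 1, \<lambda>z. axis m 1]"
  have "holo_on (\<lambda>z. jdet \<iota> (map (\<lambda>r. r z) ?rs)) UNIV"
    by (rule holo_on_jdet) (auto intro: holo_on_pd[OF F_holo])
  then show ?thesis by (simp add: comp_def minor_def[abs_def])
qed

lemma minor_scale:
  assumes "c \<noteq> 0" shows "minor i j m (c *s z) = c ^ 3 * minor i j m z"
proof -
  have pr: "prod_list (map (\<lambda>d. c ^ (d - 1)) degs) = c ^ 3" by (rule degs_prod)
  have "grads (c *s z) @ [axis i 1, axis j 1, axis m 1]
    = map2 (*s) (map (\<lambda>d. c ^ (d - 1)) degs @ [1, 1, 1]) (grads z @ [axis i 1, axis j 1, axis m 1])"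
    unfolding grads_scale[OF assms] by (simp add: len_degs)
  then show ?thesis
    using jdet_scale_rows[of "map (\<lambda>d. c ^ (d - 1)) degs @ [1, 1, 1]"
        "grads z @ [axis i 1, axis j 1, axis m 1]" \<iota>] by (simp add: minor_def len_degs pr[unfolded One_nat_def])
qed

text \<open>\<open>D3_pluecker\<close> with the unit covectors of \<open>i\<close> and
  \<open>j\<close> expresses the determinant through derivatives of the two sections in two tangent
  directions, and these are controlled by \<open>cauchy_estimate\<close>.\<close>

lemma bracket_locally_bounded:
  assumes U: "openX X U" and z0: "z0 \<in> U" and B: "bounded_sections U B" and C: "bounded_sections U C"
  shows "\<exists>\<epsilon>>0. \<exists>M. \<forall>a\<in>B. \<forall>b\<in>C. \<forall>z\<in>U \<inter> ball z0 \<epsilon>. cmod (P U a b z) \<le> M"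
proof -
  have zX: "z0 \<in> X" using U z0 openX_subset by blast
  obtain m where m: "z0 $ m \<noteq> 0" using X_coord[OF zX] by blast
  obtain i j where ij: "minor i j m z0 \<noteq> 0" using nondegenerate[OF zX m] unfolding minor_def by blast
  \<comment> \<open>\<open>\<xi> k z\<close> is the cross product of the equations with the unit
    covectors of \<open>k\<close> and \<open>m\<close>, hence a tangent vector depending
    continuously on \<open>z\<close>.\<close>
  define \<xi> where "\<xi> k z = (\<chi> l. minor l k m z)" for k z
  have \<xi>: "jdet \<iota> (grads z @ [a, axis k 1, axis m 1]) = cdot a (\<xi> k z)" for a k z
    using D3_tang[OF bij, of z a "axis k 1" "axis m 1"] by (simp add: \<xi>_def minor_def cross_vec_def[OF bij] cdot_commute)
  have tan: "tangent z (\<xi> k z)" for k z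
    by (auto simp: tangent_def \<xi>[symmetric] D3_mem(1)[OF bij])
  \<comment> \<open>Collects the factors that do not depend on the sections. They are continuous at
    \<open>z0\<close>, so \<open>Q z0 + 1\<close> is a bound nearby.\<close>
  define Q where "Q z = cmod (inverse (z $ m) * inverse (minor i j m z)) * norm (\<xi> i z) * norm (\<xi> j z)" for z
  have cm: "isCont (minor p q m) z0" for p q
    using holo_on_continuous[OF minor_holo] by (simp add: continuous_on_eq_continuous_at)
  have c\<xi>: "isCont (\<xi> k) z0" for k
  proof -
    have "continuous_on UNIV (\<xi> k)"
      unfolding \<xi>_def[abs_def] by (intro continuous_on_vec_lambda holo_on_continuous[OF minor_holo])
    then show ?thesis by (simp add: continuous_on_eq_continuous_at)
  qed
  have "isCont Q z0"
    unfolding Q_def[abs_def] by (intro continuous_intros cm c\<xi>) (use m ij in auto)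
  then have "(Q \<longlongrightarrow> Q z0) (nhds z0)" by (simp add: continuous_at tendsto_nhds_iff)
  then have "\<forall>\<^sub>F z in nhds z0. Q z < Q z0 + 1" by (rule order_tendstoD(2)) simp
  moreover have "\<forall>\<^sub>F z in nhds z0. z $ m \<noteq> 0"
    using eventually_nhds_in_open[OF open_coord, of z0 m] m by simp
  moreover have "\<forall>\<^sub>F z in nhds z0. minor i j m z \<noteq> 0"
  proof -
    have "(minor i j m \<longlongrightarrow> minor i j m z0) (nhds z0)" using cm by (simp add: continuous_at tendsto_nhds_iff)
    then show ?thesis by (rule tendsto_imp_eventually_ne) (rule ij)
  qed
  ultimately have "\<forall>\<^sub>F z in nhds z0. Q z < Q z0 + 1 \<and> z $ m \<noteq> 0 \<and> minor i j m z \<noteq> 0"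
    by eventually_elim simp
  then obtain e where e: "e > 0" "\<And>z. dist z z0 < e \<Longrightarrow> Q z < Q z0 + 1 \<and> z $ m \<noteq> 0 \<and> minor i j m z \<noteq> 0"
    unfolding eventually_nhds_metric by blast
  obtain \<epsilon> R :: real and K where est: "\<epsilon> > 0" "R > 0" "compact K" "K \<subseteq> U"
    "\<And>z \<xi> a A B. \<lbrakk>z \<in> ball z0 \<epsilon>; z \<in> X; tangent z \<xi>; a \<in> sections U; local_rep U a z A;
        \<And>y. y \<in> K \<Longrightarrow> cmod (a y) \<le> B\<rbrakk> \<Longrightarrow> cmod (cdot (grad A z) \<xi>) \<le> R * B * norm \<xi>"
  proof (rule cauchy_estimate[OF U z0], goal_cases)
    case (1 \<epsilon> C K)
    show ?case by (rule 1(1)[OF 1(2,3,4,5,6)])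
  qed
  obtain M N where M: "\<And>a z. a \<in> B \<Longrightarrow> z \<in> K \<Longrightarrow> cmod (a z) \<le> M" and N: "\<And>a z. a \<in> C \<Longrightarrow> z \<in> K \<Longrightarrow> cmod (a z) \<le> N"
    using B C est(3,4) unfolding bounded_sections_def by metis
  have BS: "B \<subseteq> sections U" "C \<subseteq> sections U" using B C by (auto simp: bounded_sections_def)
  \<comment> \<open>\<open>max 0\<close> makes the bounds nonnegative even when there is no section
    or no point to enforce it; the factor 2 counts the two products in the Pluecker
    relation.\<close>
  define M' where "M' = (Q z0 + 1) * (2 * (R * max 0 M) * (R * max 0 N))"
  have "cmod (P U a b z) \<le> M'" if a: "a \<in> B" and b: "b \<in> C" and z: "z \<in> U \<inter> ball z0 (min e \<epsilon>)" for a b z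
  proof -
    have z': "z \<in> U" "z \<in> X" "z \<in> ball z0 \<epsilon>" "Q z < Q z0 + 1" "z $ m \<noteq> 0" "minor i j m z \<noteq> 0"
      using z openX_subset[OF U] e(2)[of z] by (auto simp: dist_commute)
    obtain A A' where r: "local_rep U a z A" "local_rep U b z A'"
      using sections_rep a b BS z'(1) by (metis subset_iff)
    let ?a = "grad A z" and ?b = "grad A' z"
    have "jdet \<iota> (grads z @ [axis i 1, axis j 1, axis m 1]) * jdet \<iota> (grads z @ [?a, ?b, axis m 1])
        = cdot ?a (\<xi> j z) * jdet \<iota> (grads z @ [axis i 1, ?b, axis m 1]) - cdot ?b (\<xi> j z) * jdet \<iota> (grads z @ [axis i 1, ?a, axis m 1])"
      using D3_pluecker[OF bij, of z "axis i 1" "axis j 1" "axis m 1" ?a ?b] z'(6)[unfolded minor_def] by (simp add: \<xi>)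
    then have mj: "minor i j m z * jdet \<iota> (grads z @ [?a, ?b, axis m 1]) = cdot ?b (\<xi> j z) * cdot ?a (\<xi> i z) - cdot ?a (\<xi> j z) * cdot ?b (\<xi> i z)"
      by (simp add: minor_def D3_skew[OF bij, of z "axis i 1"] \<xi>)
    have "jdet \<iota> (grads z @ [?a, ?b, axis m 1]) = inverse (minor i j m z) * (minor i j m z * jdet \<iota> (grads z @ [?a, ?b, axis m 1]))"
      using z'(6) by simp
    also note mj
    finally have eq: "P U a b z = inverse (z $ m) * inverse (minor i j m z) * (cdot ?b (\<xi> j z) * cdot ?a (\<xi> i z) - cdot ?a (\<xi> j z) * cdot ?b (\<xi> i z))"
      using bracket_eq[OF U z'(1,5) r] by (simp add: jac_def)
    have 1: "cmod (cdot ?a (\<xi> k z)) \<le> R * max 0 M * norm (\<xi> k z)" for k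
      by (rule est(5)[OF z'(3,2) tan _ r(1)]) (use a BS M in \<open>auto simp: le_max_iff_disj\<close>)
    have 2: "cmod (cdot ?b (\<xi> k z)) \<le> R * max 0 N * norm (\<xi> k z)" for k
      by (rule est(5)[OF z'(3,2) tan _ r(2)]) (use b BS N in \<open>auto simp: le_max_iff_disj\<close>)
    have "cmod (cdot ?b (\<xi> j z) * cdot ?a (\<xi> i z) - cdot ?a (\<xi> j z) * cdot ?b (\<xi> i z))
        \<le> cmod (cdot ?b (\<xi> j z)) * cmod (cdot ?a (\<xi> i z)) + cmod (cdot ?a (\<xi> j z)) * cmod (cdot ?b (\<xi> i z))"
      by (metis norm_mult norm_triangle_ineq4)
    also have "\<dots> \<le> (R * max 0 N * norm (\<xi> j z)) * (R * max 0 M * norm (\<xi> i z)) + (R * max 0 M * norm (\<xi> j z)) * (R * max 0 N * norm (\<xi> i z))"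
      using est(2) by (intro add_mono mult_mono 1 2) auto
    finally have "cmod (P U a b z) \<le> cmod (inverse (z $ m) * inverse (minor i j m z)) *
      ((R * max 0 N * norm (\<xi> j z)) * (R * max 0 M * norm (\<xi> i z)) + (R * max 0 M * norm (\<xi> j z)) * (R * max 0 N * norm (\<xi> i z)))"
      unfolding eq norm_mult[of "inverse (z $ m) * inverse (minor i j m z)"] by (intro mult_left_mono) auto
    also have "\<dots> = Q z * (2 * (R * max 0 M) * (R * max 0 N))"
      unfolding Q_def by (simp add: algebra_simps)
    also have "\<dots> \<le> M'" unfolding M'_def using z'(4) est(2) by (intro mult_right_mono) auto
    finally show ?thesis .
  qed
  then show ?thesis using e(1) est(1) by (intro exI[of _ "min e \<epsilon>"] conjI exI[of _ M']) auto
qed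

lemma bracket_bounded:
  assumes U: "openX X U" and B: "bounded_sections U B" and C: "bounded_sections U C"
  shows "bounded_sections U {P U a b | a b. a \<in> B \<and> b \<in> C}"
  unfolding bounded_sections_def
proof (intro conjI allI impI)
  show "{P U a b | a b. a \<in> B \<and> b \<in> C} \<subseteq> sections U"
  proof -
    have "B \<subseteq> sections U" "C \<subseteq> sections U" using B C by (simp_all add: bounded_sections_def)
    then show ?thesis using bracket_sections[OF U] by blast
  qed
  fix K assume K: "compact K \<and> K \<subseteq> U"
  have "\<forall>z0\<in>K. \<exists>\<epsilon>>0. \<exists>M. \<forall>a\<in>B. \<forall>b\<in>C. \<forall>z\<in>U \<inter> ball z0 \<epsilon>. cmod (P U a b z) \<le> M"
    by (intro ballI bracket_locally_bounded[OF U _ B C]) (use K in blast)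
  from bchoice[OF this] obtain \<epsilon> where \<epsilon>: "\<forall>z0\<in>K. \<epsilon> z0 > 0 \<and> (\<exists>M. \<forall>a\<in>B. \<forall>b\<in>C. \<forall>z\<in>U \<inter> ball z0 (\<epsilon> z0). cmod (P U a b z) \<le> M)"
    by blast
  then have "\<forall>z0\<in>K. \<exists>M. \<forall>a\<in>B. \<forall>b\<in>C. \<forall>z\<in>U \<inter> ball z0 (\<epsilon> z0). cmod (P U a b z) \<le> M"
    by blast
  from bchoice[OF this] obtain M where M: "\<forall>z0\<in>K. (\<forall>a\<in>B. \<forall>b\<in>C. \<forall>z\<in>U \<inter> ball z0 (\<epsilon> z0). cmod (P U a b z) \<le> M z0)"
    by blast
  have "K \<subseteq> (\<Union>z\<in>K. ball z (\<epsilon> z))" using \<epsilon> by force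
  then obtain D where D: "D \<subseteq> K" "finite D" "K \<subseteq> (\<Union>z\<in>D. ball z (\<epsilon> z))"
    using compactE_image[of K K "\<lambda>z. ball z (\<epsilon> z)"] K by auto
  \<comment> \<open>The sum over the finite subcover replaces a maximum and needs no case
    distinction for an empty one.\<close>
  have "cmod (P U a b z) \<le> (\<Sum>x\<in>D. \<bar>M x\<bar>)" if ab: "a \<in> B" "b \<in> C" and z: "z \<in> K" for a b z
  proof -
    obtain x where x: "x \<in> D" "z \<in> ball x (\<epsilon> x)" using D(3) z by blast
    have "cmod (P U a b z) \<le> M x" using M ab x D(1) z K by blast
    also have "\<dots> \<le> \<bar>M x\<bar>" by simp
    also have "\<dots> \<le> (\<Sum>x\<in>D. \<bar>M x\<bar>)" by (rule member_le_sum) (use x D(2) in auto)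
    finally show ?thesis .
  qed
  then show "\<exists>M. \<forall>a\<in>{P U a b | a b. a \<in> B \<and> b \<in> C}. \<forall>z\<in>K. cmod (a z) \<le> M" by blast
qed

lemma bracket_lin_right:
  assumes U: "openX X U" and a: "a \<in> sections U" "a' \<in> sections U" and b: "b \<in> sections U"
  shows "P U b (\<lambda>z. c * a z + a' z) = (\<lambda>z. c * P U b a z + P U b a' z)"
  unfolding bracket_skew[OF U b sections_lin[OF a]] bracket_lin[OF U a b] bracket_skew[OF U b a(1)] bracket_skew[OF U b a(2)]
  by (simp add: fun_eq_iff algebra_simps)

lemma bracket_bilinear: "bilinear_map_on X X P"
  unfolding bilinear_map_on_def
  by (intro conjI allI impI ballI; elim conjE;
      rule bracket_sections bracket_restr bracket_lin bracket_lin_right bracket_bounded; assumption)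

lemma bracket_derivation_right:
  assumes U: "openX X U" and a: "a \<in> sections U" "a' \<in> sections U" and b: "b \<in> sections U"
  shows "P U b (\<lambda>z. a z * a' z) = (\<lambda>z. a z * P U b a' z + a' z * P U b a z)"
  unfolding bracket_skew[OF U b sections_mult[OF a]] bracket_derivation[OF U a b] bracket_skew[OF U b a(1)] bracket_skew[OF U b a(2)]
  by (simp add: fun_eq_iff algebra_simps)

text \<open>For a biderivation the Leibniz terms of \<open>p(ab,c)\<close> and
  \<open>p(a,bc)\<close> cancel the two outer terms and each other.\<close>

lemma bracket_cocycle: "hochschild_cocycle_on X X P"
  unfolding hochschild_cocycle_on_def hochschild_d_def
  by (auto simp: bracket_derivation bracket_derivation_right fun_eq_iff algebra_simps)

lemma bracket_skew_on: "skew_on X X P"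
  unfolding skew_on_def using bracket_skew by blast

end

section \<open>Local coordinates and commuting derivations\<close>

definition Lie :: "('n \<Rightarrow> complex^'n \<Rightarrow> complex) \<Rightarrow> (complex^'n::finite \<Rightarrow> complex) \<Rightarrow> complex^'n \<Rightarrow> complex" where
  "Lie \<xi> A z = (\<Sum>k\<in>UNIV. \<xi> k z * pd A k z)"

lemma Lie_zero_cong:
  assumes "open W" "z \<in> W" "\<And>y. y \<in> W \<Longrightarrow> A y = c"
  shows "Lie \<xi> A z = 0"
proof -
  have "grad A z = grad (\<lambda>_. c) z" by (rule grad_cong[OF assms])
  then have "pd A k z = 0" for k by (metis grad_nth grad_const zero_index)
  then show ?thesis by (simp add: Lie_def)
qed

lemma grad_Lie:
  assumes \<eta>: "\<And>k. holo_on (\<eta> k) W" and A: "holo_on A W" and z: "z \<in> W"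
  shows "grad (Lie \<eta> A) z = (\<Sum>k\<in>UNIV. \<eta> k z *s grad (pd A k) z + pd A k z *s grad (\<eta> k) z)"
proof -
  have "grad (\<lambda>z. \<Sum>k\<in>UNIV. \<eta> k z * pd A k z) z = (\<Sum>k\<in>UNIV. grad (\<lambda>z. \<eta> k z * pd A k z) z)"
    by (rule grad_sum[OF finite holo_on_open[OF A] holo_on_mult[OF \<eta> holo_on_pd[OF A]] z])
  also have "\<dots> = (\<Sum>k\<in>UNIV. \<eta> k z *s grad (pd A k) z + pd A k z *s grad (\<eta> k) z)"
    by (intro sum.cong refl grad_mult[OF \<eta> holo_on_pd[OF A] z])
  finally show ?thesis by (simp add: Lie_def[abs_def])
qed

text \<open>The second-order terms of the two compositions agree by \<open>pd_symmetric\<close>, so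
  the commutator of two vector fields is again of first order.\<close>

lemma Lie_commutator:
  assumes \<xi>: "\<And>k. holo_on (\<xi> k) W" and \<eta>: "\<And>k. holo_on (\<eta> k) W" and A: "holo_on A W" and z: "z \<in> W"
  shows "Lie \<xi> (Lie \<eta> A) z - Lie \<eta> (Lie \<xi> A) z = (\<Sum>k\<in>UNIV. (Lie \<xi> (\<eta> k) z - Lie \<eta> (\<xi> k) z) * pd A k z)"
proof -
  have e: "Lie \<xi> (Lie \<eta> A) z = (\<Sum>l\<in>UNIV. \<Sum>k\<in>UNIV. \<xi> l z * \<eta> k z * pd (pd A k) l z)
      + (\<Sum>k\<in>UNIV. Lie \<xi> (\<eta> k) z * pd A k z)"
    if \<eta>: "\<And>k. holo_on (\<eta> k) W" for \<xi> \<eta>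
  proof -
    have "pd (Lie \<eta> A) l z = (\<Sum>k\<in>UNIV. \<eta> k z * pd (pd A k) l z + pd A k z * pd (\<eta> k) l z)" for l
      using arg_cong[OF grad_Lie[OF \<eta> A z], of "\<lambda>v. v $ l"] by (simp add: sum_component)
    then have "Lie \<xi> (Lie \<eta> A) z = (\<Sum>l\<in>UNIV. \<Sum>k\<in>UNIV. \<xi> l z * \<eta> k z * pd (pd A k) l z)
      + (\<Sum>l\<in>UNIV. \<Sum>k\<in>UNIV. \<xi> l z * pd (\<eta> k) l z * pd A k z)"
      unfolding Lie_def[of \<xi> "Lie \<eta> A"]
      by (simp add: sum_distrib_left sum.distrib algebra_simps)
    also have "(\<Sum>l\<in>UNIV. \<Sum>k\<in>UNIV. \<xi> l z * pd (\<eta> k) l z * pd A k z) = (\<Sum>k\<in>UNIV. Lie \<xi> (\<eta> k) z * pd A k z)"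
      unfolding Lie_def sum_distrib_right by (rule sum.swap)
    finally show ?thesis .
  qed
  have "(\<Sum>l\<in>UNIV. \<Sum>k\<in>UNIV. \<eta> l z * \<xi> k z * pd (pd A k) l z) = (\<Sum>l\<in>UNIV. \<Sum>k\<in>UNIV. \<xi> l z * \<eta> k z * pd (pd A k) l z)"
    by (subst sum.swap) (intro sum.cong refl; simp add: pd_symmetric[OF A z] mult.commute)
  then show ?thesis
    unfolding e[OF \<eta>] e[OF \<xi>] by (simp add: sum_subtractf left_diff_distrib)
qed

text \<open>No condition is put on \<open>i\<close>, \<open>j\<close>, \<open>m\<close>: the set
  \<open>\<Omega>\<close> below records where the minor does not vanish, and for coinciding indices
  it is empty.\<close>

locale jacobian_frame = jacobian_variety Fs degs \<iota>
  for Fs :: "(complex^'n::finite \<Rightarrow> complex) list" and degs :: "nat list" and \<iota> :: "nat \<Rightarrow> 'n" +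
  fixes i j m :: 'n
begin

text \<open>On \<open>\<Omega>\<close> the quotients \<open>u = z\<^sub>i / z\<^sub>m\<close> and \<open>v = z\<^sub>j / z\<^sub>m\<close> are local coordinates of the surface, and the
  bracket is \<open>weight\<close> times the standard one.\<close>

definition acoord :: "'n \<Rightarrow> complex^'n \<Rightarrow> complex" where "acoord k z = z $ k * inverse (z $ m)"

definition \<Omega> where "\<Omega> = {z. z $ m \<noteq> 0} \<inter> {z. minor i j m z \<noteq> 0}"

lemma \<Omega>_open: "open \<Omega>"
proof -
  have "open {z. minor i j m z \<noteq> 0}"
    by (intro open_Collect_neq holo_on_continuous[OF minor_holo] continuous_intros)
  then show ?thesis unfolding \<Omega>_def using open_coord by blast
qed

lemma \<Omega>_conic: "conic \<Omega>"
  by (auto simp: conic_def \<Omega>_def minor_scale)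

lemma \<Omega>_coord: "z \<in> \<Omega> \<Longrightarrow> z $ m \<noteq> 0"
  by (simp add: \<Omega>_def)

lemma acoord_holo: "holo_on (acoord k) \<Omega>"
  unfolding acoord_def[abs_def]
  by (intro holo_on_mult holo_on_inverse holo_on_nth \<Omega>_open) (simp add: \<Omega>_def)

lemma grad_acoord:
  assumes "z \<in> \<Omega>"
  shows "grad (acoord k) z = inverse (z $ m) *s axis k 1 - (z $ k * inverse (z $ m) ^ 2) *s axis m 1"
proof -
  have "grad (acoord k) z = z $ k *s (- (inverse (z $ m) ^ 2) *s axis m 1) + inverse (z $ m) *s axis k 1"
    unfolding acoord_def[abs_def]
    by (rule grad_eqI, rule deriv_mult[OF deriv_nth deriv_inverse[OF deriv_nth \<Omega>_coord[OF assms]]])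
  then show ?thesis by (simp add: fvec_eq_iff algebra_simps)
qed

lemma acoord_hom: "homogeneous0_on \<Omega> (acoord k)"
  by (simp add: homogeneous0_on_def acoord_def)

definition weight where "weight = jac m (acoord i) (acoord j)"

text \<open>In the differential of the quotient of \<open>z $ k\<close> by \<open>z $ m\<close> the
  multiple of the covector of \<open>m\<close> is removed by the last row. What is left is the unit
  covector of \<open>k\<close> divided by \<open>z $ m\<close>; with the normalising factor this
  makes three inverses.\<close>

lemma weight_eq: "z \<in> \<Omega> \<Longrightarrow> weight z = inverse (z $ m) ^ 3 * minor i j m z"
  by (simp add: weight_def jac_def grad_acoord D3_diff[OF bij] D3_scale[OF bij] D3_same[OF bij] minor_def power3_eq_cube)

lemma weight_nz: "z \<in> \<Omega> \<Longrightarrow> weight z \<noteq> 0"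
  by (simp add: weight_eq) (simp add: \<Omega>_def)

lemma jac_holo_on: "holo_on A W \<Longrightarrow> holo_on B W \<Longrightarrow> W \<subseteq> \<Omega> \<Longrightarrow> holo_on (jac m A B) W"
  using holo_on_subset[OF jac_holo[of A W B m] holo_on_open[of A W]] \<Omega>_coord by blast

lemma weight_holo: "open W \<Longrightarrow> W \<subseteq> \<Omega> \<Longrightarrow> holo_on weight W"
  unfolding weight_def by (intro jac_holo_on holo_on_subset[OF acoord_holo])

text \<open>Cramer's rule for the frame dual to the differentials of \<open>u\<close> and
  \<open>v\<close>. The formula makes sense off the zero set, so \<open>op1\<close> and
  \<open>op2\<close> are holomorphic vector fields on the ambient open set \<open>\<Omega>\<close>;
  they annihilate the equations and \<open>z $ m\<close>.\<close>

definition op1 where "op1 A z = inverse (weight z) * jac m A (acoord j) z"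
definition op2 where "op2 A z = inverse (weight z) * jac m (acoord i) A z"

lemma op_holo:
  assumes "holo_on A W" "W \<subseteq> \<Omega>"
  shows "holo_on (op1 A) W" "holo_on (op2 A) W"
proof -
  have o: "open W" using holo_on_open[OF assms(1)] .
  have c: "holo_on (acoord k) W" for k by (rule holo_on_subset[OF acoord_holo o assms(2)])
  have w: "holo_on (\<lambda>z. inverse (weight z)) W"
    by (rule holo_on_inverse[OF weight_holo[OF o assms(2)]]) (use weight_nz assms(2) in blast)
  show "holo_on (op1 A) W" "holo_on (op2 A) W"
    unfolding op1_def[abs_def] op2_def[abs_def]
    by (intro holo_on_mult w jac_holo_on assms c)+
qed

lemma jac_expand: "jac m A B z = (\<Sum>k\<in>UNIV. jac m (\<lambda>z. z $ k) B z * pd A k z)"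
  unfolding jac_def D3_tang[OF bij, of z "grad A z"] grad_coord
  by (simp add: cdot_def cross_vec_def[OF bij] sum_distrib_left mult.assoc)

lemma op_Lie: "op1 A = Lie (\<lambda>k. op1 (\<lambda>z. z $ k)) A" "op2 A = Lie (\<lambda>k. op2 (\<lambda>z. z $ k)) A"
proof -
  show "op1 A = Lie (\<lambda>k. op1 (\<lambda>z. z $ k)) A"
    by (rule ext) (simp add: op1_def Lie_def jac_expand[of A] sum_distrib_left mult.assoc)
  show "op2 A = Lie (\<lambda>k. op2 (\<lambda>z. z $ k)) A"
    by (rule ext) (simp add: op2_def Lie_def jac_skew[of m "acoord i"] jac_expand[of A] sum_distrib_left sum_negf mult.assoc)
qed

lemma op_frame:
  assumes "z \<in> \<Omega>"
  shows "op1 (acoord i) z = 1" "op1 (acoord j) z = 0" "op2 (acoord i) z = 0" "op2 (acoord j) z = 1"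
    "op1 (\<lambda>z. z $ m) z = 0" "op2 (\<lambda>z. z $ m) z = 0"
  using weight_nz[OF assms] by (simp_all add: op1_def op2_def weight_def[symmetric]) (simp_all add: jac_def D3_same[OF bij])

lemma op_equation: "F \<in> set Fs \<Longrightarrow> op1 F z = 0" "F \<in> set Fs \<Longrightarrow> op2 F z = 0"
  by (simp_all add: op1_def op2_def jac_def D3_mem[OF bij])

text \<open>The commutator is a vector field which annihilates the equations and the three coordinates
  \<open>z\<^sub>i\<close>, \<open>z\<^sub>j\<close>, \<open>z\<^sub>m\<close>, whose differentials span the cotangent space.\<close>

lemma op_commute:
  assumes A: "holo_on A W" and W: "W \<subseteq> \<Omega>" and z: "z \<in> W"
  shows "op1 (op2 A) z = op2 (op1 A) z"
proof -
  let ?\<xi> = "\<lambda>k. op1 (\<lambda>z. z $ k)" and ?\<eta> = "\<lambda>k. op2 (\<lambda>z. z $ k)"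
  have o: "open W" using holo_on_open[OF A] .
  have h: "holo_on (?\<xi> k) W" "holo_on (?\<eta> k) W" for k
    using op_holo[OF holo_on_nth[OF o] W] by auto
  define \<zeta> where "\<zeta> = (\<chi> k. Lie ?\<xi> (?\<eta> k) z - Lie ?\<eta> (?\<xi> k) z)"
  have comm: "op1 (op2 B) z - op2 (op1 B) z = cdot (grad B z) \<zeta>" if "holo_on B W" for B
    using Lie_commutator[OF h that z] op_Lie(1)[of "op2 B"] op_Lie(2)[of "op1 B"] op_Lie(2)[of B] op_Lie(1)[of B]
    by (simp add: cdot_def \<zeta>_def mult.commute)
  have const: "op1 B z = 0" "op2 B z = 0" if "\<And>y. y \<in> W \<Longrightarrow> B y = c" for B c
    by (subst op_Lie(1), rule Lie_zero_cong[OF o z that], assumption)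
       (subst op_Lie(2), rule Lie_zero_cong[OF o z that], assumption)
  have z\<Omega>: "z \<in> \<Omega>" using z W by blast
  \<comment> \<open>If \<open>op1 B\<close> and \<open>op2 B\<close> are both constant, either
    composition of the operators kills \<open>B\<close>, and so does their commutator.\<close>
  have c0: "cdot (grad B z) \<zeta> = 0" if B: "holo_on B W" "\<And>y. y \<in> W \<Longrightarrow> op1 B y = c" "\<And>y. y \<in> W \<Longrightarrow> op2 B y = d" for B c d
    using comm[OF B(1)] const(1)[OF B(3)] const(2)[OF B(2)] by simp
  have acoord: "cdot (grad (acoord i) z) \<zeta> = 0" "cdot (grad (acoord j) z) \<zeta> = 0"
    by (rule c0[OF holo_on_subset[OF acoord_holo o W], where c = 1 and d = 0];
        use W in \<open>force intro!: op_frame\<close>)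
       (rule c0[OF holo_on_subset[OF acoord_holo o W], where c = 0 and d = 1];
        use W in \<open>force intro!: op_frame\<close>)
  have m: "\<zeta> $ m = 0"
    using c0[OF holo_on_nth[OF o], of m 0 0] op_frame(5,6) W by auto
  have F: "cdot (grad F z) \<zeta> = 0" if "F \<in> set Fs" for F
    by (rule c0[OF holo_on_subset[OF F_holo[OF that] o], of 0 0]) (simp_all add: op_equation[OF that])
  have "\<zeta> = 0"
  proof (rule ccontr)
    assume "\<zeta> \<noteq> 0"
    then have "jdet \<iota> (grads z @ [grad (acoord i) z, grad (acoord j) z, axis m 1]) = 0"
      by (rule D3_null[OF bij]) (use acoord m F in auto)
    then show False using weight_nz[OF z\<Omega>] by (simp add: weight_def jac_def)
  qed
  then show ?thesis using comm[OF A] by simp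
qed

text \<open>\<open>D3_pluecker\<close> with the differentials of \<open>u\<close> and
  \<open>v\<close> as reference pair. Passing from the four Jacobians to \<open>op1\<close> and
  \<open>op2\<close> brings in the weight twice, and one factor cancels against the left-hand
  side.\<close>

lemma jac_pluecker:
  assumes "z \<in> \<Omega>"
  shows "jac m A B z = weight z * (op1 A z * op2 B z - op2 A z * op1 B z)"
proof -
  have nz: "jdet \<iota> (grads z @ [grad (acoord i) z, grad (acoord j) z, axis m 1]) \<noteq> 0"
    using weight_nz[OF assms] by (auto simp: weight_def jac_def)
  have "weight z * jac m A B z = inverse (z $ m) ^ 2 * (jdet \<iota> (grads z @ [grad (acoord i) z, grad (acoord j) z, axis m 1])
      * jdet \<iota> (grads z @ [grad A z, grad B z, axis m 1]))"
    by (simp add: weight_def jac_def power2_eq_square)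
  also have "\<dots> = jac m A (acoord j) z * jac m (acoord i) B z - jac m B (acoord j) z * jac m (acoord i) A z"
    unfolding D3_pluecker[OF bij nz] by (simp add: jac_def power2_eq_square right_diff_distrib)
  finally have "inverse (weight z) * (weight z * jac m A B z)
    = inverse (weight z) * (jac m A (acoord j) z * jac m (acoord i) B z - jac m B (acoord j) z * jac m (acoord i) A z)" by simp
  then show ?thesis
    using weight_nz[OF assms] by (simp add: op1_def op2_def right_diff_distrib mult.assoc[symmetric])
qed

end

section \<open>A symmetric local solution\<close>

text \<open>A section over \<open>S\<close>, given on all open subsets at once: since sections are
  extended by 0, its restrictions are different functions and have to be carried along.\<close>

definition section_family :: "(complex^'n) set \<Rightarrow> (complex^'n) set \<Rightarrow> ((complex^'n) set \<Rightarrow> complex^'n \<Rightarrow> complex) \<Rightarrow> bool" where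
  "section_family X S g \<longleftrightarrow> (\<forall>U. openX X U \<and> U \<subseteq> S \<longrightarrow>
     g U \<in> sections U \<and> (\<forall>V. openX X V \<and> V \<subseteq> U \<longrightarrow> g V = restr V (g U)))"

definition linear_map_on :: "(complex^'n) set \<Rightarrow> (complex^'n) set \<Rightarrow>
    ((complex^'n) set \<Rightarrow> (complex^'n \<Rightarrow> complex) \<Rightarrow> complex^'n \<Rightarrow> complex) \<Rightarrow> bool" where
  "linear_map_on X S E \<longleftrightarrow> (\<forall>U. openX X U \<and> U \<subseteq> S \<longrightarrow>
     (\<forall>a\<in>sections U. E U a \<in> sections U \<and>
        (\<forall>V. openX X V \<and> V \<subseteq> U \<longrightarrow> E V (restr V a) = restr V (E U a)) \<and>
        (\<forall>c. \<forall>a'\<in>sections U. E U (\<lambda>z. c * a z + a' z) = (\<lambda>z. c * E U a z + E U a' z))) \<and>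
     (\<forall>B. bounded_sections U B \<longrightarrow> bounded_sections U (E U ` B)))"

lemma linear_map_onD:
  assumes "linear_map_on X S E" "openX X U" "U \<subseteq> S"
  shows "a \<in> sections U \<Longrightarrow> E U a \<in> sections U"
    "a \<in> sections U \<Longrightarrow> openX X V \<Longrightarrow> V \<subseteq> U \<Longrightarrow> E V (restr V a) = restr V (E U a)"
    "a \<in> sections U \<Longrightarrow> a' \<in> sections U \<Longrightarrow> E U (\<lambda>z. c * a z + a' z) = (\<lambda>z. c * E U a z + E U a' z)"
    "bounded_sections U B \<Longrightarrow> bounded_sections U (E U ` B)"
proof -
  note h = assms(1)[unfolded linear_map_on_def, THEN spec, THEN mp, OF conjI[OF assms(2,3)]]
  note h1 = conjunct1[OF h, THEN bspec]
  show "E U a \<in> sections U" if "a \<in> sections U" by (rule conjunct1[OF h1[OF that]])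
  show "E V (restr V a) = restr V (E U a)" if "a \<in> sections U" "openX X V" "V \<subseteq> U"
    by (rule h1[OF that(1), THEN conjunct2, THEN conjunct1, THEN spec, THEN mp, OF conjI[OF that(2,3)]])
  show "E U (\<lambda>z. c * a z + a' z) = (\<lambda>z. c * E U a z + E U a' z)" if "a \<in> sections U" "a' \<in> sections U"
    by (rule h1[OF that(1), THEN conjunct2, THEN conjunct2, THEN spec, THEN bspec, OF that(2)])
  show "bounded_sections U (E U ` B)" if "bounded_sections U B"
    by (rule conjunct2[OF h, THEN spec, THEN mp, OF that])
qed

lemma section_familyD:
  assumes "section_family X S g" "openX X U" "U \<subseteq> S"
  shows "g U \<in> sections U" "openX X V \<Longrightarrow> V \<subseteq> U \<Longrightarrow> g V = restr V (g U)"
proof -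
  note h = assms(1)[unfolded section_family_def, THEN spec, THEN mp, OF conjI[OF assms(2,3)]]
  show "g U \<in> sections U" by (rule conjunct1[OF h])
  show "g V = restr V (g U)" if "openX X V" "V \<subseteq> U"
    by (rule conjunct2[OF h, THEN spec, THEN mp, OF conjI[OF that]])
qed

lemma bilinear_map_onD:
  assumes "bilinear_map_on X S q" "openX X U" "U \<subseteq> S"
  shows "a \<in> sections U \<Longrightarrow> b \<in> sections U \<Longrightarrow> q U a b \<in> sections U"
    "a \<in> sections U \<Longrightarrow> b \<in> sections U \<Longrightarrow> openX X V \<Longrightarrow> V \<subseteq> U \<Longrightarrow> q V (restr V a) (restr V b) = restr V (q U a b)"
    "a \<in> sections U \<Longrightarrow> b \<in> sections U \<Longrightarrow> a' \<in> sections U \<Longrightarrow>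
      q U (\<lambda>z. c * a z + a' z) b = (\<lambda>z. c * q U a b z + q U a' b z)"
    "a \<in> sections U \<Longrightarrow> b \<in> sections U \<Longrightarrow> a' \<in> sections U \<Longrightarrow>
      q U b (\<lambda>z. c * a z + a' z) = (\<lambda>z. c * q U b a z + q U b a' z)"
    "bounded_sections U B \<Longrightarrow> bounded_sections U C \<Longrightarrow> bounded_sections U {q U a b | a b. a \<in> B \<and> b \<in> C}"
proof -
  note h = assms(1)[unfolded bilinear_map_on_def, THEN spec, THEN mp, OF conjI[OF assms(2,3)]]
  note h1 = conjunct1[OF h, THEN bspec, THEN bspec]
  show "q U a b \<in> sections U" if "a \<in> sections U" "b \<in> sections U" by (rule conjunct1[OF h1[OF that]])
  show "q V (restr V a) (restr V b) = restr V (q U a b)"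
    if "a \<in> sections U" "b \<in> sections U" "openX X V" "V \<subseteq> U"
    by (rule h1[OF that(1,2), THEN conjunct2, THEN conjunct1, THEN spec, THEN mp, OF conjI[OF that(3,4)]])
  note h2 = h1[THEN conjunct2, THEN conjunct2, THEN spec, THEN bspec]
  show "q U (\<lambda>z. c * a z + a' z) b = (\<lambda>z. c * q U a b z + q U a' b z)"
    "q U b (\<lambda>z. c * a z + a' z) = (\<lambda>z. c * q U b a z + q U b a' z)"
    if "a \<in> sections U" "b \<in> sections U" "a' \<in> sections U"
    by (rule conjunct1[OF h2[OF that]], rule conjunct2[OF h2[OF that]])
  show "bounded_sections U {q U a b | a b. a \<in> B \<and> b \<in> C}" if "bounded_sections U B" "bounded_sections U C"
    by (rule conjunct2[OF h, THEN spec, THEN spec, THEN mp, OF conjI[OF that]])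
qed

lemma bounded_sections_scale:
  assumes "g \<in> sections U" "bounded_sections U B"
  shows "bounded_sections U ((\<lambda>a z. g z * a z) ` B)"
proof (rule bounded_sections_subset[OF bounded_sections_mult[OF bounded_sections_single[OF assms(1)] assms(2)]], rule subsetI, elim imageE)
  fix h a assume "h = (\<lambda>z. g z * a z)" "a \<in> B"
  then show "h \<in> {\<lambda>z. x z * y z | x y. x \<in> {g} \<and> y \<in> B}"
    by (intro CollectI exI[of _ g] exI[of _ a]) simp
qed

lemma linear_map_on_comp:
  assumes E: "linear_map_on X S E" and F: "linear_map_on X S F"
  shows "linear_map_on X S (\<lambda>U a. E U (F U a))"
  unfolding linear_map_on_def
proof (intro allI impI conjI ballI; elim conjE)
  fix U assume U: "openX X U" "U \<subseteq> S"
  note e = linear_map_onD[OF E U] and f = linear_map_onD[OF F U]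
  show "E U (F U a) \<in> sections U" if "a \<in> sections U" for a by (rule e(1)[OF f(1)[OF that]])
  show "E V (F V (restr V a)) = restr V (E U (F U a))" if "a \<in> sections U" "openX X V" "V \<subseteq> U" for a V
    unfolding f(2)[OF that] by (rule e(2)[OF f(1)[OF that(1)] that(2,3)])
  show "E U (F U (\<lambda>z. c * a z + a' z)) = (\<lambda>z. c * E U (F U a) z + E U (F U a') z)"
    if "a \<in> sections U" "a' \<in> sections U" for a a' c
    unfolding f(3)[OF that] by (rule e(3)[OF f(1)[OF that(1)] f(1)[OF that(2)]])
  show "bounded_sections U ((\<lambda>a. E U (F U a)) ` B)" if "bounded_sections U B" for B
    using e(4)[OF f(4)[OF that]] by (simp add: image_image)
qed

text \<open>The shape of every summand of the symmetric solution: a coefficient times a differential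
  operator in each argument.\<close>

lemma bilinear_map_on_term:
  assumes g: "section_family X S g" and E: "linear_map_on X S E" and F: "linear_map_on X S F"
  shows "bilinear_map_on X S (\<lambda>U a b z. g U z * (E U a z * F U b z))"
  unfolding bilinear_map_on_def
proof (intro allI impI conjI ballI; elim conjE)
  fix U assume U: "openX X U" "U \<subseteq> S"
  note e = linear_map_onD[OF E U] and f = linear_map_onD[OF F U] and g = section_familyD[OF g U]
  show "(\<lambda>z. g U z * (E U a z * F U b z)) \<in> sections U" if "a \<in> sections U" "b \<in> sections U" for a b
    using that by (intro sections_mult g(1) e(1) f(1))
  show "(\<lambda>z. g V z * (E V (restr V a) z * F V (restr V b) z)) = restr V (\<lambda>z. g U z * (E U a z * F U b z))"
    if "a \<in> sections U" "b \<in> sections U" "openX X V" "V \<subseteq> U" for a b V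
    using g(2)[OF that(3,4)] e(2)[OF that(1,3,4)] f(2)[OF that(2,3,4)] by (auto simp: restr_def)
  show "(\<lambda>z. g U z * (E U (\<lambda>z. c * a z + a' z) z * F U b z))
      = (\<lambda>z. c * (g U z * (E U a z * F U b z)) + g U z * (E U a' z * F U b z))"
    if "a \<in> sections U" "a' \<in> sections U" for a b a' c
    unfolding e(3)[OF that] by (simp add: algebra_simps)
  show "(\<lambda>z. g U z * (E U b z * F U (\<lambda>z. c * a z + a' z) z))
      = (\<lambda>z. c * (g U z * (E U b z * F U a z)) + g U z * (E U b z * F U a' z))"
    if "a \<in> sections U" "a' \<in> sections U" for a b a' c
    unfolding f(3)[OF that] by (simp add: algebra_simps)
  show "bounded_sections U {\<lambda>z. g U z * (E U a z * F U b z) | a b. a \<in> B \<and> b \<in> C}"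
    if "bounded_sections U B" "bounded_sections U C" for B C
  proof (rule bounded_sections_subset[OF bounded_sections_mult[OF bounded_sections_single[OF g(1)]
          bounded_sections_mult[OF e(4)[OF that(1)] f(4)[OF that(2)]]]], rule subsetI, elim CollectE exE conjE)
    fix h a b assume "h = (\<lambda>z. g U z * (E U a z * F U b z))" "a \<in> B" "b \<in> C"
    then show "h \<in> {\<lambda>z. x z * y z | x y. x \<in> {g U} \<and> y \<in> {\<lambda>z. x z * y z | x y. x \<in> E U ` B \<and> y \<in> F U ` C}}"
      by (intro CollectI exI[of _ "g U"] exI[of _ "\<lambda>z. E U a z * F U b z"] conjI exI[of _ "E U a"] exI[of _ "F U b"]) auto
  qed
qed

lemma bilinear_map_on_add:
  assumes q: "bilinear_map_on X S q" and r: "bilinear_map_on X S r"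
  shows "bilinear_map_on X S (\<lambda>U a b z. q U a b z + r U a b z)"
  unfolding bilinear_map_on_def
proof (intro allI impI conjI ballI; elim conjE)
  fix U assume U: "openX X U" "U \<subseteq> S"
  note q = bilinear_map_onD[OF q U] and r = bilinear_map_onD[OF r U]
  show "(\<lambda>z. q U a b z + r U a b z) \<in> sections U" if "a \<in> sections U" "b \<in> sections U" for a b
    using that by (intro sections_add q(1) r(1))
  show "(\<lambda>z. q V (restr V a) (restr V b) z + r V (restr V a) (restr V b) z) = restr V (\<lambda>z. q U a b z + r U a b z)"
    if "a \<in> sections U" "b \<in> sections U" "openX X V" "V \<subseteq> U" for a b V
    unfolding q(2)[OF that] r(2)[OF that] by (auto simp: restr_def)
  show "(\<lambda>z. q U (\<lambda>z. c * a z + a' z) b z + r U (\<lambda>z. c * a z + a' z) b z)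
      = (\<lambda>z. c * (q U a b z + r U a b z) + (q U a' b z + r U a' b z))"
    if "a \<in> sections U" "b \<in> sections U" "a' \<in> sections U" for a b a' c
    unfolding q(3)[OF that] r(3)[OF that] by (simp add: algebra_simps)
  show "(\<lambda>z. q U b (\<lambda>z. c * a z + a' z) z + r U b (\<lambda>z. c * a z + a' z) z)
      = (\<lambda>z. c * (q U b a z + r U b a z) + (q U b a' z + r U b a' z))"
    if "a \<in> sections U" "b \<in> sections U" "a' \<in> sections U" for a b a' c
    unfolding q(4)[OF that] r(4)[OF that] by (simp add: algebra_simps)
  show "bounded_sections U {\<lambda>z. q U a b z + r U a b z | a b. a \<in> B \<and> b \<in> C}"
    if "bounded_sections U B" "bounded_sections U C" for B C
    by (rule bounded_sections_subset[OF bounded_sections_add[OF q(5)[OF that] r(5)[OF that]]]) auto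
qed

lemma section_family_mult:
  assumes f: "section_family X S f" and g: "section_family X S g"
  shows "section_family X S (\<lambda>U z. f U z * g U z)"
  unfolding section_family_def
proof (intro allI impI conjI; elim conjE)
  fix U assume U: "openX X U" "U \<subseteq> S"
  note f = section_familyD[OF f U] and g = section_familyD[OF g U]
  show "(\<lambda>z. f U z * g U z) \<in> sections U" by (intro sections_mult f(1) g(1))
  show "(\<lambda>z. f V z * g V z) = restr V (\<lambda>z. f U z * g U z)" if "openX X V" "V \<subseteq> U" for V
    using f(2)[OF that] g(2)[OF that] by (auto simp: restr_def)
qed

lemma section_family_scale:
  assumes f: "section_family X S f" shows "section_family X S (\<lambda>U z. c * f U z)"
  unfolding section_family_def
proof (intro allI impI conjI; elim conjE)
  fix U assume U: "openX X U" "U \<subseteq> S"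
  note f = section_familyD[OF f U]
  show "(\<lambda>z. c * f U z) \<in> sections U" by (intro sections_scale f(1))
  show "(\<lambda>z. c * f V z) = restr V (\<lambda>z. c * f U z)" if "openX X V" "V \<subseteq> U" for V
    using f(2)[OF that] by (auto simp: restr_def)
qed

lemma section_family_linear:
  assumes E: "linear_map_on X S E" and f: "section_family X S f"
  shows "section_family X S (\<lambda>U. E U (f U))"
  unfolding section_family_def
proof (intro allI impI conjI; elim conjE)
  fix U assume U: "openX X U" "U \<subseteq> S"
  note f = section_familyD[OF f U] and e = linear_map_onD[OF E U]
  show "E U (f U) \<in> sections U" by (intro e(1) f(1))
  show "E V (f V) = restr V (E U (f U))" if "openX X V" "V \<subseteq> U" for V
    unfolding f(2)[OF that] by (rule e(2)[OF f(1) that])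
qed

text \<open>One argument is frozen at a compatible family; boundedness survives because a single
  section is a bounded set. The derivations \<open>D1\<close> and \<open>D2\<close> below are of
  this form.\<close>

lemma linear_map_on_bilinear:
  assumes q: "bilinear_map_on X S q" and f: "section_family X S f" and g: "section_family X S g"
  shows "linear_map_on X S (\<lambda>U a z. g U z * q U a (f U) z)" "linear_map_on X S (\<lambda>U a z. g U z * q U (f U) a z)"
proof -
  have main: "linear_map_on X S (\<lambda>U a z. g U z * r U a z)"
    if r: "\<And>U a. openX X U \<Longrightarrow> U \<subseteq> S \<Longrightarrow> a \<in> sections U \<Longrightarrow> r U a \<in> sections U"
      "\<And>U V a. openX X U \<Longrightarrow> U \<subseteq> S \<Longrightarrow> a \<in> sections U \<Longrightarrow> openX X V \<Longrightarrow> V \<subseteq> U \<Longrightarrow> r V (restr V a) = restr V (r U a)"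
      "\<And>U a a' c. openX X U \<Longrightarrow> U \<subseteq> S \<Longrightarrow> a \<in> sections U \<Longrightarrow> a' \<in> sections U \<Longrightarrow>
        r U (\<lambda>z. c * a z + a' z) = (\<lambda>z. c * r U a z + r U a' z)"
      "\<And>U B. openX X U \<Longrightarrow> U \<subseteq> S \<Longrightarrow> bounded_sections U B \<Longrightarrow> bounded_sections U (r U ` B)" for r
    unfolding linear_map_on_def
  proof (intro allI impI conjI ballI; elim conjE)
    fix U assume U: "openX X U" "U \<subseteq> S"
    note g = section_familyD[OF g U]
    show "(\<lambda>z. g U z * r U a z) \<in> sections U" if "a \<in> sections U" for a
      by (intro sections_mult g(1) r(1)[OF U that])
    show "(\<lambda>z. g V z * r V (restr V a) z) = restr V (\<lambda>z. g U z * r U a z)"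
      if "a \<in> sections U" "openX X V" "V \<subseteq> U" for a V
      using g(2)[OF that(2,3)] r(2)[OF U that] by (auto simp: restr_def)
    show "(\<lambda>z. g U z * r U (\<lambda>z. c * a z + a' z) z) = (\<lambda>z. c * (g U z * r U a z) + g U z * r U a' z)"
      if "a \<in> sections U" "a' \<in> sections U" for a a' c
      unfolding r(3)[OF U that] by (simp add: algebra_simps)
    show "bounded_sections U ((\<lambda>a z. g U z * r U a z) ` B)" if "bounded_sections U B" for B
      using bounded_sections_scale[OF g(1) r(4)[OF U that]] by (simp only: image_image)
  qed
  note q' = bilinear_map_onD[OF q] and f' = section_familyD[OF f]
  show "linear_map_on X S (\<lambda>U a z. g U z * q U a (f U) z)"
  proof (rule main[where r = "\<lambda>U a. q U a (f U)"])
    fix U assume U: "openX X U" "U \<subseteq> S"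
    show "q U a (f U) \<in> sections U" if "a \<in> sections U" for a by (rule q'(1)[OF U that f'(1)[OF U]])
    show "q V (restr V a) (f V) = restr V (q U a (f U))" if "a \<in> sections U" "openX X V" "V \<subseteq> U" for V a
      unfolding f'(2)[OF U that(2,3)] by (rule q'(2)[OF U that(1) f'(1)[OF U] that(2,3)])
    show "q U (\<lambda>z. c * a z + a' z) (f U) = (\<lambda>z. c * q U a (f U) z + q U a' (f U) z)"
      if "a \<in> sections U" "a' \<in> sections U" for a a' c by (rule q'(3)[OF U that(1) f'(1)[OF U] that(2)])
    show "bounded_sections U ((\<lambda>a. q U a (f U)) ` B)" if "bounded_sections U B" for B
      by (rule bounded_sections_subset[OF q'(5)[OF U that bounded_sections_single[OF f'(1)[OF U]]]]) blast
  qed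
  show "linear_map_on X S (\<lambda>U a z. g U z * q U (f U) a z)"
  proof (rule main[where r = "\<lambda>U a. q U (f U) a"])
    fix U assume U: "openX X U" "U \<subseteq> S"
    show "q U (f U) a \<in> sections U" if "a \<in> sections U" for a by (rule q'(1)[OF U f'(1)[OF U] that])
    show "q V (f V) (restr V a) = restr V (q U (f U) a)" if "a \<in> sections U" "openX X V" "V \<subseteq> U" for V a
      unfolding f'(2)[OF U that(2,3)] by (rule q'(2)[OF U f'(1)[OF U] that])
    show "q U (f U) (\<lambda>z. c * a z + a' z) = (\<lambda>z. c * q U (f U) a z + q U (f U) a' z)"
      if "a \<in> sections U" "a' \<in> sections U" for a a' c by (rule q'(4)[OF U that(1) f'(1)[OF U] that(2)])
    show "bounded_sections U ((\<lambda>a. q U (f U) a) ` B)" if "bounded_sections U B" for B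
      by (rule bounded_sections_subset[OF q'(5)[OF U bounded_sections_single[OF f'(1)[OF U]] that]]) blast
  qed
qed

lemma bilinear_map_on_subset: "bilinear_map_on X S q \<Longrightarrow> T \<subseteq> S \<Longrightarrow> bilinear_map_on X T q"
  unfolding bilinear_map_on_def using order_trans[of _ T S] by simp

text \<open>The equation for the second-order term at one point, as an identity between numbers. The
  variables are the values of \<open>w\<close>, \<open>a\<close>, \<open>b\<close>, \<open>c\<close>
  and of their derivatives, the digits naming the derivations; on the right the Leibniz rule has
  been applied to \<open>ab\<close> and \<open>bc\<close>. The terms with \<open>w1\<close> and
  \<open>w2\<close> fix the coefficient 1/3.\<close>

lemma star_product_identity:
  fixes w w1 w2 a a1 a2 a11 a12 a22 b b1 b2 b11 b12 b22 c c1 c2 c11 c12 c22 :: complex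
  shows "w * ((w1 * (a1 * b2 - a2 * b1) + w * (a11 * b2 + a1 * b12 - a12 * b1 - a2 * b11)) * c2 - (w2 * (a1 * b2 - a2 * b1) + w * (a12 * b2 + a1 * b22 - a22 * b1 - a2 * b12)) * c1)
      - w * (a1 * (w2 * (b1 * c2 - b2 * c1) + w * (b12 * c2 + b1 * c22 - b22 * c1 - b2 * c12)) - a2 * (w1 * (b1 * c2 - b2 * c1) + w * (b11 * c2 + b1 * c12 - b12 * c1 - b2 * c11)))
    = a * (w * w / 2 * (b11 * c22 - 2 * b12 * c12 + b22 * c11) + w / 3 * (w2 * (b11 * c2 + c11 * b2 - b12 * c1 - c12 * b1) + w1 * (b22 * c1 + c22 * b1 - b12 * c2 - c12 * b2)))
      - (w * w / 2 * ((a * b11 + 2 * a1 * b1 + b * a11) * c22 - 2 * (a * b12 + a1 * b2 + a2 * b1 + b * a12) * c12 + (a * b22 + 2 * a2 * b2 + b * a22) * c11) + w / 3 * (w2 * ((a * b11 + 2 * a1 * b1 + b * a11) * c2 + c11 * (a * b2 + b * a2) - (a * b12 + a1 * b2 + a2 * b1 + b * a12) * c1 - c12 * (a * b1 + b * a1)) + w1 * ((a * b22 + 2 * a2 * b2 + b * a22) * c1 + c22 * (a * b1 + b * a1) - (a * b12 + a1 * b2 + a2 * b1 + b * a12) * c2 - c12 * (a * b2 + b * a2))))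
      + (w * w / 2 * (a11 * (b * c22 + 2 * b2 * c2 + c * b22) - 2 * a12 * (b * c12 + b1 * c2 + b2 * c1 + c * b12) + a22 * (b * c11 + 2 * b1 * c1 + c * b11)) + w / 3 * (w2 * (a11 * (b * c2 + c * b2) + (b * c11 + 2 * b1 * c1 + c * b11) * a2 - a12 * (b * c1 + c * b1) - (b * c12 + b1 * c2 + b2 * c1 + c * b12) * a1) + w1 * (a22 * (b * c1 + c * b1) + (b * c22 + 2 * b2 * c2 + c * b22) * a1 - a12 * (b * c2 + c * b2) - (b * c12 + b1 * c2 + b2 * c1 + c * b12) * a2)))
      - (w * w / 2 * (a11 * b22 - 2 * a12 * b12 + a22 * b11) + w / 3 * (w2 * (a11 * b2 + b11 * a2 - a12 * b1 - b12 * a1) + w1 * (a22 * b1 + b22 * a1 - a12 * b2 - b12 * a2))) * c"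
  by (simp add: field_simps)

section \<open>Commuting derivations and the star product over a coordinate domain\<close>

context jacobian_frame
begin

definition S where "S = X \<inter> \<Omega>"

lemma S_openX: "openX X S"
  unfolding openX_def S_def by (intro conjI openin_open_Int \<Omega>_open conic_Int X_conic \<Omega>_conic)

definition coord_sec where "coord_sec k U = restr U (acoord k)"

lemma coord_sec_rep:
  assumes "U \<subseteq> S" "z \<in> U" shows "local_rep U (coord_sec k U) z (acoord k)"
  unfolding local_rep_def using assms acoord_holo acoord_hom \<Omega>_conic
  by (intro exI[of _ \<Omega>]) (auto simp: coord_sec_def restr_def S_def)

lemma coord_sec_family: "section_family X S (coord_sec k)"
  unfolding section_family_def
proof (intro allI impI conjI; elim conjE)
  fix U assume U: "openX X U" "U \<subseteq> S"
  show "coord_sec k U \<in> sections U"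
  proof (rule sectionsI)
    show "coord_sec k U z = 0" if "z \<notin> U" for z using that by (simp add: coord_sec_def restr_def)
    show "homogeneous0_on U (coord_sec k U)"
      using openX_conic[OF U(1)] by (auto simp: homogeneous0_on_def coord_sec_def restr_def acoord_def conic_def)
    show "\<exists>A. local_rep U (coord_sec k U) z A" if "z \<in> U" for z using coord_sec_rep[OF U(2) that] by blast
  qed
  show "coord_sec k V = restr V (coord_sec k U)" if "openX X V" "V \<subseteq> U" for V
    using that by (auto simp: coord_sec_def restr_def fun_eq_iff)
qed

definition weight_sec where "weight_sec U = P U (coord_sec i U) (coord_sec j U)"

lemma weight_sec_rep:
  assumes U: "openX X U" "U \<subseteq> S" and z: "z \<in> U"
  shows "local_rep U (weight_sec U) z weight"
  unfolding weight_sec_def weight_def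
  by (rule bracket_rep[OF U(1) z _ coord_sec_rep[OF U(2) z] coord_sec_rep[OF U(2) z]])
     (use \<Omega>_coord U z in \<open>auto simp: S_def\<close>)

lemma weight_sec_value: "openX X U \<Longrightarrow> U \<subseteq> S \<Longrightarrow> z \<in> U \<Longrightarrow> weight_sec U z = weight z"
  by (rule local_rep_value[OF weight_sec_rep, symmetric])

lemma S_\<Omega>: "U \<subseteq> S \<Longrightarrow> z \<in> U \<Longrightarrow> z \<in> \<Omega>"
  by (auto simp: S_def)

lemma weight_sec_nz: "openX X U \<Longrightarrow> U \<subseteq> S \<Longrightarrow> z \<in> U \<Longrightarrow> weight_sec U z \<noteq> 0"
  by (simp add: weight_sec_value weight_nz S_\<Omega>)

lemma P_bilinear: "bilinear_map_on X S P"
  by (rule bilinear_map_on_subset[OF bracket_bilinear openX_subset[OF S_openX]])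

lemma weight_sec_family: "section_family X S weight_sec"
  unfolding section_family_def
proof (intro allI impI conjI; elim conjE)
  fix U assume U: "openX X U" "U \<subseteq> S"
  note f = section_familyD[OF coord_sec_family U]
  show "weight_sec U \<in> sections U" unfolding weight_sec_def by (rule bracket_sections[OF U(1) f(1) f(1)])
  show "weight_sec V = restr V (weight_sec U)" if "openX X V" "V \<subseteq> U" for V
    unfolding weight_sec_def f(2)[OF that] by (rule bracket_restr[OF U(1) that f(1) f(1)])
qed

lemma weight_sec_inverse_family: "section_family X S (\<lambda>U z. inverse (weight_sec U z))"
  unfolding section_family_def
proof (intro allI impI conjI; elim conjE)
  fix U assume U: "openX X U" "U \<subseteq> S"
  note f = section_familyD[OF weight_sec_family U]
  show "(\<lambda>z. inverse (weight_sec U z)) \<in> sections U" by (rule sections_inverse[OF f(1) weight_sec_nz[OF U]])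
  show "(\<lambda>z. inverse (weight_sec V z)) = restr V (\<lambda>z. inverse (weight_sec U z))" if "openX X V" "V \<subseteq> U" for V
    using f(2)[OF that] by (auto simp: restr_def)
qed

text \<open>The operators \<open>op1\<close> and \<open>op2\<close> on sections. They are written
  with the bracket, which is already known to be bounded and compatible with restriction.\<close>

definition D1 where "D1 U a = (\<lambda>z. inverse (weight_sec U z) * P U a (coord_sec j U) z)"
definition D2 where "D2 U a = (\<lambda>z. inverse (weight_sec U z) * P U (coord_sec i U) a z)"

lemma D_linear: "linear_map_on X S D1" "linear_map_on X S D2"
  unfolding D1_def[abs_def] D2_def[abs_def]
  by (rule linear_map_on_bilinear[OF P_bilinear coord_sec_family weight_sec_inverse_family])+

lemma D_rep:
  assumes U: "openX X U" "U \<subseteq> S" and z: "z \<in> U" and A: "local_rep U a z A"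
  shows "local_rep U (D1 U a) z (op1 A)" "local_rep U (D2 U a) z (op2 A)"
proof -
  have m: "z $ m \<noteq> 0" using \<Omega>_coord S_\<Omega>[OF U(2) z] .
  have i: "local_rep U (\<lambda>z. inverse (weight_sec U z)) z (\<lambda>z. inverse (weight z))"
    by (rule local_rep_inverse[OF weight_sec_rep[OF U z] z weight_sec_nz[OF U z]])
  show "local_rep U (D1 U a) z (op1 A)"
    unfolding D1_def op1_def[abs_def]
    by (rule local_rep_mult[OF i bracket_rep[OF U(1) z m A coord_sec_rep[OF U(2) z]]])
  show "local_rep U (D2 U a) z (op2 A)"
    unfolding D2_def op2_def[abs_def]
    by (rule local_rep_mult[OF i bracket_rep[OF U(1) z m coord_sec_rep[OF U(2) z] A]])
qed

lemma D_outside: "z \<notin> U \<Longrightarrow> D1 U a z = 0" "z \<notin> U \<Longrightarrow> D2 U a z = 0"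
  by (simp_all add: D1_def D2_def bracket_outside)

lemma P_frame:
  assumes U: "openX X U" "U \<subseteq> S" and a: "a \<in> sections U" and b: "b \<in> sections U"
  shows "P U a b = (\<lambda>z. weight_sec U z * (D1 U a z * D2 U b z - D2 U a z * D1 U b z))"
proof
  fix z show "P U a b z = weight_sec U z * (D1 U a z * D2 U b z - D2 U a z * D1 U b z)"
  proof (cases "z \<in> U")
    case z: True
    have m: "z $ m \<noteq> 0" using \<Omega>_coord S_\<Omega>[OF U(2) z] .
    obtain A where A: "local_rep U a z A" using sections_rep[OF a z] by blast
    obtain B where B: "local_rep U b z B" using sections_rep[OF b z] by blast
    have "P U a b z = jac m A B z" by (rule bracket_eq[OF U(1) z m A B])
    also have "\<dots> = weight z * (op1 A z * op2 B z - op2 A z * op1 B z)" by (rule jac_pluecker[OF S_\<Omega>[OF U(2) z]])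
    finally show ?thesis
      using weight_sec_value[OF U z] local_rep_value[OF D_rep(1)[OF U z A] z] local_rep_value[OF D_rep(2)[OF U z A] z]
        local_rep_value[OF D_rep(1)[OF U z B] z] local_rep_value[OF D_rep(2)[OF U z B] z] by simp
  qed (simp add: bracket_outside D_outside)
qed

lemma D_commute:
  assumes U: "openX X U" "U \<subseteq> S" and a: "a \<in> sections U"
  shows "D2 U (D1 U a) = D1 U (D2 U a)"
proof
  fix z show "D2 U (D1 U a) z = D1 U (D2 U a) z"
  proof (cases "z \<in> U")
    case z: True
    obtain A where A: "local_rep U a z A" using sections_rep[OF a z] by blast
    then obtain W where W: "z \<in> W" "holo_on A W" by (rule local_rep_conic) blast
    have o: "open (W \<inter> \<Omega>)" using holo_on_open[OF W(2)] \<Omega>_open by blast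
    have "op1 (op2 A) z = op2 (op1 A) z"
      by (rule op_commute[OF holo_on_subset[OF W(2) o]]) (use W(1) S_\<Omega>[OF U(2) z] in auto)
    then show ?thesis
      using local_rep_value[OF D_rep(1)[OF U z D_rep(2)[OF U z A]] z]
        local_rep_value[OF D_rep(2)[OF U z D_rep(1)[OF U z A]] z] by simp
  qed (simp add: D_outside)
qed

lemma D_mult:
  assumes U: "openX X U" "U \<subseteq> S" and a: "a \<in> sections U" and b: "b \<in> sections U"
  shows "D1 U (\<lambda>z. a z * b z) = (\<lambda>z. a z * D1 U b z + b z * D1 U a z)"
    "D2 U (\<lambda>z. a z * b z) = (\<lambda>z. a z * D2 U b z + b z * D2 U a z)"
  unfolding D1_def D2_def
  by (simp_all add: bracket_derivation[OF U(1) a b section_familyD(1)[OF coord_sec_family U]]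
      bracket_derivation_right[OF U(1) a b section_familyD(1)[OF coord_sec_family U]] algebra_simps)

lemma linear_map_on_add_diff:
  assumes E: "linear_map_on X T E" and U: "openX X U" "U \<subseteq> T" and a: "a \<in> sections U" and b: "b \<in> sections U"
  shows "E U (\<lambda>z. a z + b z) = (\<lambda>z. E U a z + E U b z)" "E U (\<lambda>z. a z - b z) = (\<lambda>z. E U a z - E U b z)"
  using linear_map_onD(3)[OF E U a b, of 1] linear_map_onD(3)[OF E U b a, of "-1"] by (simp_all add: fun_eq_iff)

lemmas D_sections = linear_map_onD(1)[OF D_linear(1)] linear_map_onD(1)[OF D_linear(2)]
lemmas D_diff = linear_map_on_add_diff(2)[OF D_linear(1)] linear_map_on_add_diff(2)[OF D_linear(2)]
lemmas D_add = linear_map_on_add_diff(1)[OF D_linear(1)] linear_map_on_add_diff(1)[OF D_linear(2)]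

text \<open>Mixed second derivatives are all written with \<open>D1\<close> outside, the normal form
  in which the identities that follow are purely algebraic.\<close>

lemma D_P:
  assumes U: "openX X U" "U \<subseteq> S" and a: "a \<in> sections U" and b: "b \<in> sections U"
  shows "D1 U (P U a b) z = D1 U (weight_sec U) z * (D1 U a z * D2 U b z - D2 U a z * D1 U b z)
      + weight_sec U z * (D1 U (D1 U a) z * D2 U b z + D1 U a z * D1 U (D2 U b) z
        - D1 U (D2 U a) z * D1 U b z - D2 U a z * D1 U (D1 U b) z)"
    "D2 U (P U a b) z = D2 U (weight_sec U) z * (D1 U a z * D2 U b z - D2 U a z * D1 U b z)
      + weight_sec U z * (D1 U (D2 U a) z * D2 U b z + D1 U a z * D2 U (D2 U b) z
        - D2 U (D2 U a) z * D1 U b z - D2 U a z * D1 U (D2 U b) z)"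
proof -
  note W = section_familyD(1)[OF weight_sec_family U]
  note s = D_sections(1)[OF U a] D_sections(2)[OF U a] D_sections(1)[OF U b] D_sections(2)[OF U b]
  note p = sections_mult[OF s(1,4)] sections_mult[OF s(2,3)]
  note m = D_mult(1)[OF U W sections_diff[OF p]] D_mult(2)[OF U W sections_diff[OF p]]
    D_mult(1)[OF U s(1,4)] D_mult(2)[OF U s(1,4)] D_mult(1)[OF U s(2,3)] D_mult(2)[OF U s(2,3)]
  note d = D_diff(1)[OF U p] D_diff(2)[OF U p]
  show "D1 U (P U a b) z = D1 U (weight_sec U) z * (D1 U a z * D2 U b z - D2 U a z * D1 U b z)
      + weight_sec U z * (D1 U (D1 U a) z * D2 U b z + D1 U a z * D1 U (D2 U b) z
        - D1 U (D2 U a) z * D1 U b z - D2 U a z * D1 U (D1 U b) z)"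
    unfolding P_frame[OF U a b] m d by (simp add: algebra_simps)
  show "D2 U (P U a b) z = D2 U (weight_sec U) z * (D1 U a z * D2 U b z - D2 U a z * D1 U b z)
      + weight_sec U z * (D1 U (D2 U a) z * D2 U b z + D1 U a z * D2 U (D2 U b) z
        - D2 U (D2 U a) z * D1 U b z - D2 U a z * D1 U (D2 U b) z)"
    unfolding P_frame[OF U a b] m d D_commute[OF U a] D_commute[OF U b] by (simp add: algebra_simps)
qed

text \<open>The derivatives of the weight drop out of the cyclic sum because they multiply a
  determinant with two equal rows: in two variables every bivector field satisfies Jacobi. The
  second derivatives cancel since the derivations commute.\<close>

lemma jacobi_frame:
  assumes U: "openX X U" "U \<subseteq> S" and a: "a \<in> sections U" and b: "b \<in> sections U" and c: "c \<in> sections U"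
  shows "P U (P U a b) c z + P U (P U b c) a z + P U (P U c a) b z = 0"
proof -
  note s = bracket_sections[OF U(1) a b] bracket_sections[OF U(1) b c] bracket_sections[OF U(1) c a]
  have e: "P U (P U a b) c z = weight_sec U z * (D1 U (P U a b) z * D2 U c z - D2 U (P U a b) z * D1 U c z)"
    "P U (P U b c) a z = weight_sec U z * (D1 U (P U b c) z * D2 U a z - D2 U (P U b c) z * D1 U a z)"
    "P U (P U c a) b z = weight_sec U z * (D1 U (P U c a) z * D2 U b z - D2 U (P U c a) z * D1 U b z)"
    using fun_cong[OF P_frame[OF U s(1) c]] fun_cong[OF P_frame[OF U s(2) a]] fun_cong[OF P_frame[OF U s(3) b]] by blast+
  show ?thesis
    unfolding e D_P[OF U a b] D_P[OF U b c] D_P[OF U c a] by (simp add: algebra_simps)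
qed

text \<open>The second-order term of Kontsevich's star product for the bivector \<open>w D\<^sub>1 \<and> D\<^sub>2\<close> with commuting
  \<open>D\<^sub>1\<close>, \<open>D\<^sub>2\<close>: Moyal's symmetric term and the correction by the derivatives of \<open>w\<close>.\<close>

definition moyal :: "'n sheaf_map" where
  "moyal U a b = (\<lambda>z. weight_sec U z * weight_sec U z / 2 *
        (D1 U (D1 U a) z * D2 U (D2 U b) z - 2 * D1 U (D2 U a) z * D1 U (D2 U b) z + D2 U (D2 U a) z * D1 U (D1 U b) z)
      + weight_sec U z / 3 *
        (D2 U (weight_sec U) z * (D1 U (D1 U a) z * D2 U b z + D1 U (D1 U b) z * D2 U a z
            - D1 U (D2 U a) z * D1 U b z - D1 U (D2 U b) z * D1 U a z)
         + D1 U (weight_sec U) z * (D2 U (D2 U a) z * D1 U b z + D2 U (D2 U b) z * D1 U a z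
            - D1 U (D2 U a) z * D2 U b z - D1 U (D2 U b) z * D2 U a z)))"

lemma moyal_symmetric: "moyal U a b = moyal U b a"
  by (rule ext) (simp add: moyal_def algebra_simps)

lemma moyal_bilinear: "bilinear_map_on X S moyal"
proof -
  define t where "t g E F = (\<lambda>U a b z. g U z * (E U a z * F U b z))"
    for g :: "(complex^'n) set \<Rightarrow> complex^'n \<Rightarrow> complex"
      and E F :: "(complex^'n) set \<Rightarrow> (complex^'n \<Rightarrow> complex) \<Rightarrow> complex^'n \<Rightarrow> complex"
  define k where "k c h = (\<lambda>U z. c * (weight_sec U z * h U z))" for c and h :: "(complex^'n) set \<Rightarrow> complex^'n \<Rightarrow> complex"
  let ?D11 = "\<lambda>U a. D1 U (D1 U a)" and ?D12 = "\<lambda>U a. D1 U (D2 U a)" and ?D22 = "\<lambda>U a. D2 U (D2 U a)"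
  let ?W1 = "\<lambda>U. D1 U (weight_sec U)" and ?W2 = "\<lambda>U. D2 U (weight_sec U)"
  \<comment> \<open>Eleven summands of the form treated in \<open>bilinear_map_on_term\<close>; the
    coefficient -1 of the mixed term is the product of 1/2 and -2. Nesting to the right lets them be
    split off one at a time.\<close>
  have eq: "moyal = (\<lambda>U a b z. t (k (1/2) weight_sec) ?D11 ?D22 U a b z + (t (k (-1) weight_sec) ?D12 ?D12 U a b z
      + (t (k (1/2) weight_sec) ?D22 ?D11 U a b z + (t (k (1/3) ?W2) ?D11 D2 U a b z + (t (k (1/3) ?W2) D2 ?D11 U a b z
      + (t (k (-1/3) ?W2) ?D12 D1 U a b z + (t (k (-1/3) ?W2) D1 ?D12 U a b z
      + (t (k (1/3) ?W1) ?D22 D1 U a b z + (t (k (1/3) ?W1) D1 ?D22 U a b z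
      + (t (k (-1/3) ?W1) ?D12 D2 U a b z + t (k (-1/3) ?W1) D2 ?D12 U a b z))))))))))"
    by (intro ext) (simp add: moyal_def t_def k_def field_simps)
  have k: "section_family X S (k c h)" if "section_family X S h" for c h
    unfolding k_def by (intro section_family_scale section_family_mult weight_sec_family that)
  have T: "bilinear_map_on X S (t g E F)" if "section_family X S g" "linear_map_on X S E" "linear_map_on X S F" for g E F
    unfolding t_def by (rule bilinear_map_on_term[OF that])
  note DD = linear_map_on_comp[OF D_linear(1) D_linear(1)] linear_map_on_comp[OF D_linear(1) D_linear(2)]
    linear_map_on_comp[OF D_linear(2) D_linear(2)]
  note DW = section_family_linear[OF D_linear(1) weight_sec_family] section_family_linear[OF D_linear(2) weight_sec_family]
  show ?thesis
    unfolding eq by (intro bilinear_map_on_add T k; fact D_linear DD DW weight_sec_family)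
qed

lemma moyal_solution: "local_solution X P S moyal"
  unfolding local_solution_def
proof (intro conjI moyal_bilinear allI impI ballI)
  fix U a b c z
  assume "openX X U \<and> U \<subseteq> S" and a: "a \<in> sections U" and b: "b \<in> sections U" and c: "c \<in> sections U"
  then have U: "openX X U" "U \<subseteq> S" by auto
  \<comment> \<open>Leibniz rules up to order two. With \<open>ab\<close> and \<open>bc\<close>
    expanded, only values of \<open>a\<close>, \<open>b\<close>, \<open>c\<close>, the weight and
    their derivatives remain, the variables of \<open>star_product_identity\<close>.\<close>
  have mult1: "D1 U (\<lambda>z. x z * y z) = (\<lambda>z. x z * D1 U y z + y z * D1 U x z)"
      "D2 U (\<lambda>z. x z * y z) = (\<lambda>z. x z * D2 U y z + y z * D2 U x z)"
      "D1 U (D1 U (\<lambda>z. x z * y z)) = (\<lambda>z. x z * D1 U (D1 U y) z + 2 * D1 U x z * D1 U y z + y z * D1 U (D1 U x) z)"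
      "D1 U (D2 U (\<lambda>z. x z * y z)) = (\<lambda>z. x z * D1 U (D2 U y) z + D1 U x z * D2 U y z + D2 U x z * D1 U y z + y z * D1 U (D2 U x) z)"
      "D2 U (D2 U (\<lambda>z. x z * y z)) = (\<lambda>z. x z * D2 U (D2 U y) z + 2 * D2 U x z * D2 U y z + y z * D2 U (D2 U x) z)"
    if x: "x \<in> sections U" and y: "y \<in> sections U" for x y
  proof -
    note s = D_sections(1)[OF U x] D_sections(2)[OF U x] D_sections(1)[OF U y] D_sections(2)[OF U y]
    note m = D_mult[OF U x y] D_mult[OF U x s(3)] D_mult[OF U x s(4)] D_mult[OF U y s(1)] D_mult[OF U y s(2)]
    note d = D_add[OF U sections_mult[OF x s(3)] sections_mult[OF y s(1)]] D_add[OF U sections_mult[OF x s(4)] sections_mult[OF y s(2)]]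
    show "D1 U (\<lambda>z. x z * y z) = (\<lambda>z. x z * D1 U y z + y z * D1 U x z)"
      "D2 U (\<lambda>z. x z * y z) = (\<lambda>z. x z * D2 U y z + y z * D2 U x z)" by (rule m)+
    show "D1 U (D1 U (\<lambda>z. x z * y z)) = (\<lambda>z. x z * D1 U (D1 U y) z + 2 * D1 U x z * D1 U y z + y z * D1 U (D1 U x) z)"
      "D1 U (D2 U (\<lambda>z. x z * y z)) = (\<lambda>z. x z * D1 U (D2 U y) z + D1 U x z * D2 U y z + D2 U x z * D1 U y z + y z * D1 U (D2 U x) z)"
      "D2 U (D2 U (\<lambda>z. x z * y z)) = (\<lambda>z. x z * D2 U (D2 U y) z + 2 * D2 U x z * D2 U y z + y z * D2 U (D2 U x) z)"
      unfolding m d by (simp_all add: fun_eq_iff algebra_simps)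
  qed
  have e: "P U (P U a b) c z = weight_sec U z * (D1 U (P U a b) z * D2 U c z - D2 U (P U a b) z * D1 U c z)"
    "P U a (P U b c) z = weight_sec U z * (D1 U a z * D2 U (P U b c) z - D2 U a z * D1 U (P U b c) z)"
    using fun_cong[OF P_frame[OF U bracket_sections[OF U(1) a b] c]]
      fun_cong[OF P_frame[OF U a bracket_sections[OF U(1) b c]]] by blast+
  show "P U (P U a b) c z - P U a (P U b c) z = hochschild_d moyal U a b c z"
    unfolding e D_P[OF U a b] D_P[OF U b c] hochschild_d_def moyal_def mult1(3-5)[OF a b] mult1(3-5)[OF b c]
    unfolding mult1(1,2)[OF a b] mult1(1,2)[OF b c]
    by (rule star_product_identity)
qed

end

section \<open>From coordinate domains to the whole variety\<close>

context jacobian_variety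
begin

lemma frame_at:
  assumes "z \<in> X"
  obtains i j m where "z \<in> jacobian_frame.S Fs \<iota> i j m"
proof -
  obtain m where m: "z $ m \<noteq> 0" using X_coord[OF assms] by blast
  obtain i j where "jdet \<iota> (grads z @ [axis i 1, axis j 1, axis m 1]) \<noteq> 0"
    using nondegenerate[OF assms m] by blast
  moreover interpret jacobian_frame Fs degs \<iota> i j m by unfold_locales
  have "z \<in> S" using assms m calculation by (simp add: S_def \<Omega>_def minor_def)
  then show ?thesis using that by blast
qed

theorem symmetric_local_solution:
  assumes "z \<in> X"
  obtains S q where "openX X S" "z \<in> S" "local_solution X P S q" "\<And>U a b. q U a b = q U b a"
proof -
  obtain i j m where z: "z \<in> jacobian_frame.S Fs \<iota> i j m" using frame_at[OF assms] by blast
  interpret jacobian_frame Fs degs \<iota> i j m by unfold_locales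
  show ?thesis using that[OF S_openX z moyal_solution moyal_symmetric] .
qed

text \<open>Restriction to a neighbourhood of \<open>z\<close> with a frame does not change the
  values of the iterated brackets at \<open>z\<close>.\<close>

theorem jacobi:
  assumes U: "openX X U" and a: "a \<in> sections U" and b: "b \<in> sections U" and c: "c \<in> sections U"
  shows "P U (P U a b) c z + P U (P U b c) a z + P U (P U c a) b z = 0"
proof (cases "z \<in> U")
  case z: True
  obtain i j m where zS: "z \<in> jacobian_frame.S Fs \<iota> i j m" using frame_at openX_subset[OF U] z by blast
  interpret jacobian_frame Fs degs \<iota> i j m by unfold_locales
  define V where "V = U \<inter> S"
  have V: "openX X V" "V \<subseteq> U" "V \<subseteq> S" "z \<in> V"
    using openX_Int[OF U S_openX] z zS by (auto simp: V_def)
  have r: "P U (P U x y) w z = P V (P V (restr V x) (restr V y)) (restr V w) z"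
    if "x \<in> sections U" "y \<in> sections U" "w \<in> sections U" for x y w
    using bracket_restr[OF U V(1,2) that(1,2)] bracket_restr[OF U V(1,2) bracket_sections[OF U that(1,2)] that(3)] V(4)
    by (simp add: restr_apply)
  show ?thesis
    unfolding r[OF a b c] r[OF b c a] r[OF c a b]
    by (intro jacobi_frame V sections_restr[OF _ V(2)] a b c openX_conic[OF V(1)])
qed (simp add: bracket_outside)

theorem bracket_poisson: "poisson_bracket X P"
  unfolding poisson_bracket_def
  by (intro conjI allI impI ballI bracket_bilinear bracket_skew_on bracket_cocycle jacobi)

end

section \<open>The Cech obstruction\<close>

lemma bilinear_map_on_scale:
  assumes q: "bilinear_map_on X S q"
  shows "bilinear_map_on X S (\<lambda>U a b z. c * q U a b z)"
  unfolding bilinear_map_on_def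
proof (intro allI impI conjI ballI; elim conjE)
  fix U assume U: "openX X U" "U \<subseteq> S"
  note q = bilinear_map_onD[OF q U]
  show "(\<lambda>z. c * q U a b z) \<in> sections U" if "a \<in> sections U" "b \<in> sections U" for a b
    by (rule sections_scale[OF q(1)[OF that]])
  show "(\<lambda>z. c * q V (restr V a) (restr V b) z) = restr V (\<lambda>z. c * q U a b z)"
    if "a \<in> sections U" "b \<in> sections U" "openX X V" "V \<subseteq> U" for a b V
    unfolding q(2)[OF that] by (auto simp: restr_def)
  show "(\<lambda>z. c * q U (\<lambda>z. k * a z + a' z) b z) = (\<lambda>z. k * (c * q U a b z) + c * q U a' b z)"
    if "a \<in> sections U" "b \<in> sections U" "a' \<in> sections U" for a b a' k
    unfolding q(3)[OF that] by (simp add: algebra_simps)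
  show "(\<lambda>z. c * q U b (\<lambda>z. k * a z + a' z) z) = (\<lambda>z. k * (c * q U b a z) + c * q U b a' z)"
    if "a \<in> sections U" "b \<in> sections U" "a' \<in> sections U" for a b a' k
    unfolding q(4)[OF that] by (simp add: algebra_simps)
  show "bounded_sections U {\<lambda>z. c * q U a b z | a b. a \<in> B \<and> b \<in> C}"
    if "bounded_sections U B" "bounded_sections U C" for B C
    unfolding bounded_sections_def
  proof (intro conjI allI impI)
    have b: "bounded_sections U {q U a b | a b. a \<in> B \<and> b \<in> C}" by (rule q(5)[OF that])
    then have s: "q U a b \<in> sections U" if "a \<in> B" "b \<in> C" for a b
      using that unfolding bounded_sections_def by blast
    show "{\<lambda>z. c * q U a b z | a b. a \<in> B \<and> b \<in> C} \<subseteq> sections U"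
      by (rule subsetI, elim CollectE exE conjE, hypsubst, rule sections_scale, rule s)
    fix K assume "compact K \<and> K \<subseteq> U"
    with b obtain M where M: "\<forall>f\<in>{q U a b | a b. a \<in> B \<and> b \<in> C}. \<forall>z\<in>K. cmod (f z) \<le> M"
      unfolding bounded_sections_def by blast
    show "\<exists>M. \<forall>f\<in>{\<lambda>z. c * q U a b z | a b. a \<in> B \<and> b \<in> C}. \<forall>z\<in>K. cmod (f z) \<le> M"
    proof (intro exI[of _ "cmod c * M"] ballI, elim CollectE exE conjE, hypsubst)
      fix z a b assume "z \<in> K" "a \<in> B" "b \<in> C"
      then have "cmod (q U a b z) \<le> M" using M by blast
      then show "cmod (c * q U a b z) \<le> cmod c * M" by (simp add: norm_mult mult_left_mono)
    qed
  qed
qed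

lemma bilinear_map_on_swap:
  assumes q: "bilinear_map_on X S q"
  shows "bilinear_map_on X S (\<lambda>U a b. q U b a)"
  unfolding bilinear_map_on_def
proof (intro allI impI conjI ballI; elim conjE)
  fix U assume U: "openX X U" "U \<subseteq> S"
  note q = bilinear_map_onD[OF q U]
  show "q U b a \<in> sections U" if "a \<in> sections U" "b \<in> sections U" for a b by (rule q(1)[OF that(2,1)])
  show "q V (restr V b) (restr V a) = restr V (q U b a)"
    if "a \<in> sections U" "b \<in> sections U" "openX X V" "V \<subseteq> U" for a b V by (rule q(2)[OF that(2,1,3,4)])
  show "q U b (\<lambda>z. c * a z + a' z) = (\<lambda>z. c * q U b a z + q U b a' z)"
    "q U (\<lambda>z. c * a z + a' z) b = (\<lambda>z. c * q U a b z + q U a' b z)"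
    if "a \<in> sections U" "b \<in> sections U" "a' \<in> sections U" for a b a' c
    by (rule q(4)[OF that], rule q(3)[OF that])
  show "bounded_sections U {q U b a | a b. a \<in> B \<and> b \<in> C}" if "bounded_sections U B" "bounded_sections U C" for B C
    by (rule bounded_sections_subset[OF q(5)[OF that(2,1)]]) blast
qed

lemma bilinear_map_on_diff:
  assumes "bilinear_map_on X S q" "bilinear_map_on X S r" shows "bilinear_map_on X S (sm_diff q r)"
  using bilinear_map_on_add[OF assms(1) bilinear_map_on_scale[OF assms(2), of "-1"]]
  by (simp add: sm_diff_def)

lemma bilinear_map_on_skew_part:
  assumes "bilinear_map_on X S q" shows "bilinear_map_on X S (skew_part q)"
  using bilinear_map_on_scale[OF bilinear_map_on_diff[OF assms bilinear_map_on_swap[OF assms]], of "1/2"]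
  by (simp add: sm_diff_def skew_part_def)

lemma QI:
  assumes "bilinear_map_on X S q"
    "\<And>U a b z. openX X U \<Longrightarrow> U \<subseteq> S \<Longrightarrow> a \<in> sections U \<Longrightarrow> b \<in> sections U \<Longrightarrow> q U a b z = - q U b a z"
    "\<And>U a b c z. openX X U \<Longrightarrow> U \<subseteq> S \<Longrightarrow> a \<in> sections U \<Longrightarrow> b \<in> sections U \<Longrightarrow> c \<in> sections U \<Longrightarrow>
      hochschild_d q U a b c z = 0"
  shows "q \<in> Q X S"
  unfolding Q_def skew_on_def hochschild_cocycle_on_def
  by (intro CollectI conjI allI impI ballI ext assms(1); elim conjE; rule assms(2,3))

lemma QD:
  assumes "q \<in> Q X S"
  shows "bilinear_map_on X S q"
    "openX X U \<Longrightarrow> U \<subseteq> S \<Longrightarrow> a \<in> sections U \<Longrightarrow> b \<in> sections U \<Longrightarrow> q U a b z = - q U b a z"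
    "openX X U \<Longrightarrow> U \<subseteq> S \<Longrightarrow> a \<in> sections U \<Longrightarrow> b \<in> sections U \<Longrightarrow> c \<in> sections U \<Longrightarrow>
      hochschild_d q U a b c z = 0"
proof -
  have h: "bilinear_map_on X S q" "skew_on X S q" "hochschild_cocycle_on X S q" using assms by (simp_all add: Q_def)
  show "bilinear_map_on X S q" by (rule h(1))
  show "q U a b z = - q U b a z" if "openX X U" "U \<subseteq> S" "a \<in> sections U" "b \<in> sections U"
    using h(2)[unfolded skew_on_def, THEN spec, THEN mp, OF conjI[OF that(1,2)], THEN bspec, OF that(3), THEN bspec, OF that(4)]
    by (rule fun_cong)
  show "hochschild_d q U a b c z = 0"
    if "openX X U" "U \<subseteq> S" "a \<in> sections U" "b \<in> sections U" "c \<in> sections U"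
    using h(3)[unfolded hochschild_cocycle_on_def, THEN spec, THEN mp, OF conjI[OF that(1,2)],
        THEN bspec, OF that(3), THEN bspec, OF that(4), THEN bspec, OF that(5)]
    by (rule fun_cong)
qed

lemma Q_subset:
  assumes q: "q \<in> Q X S" and T: "T \<subseteq> S" shows "q \<in> Q X T"
proof (rule QI)
  show "bilinear_map_on X T q" by (rule bilinear_map_on_subset[OF QD(1)[OF q] T])
  fix U a b c z assume h: "openX X U" "U \<subseteq> T" "a \<in> sections U" "b \<in> sections U"
  have US: "U \<subseteq> S" using h(2) T by simp
  show "q U a b z = - q U b a z" by (rule QD(2)[OF q h(1) US h(3,4)])
  assume "c \<in> sections U"
  then show "hochschild_d q U a b c z = 0" by (rule QD(3)[OF q h(1) US h(3,4)])
qed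

lemma Q_add:
  assumes q: "q \<in> Q X S" and r: "r \<in> Q X S" shows "sm_add q r \<in> Q X S"
proof (rule QI)
  show "bilinear_map_on X S (sm_add q r)"
    unfolding sm_add_def by (rule bilinear_map_on_add[OF QD(1)[OF q] QD(1)[OF r]])
  fix U a b c z assume h: "openX X U" "U \<subseteq> S" "a \<in> sections U" "b \<in> sections U"
  show "sm_add q r U a b z = - sm_add q r U b a z"
    using QD(2)[OF q h, of z] QD(2)[OF r h, of z] by (simp add: sm_add_def)
  assume c: "c \<in> sections U"
  have "hochschild_d (sm_add q r) U a b c z = hochschild_d q U a b c z + hochschild_d r U a b c z"
    by (simp add: hochschild_d_def sm_add_def algebra_simps)
  then show "hochschild_d (sm_add q r) U a b c z = 0"
    using QD(3)[OF q h c, of z] QD(3)[OF r h c, of z] by simp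
qed

lemma Q_uminus:
  assumes q: "q \<in> Q X S" shows "(\<lambda>U a b z. - q U a b z) \<in> Q X S"
proof (rule QI)
  show "bilinear_map_on X S (\<lambda>U a b z. - q U a b z)"
    using bilinear_map_on_scale[OF QD(1)[OF q], of "-1"] by simp
  fix U a b c z assume h: "openX X U" "U \<subseteq> S" "a \<in> sections U" "b \<in> sections U"
  show "- q U a b z = - (- q U b a z)"
    using QD(2)[OF q h, of z] by simp
  assume c: "c \<in> sections U"
  show "hochschild_d (\<lambda>U a b z. - q U a b z) U a b c z = 0"
    using QD(3)[OF q h c, of z] by (simp add: hochschild_d_def algebra_simps)
qed

lemma Q_zero: "(\<lambda>_ _ _ _. 0) \<in> Q X S"
proof (rule QI)
  show "bilinear_map_on X S (\<lambda>_ _ _ _. 0)"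
    unfolding bilinear_map_on_def
    by (auto simp: sections_zero restr_def intro: bounded_sections_subset[OF bounded_sections_single[OF sections_zero]])
qed (simp_all add: hochschild_d_def)

lemma local_solutionD:
  assumes "local_solution X p S q"
  shows "bilinear_map_on X S q"
    "openX X U \<Longrightarrow> U \<subseteq> S \<Longrightarrow> a \<in> sections U \<Longrightarrow> b \<in> sections U \<Longrightarrow> c \<in> sections U \<Longrightarrow>
      p U (p U a b) c z - p U a (p U b c) z = hochschild_d q U a b c z"
proof -
  show "bilinear_map_on X S q" using assms by (simp add: local_solution_def)
  show "p U (p U a b) c z - p U a (p U b c) z = hochschild_d q U a b c z"
    if "openX X U" "U \<subseteq> S" "a \<in> sections U" "b \<in> sections U" "c \<in> sections U"
    by (rule assms[unfolded local_solution_def, THEN conjunct2, THEN spec, THEN mp, OF conjI[OF that(1,2)],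
        THEN bspec, OF that(3), THEN bspec, OF that(4), THEN bspec, OF that(5), THEN spec])
qed

lemma local_solution_subset:
  assumes "local_solution X p S q" "T \<subseteq> S" shows "local_solution X p T q"
  unfolding local_solution_def
  by (intro conjI bilinear_map_on_subset[OF local_solutionD(1)[OF assms(1)] assms(2)] allI impI ballI; elim conjE;
      rule local_solutionD(2)[OF assms(1)]; use assms(2) in auto)

text \<open>Exchanging the arguments of a cochain turns its coboundary into minus the coboundary
  with \<open>a\<close> and \<open>c\<close> exchanged. So the coboundary of the skew part is half
  the sum of two values of the coboundary of \<open>sm_diff q r\<close>, and these vanish since both
  maps solve the same equation.\<close>

lemma skew_part_diff_Q:
  assumes q: "local_solution X p S q" and r: "local_solution X p S r"
  shows "skew_part (sm_diff q r) \<in> Q X S"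
proof (rule QI)
  show "bilinear_map_on X S (skew_part (sm_diff q r))"
    by (rule bilinear_map_on_skew_part[OF bilinear_map_on_diff[OF local_solutionD(1)[OF q] local_solutionD(1)[OF r]]])
  fix U a b c z assume h: "openX X U" "U \<subseteq> S" "a \<in> sections U" "b \<in> sections U"
  show "skew_part (sm_diff q r) U a b z = - skew_part (sm_diff q r) U b a z"
    by (simp add: skew_part_def minus_divide_left)
  assume c: "c \<in> sections U"
  have "hochschild_d (skew_part (sm_diff q r)) U a b c z
    = ((hochschild_d q U a b c z - hochschild_d r U a b c z) + (hochschild_d q U c b a z - hochschild_d r U c b a z)) / 2"
    by (simp add: hochschild_d_def skew_part_def sm_diff_def mult.commute field_simps)
  then show "hochschild_d (skew_part (sm_diff q r)) U a b c z = 0"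
    using local_solutionD(2)[OF q h c, of z] local_solutionD(2)[OF r h c, of z]
      local_solutionD(2)[OF q h(1,2) c h(4,3), of z] local_solutionD(2)[OF r h(1,2) c h(4,3), of z] by simp
qed

text \<open>The skew part of a single solution is a cocycle, because subtracting a symmetric
  solution does not change it. These skew parts are the primitives in
  \<open>ob1_eq_zero\<close>.\<close>

lemma skew_part_Q:
  assumes q: "local_solution X p S q" and r: "local_solution X p S r" and sym: "\<And>U a b. r U a b = r U b a"
  shows "skew_part q \<in> Q X S"
proof -
  have "skew_part (sm_diff q r) = skew_part q"
    by (intro ext) (simp add: skew_part_def sm_diff_def sym[of _ a b for a b])
  then show ?thesis using skew_part_diff_Q[OF q r] by simp
qed

lemma eq_onD:
  assumes "eq_on X S q r" "openX X U" "U \<subseteq> S" "a \<in> sections U" "b \<in> sections U"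
  shows "q U a b z = r U a b z"
  by (rule fun_cong, rule assms(1)[unfolded eq_on_def, THEN spec, THEN mp, OF conjI[OF assms(2,3)], THEN bspec, OF assms(4), THEN bspec, OF assms(5)])

lemma eq_onI:
  assumes "\<And>U a b z. openX X U \<Longrightarrow> U \<subseteq> S \<Longrightarrow> a \<in> sections U \<Longrightarrow> b \<in> sections U \<Longrightarrow> q U a b z = r U a b z"
  shows "eq_on X S q r"
  unfolding eq_on_def by (intro allI impI ballI ext; elim conjE; rule assms)

section \<open>Equivalence of Cech cocycles on different coverings\<close>

lemma cech_Z1_iff: "(\<U>, q) \<in> cech_Z1 X \<longleftrightarrow> open_cover X \<U> \<and>
     (\<forall>U\<in>\<U>. \<forall>V\<in>\<U>. q U V \<in> Q X (U \<inter> V)) \<and>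
     (\<forall>U\<in>\<U>. \<forall>V\<in>\<U>. \<forall>W\<in>\<U>. eq_on X (U \<inter> V \<inter> W) (q U W) (sm_add (q U V) (q V W)))"
  by (simp add: cech_Z1_def)

lemma cech_rel_iff: "((\<U>, q), (\<V>, r)) \<in> cech_rel X \<longleftrightarrow> (\<U>, q) \<in> cech_Z1 X \<and> (\<V>, r) \<in> cech_Z1 X \<and>
     (\<exists>\<W> \<sigma> \<tau> s. open_cover X \<W> \<and>
        (\<forall>W\<in>\<W>. \<sigma> W \<in> \<U> \<and> W \<subseteq> \<sigma> W \<and> \<tau> W \<in> \<V> \<and> W \<subseteq> \<tau> W \<and> s W \<in> Q X W) \<and>
        (\<forall>W\<in>\<W>. \<forall>W'\<in>\<W>. eq_on X (W \<inter> W')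
           (sm_diff (q (\<sigma> W) (\<sigma> W')) (r (\<tau> W) (\<tau> W'))) (sm_diff (s W) (s W'))))"
  by (simp add: cech_rel_def)

lemma cech_rel_sym:
  assumes "(c, d) \<in> cech_rel X" shows "(d, c) \<in> cech_rel X"
proof -
  obtain \<U> q \<V> r where cd: "c = (\<U>, q)" "d = (\<V>, r)" by fastforce
  obtain \<W> \<sigma> \<tau> s where Z: "(\<U>, q) \<in> cech_Z1 X" "(\<V>, r) \<in> cech_Z1 X" "open_cover X \<W>"
      and W: "\<forall>W\<in>\<W>. \<sigma> W \<in> \<U> \<and> W \<subseteq> \<sigma> W \<and> \<tau> W \<in> \<V> \<and> W \<subseteq> \<tau> W \<and> s W \<in> Q X W"
      and e: "\<forall>W\<in>\<W>. \<forall>W'\<in>\<W>. eq_on X (W \<inter> W') (sm_diff (q (\<sigma> W) (\<sigma> W')) (r (\<tau> W) (\<tau> W'))) (sm_diff (s W) (s W'))"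
    using assms unfolding cd cech_rel_iff by (elim conjE exE)
  show ?thesis
    unfolding cd cech_rel_iff
  proof (intro conjI Z(1,2), rule exI[of _ \<W>], rule exI[of _ \<tau>], rule exI[of _ \<sigma>],
      rule exI[of _ "\<lambda>W U a b z. - s W U a b z"], intro conjI Z(3) ballI)
    fix W assume w: "W \<in> \<W>"
    note h = W[THEN bspec, OF w]
    show "\<tau> W \<in> \<V>" "W \<subseteq> \<tau> W" "\<sigma> W \<in> \<U>" "W \<subseteq> \<sigma> W" using h by blast+
    show "(\<lambda>U a b z. - s W U a b z) \<in> Q X W" by (rule Q_uminus) (use h in blast)
    fix W' assume w': "W' \<in> \<W>"
    show "eq_on X (W \<inter> W') (sm_diff (r (\<tau> W) (\<tau> W')) (q (\<sigma> W) (\<sigma> W')))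
      (sm_diff (\<lambda>U a b z. - s W U a b z) (\<lambda>U a b z. - s W' U a b z))"
    proof (rule eq_onI)
      fix U a b z assume u: "openX X U" "U \<subseteq> W \<inter> W'" "a \<in> sections U" "b \<in> sections U"
      show "sm_diff (r (\<tau> W) (\<tau> W')) (q (\<sigma> W) (\<sigma> W')) U a b z = sm_diff (\<lambda>U a b z. - s W U a b z) (\<lambda>U a b z. - s W' U a b z) U a b z"
        using eq_onD[OF e[THEN bspec, OF w, THEN bspec, OF w'] u, of z] by (simp add: sm_diff_def algebra_simps)
    qed
  qed
qed

lemma open_cover_Int:
  assumes "open_cover X \<A>" "open_cover X \<B>"
  shows "open_cover X {A \<inter> B | A B. A \<in> \<A> \<and> B \<in> \<B>}"
proof -
  have "\<Union>{A \<inter> B | A B. A \<in> \<A> \<and> B \<in> \<B>} = \<Union>\<A> \<inter> \<Union>\<B>" by blast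
  then show ?thesis using assms by (auto simp: open_cover_def intro: openX_Int)
qed

text \<open>The two refinements may choose different members of the middle covering. The middle
  cocycle, evaluated on the two choices, is the correction to be added to the sum of the
  primitives.\<close>

lemma cech_rel_trans:
  assumes "(c, d) \<in> cech_rel X" "(d, e) \<in> cech_rel X" shows "(c, e) \<in> cech_rel X"
proof -
  obtain \<U> q \<V> r \<T> t where cde: "c = (\<U>, q)" "d = (\<V>, r)" "e = (\<T>, t)" by (metis surj_pair)
  obtain \<W> \<sigma> \<tau> s where Z: "(\<U>, q) \<in> cech_Z1 X" "(\<V>, r) \<in> cech_Z1 X" "open_cover X \<W>"
      and W: "\<forall>W\<in>\<W>. \<sigma> W \<in> \<U> \<and> W \<subseteq> \<sigma> W \<and> \<tau> W \<in> \<V> \<and> W \<subseteq> \<tau> W \<and> s W \<in> Q X W"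
      and eq: "\<forall>W\<in>\<W>. \<forall>W'\<in>\<W>. eq_on X (W \<inter> W') (sm_diff (q (\<sigma> W) (\<sigma> W')) (r (\<tau> W) (\<tau> W'))) (sm_diff (s W) (s W'))"
    using assms(1) unfolding cde cech_rel_iff by (elim conjE exE)
  obtain \<W>' \<sigma>' \<tau>' s' where Z': "(\<T>, t) \<in> cech_Z1 X" "open_cover X \<W>'"
      and W': "\<forall>W\<in>\<W>'. \<sigma>' W \<in> \<V> \<and> W \<subseteq> \<sigma>' W \<and> \<tau>' W \<in> \<T> \<and> W \<subseteq> \<tau>' W \<and> s' W \<in> Q X W"
      and eq': "\<forall>W\<in>\<W>'. \<forall>W'\<in>\<W>'. eq_on X (W \<inter> W') (sm_diff (r (\<sigma>' W) (\<sigma>' W')) (t (\<tau>' W) (\<tau>' W'))) (sm_diff (s' W) (s' W'))"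
    using assms(2) unfolding cde cech_rel_iff by (elim conjE exE)
  define \<Z> where "\<Z> = {W \<inter> W' | W W'. W \<in> \<W> \<and> W' \<in> \<W>'}"
  \<comment> \<open>A set may be an intersection in several ways; one of them is fixed by
    choice.\<close>
  have "\<forall>Y\<in>\<Z>. \<exists>p. fst p \<in> \<W> \<and> snd p \<in> \<W>' \<and> Y = fst p \<inter> snd p"
    unfolding \<Z>_def by force
  from bchoice[OF this] obtain f where f: "\<forall>Y\<in>\<Z>. fst (f Y) \<in> \<W> \<and> snd (f Y) \<in> \<W>' \<and> Y = fst (f Y) \<inter> snd (f Y)" by blast
  have cover: "open_cover X \<Z>"
    unfolding \<Z>_def by (rule open_cover_Int[OF Z(3) Z'(2)])
  have r: "r A B \<in> Q X (A \<inter> B)" if "A \<in> \<V>" "B \<in> \<V>" for A B using Z(2) that unfolding cech_Z1_iff by blast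
  have rc: "eq_on X (A \<inter> B \<inter> C) (r A C) (sm_add (r A B) (r B C))" if "A \<in> \<V>" "B \<in> \<V>" "C \<in> \<V>" for A B C
    using Z(2) that unfolding cech_Z1_iff by blast
  define g where "g Y = sm_add (sm_add (s (fst (f Y))) (s' (snd (f Y)))) (r (\<tau> (fst (f Y))) (\<sigma>' (snd (f Y))))" for Y
  show ?thesis
    unfolding cde cech_rel_iff
  proof (intro conjI Z(1) Z'(1), rule exI[of _ \<Z>], rule exI[of _ "\<lambda>Y. \<sigma> (fst (f Y))"],
      rule exI[of _ "\<lambda>Y. \<tau>' (snd (f Y))"], rule exI[of _ g], intro conjI cover ballI)
    fix Y assume Y: "Y \<in> \<Z>"
    note y = f[THEN bspec, OF Y]
    have y1: "fst (f Y) \<in> \<W>" "snd (f Y) \<in> \<W>'" "Y \<subseteq> fst (f Y)" "Y \<subseteq> snd (f Y)" using y by auto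
    note h = W[THEN bspec, OF y1(1)] and h' = W'[THEN bspec, OF y1(2)]
    show "\<sigma> (fst (f Y)) \<in> \<U>" "\<tau>' (snd (f Y)) \<in> \<T>" using h h' by auto
    show "Y \<subseteq> \<sigma> (fst (f Y))" "Y \<subseteq> \<tau>' (snd (f Y))" using h h' y1 by auto
    show "g Y \<in> Q X Y"
      unfolding g_def
    proof (intro Q_add)
      show "s (fst (f Y)) \<in> Q X Y" by (rule Q_subset[of _ _ "fst (f Y)"]) (use h y1 in auto)
      show "s' (snd (f Y)) \<in> Q X Y" by (rule Q_subset[of _ _ "snd (f Y)"]) (use h' y1 in auto)
      show "r (\<tau> (fst (f Y))) (\<sigma>' (snd (f Y))) \<in> Q X Y"
        by (rule Q_subset[OF r]) (use h h' y1 in auto)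
    qed
    fix Y' assume Y': "Y' \<in> \<Z>"
    have y2: "fst (f Y') \<in> \<W>" "snd (f Y') \<in> \<W>'" "Y' \<subseteq> fst (f Y')" "Y' \<subseteq> snd (f Y')" using f[THEN bspec, OF Y'] by auto
    note k = W[THEN bspec, OF y2(1)] and k' = W'[THEN bspec, OF y2(2)]
    show "eq_on X (Y \<inter> Y') (sm_diff (q (\<sigma> (fst (f Y))) (\<sigma> (fst (f Y')))) (t (\<tau>' (snd (f Y))) (\<tau>' (snd (f Y'))))) (sm_diff (g Y) (g Y'))"
    proof (rule eq_onI)
      fix U a b z assume u: "openX X U" "U \<subseteq> Y \<inter> Y'" "a \<in> sections U" "b \<in> sections U"
      let ?A = "\<tau> (fst (f Y))" and ?B = "\<tau> (fst (f Y'))" and ?C = "\<sigma>' (snd (f Y))" and ?D = "\<sigma>' (snd (f Y'))"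
      have i: "?A \<in> \<V>" "?B \<in> \<V>" "?C \<in> \<V>" "?D \<in> \<V>" "U \<subseteq> ?A" "U \<subseteq> ?B" "U \<subseteq> ?C" "U \<subseteq> ?D"
        using h h' k k' y1 y2 u(2) by auto
      have 1: "sm_diff (q (\<sigma> (fst (f Y))) (\<sigma> (fst (f Y')))) (r ?A ?B) U a b z = sm_diff (s (fst (f Y))) (s (fst (f Y'))) U a b z"
        by (rule eq_onD[OF eq[THEN bspec, OF y1(1), THEN bspec, OF y2(1)] u(1) _ u(3,4)]) (use u(2) y1 y2 in auto)
      have 2: "sm_diff (r ?C ?D) (t (\<tau>' (snd (f Y))) (\<tau>' (snd (f Y')))) U a b z = sm_diff (s' (snd (f Y))) (s' (snd (f Y'))) U a b z"
        by (rule eq_onD[OF eq'[THEN bspec, OF y1(2), THEN bspec, OF y2(2)] u(1) _ u(3,4)]) (use u(2) y1 y2 in auto)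
      have 3: "r ?A ?D U a b z = sm_add (r ?A ?B) (r ?B ?D) U a b z"
        by (rule eq_onD[OF rc[OF i(1,2,4)] u(1) _ u(3,4)]) (use i in auto)
      have 4: "r ?A ?D U a b z = sm_add (r ?A ?C) (r ?C ?D) U a b z"
        by (rule eq_onD[OF rc[OF i(1,3,4)] u(1) _ u(3,4)]) (use i in auto)
      show "sm_diff (q (\<sigma> (fst (f Y))) (\<sigma> (fst (f Y')))) (t (\<tau>' (snd (f Y))) (\<tau>' (snd (f Y')))) U a b z = sm_diff (g Y) (g Y') U a b z"
      proof -
        \<comment> \<open>The cocycle relations for \<open>?A\<close>, \<open>?B\<close>,
          \<open>?D\<close> and for \<open>?A\<close>, \<open>?C\<close>, \<open>?D\<close>: the
          change of the middle cocycle between the two choices is the difference of the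
          corrections.\<close>
        have "r ?A ?B U a b z - r ?C ?D U a b z = r ?A ?C U a b z - r ?B ?D U a b z"
          using 3 4 by (simp add: sm_add_def diff_eq_eq algebra_simps)
        moreover have "q (\<sigma> (fst (f Y))) (\<sigma> (fst (f Y'))) U a b z - t (\<tau>' (snd (f Y))) (\<tau>' (snd (f Y'))) U a b z
          = sm_diff (q (\<sigma> (fst (f Y))) (\<sigma> (fst (f Y')))) (r ?A ?B) U a b z + (r ?A ?B U a b z - r ?C ?D U a b z)
            + sm_diff (r ?C ?D) (t (\<tau>' (snd (f Y))) (\<tau>' (snd (f Y')))) U a b z"
          by (simp add: sm_diff_def)
        ultimately show ?thesis unfolding 1 2 by (simp add: g_def sm_diff_def sm_add_def)
      qed
    qed
  qed
qed

theorem ob1_eq_zero: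
  assumes X: "openX X X"
    and sol: "\<And>z. z \<in> X \<Longrightarrow> \<exists>S q. openX X S \<and> z \<in> S \<and> local_solution X p S q \<and> (\<forall>U a b. q U a b = q U b a)"
  shows "ob1 X p = cech_H1_zero X"
proof -
  let ?sol = "\<lambda>S q. local_solution X p S q \<and> (\<forall>U a b. q U a b = q U b a)"
  define \<S> where "\<S> = {S. openX X S \<and> (\<exists>q. ?sol S q)}"
  have \<S>: "open_cover X \<S>"
    unfolding open_cover_def
  proof (intro conjI ballI equalityI subsetI)
    show "openX X S" if "S \<in> \<S>" for S using that by (simp add: \<S>_def)
    show "z \<in> X" if "z \<in> \<Union>\<S>" for z using that openX_subset by (fastforce simp: \<S>_def)
    show "z \<in> \<Union>\<S>" if "z \<in> X" for z using sol[OF that] unfolding \<S>_def by blast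
  qed
  define zero :: "'a cech_cochain" where "zero = ({X}, \<lambda>_ _ _ _ _ _. 0)"
  have zero: "zero \<in> cech_Z1 X"
    unfolding zero_def cech_Z1_iff by (auto simp: open_cover_def X Q_zero sm_add_def intro: eq_onI)
  define sys where "sys \<U> p2 = (\<U>, \<lambda>U V. skew_part (sm_diff (p2 U) (p2 V)))"
    for \<U> :: "(complex^'a) set set" and p2 :: "(complex^'a) set \<Rightarrow> 'a sheaf_map"
  have rel: "(sys \<U> p2, zero) \<in> cech_rel X" if \<U>: "open_cover X \<U>" and p2: "\<forall>U\<in>\<U>. local_solution X p U (p2 U)" for \<U> p2
  proof -
    have Z: "sys \<U> p2 \<in> cech_Z1 X"
      unfolding sys_def cech_Z1_iff
    proof (intro conjI \<U> ballI)
      show "skew_part (sm_diff (p2 U) (p2 V)) \<in> Q X (U \<inter> V)" if "U \<in> \<U>" "V \<in> \<U>" for U V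
        by (rule skew_part_diff_Q[of _ p]; rule local_solution_subset[of _ _ U] local_solution_subset[of _ _ V]; use p2 that in auto)
      show "eq_on X (U \<inter> V \<inter> W) (skew_part (sm_diff (p2 U) (p2 W)))
          (sm_add (skew_part (sm_diff (p2 U) (p2 V))) (skew_part (sm_diff (p2 V) (p2 W))))" for U V W
        by (rule eq_onI) (simp add: skew_part_def sm_diff_def sm_add_def field_simps)
    qed
    \<comment> \<open>Each member lies in the domain of a symmetric solution, so that
      \<open>skew_part_Q\<close> applies on it: the skew part of a given solution is a section of
      \<open>Q\<close> by comparison with such a solution.\<close>
    define \<W> where "\<W> = {U \<inter> S | U S. U \<in> \<U> \<and> S \<in> \<S>}"
    have cover: "open_cover X \<W>"
      unfolding \<W>_def by (rule open_cover_Int[OF \<U> \<S>])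
    have "\<forall>W\<in>\<W>. \<exists>U. U \<in> \<U> \<and> W \<subseteq> U \<and> (\<exists>S\<in>\<S>. W \<subseteq> S)"
      unfolding \<W>_def by blast
    from bchoice[OF this] obtain \<sigma> where \<sigma>: "\<forall>W\<in>\<W>. \<sigma> W \<in> \<U> \<and> W \<subseteq> \<sigma> W \<and> (\<exists>S\<in>\<S>. W \<subseteq> S)" by blast
    have sub: "W \<subseteq> X" if "W \<in> \<W>" for W using cover that openX_subset unfolding open_cover_def by blast
    show ?thesis
      unfolding sys_def zero_def cech_rel_iff
    proof (intro conjI, goal_cases)
      case 3
      show ?case
      proof (rule exI[of _ \<W>], rule exI[of _ \<sigma>], rule exI[of _ "\<lambda>_. X"],
        rule exI[of _ "\<lambda>W. skew_part (p2 (\<sigma> W))"], intro conjI cover ballI)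
      fix W assume W: "W \<in> \<W>"
      note h = \<sigma>[THEN bspec, OF W]
      show "\<sigma> W \<in> \<U>" "W \<subseteq> \<sigma> W" "X \<in> {X}" "W \<subseteq> X" using h sub[OF W] by auto
      obtain S q where S: "W \<subseteq> S" "local_solution X p S q" "\<And>U a b. q U a b = q U b a"
        using h unfolding \<S>_def by blast
      have "local_solution X p W (p2 (\<sigma> W))"
        by (rule local_solution_subset[of _ _ "\<sigma> W"]) (use p2 h in auto)
      then show "skew_part (p2 (\<sigma> W)) \<in> Q X W"
        by (rule skew_part_Q[OF _ local_solution_subset[OF S(2,1)] S(3)])
      fix W'
      show "eq_on X (W \<inter> W') (sm_diff (skew_part (sm_diff (p2 (\<sigma> W)) (p2 (\<sigma> W')))) (\<lambda>_ _ _ _. 0))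
          (sm_diff (skew_part (p2 (\<sigma> W))) (skew_part (p2 (\<sigma> W'))))"
        by (rule eq_onI) (simp add: skew_part_def sm_diff_def field_simps)
      qed
    qed (use Z zero in \<open>simp_all add: sys_def zero_def\<close>)
  qed
  have img: "cech_rel X `` {sys \<U> p2} = cech_rel X `` {zero}"
    if "open_cover X \<U>" "\<forall>U\<in>\<U>. local_solution X p U (p2 U)" for \<U> p2
    using rel[OF that] cech_rel_sym cech_rel_trans by blast
  have ob: "ob1 X p = (\<Union>(\<U>, p2)\<in>{(\<U>, p2). open_cover X \<U> \<and> (\<forall>U\<in>\<U>. local_solution X p U (p2 U))}. cech_rel X `` {sys \<U> p2})"
    unfolding ob1_def sys_def by blast
  have "\<forall>S\<in>\<S>. \<exists>q. ?sol S q" by (simp add: \<S>_def)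
  from bchoice[OF this] obtain p0 where "\<forall>S\<in>\<S>. ?sol S (p0 S)" by blast
  then have "\<forall>S\<in>\<S>. local_solution X p S (p0 S)" by blast
  \<comment> \<open>At least one system of local solutions exists, so the union defining
    \<open>ob1\<close> is not empty.\<close>
  then have mem: "(\<S>, p0) \<in> {(\<U>, p2). open_cover X \<U> \<and> (\<forall>U\<in>\<U>. local_solution X p U (p2 U))}" (is "_ \<in> ?I")
    using \<S> by blast
  have const: "(case x of (\<U>, p2) \<Rightarrow> cech_rel X `` {sys \<U> p2}) = cech_rel X `` {zero}" if "x \<in> ?I" for x
  proof (cases x)
    case (Pair \<U> p2)
    with that show ?thesis using img[of \<U> p2] by simp
  qed
  have "ob1 X p = (\<Union>x\<in>?I. cech_rel X `` {zero})"
    unfolding ob by (rule arg_cong[where f = Union], rule image_cong[OF refl const])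
  also have "\<dots> = cech_rel X `` {zero}" using mem by (simp only: UN_constant) auto
  finally show ?thesis by (simp add: cech_H1_zero_def zero_def)
qed

section \<open>Harrison cohomology of the stalks\<close>

text \<open>Common form of \<open>harr_B3\<close> and \<open>tyu_B2\<close>: additive groups of
  functions on \<open>K\<close>. The coset computations rest on this together with the formula for
  the multiplication.\<close>

definition pointwise_subgroup :: "('b, 'm) ring_scheme \<Rightarrow> 't set \<Rightarrow> ('t \<Rightarrow> 'b) set \<Rightarrow> bool" where
  "pointwise_subgroup A K N \<longleftrightarrow> N \<subseteq> K \<rightarrow>\<^sub>E carrier A \<and> restrict (\<lambda>_. \<zero>\<^bsub>A\<^esub>) K \<in> N \<and>
     (\<forall>f\<in>N. \<forall>g\<in>N. restrict (\<lambda>t. f t \<oplus>\<^bsub>A\<^esub> g t) K \<in> N) \<and>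
     (\<forall>f\<in>N. restrict (\<lambda>t. \<ominus>\<^bsub>A\<^esub> f t) K \<in> N)"

context abelian_group
begin

context
  fixes K :: "'t set" and N :: "('t \<Rightarrow> 'a) set" and M :: "('t \<Rightarrow> 'a) monoid"
  assumes N: "pointwise_subgroup G K N"
    and M: "\<And>f g. mult M f g = restrict (\<lambda>t. f t \<oplus> g t) K"
begin

lemma pointwise_D:
  shows "f \<in> N \<Longrightarrow> f \<in> K \<rightarrow>\<^sub>E carrier G" "restrict (\<lambda>_. \<zero>) K \<in> N"
    "f \<in> N \<Longrightarrow> g \<in> N \<Longrightarrow> restrict (\<lambda>t. f t \<oplus> g t) K \<in> N"
    "f \<in> N \<Longrightarrow> restrict (\<lambda>t. \<ominus> f t) K \<in> N"
  using N unfolding pointwise_subgroup_def by blast+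

lemma pointwise_coset:
  assumes e: "e \<in> N" shows "N #>\<^bsub>M\<^esub> e = N"
proof (intro equalityI subsetI)
  fix x assume "x \<in> N #>\<^bsub>M\<^esub> e"
  then obtain h where h: "h \<in> N" "x = restrict (\<lambda>t. h t \<oplus> e t) K" by (auto simp: r_coset_def M)
  show "x \<in> N" unfolding h(2) by (rule pointwise_D(3)[OF h(1) e])
next
  fix x assume x: "x \<in> N"
  let ?y = "restrict (\<lambda>t. x t \<oplus> restrict (\<lambda>t. \<ominus> e t) K t) K"
  have "?y \<in> N" by (rule pointwise_D(3)[OF x pointwise_D(4)[OF e]])
  moreover have "restrict (\<lambda>t. ?y t \<oplus> e t) K = x"
  proof (rule extensionalityI[of _ K])
    show "x \<in> extensional K" using pointwise_D(1)[OF x] by (simp add: PiE_def)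
    fix t assume t: "t \<in> K"
    then have "x t \<in> carrier G" "e t \<in> carrier G" using pointwise_D(1)[OF x] pointwise_D(1)[OF e] by auto
    then show "restrict (\<lambda>t. ?y t \<oplus> e t) K t = x t" using t by (simp add: a_assoc l_neg)
  qed simp
  ultimately show "x \<in> N #>\<^bsub>M\<^esub> e" unfolding r_coset_def M by (intro UN_I[of ?y]) simp_all
qed

lemma pointwise_set_mult: "N <#>\<^bsub>M\<^esub> N = N"
proof -
  have "N <#>\<^bsub>M\<^esub> N = (\<Union>e\<in>N. N #>\<^bsub>M\<^esub> e)" by (auto simp: set_mult_def r_coset_def)
  also have "\<dots> = (\<Union>e\<in>N. N)" by (rule SUP_cong[OF refl pointwise_coset])
  finally show ?thesis using pointwise_D(2) by auto
qed

text \<open>The coset contains \<open>D\<close>, hence by idempotency also \<open>D + D\<close>,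
  which is therefore \<open>k + D\<close> with \<open>k\<close> in \<open>N\<close>; cancelling
  gives \<open>D = k\<close>.\<close>

lemma pointwise_idempotent:
  assumes D: "D \<in> K \<rightarrow>\<^sub>E carrier G" and id: "(N #>\<^bsub>M\<^esub> D) <#>\<^bsub>M\<^esub> (N #>\<^bsub>M\<^esub> D) = N #>\<^bsub>M\<^esub> D"
  shows "N #>\<^bsub>M\<^esub> D = N"
proof -
  let ?z = "restrict (\<lambda>_. \<zero>) K"
  have Dt: "D t \<in> carrier G" if "t \<in> K" for t using D that by auto
  have "mult M ?z D = D"
    unfolding M by (rule extensionalityI[of _ K]) (use D Dt in \<open>auto simp: PiE_def\<close>)
  then have DN: "D \<in> N #>\<^bsub>M\<^esub> D" unfolding r_coset_def by (intro UN_I[OF pointwise_D(2)]) simp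
  have "mult M D D \<in> (N #>\<^bsub>M\<^esub> D) <#>\<^bsub>M\<^esub> (N #>\<^bsub>M\<^esub> D)" unfolding set_mult_def by (intro UN_I[OF DN]) simp
  then have "mult M D D \<in> N #>\<^bsub>M\<^esub> D" by (simp only: id)
  then obtain k where k: "k \<in> N" "mult M D D = mult M k D" by (auto simp: r_coset_def)
  have "D = k"
  proof (rule extensionalityI[of _ K])
    show "D \<in> extensional K" "k \<in> extensional K" using D pointwise_D(1)[OF k(1)] by (auto simp: PiE_def)
    fix t assume t: "t \<in> K"
    have "D t \<oplus> D t = k t \<oplus> D t" using fun_cong[OF k(2), of t] t unfolding M by simp
    moreover have "k t \<in> carrier G" using pointwise_D(1)[OF k(1)] t by auto
    ultimately show "D t = k t" using Dt[OF t] add.right_cancel[of "D t" "D t" "k t"] by simp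
  qed
  then show ?thesis using pointwise_coset k(1) by simp
qed

end

end

text \<open>What the computations with cochains ask of a stalk: a commutative ring with additive
  scalars, and bounded sets stable under subsets, sums and negatives, so that bounded cochains can
  be added and negated.\<close>

locale born_cring = cring A for A :: "('b, 'm) born_algebra_scheme" (structure) +
  assumes smult_closed: "x \<in> carrier A \<Longrightarrow> t \<odot> x \<in> carrier A"
    and smult_add: "x \<in> carrier A \<Longrightarrow> y \<in> carrier A \<Longrightarrow> t \<odot> (x \<oplus> y) = (t \<odot> x) \<oplus> (t \<odot> y)"
    and born_subset: "B \<in> bornology A \<Longrightarrow> C \<subseteq> B \<Longrightarrow> C \<in> bornology A"
    and born_carrier: "B \<in> bornology A \<Longrightarrow> B \<subseteq> carrier A"
    and born_zero: "{\<zero>} \<in> bornology A"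
    and born_add: "B \<in> bornology A \<Longrightarrow> C \<in> bornology A \<Longrightarrow> {b \<oplus> c | b c. b \<in> B \<and> c \<in> C} \<in> bornology A"
    and born_neg: "B \<in> bornology A \<Longrightarrow> {\<ominus> b | b. b \<in> B} \<in> bornology A"
begin

lemma smult_zero: "t \<odot> \<zero> = \<zero>"
proof -
  have "t \<odot> \<zero> \<oplus> t \<odot> \<zero> = t \<odot> \<zero> \<oplus> \<zero>" using smult_add[of \<zero> \<zero> t] smult_closed[of \<zero> t] by simp
  then show ?thesis using smult_closed[of \<zero> t] add.l_cancel_one[of "t \<odot> \<zero>" "t \<odot> \<zero>"] by simp
qed

lemma smult_neg: "x \<in> carrier A \<Longrightarrow> t \<odot> (\<ominus> x) = \<ominus> (t \<odot> x)"
proof -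
  assume x: "x \<in> carrier A"
  have "t \<odot> (\<ominus> x) \<oplus> t \<odot> x = \<zero>"
    using smult_add[of "\<ominus> x" x t] x by (simp add: l_neg smult_zero)
  then show ?thesis using x smult_closed by (intro minus_equality[symmetric]) auto
qed

lemma linear_inD:
  assumes "linear_in A f" "x \<in> carrier A"
  shows "f x \<in> carrier A" "y \<in> carrier A \<Longrightarrow> f ((t \<odot> x) \<oplus> y) = (t \<odot> f x) \<oplus> f y"
  using assms unfolding linear_in_def by blast+

lemma linear_in_zero: "linear_in A (\<lambda>x. \<zero>)"
  by (simp add: linear_in_def smult_zero)

lemma linear_in_add:
  assumes "linear_in A f" "linear_in A g" shows "linear_in A (\<lambda>x. f x \<oplus> g x)"
  unfolding linear_in_def
proof (intro ballI allI conjI)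
  fix x y t assume xy: "x \<in> carrier A" "y \<in> carrier A"
  have c: "f x \<in> carrier A" "f y \<in> carrier A" "g x \<in> carrier A" "g y \<in> carrier A"
    by (rule linear_inD[OF assms(1) xy(1)] linear_inD[OF assms(1) xy(2)] linear_inD[OF assms(2) xy(1)] linear_inD[OF assms(2) xy(2)])+
  then show "f x \<oplus> g x \<in> carrier A" by simp
  show "f ((t \<odot> x) \<oplus> y) \<oplus> g ((t \<odot> x) \<oplus> y) = (t \<odot> (f x \<oplus> g x)) \<oplus> (f y \<oplus> g y)"
    unfolding linear_inD(2)[OF assms(1) xy] linear_inD(2)[OF assms(2) xy] smult_add[OF c(1,3)]
    using c smult_closed[OF c(1), of t] smult_closed[OF c(3), of t] by (simp add: a_ac)
qed

lemma linear_in_neg: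
  assumes "linear_in A f" shows "linear_in A (\<lambda>x. \<ominus> f x)"
  unfolding linear_in_def
proof (intro ballI allI conjI)
  fix x y t assume xy: "x \<in> carrier A" "y \<in> carrier A"
  have c: "f x \<in> carrier A" "f y \<in> carrier A"
    by (rule linear_inD[OF assms xy(1)] linear_inD[OF assms xy(2)])+
  then show "\<ominus> f x \<in> carrier A" by simp
  show "\<ominus> f ((t \<odot> x) \<oplus> y) = (t \<odot> (\<ominus> f x)) \<oplus> (\<ominus> f y)"
    unfolding linear_inD(2)[OF assms xy] smult_neg[OF c(1)]
    using c smult_closed[OF c(1), of t] by (simp add: minus_add)
qed

lemma cochain_value:
  assumes "bilinear_cochain A h" "a \<in> carrier A" "b \<in> carrier A" shows "h a b \<in> carrier A"
proof -
  have "linear_in A (\<lambda>x. h a x)" using assms unfolding bilinear_cochain_def by blast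
  then show ?thesis by (rule linear_inD(1)[OF _ assms(3)])
qed

lemma hoch_d2_value:
  assumes h: "bilinear_cochain A h" and t: "t \<in> cube A" shows "hoch_d2 A h t \<in> carrier A"
  using t cochain_value[OF h] by (auto simp: hoch_d2_def cube_def)

lemma alternating_sum_add:
  assumes "x1 \<in> carrier A" "x2 \<in> carrier A" "x3 \<in> carrier A" "x4 \<in> carrier A"
    "y1 \<in> carrier A" "y2 \<in> carrier A" "y3 \<in> carrier A" "y4 \<in> carrier A"
  shows "(x1 \<ominus> x2 \<oplus> x3 \<ominus> x4) \<oplus> (y1 \<ominus> y2 \<oplus> y3 \<ominus> y4)
    = (x1 \<oplus> y1) \<ominus> (x2 \<oplus> y2) \<oplus> (x3 \<oplus> y3) \<ominus> (x4 \<oplus> y4)"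
  using assms by (simp add: a_minus_def minus_add a_ac)

lemma alternating_sum_neg:
  assumes "x1 \<in> carrier A" "x2 \<in> carrier A" "x3 \<in> carrier A" "x4 \<in> carrier A"
  shows "\<ominus> (x1 \<ominus> x2 \<oplus> x3 \<ominus> x4) = (\<ominus> x1) \<ominus> (\<ominus> x2) \<oplus> (\<ominus> x3) \<ominus> (\<ominus> x4)"
  using assms by (simp add: a_minus_def minus_add)

lemma harr_B3_subgroup: "pointwise_subgroup A (cube A) (harr_B3 A)"
  unfolding pointwise_subgroup_def
proof (intro conjI ballI subsetI)
  fix f assume "f \<in> harr_B3 A"
  then obtain h where "f = hoch_d2 A h" "bilinear_cochain A h" unfolding harr_B3_def by blast
  then show "f \<in> cube A \<rightarrow>\<^sub>E carrier A"
    using hoch_d2_value by (intro PiE_I) (auto simp: hoch_d2_def)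
next
  have "bilinear_cochain A (\<lambda>_ _. \<zero>)"
    unfolding bilinear_cochain_def
    by (intro conjI ballI linear_in_zero) (rule born_subset[OF born_zero], auto)
  moreover have "hoch_d2 A (\<lambda>_ _. \<zero>) = restrict (\<lambda>_. \<zero>) (cube A)"
    by (rule ext) (auto simp: hoch_d2_def restrict_def cube_def a_minus_def)
  ultimately show "restrict (\<lambda>_. \<zero>) (cube A) \<in> harr_B3 A"
    unfolding harr_B3_def by (intro CollectI exI[of _ "\<lambda>_ _. \<zero>"]) auto
next
  fix f g assume "f \<in> harr_B3 A" "g \<in> harr_B3 A"
  then obtain h k where h: "f = hoch_d2 A h" "bilinear_cochain A h" "\<forall>a\<in>carrier A. \<forall>b\<in>carrier A. h a b = h b a"
    and k: "g = hoch_d2 A k" "bilinear_cochain A k" "\<forall>a\<in>carrier A. \<forall>b\<in>carrier A. k a b = k b a"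
    unfolding harr_B3_def by blast
  have bc: "bilinear_cochain A (\<lambda>a b. h a b \<oplus> k a b)"
    unfolding bilinear_cochain_def
  proof (intro conjI ballI)
    fix a assume a: "a \<in> carrier A"
    show "linear_in A (\<lambda>x. h a x \<oplus> k a x)" "linear_in A (\<lambda>x. h x a \<oplus> k x a)"
      by (intro linear_in_add; use h(2) k(2) a in \<open>simp add: bilinear_cochain_def\<close>)+
  next
    fix B C assume BC: "B \<in> bornology A" "C \<in> bornology A"
    have "{h b c | b c. b \<in> B \<and> c \<in> C} \<in> bornology A" "{k b c | b c. b \<in> B \<and> c \<in> C} \<in> bornology A"
      using h(2) k(2) BC unfolding bilinear_cochain_def by blast+
    then show "{h b c \<oplus> k b c | b c. b \<in> B \<and> c \<in> C} \<in> bornology A" by (rule born_subset[OF born_add]) blast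
  qed
  have "restrict (\<lambda>t. f t \<oplus> g t) (cube A) = hoch_d2 A (\<lambda>a b. h a b \<oplus> k a b)"
  proof (rule extensionalityI[of _ "cube A"])
    fix t assume t: "t \<in> cube A"
    then obtain a b c where abc: "t = (a, b, c)" "a \<in> carrier A" "b \<in> carrier A" "c \<in> carrier A"
      by (auto simp: cube_def)
    have v: "h x y \<in> carrier A" "k x y \<in> carrier A" if "x \<in> carrier A" "y \<in> carrier A" for x y
      using cochain_value h(2) k(2) that by auto
    show "restrict (\<lambda>t. f t \<oplus> g t) (cube A) t = hoch_d2 A (\<lambda>a b. h a b \<oplus> k a b) t"
      using t v[of b c] v[of "a \<otimes> b" c] v[of a "b \<otimes> c"] v[of a b] abc(2-4)
      unfolding h(1) k(1) hoch_d2_def abc(1)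
      by (simp add: alternating_sum_add l_distr r_distr)
  qed (auto simp: hoch_d2_def)
  then show "restrict (\<lambda>t. f t \<oplus> g t) (cube A) \<in> harr_B3 A"
    unfolding harr_B3_def
    by (intro CollectI exI[of _ "\<lambda>a b. h a b \<oplus> k a b"] conjI bc ballI arg_cong2[where f = "add A"])
      (assumption | rule h(3)[rule_format] k(3)[rule_format])+
next
  fix f assume "f \<in> harr_B3 A"
  then obtain h where h: "f = hoch_d2 A h" "bilinear_cochain A h" "\<forall>a\<in>carrier A. \<forall>b\<in>carrier A. h a b = h b a"
    unfolding harr_B3_def by blast
  have bc: "bilinear_cochain A (\<lambda>a b. \<ominus> h a b)"
    unfolding bilinear_cochain_def
  proof (intro conjI ballI)
    fix a assume a: "a \<in> carrier A"
    show "linear_in A (\<lambda>x. \<ominus> h a x)" "linear_in A (\<lambda>x. \<ominus> h x a)"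
      by (intro linear_in_neg; use h(2) a in \<open>simp add: bilinear_cochain_def\<close>)+
  next
    fix B C assume BC: "B \<in> bornology A" "C \<in> bornology A"
    have "{h b c | b c. b \<in> B \<and> c \<in> C} \<in> bornology A"
      using h(2) BC unfolding bilinear_cochain_def by blast
    then show "{\<ominus> h b c | b c. b \<in> B \<and> c \<in> C} \<in> bornology A" by (rule born_subset[OF born_neg]) blast
  qed
  have "restrict (\<lambda>t. \<ominus> f t) (cube A) = hoch_d2 A (\<lambda>a b. \<ominus> h a b)"
  proof (rule extensionalityI[of _ "cube A"])
    fix t assume t: "t \<in> cube A"
    then obtain a b c where abc: "t = (a, b, c)" "a \<in> carrier A" "b \<in> carrier A" "c \<in> carrier A"
      by (auto simp: cube_def)
    have v: "h x y \<in> carrier A" if "x \<in> carrier A" "y \<in> carrier A" for x y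
      using cochain_value h(2) that by auto
    show "restrict (\<lambda>t. \<ominus> f t) (cube A) t = hoch_d2 A (\<lambda>a b. \<ominus> h a b) t"
      using t v[of b c] v[of "a \<otimes> b" c] v[of a "b \<otimes> c"] v[of a b] abc(2-4)
      unfolding h(1) hoch_d2_def abc(1)
      by (simp add: alternating_sum_neg l_minus r_minus)
  qed (auto simp: hoch_d2_def)
  then show "restrict (\<lambda>t. \<ominus> f t) (cube A) \<in> harr_B3 A"
    unfolding harr_B3_def
    by (intro CollectI exI[of _ "\<lambda>a b. \<ominus> h a b"] conjI bc ballI arg_cong[where f = "a_inv A"])
      (assumption | rule h(3)[rule_format])+
qed

lemma harr_mult: "mult (harr_Z3 A) f g = restrict (\<lambda>t. f t \<oplus> g t) (cube A)"
  by (simp add: harr_Z3_def)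

lemma Harr3_one: "one (Harr3 A) = harr_B3 A"
  by (simp add: Harr3_def FactGroup_def)

text \<open>A homomorphism is controlled on the carrier only, so the neutral element has to be
  exhibited there: it is the coset of the zero cochain, which is a Harrison cocycle.\<close>

lemma Harr3_one_closed: "harr_B3 A \<in> carrier (Harr3 A)"
proof -
  let ?z = "restrict (\<lambda>t. \<zero>) (cube A)"
  have "trilinear_cochain A ?z"
    unfolding trilinear_cochain_def
  proof (intro conjI ballI)
    fix a b assume ab: "a \<in> carrier A" "b \<in> carrier A"
    show "linear_in A (\<lambda>x. ?z (x, a, b))" "linear_in A (\<lambda>x. ?z (a, x, b))" "linear_in A (\<lambda>x. ?z (a, b, x))"
      using ab smult_closed smult_zero by (auto simp: linear_in_def cube_def)
  next
    fix B C D assume B: "B \<in> bornology A" "C \<in> bornology A" "D \<in> bornology A"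
    show "{?z (b, c, d) | b c d. b \<in> B \<and> c \<in> C \<and> d \<in> D} \<in> bornology A"
      by (rule born_subset[OF born_zero]) (use born_carrier[OF B(1)] born_carrier[OF B(2)] born_carrier[OF B(3)] in \<open>auto simp: cube_def\<close>)
  qed simp
  moreover have "harr_e1 A ?z = ?z"
    by (rule ext) (auto simp: harr_e1_def restrict_def cube_def smult_zero a_minus_def)
  moreover have "hoch_d3_zero A ?z"
    by (simp add: hoch_d3_zero_def cube_def a_minus_def)
  ultimately have "?z \<in> carrier (harr_Z3 A)" by (simp add: harr_Z3_def)
  moreover have "harr_B3 A #>\<^bsub>harr_Z3 A\<^esub> ?z = harr_B3 A"
    by (rule pointwise_coset[OF harr_B3_subgroup harr_mult]) (use harr_B3_subgroup in \<open>simp add: pointwise_subgroup_def\<close>)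
  ultimately show ?thesis by (auto simp: Harr3_def FactGroup_def RCOSETS_def)
qed

lemma harrison_obstruction_zero:
  assumes "harr_e1 A (gerstenhaber_square A q) \<in> harr_B3 A"
  shows "harrison_obstruction A q = one (Harr3 A)"
  unfolding harrison_obstruction_def Harr3_one
  by (rule pointwise_coset[OF harr_B3_subgroup harr_mult assms])

lemma Harr3_one_idem: "mult (Harr3 A) (harr_B3 A) (harr_B3 A) = harr_B3 A"
  unfolding Harr3_def FactGroup_def by (simp add: pointwise_set_mult[OF harr_B3_subgroup harr_mult])

end

section \<open>Stalks as commutative algebras with bounded sets\<close>

context
  fixes X :: "(complex^'n) set" and x :: "complex^'n"
  assumes X: "openX X X" and x: "x \<in> X"
begin

lemma germ_eqI:
  assumes "openX X V" "x \<in> V" "\<And>z. z \<in> V \<Longrightarrow> f z = g z"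
  shows "germ X x f = germ X x g"
proof -
  have *: "germ X x f \<subseteq> germ X x g" if "\<And>z. z \<in> V \<Longrightarrow> f z = g z" for f g
  proof
    fix h assume "h \<in> germ X x f"
    then obtain W where W: "openX X W" "x \<in> W" "\<And>z. z \<in> W \<Longrightarrow> h z = f z" unfolding germ_def by blast
    show "h \<in> germ X x g"
      unfolding germ_def
      by (intro CollectI exI[of _ "V \<inter> W"] conjI openX_Int assms W ballI) (use W(2) assms(2) that W(3) in auto)
  qed
  show ?thesis by (intro equalityI *) (simp_all add: assms(3))
qed

lemma germ_self: "f \<in> germ X x f"
  unfolding germ_def using X x by blast

lemma germ_memE:
  assumes "f \<in> germ X x g"
  obtains V where "openX X V" "x \<in> V" "\<forall>z\<in>V. f z = g z"
  using assms unfolding germ_def by blast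

lemma germ_restr: "openX X V \<Longrightarrow> x \<in> V \<Longrightarrow> germ X x (restr V f) = germ X x f"
  by (rule germ_eqI[of V]) (simp_all add: restr_apply)

text \<open>The operations of a stalk are unions over all representatives. When the result does not
  depend on the representative, the union collapses to a single set.\<close>

lemma germ_UN1:
  assumes "\<And>f' V. openX X V \<Longrightarrow> x \<in> V \<Longrightarrow> \<forall>z\<in>V. f' z = f z \<Longrightarrow> G f' = G f"
  shows "(\<Union>f'\<in>germ X x f. G f') = G f"
proof -
  have "(\<Union>f'\<in>germ X x f. G f') = (\<Union>f'\<in>germ X x f. G f)"
    by (rule SUP_cong[OF refl], erule germ_memE, rule assms)
  then show ?thesis using germ_self by auto
qed

lemma stalk_mult: "mult (stalk X x) (germ X x f) (germ X x g) = germ X x (\<lambda>z. f z * g z)"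
proof -
  have "(\<Union>f'\<in>germ X x f. \<Union>g'\<in>germ X x g. germ X x (\<lambda>z. f' z * g' z)) = (\<Union>f'\<in>germ X x f. germ X x (\<lambda>z. f' z * g z))"
    by (intro SUP_cong[OF refl] germ_UN1) (rule germ_eqI, assumption, assumption, simp only:)
  also have "\<dots> = germ X x (\<lambda>z. f z * g z)"
    by (intro germ_UN1) (rule germ_eqI, assumption, assumption, simp only:)
  finally show ?thesis by (simp add: stalk_def)
qed

lemma stalk_add: "add (stalk X x) (germ X x f) (germ X x g) = germ X x (\<lambda>z. f z + g z)"
proof -
  have "(\<Union>f'\<in>germ X x f. \<Union>g'\<in>germ X x g. germ X x (\<lambda>z. f' z + g' z)) = (\<Union>f'\<in>germ X x f. germ X x (\<lambda>z. f' z + g z))"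
    by (intro SUP_cong[OF refl] germ_UN1) (rule germ_eqI, assumption, assumption, simp only:)
  also have "\<dots> = germ X x (\<lambda>z. f z + g z)"
    by (intro germ_UN1) (rule germ_eqI, assumption, assumption, simp only:)
  finally show ?thesis by (simp add: stalk_def)
qed

lemma stalk_smult: "smult (stalk X x) t (germ X x f) = germ X x (\<lambda>z. t * f z)"
proof -
  have "(\<Union>f'\<in>germ X x f. germ X x (\<lambda>z. t * f' z)) = germ X x (\<lambda>z. t * f z)"
    by (intro germ_UN1) (rule germ_eqI, assumption, assumption, simp only:)
  then show ?thesis by (simp add: stalk_def)
qed

lemma stalk_zero: "zero (stalk X x) = germ X x (\<lambda>z. 0)"
  and stalk_one: "one (stalk X x) = germ X x (\<lambda>z. 1)"
  by (simp_all add: stalk_def)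

lemma stalk_germ: "openX X U \<Longrightarrow> x \<in> U \<Longrightarrow> f \<in> sections U \<Longrightarrow> germ X x f \<in> carrier (stalk X x)"
  by (auto simp: stalk_def)

lemma stalk_rep:
  assumes S: "openX X S" "x \<in> S" and a: "a \<in> carrier (stalk X x)"
  obtains U f where "openX X U" "x \<in> U" "U \<subseteq> S" "f \<in> sections U" "a = germ X x f"
proof -
  obtain V f where V: "openX X V" "x \<in> V" "f \<in> sections V" "a = germ X x f"
    using a by (auto simp: stalk_def)
  have o: "openX X (V \<inter> S)" "x \<in> V \<inter> S" using openX_Int[OF V(1) S(1)] V(2) S(2) by auto
  show ?thesis
    by (rule that[OF o _ sections_restr[OF V(3) _ openX_conic[OF o(1)]]]) (simp_all add: germ_restr[OF o] V(4))
qed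

text \<open>Identities between germs are reduced in this way to identities between sections over one
  open set; \<open>S\<close> makes room for the domain of a local solution.\<close>

lemma stalk_rep3:
  assumes S: "openX X S" "x \<in> S"
    and a: "a \<in> carrier (stalk X x)" and b: "b \<in> carrier (stalk X x)" and c: "c \<in> carrier (stalk X x)"
  obtains U f g h where "openX X U" "x \<in> U" "U \<subseteq> S"
    "f \<in> sections U" "g \<in> sections U" "h \<in> sections U" "a = germ X x f" "b = germ X x g" "c = germ X x h"
proof -
  obtain V f where V: "openX X V" "x \<in> V" "V \<subseteq> S" "f \<in> sections V" "a = germ X x f"
    by (rule stalk_rep[OF S a])
  obtain W g where W: "openX X W" "x \<in> W" "W \<subseteq> V" "g \<in> sections W" "b = germ X x g"
    by (rule stalk_rep[OF V(1,2) b])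
  obtain U h where U: "openX X U" "x \<in> U" "U \<subseteq> W" "h \<in> sections U" "c = germ X x h"
    by (rule stalk_rep[OF W(1,2) c])
  have s: "restr U f \<in> sections U" "restr U g \<in> sections U"
    using sections_restr[OF V(4) _ openX_conic[OF U(1)]] sections_restr[OF W(4) U(3) openX_conic[OF U(1)]] U(3) W(3)
    by auto
  show ?thesis
    by (rule that[OF U(1,2) _ s U(4)]) (use U W V in \<open>simp_all add: germ_restr\<close>)
qed

text \<open>The constant 1 has to be cut off outside \<open>X\<close> to be a section; its germ
  stays the same.\<close>

lemma section_one: "restr X (\<lambda>_. 1) \<in> sections X"
proof (rule sectionsI)
  show "restr X (\<lambda>_. 1) z = 0" if "z \<notin> X" for z using that by (simp add: restr_def)
  show "\<exists>A. local_rep X (restr X (\<lambda>_. 1)) z A" for z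
    using local_rep_restr[OF local_rep_const] by blast
  show "homogeneous0_on X (restr X (\<lambda>_. 1))"
    using openX_conic[OF X] by (auto simp: homogeneous0_on_def restr_def conic_def)
qed

lemma stalk_closed:
  assumes "a \<in> carrier (stalk X x)" "b \<in> carrier (stalk X x)"
  shows "mult (stalk X x) a b \<in> carrier (stalk X x)" "add (stalk X x) a b \<in> carrier (stalk X x)"
    "smult (stalk X x) t a \<in> carrier (stalk X x)"
proof -
  obtain U f g where U: "openX X U" "x \<in> U" and s: "f \<in> sections U" "g \<in> sections U"
    and e: "a = germ X x f" "b = germ X x g"
    by (rule stalk_rep3[OF X x assms assms(2)])
  show "mult (stalk X x) a b \<in> carrier (stalk X x)" "add (stalk X x) a b \<in> carrier (stalk X x)"
    "smult (stalk X x) t a \<in> carrier (stalk X x)"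
    unfolding e stalk_mult stalk_add stalk_smult
    by (intro stalk_germ[OF U] sections_mult sections_add sections_scale s)+
qed

lemma stalk_units: "zero (stalk X x) \<in> carrier (stalk X x)" "one (stalk X x) \<in> carrier (stalk X x)"
proof -
  show "zero (stalk X x) \<in> carrier (stalk X x)" unfolding stalk_zero by (rule stalk_germ[OF X x sections_zero])
  show "one (stalk X x) \<in> carrier (stalk X x)"
    unfolding stalk_one using stalk_germ[OF X x section_one] by (simp add: germ_restr[OF X x])
qed

lemmas stalk_ops = stalk_mult stalk_add stalk_smult stalk_zero stalk_one

lemma stalk_cring: "cring (stalk X x)"
proof (rule cringI)
  show "abelian_group (stalk X x)"
  proof (rule abelian_groupI)
    fix a b c
    assume a: "a \<in> carrier (stalk X x)" and b: "b \<in> carrier (stalk X x)" and c: "c \<in> carrier (stalk X x)"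
    obtain U f g h where U: "openX X U" "x \<in> U" and s: "f \<in> sections U"
      and e: "a = germ X x f" "b = germ X x g" "c = germ X x h"
      by (rule stalk_rep3[OF X x a b c])
    show "add (stalk X x) (add (stalk X x) a b) c = add (stalk X x) a (add (stalk X x) b c)"
      unfolding e stalk_ops by (simp add: algebra_simps)
  next
    fix a b
    assume a: "a \<in> carrier (stalk X x)" and b: "b \<in> carrier (stalk X x)"
    obtain U f g where e: "a = germ X x f" "b = germ X x g"
      by (rule stalk_rep3[OF X x a b b])
    show "add (stalk X x) a b = add (stalk X x) b a"
      unfolding e stalk_ops by (simp add: algebra_simps)
  next
    fix a assume a: "a \<in> carrier (stalk X x)"
    obtain U f where U: "openX X U" "x \<in> U" and s: "f \<in> sections U" and e: "a = germ X x f"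
      by (rule stalk_rep[OF X x a])
    show "add (stalk X x) (zero (stalk X x)) a = a"
      unfolding e stalk_ops by simp
    show "\<exists>b\<in>carrier (stalk X x). add (stalk X x) b a = zero (stalk X x)"
      by (intro bexI[OF _ stalk_germ[OF U sections_uminus[OF s]]]) (simp add: e stalk_ops)
  qed (auto intro: stalk_closed stalk_units)
next
  show "Group.comm_monoid (stalk X x)"
  proof (rule comm_monoidI)
    fix a b c
    assume a: "a \<in> carrier (stalk X x)" and b: "b \<in> carrier (stalk X x)" and c: "c \<in> carrier (stalk X x)"
    obtain U f g h where e: "a = germ X x f" "b = germ X x g" "c = germ X x h"
      by (rule stalk_rep3[OF X x a b c])
    show "mult (stalk X x) (mult (stalk X x) a b) c = mult (stalk X x) a (mult (stalk X x) b c)"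
      unfolding e stalk_ops by (simp add: algebra_simps)
  next
    fix a b
    assume a: "a \<in> carrier (stalk X x)" and b: "b \<in> carrier (stalk X x)"
    obtain U f g where e: "a = germ X x f" "b = germ X x g"
      by (rule stalk_rep3[OF X x a b b])
    show "mult (stalk X x) a b = mult (stalk X x) b a"
      unfolding e stalk_ops by (simp add: algebra_simps)
  next
    fix a assume a: "a \<in> carrier (stalk X x)"
    obtain U f where e: "a = germ X x f"
      by (rule stalk_rep[OF X x a])
    show "mult (stalk X x) (one (stalk X x)) a = a"
      unfolding e stalk_ops by simp
  qed (auto intro: stalk_closed stalk_units)
next
  fix a b c
  assume a: "a \<in> carrier (stalk X x)" and b: "b \<in> carrier (stalk X x)" and c: "c \<in> carrier (stalk X x)"
  obtain U f g h where e: "a = germ X x f" "b = germ X x g" "c = germ X x h"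
    by (rule stalk_rep3[OF X x a b c])
  show "mult (stalk X x) (add (stalk X x) a b) c = add (stalk X x) (mult (stalk X x) a c) (mult (stalk X x) b c)"
    unfolding e stalk_ops by (simp add: algebra_simps)
qed

lemma stalk_uminus:
  assumes "openX X U" "x \<in> U" "f \<in> sections U"
  shows "a_inv (stalk X x) (germ X x f) = germ X x (\<lambda>z. - f z)"
proof -
  interpret cring "stalk X x" by (rule stalk_cring)
  show ?thesis
    by (rule minus_equality) (simp_all add: stalk_add stalk_zero stalk_germ[OF assms(1,2)] sections_uminus assms(3))
qed

lemma stalk_diff:
  assumes "openX X U" "x \<in> U" "f \<in> sections U" "g \<in> sections U"
  shows "a_minus (stalk X x) (germ X x f) (germ X x g) = germ X x (\<lambda>z. f z - g z)"
  by (simp add: a_minus_def stalk_uminus[OF assms(1,2,4)] stalk_add)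

lemma stalk_bornI:
  assumes "openX X U" "x \<in> U" "B \<subseteq> sections U" "\<forall>f\<in>B. \<forall>z\<in>U. cmod (f z) \<le> M" "C \<subseteq> germ X x ` B"
  shows "C \<in> bornology (stalk X x)"
proof -
  obtain D where D: "D \<subseteq> B" "C = germ X x ` D" using assms(5) by (auto simp: subset_image_iff)
  have "D \<subseteq> sections U" "\<forall>f\<in>D. \<forall>z\<in>U. cmod (f z) \<le> M" using D(1) assms(3,4) by blast+
  then show ?thesis unfolding stalk_def D(2) using assms(1,2) by auto
qed

lemma stalk_bornE:
  assumes "C \<in> bornology (stalk X x)"
  obtains U B M where "openX X U" "x \<in> U" "B \<subseteq> sections U" "\<forall>f\<in>B. \<forall>z\<in>U. cmod (f z) \<le> M" "C = germ X x ` B"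
  using assms unfolding stalk_def by auto

lemma stalk_bornE2:
  assumes "B \<in> bornology (stalk X x)" "C \<in> bornology (stalk X x)" "openX X S" "x \<in> S"
  obtains U B' C' M N where "openX X U" "x \<in> U" "U \<subseteq> S" "B' \<subseteq> sections U" "C' \<subseteq> sections U"
    "\<forall>f\<in>B'. \<forall>z\<in>U. cmod (f z) \<le> M" "\<forall>f\<in>C'. \<forall>z\<in>U. cmod (f z) \<le> N"
    "B = germ X x ` B'" "C = germ X x ` C'"
proof -
  obtain U B' M where U: "openX X U" "x \<in> U" "B' \<subseteq> sections U" "\<forall>f\<in>B'. \<forall>z\<in>U. cmod (f z) \<le> M" "B = germ X x ` B'"
    by (rule stalk_bornE[OF assms(1)])
  obtain V C' N where V: "openX X V" "x \<in> V" "C' \<subseteq> sections V" "\<forall>f\<in>C'. \<forall>z\<in>V. cmod (f z) \<le> N" "C = germ X x ` C'"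
    by (rule stalk_bornE[OF assms(2)])
  let ?W = "U \<inter> V \<inter> S"
  have W: "openX X ?W" "x \<in> ?W" using openX_Int[OF openX_Int[OF U(1) V(1)] assms(3)] U(2) V(2) assms(4) by auto
  show ?thesis
  proof (rule that[OF W])
    show "restr ?W ` B' \<subseteq> sections ?W" "restr ?W ` C' \<subseteq> sections ?W"
      using U(3) V(3) by (auto intro!: sections_restr[OF _ _ openX_conic[OF W(1)]])
    show "\<forall>f\<in>restr ?W ` B'. \<forall>z\<in>?W. cmod (f z) \<le> M"
      using U(4) by (auto simp: restr_apply)
    show "\<forall>f\<in>restr ?W ` C'. \<forall>z\<in>?W. cmod (f z) \<le> N"
      using V(4) by (auto simp: restr_apply)
    show "B = germ X x ` restr ?W ` B'" "C = germ X x ` restr ?W ` C'"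
      unfolding U(5) V(5) image_image germ_restr[OF W] by (rule refl)+
  qed blast
qed

lemma stalk_born_cring: "born_cring (stalk X x)"
proof -
  interpret cring "stalk X x" by (rule stalk_cring)
  show ?thesis
  proof unfold_locales
    show "smult (stalk X x) t a \<in> carrier (stalk X x)" if "a \<in> carrier (stalk X x)" for a t
      using stalk_closed(3)[OF that that] .
  next
    fix a b t assume a: "a \<in> carrier (stalk X x)" and b: "b \<in> carrier (stalk X x)"
    obtain U f g where e: "a = germ X x f" "b = germ X x g"
      by (rule stalk_rep3[OF X x a b b])
    show "smult (stalk X x) t (add (stalk X x) a b) = add (stalk X x) (smult (stalk X x) t a) (smult (stalk X x) t b)"
      unfolding e stalk_ops by (simp add: algebra_simps)
  next
    fix B C assume B: "B \<in> bornology (stalk X x)" and C: "C \<subseteq> B"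
    obtain U B' M where U: "openX X U" "x \<in> U" "B' \<subseteq> sections U" "\<forall>f\<in>B'. \<forall>z\<in>U. cmod (f z) \<le> M" "B = germ X x ` B'"
      by (rule stalk_bornE[OF B])
    show "C \<in> bornology (stalk X x)" by (rule stalk_bornI[OF U(1-4)]) (use C U(5) in simp)
  next
    fix B assume B: "B \<in> bornology (stalk X x)"
    obtain U B' M where U: "openX X U" "x \<in> U" "B' \<subseteq> sections U" "\<forall>f\<in>B'. \<forall>z\<in>U. cmod (f z) \<le> M" "B = germ X x ` B'"
      by (rule stalk_bornE[OF B])
    show "B \<subseteq> carrier (stalk X x)" unfolding U(5) using stalk_germ[OF U(1,2)] U(3) by blast
    show "{a_inv (stalk X x) b | b. b \<in> B} \<in> bornology (stalk X x)"
    proof (rule stalk_bornI[OF U(1,2), of "(\<lambda>f z. - f z) ` B'" M])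
      show "(\<lambda>f z. - f z) ` B' \<subseteq> sections U" using U(3) sections_uminus by blast
      show "\<forall>f\<in>(\<lambda>f z. - f z) ` B'. \<forall>z\<in>U. cmod (f z) \<le> M" using U(4) by auto
      have "a_inv (stalk X x) (germ X x f) = germ X x (\<lambda>z. - f z)" if "f \<in> B'" for f
        using stalk_uminus[OF U(1,2)] U(3) that by blast
      then show "{a_inv (stalk X x) b | b. b \<in> B} \<subseteq> germ X x ` (\<lambda>f z. - f z) ` B'" unfolding U(5) by auto
    qed
  next
    show "{zero (stalk X x)} \<in> bornology (stalk X x)"
      by (rule stalk_bornI[OF X x, of "{\<lambda>z. 0}" 0]) (simp_all add: sections_zero stalk_zero)
  next
    fix B C assume BC: "B \<in> bornology (stalk X x)" "C \<in> bornology (stalk X x)"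
    obtain U B' C' M N where U: "openX X U" "x \<in> U" and s: "B' \<subseteq> sections U" "C' \<subseteq> sections U"
      and M: "\<forall>f\<in>B'. \<forall>z\<in>U. cmod (f z) \<le> M" and N: "\<forall>f\<in>C'. \<forall>z\<in>U. cmod (f z) \<le> N"
      and e: "B = germ X x ` B'" "C = germ X x ` C'"
      by (rule stalk_bornE2[OF BC X x])
    let ?D = "(\<lambda>(f, g) z. f z + g z) ` (B' \<times> C')"
    show "{add (stalk X x) b c | b c. b \<in> B \<and> c \<in> C} \<in> bornology (stalk X x)"
    proof (rule stalk_bornI[OF U, of ?D "M + N"])
      show "?D \<subseteq> sections U" using s by (auto intro!: sections_add)
      show "\<forall>f\<in>?D. \<forall>z\<in>U. cmod (f z) \<le> M + N"
        using M N by (auto intro!: order_trans[OF norm_triangle_ineq] add_mono)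
      show "{add (stalk X x) b c | b c. b \<in> B \<and> c \<in> C} \<subseteq> germ X x ` ?D"
      proof clarify
        fix b c assume "b \<in> B" "c \<in> C"
        then obtain f g where "f \<in> B'" "g \<in> C'" "b = germ X x f" "c = germ X x g" unfolding e by blast
        then show "add (stalk X x) b c \<in> germ X x ` ?D"
          by (intro image_eqI[OF _ imageI[of "(f, g)"]]) (simp_all add: stalk_add)
      qed
    qed
  qed
qed

end

text \<open>The equation of a local solution concerns only sections over subsets of
  \<open>S\<close>, a restriction absent from \<open>stalk_map\<close>; for \<open>S = X\<close> the
  two maps agree by \<open>stalk_map_local\<close>.\<close>

definition local_stalk_map :: "(complex^'n) set \<Rightarrow> (complex^'n) set \<Rightarrow> 'n sheaf_map \<Rightarrow> complex^'n \<Rightarrow>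
    (complex^'n \<Rightarrow> complex) set \<Rightarrow> (complex^'n \<Rightarrow> complex) set \<Rightarrow> (complex^'n \<Rightarrow> complex) set" where
  "local_stalk_map X S q x a b = \<Union> {germ X x (q U f g) | U f g.
     openX X U \<and> x \<in> U \<and> U \<subseteq> S \<and> f \<in> sections U \<inter> a \<and> g \<in> sections U \<inter> b}"

lemma stalk_map_local: "stalk_map X q x = local_stalk_map X X q x"
proof -
  have "openX X U \<and> P \<longleftrightarrow> openX X U \<and> U \<subseteq> X \<and> P" for U P using openX_subset[of X U] by auto
  then show ?thesis unfolding stalk_map_def local_stalk_map_def fun_eq_iff
    by (simp add: conj_left_commute)
qed

context
  fixes X :: "(complex^'n) set" and x :: "complex^'n"
  assumes X: "openX X X" and x: "x \<in> X"
begin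

text \<open>Two choices of representatives coincide near \<open>x\<close>, and compatibility with
  restriction carries this over to the values of \<open>q\<close>; the union in the definition is
  then over a single germ.\<close>

lemma local_stalk_map_germ:
  assumes q: "bilinear_map_on X S q" and U: "openX X U" "x \<in> U" "U \<subseteq> S"
    and f: "f \<in> sections U" and g: "g \<in> sections U"
  shows "local_stalk_map X S q x (germ X x f) (germ X x g) = germ X x (q U f g)"
proof -
  have eq: "germ X x (q V f' g') = germ X x (q U f g)"
    if V: "openX X V" "x \<in> V" "V \<subseteq> S" and f': "f' \<in> sections V" "f' \<in> germ X x f"
      and g': "g' \<in> sections V" "g' \<in> germ X x g" for V f' g'
  proof -
    obtain V1 where V1: "openX X V1" "x \<in> V1" "\<forall>z\<in>V1. f' z = f z" by (rule germ_memE[OF X x f'(2)])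
    obtain V2 where V2: "openX X V2" "x \<in> V2" "\<forall>z\<in>V2. g' z = g z" by (rule germ_memE[OF X x g'(2)])
    define W where "W = U \<inter> V \<inter> (V1 \<inter> V2)"
    have W: "openX X W" "x \<in> W" "W \<subseteq> U" "W \<subseteq> V"
      unfolding W_def by (intro openX_Int U V(1) V1(1) V2(1)) (use U(2) V(2) V1(2) V2(2) in auto)
    have r: "restr W f' = restr W f" "restr W g' = restr W g"
      using V1(3) V2(3) by (auto simp: restr_def W_def fun_eq_iff)
    have "germ X x (q V f' g') = germ X x (restr W (q V f' g'))" by (rule germ_restr[OF X x W(1,2), symmetric])
    also have "restr W (q V f' g') = q W (restr W f) (restr W g)"
      unfolding r[symmetric] by (rule bilinear_map_onD(2)[OF q V(1,3) f'(1) g'(1) W(1,4), symmetric])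
    also have "\<dots> = restr W (q U f g)" by (rule bilinear_map_onD(2)[OF q U(1,3) f g W(1,3)])
    also have "germ X x \<dots> = germ X x (q U f g)" by (rule germ_restr[OF X x W(1,2)])
    finally show ?thesis .
  qed
  have "{germ X x (q V f' g') | V f' g'. openX X V \<and> x \<in> V \<and> V \<subseteq> S \<and>
      f' \<in> sections V \<inter> germ X x f \<and> g' \<in> sections V \<inter> germ X x g} = {germ X x (q U f g)}" (is "?L = ?R")
  proof (intro equalityI subsetI)
    fix y assume "y \<in> ?L"
    then show "y \<in> ?R" using eq by auto
  next
    fix y assume y: "y \<in> ?R"
    show "y \<in> ?L"
      by (rule CollectI, rule exI[of _ U], rule exI[of _ f], rule exI[of _ g])
        (use y U f g germ_self[OF X x] in auto)
  qed
  then show ?thesis unfolding local_stalk_map_def by simp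
qed

end

section \<open>The Harrison class of the bracket at a point\<close>

context jacobian_variety
begin

text \<open>Bounded sets of sections are controlled on compact sets, bounded sets of germs on a
  whole conic neighbourhood. The points of \<open>X\<close> with a multiple in a small ball form
  such a neighbourhood, and a function homogeneous of degree 0 takes no value there that it does not
  take on \<open>K\<close>.\<close>

lemma conic_neighbourhood:
  assumes W: "openX X W" "x \<in> W"
  obtains K V where "compact K" "K \<subseteq> W" "openX X V" "x \<in> V" "V \<subseteq> W"
    "\<forall>z\<in>V. \<exists>c y. c \<noteq> 0 \<and> y \<in> K \<and> z = c *s y"
proof -
  obtain \<delta> where d: "\<delta> > 0" "compact (cball x \<delta> \<inter> X)" "cball x \<delta> \<inter> X \<subseteq> W"
    by (rule openX_cball[OF W])
  let ?T = "\<Union>c\<in>-{0}. (\<lambda>z. c *s z) -` ball x \<delta>"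
  have "open ?T"
    by (intro open_UN ballI open_vimage open_ball) (auto intro!: continuous_intros simp: vector_scalar_mult_def)
  moreover have T: "conic ?T"
    unfolding conic_def
  proof (intro ballI allI impI)
    fix z c assume z: "z \<in> ?T" and c: "c \<noteq> (0::complex)"
    then obtain d where d: "d \<noteq> 0" "d *s z \<in> ball x \<delta>" by auto
    then have "(d / c) *s (c *s z) \<in> ball x \<delta>" using c by (simp add: vector_smult_assoc)
    then show "c *s z \<in> ?T" using d c by (intro UN_I[of "d / c"]) auto
  qed
  ultimately have V: "openX X (X \<inter> ?T)"
    unfolding openX_def using conic_Int[OF X_conic T] by (auto intro: openin_open_Int)
  have rep: "\<forall>z\<in>X \<inter> ?T. \<exists>c y. c \<noteq> 0 \<and> y \<in> cball x \<delta> \<inter> X \<and> z = c *s y"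
  proof
    fix z assume z: "z \<in> X \<inter> ?T"
    obtain d where "d \<noteq> 0" "d *s z \<in> ball x \<delta>" using z by auto
    moreover have "d *s z \<in> X" using X_conic z \<open>d \<noteq> 0\<close> unfolding conic_def by blast
    ultimately show "\<exists>c y. c \<noteq> 0 \<and> y \<in> cball x \<delta> \<inter> X \<and> z = c *s y"
      by (intro exI[of _ "inverse d"] exI[of _ "d *s z"]) (simp_all add: vector_smult_assoc)
  qed
  show ?thesis
  proof (rule that[OF d(2,3) V _ _ rep])
    have "1 *s x \<in> ball x \<delta>" using d(1) by simp
    then show "x \<in> X \<inter> ?T" using openX_subset[OF W(1)] W(2) by (intro IntI UN_I[of 1]) auto
    show "X \<inter> ?T \<subseteq> W"
    proof
      fix z assume "z \<in> X \<inter> ?T"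
      from bspec[OF rep this] obtain c y where "c \<noteq> 0" "y \<in> cball x \<delta> \<inter> X" "z = c *s y" by blast
      then show "z \<in> W" using d(3) openX_conic[OF W(1)] unfolding conic_def by blast
    qed
  qed
qed

lemma local_stalk_map_cochain:
  assumes S: "openX X S" "x \<in> S" and q: "bilinear_map_on X S q"
  shows "bilinear_cochain (stalk X x) (local_stalk_map X S q x)"
proof -
  have x: "x \<in> X" using openX_subset[OF S(1)] S(2) by blast
  note ops = stalk_ops[OF openX_X x] and sg = stalk_germ[OF openX_X x]
  note lsm = local_stalk_map_germ[OF openX_X x q]
  show ?thesis
    unfolding bilinear_cochain_def
  proof (intro conjI ballI)
    fix c assume c: "c \<in> carrier (stalk X x)"
    show "linear_in (stalk X x) (local_stalk_map X S q x c)"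
      unfolding linear_in_def
    proof (intro ballI allI conjI)
      fix a b t assume a: "a \<in> carrier (stalk X x)" and b: "b \<in> carrier (stalk X x)"
      obtain U f g h where U: "openX X U" "x \<in> U" "U \<subseteq> S" and s: "f \<in> sections U" "g \<in> sections U" "h \<in> sections U"
        and e: "a = germ X x f" "b = germ X x g" "c = germ X x h"
        by (rule stalk_rep3[OF openX_X x S a b c])
      show "local_stalk_map X S q x c a \<in> carrier (stalk X x)"
        unfolding e lsm[OF U s(3,1)] by (rule sg[OF U(1,2) bilinear_map_onD(1)[OF q U(1,3) s(3,1)]])
      show "local_stalk_map X S q x c (add (stalk X x) (smult (stalk X x) t a) b)
        = add (stalk X x) (smult (stalk X x) t (local_stalk_map X S q x c a)) (local_stalk_map X S q x c b)"
        unfolding e ops lsm[OF U s(3,1)] lsm[OF U s(3,2)] lsm[OF U s(3) sections_lin[OF s(1,2)]]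
          bilinear_map_onD(4)[OF q U(1,3) s(1,3,2)] ..
    qed
    show "linear_in (stalk X x) (\<lambda>a. local_stalk_map X S q x a c)"
      unfolding linear_in_def
    proof (intro ballI allI conjI)
      fix a b t assume a: "a \<in> carrier (stalk X x)" and b: "b \<in> carrier (stalk X x)"
      obtain U f g h where U: "openX X U" "x \<in> U" "U \<subseteq> S" and s: "f \<in> sections U" "g \<in> sections U" "h \<in> sections U"
        and e: "a = germ X x f" "b = germ X x g" "c = germ X x h"
        by (rule stalk_rep3[OF openX_X x S a b c])
      show "local_stalk_map X S q x a c \<in> carrier (stalk X x)"
        unfolding e lsm[OF U s(1,3)] by (rule sg[OF U(1,2) bilinear_map_onD(1)[OF q U(1,3) s(1,3)]])
      show "local_stalk_map X S q x (add (stalk X x) (smult (stalk X x) t a) b) c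
        = add (stalk X x) (smult (stalk X x) t (local_stalk_map X S q x a c)) (local_stalk_map X S q x b c)"
        unfolding e ops lsm[OF U s(1,3)] lsm[OF U s(2,3)] lsm[OF U sections_lin[OF s(1,2)] s(3)]
          bilinear_map_onD(3)[OF q U(1,3) s(1,3,2)] ..
    qed
  next
    fix B C assume BC: "B \<in> bornology (stalk X x)" "C \<in> bornology (stalk X x)"
    obtain U B' C' M N where U: "openX X U" "x \<in> U" "U \<subseteq> S" and s: "B' \<subseteq> sections U" "C' \<subseteq> sections U"
      and M: "\<forall>f\<in>B'. \<forall>z\<in>U. cmod (f z) \<le> M" and N: "\<forall>f\<in>C'. \<forall>z\<in>U. cmod (f z) \<le> N"
      and e: "B = germ X x ` B'" "C = germ X x ` C'"
      by (rule stalk_bornE2[OF openX_X x BC S])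
    have "bounded_sections U B'" "bounded_sections U C'"
      unfolding bounded_sections_def using s M N by blast+
    note bd = bilinear_map_onD(5)[OF q U(1,3) this]
    obtain K V where K: "compact K" "K \<subseteq> U" and V: "openX X V" "x \<in> V" "V \<subseteq> U"
      and rep: "\<forall>z\<in>V. \<exists>c y. c \<noteq> 0 \<and> y \<in> K \<and> z = c *s y"
      by (rule conic_neighbourhood[OF U(1,2)])
    obtain L where L: "\<forall>h\<in>{q U a b | a b. a \<in> B' \<and> b \<in> C'}. \<forall>z\<in>K. cmod (h z) \<le> L"
      using bd K unfolding bounded_sections_def by blast
    let ?D = "restr V ` {q U a b | a b. a \<in> B' \<and> b \<in> C'}"
    show "{local_stalk_map X S q x b c | b c. b \<in> B \<and> c \<in> C} \<in> bornology (stalk X x)"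
    proof (rule stalk_bornI[OF openX_X x V(1,2), of ?D L])
      have "{q U a b | a b. a \<in> B' \<and> b \<in> C'} \<subseteq> sections U" using bd unfolding bounded_sections_def by blast
      then show "?D \<subseteq> sections V" by (auto intro!: sections_restr[OF _ V(3) openX_conic[OF V(1)]])
      show "\<forall>f\<in>?D. \<forall>z\<in>V. cmod (f z) \<le> L"
      proof (intro ballI)
        fix f z assume "f \<in> ?D" and z: "z \<in> V"
        then obtain a b where ab: "f = restr V (q U a b)" "a \<in> B'" "b \<in> C'" by blast
        obtain c y where cy: "c \<noteq> 0" "y \<in> K" "z = c *s y" using bspec[OF rep z] by blast
        \<comment> \<open>Homogeneity of degree 0 transfers the bound from the point
          \<open>y\<close> of \<open>K\<close> to its multiple \<open>z\<close>.\<close>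
        have "homogeneous0_on U (q U a b)"
          by (rule sections_hom[OF bilinear_map_onD(1)[OF q U(1,3) subsetD[OF s(1) ab(2)] subsetD[OF s(2) ab(3)]]])
        then have "f z = q U a b y" using z cy K(2) unfolding homogeneous0_on_def ab(1) by (auto simp: restr_apply)
        then show "cmod (f z) \<le> L" using L ab(2,3) cy(2) by auto
      qed
      show "{local_stalk_map X S q x b c | b c. b \<in> B \<and> c \<in> C} \<subseteq> germ X x ` ?D"
      proof clarify
        fix b c assume "b \<in> B" "c \<in> C"
        then obtain f g where fg: "f \<in> B'" "g \<in> C'" "b = germ X x f" "c = germ X x g" unfolding e by blast
        have "local_stalk_map X S q x b c = germ X x (restr V (q U f g))"
          unfolding fg(3,4) germ_restr[OF openX_X x V(1,2)] by (rule lsm[OF U subsetD[OF s(1) fg(1)] subsetD[OF s(2) fg(2)]])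
        then show "local_stalk_map X S q x b c \<in> germ X x ` ?D"
          using fg(1,2) by blast
      qed
    qed
  qed
qed

lemma stalk_bracket:
  assumes "x \<in> X" "openX X U" "x \<in> U" "f \<in> sections U" "g \<in> sections U"
  shows "stalk_map X P x (germ X x f) (germ X x g) = germ X x (P U f g)"
  unfolding stalk_map_local
  by (rule local_stalk_map_germ[OF openX_X assms(1) bracket_bilinear assms(2,3) openX_subset[OF assms(2)] assms(4,5)])

text \<open>The inner sign is moved outside by linearity with the scalar -1 and the zero section as
  second summand; linearity applied to the zero section alone shows that this summand contributes
  nothing.\<close>

lemma bracket_flip:
  assumes U: "openX X U" and a: "a \<in> sections U" and b: "b \<in> sections U" and c: "c \<in> sections U"
  shows "P U (P U a b) c z = - P U (P U b a) c z"
  unfolding bracket_skew[OF U a b]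
  using fun_cong[OF bracket_lin[OF U bracket_sections[OF U b a] sections_zero c, of "-1"], of z]
    fun_cong[OF bracket_lin[OF U sections_zero sections_zero c, of "-1"], of z] by simp

text \<open>In this form \<open>[p,p]\<close> is visibly fixed by \<open>e\<^sub>1\<close>.\<close>

lemma bracket_square:
  assumes U: "openX X U" and a: "a \<in> sections U" and b: "b \<in> sections U" and c: "c \<in> sections U"
  shows "P U (P U a b) c z - P U a (P U b c) z = P U (P U a c) b z"
  using jacobi[OF U a b c, of z] bracket_flip[OF U c a b, of z]
    fun_cong[OF bracket_skew[OF U a bracket_sections[OF U b c]], of z] by simp

text \<open>Both sides are the germ of the bracket of \<open>P U f h\<close> with \<open>g\<close>:
  the left one because the projector does not change it, the right one by the equation of the local
  solution.\<close>

lemma stalk_obstruction: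
  assumes S: "openX X S" "x \<in> S" and q: "local_solution X P S q"
  shows "harr_e1 (stalk X x) (gerstenhaber_square (stalk X x) (stalk_map X P x))
    = hoch_d2 (stalk X x) (local_stalk_map X S q x)"
proof (rule extensionalityI[of _ "cube (stalk X x)"])
  fix t assume t: "t \<in> cube (stalk X x)"
  then obtain a b c where abc: "t = (a, b, c)" and a: "a \<in> carrier (stalk X x)"
    and b: "b \<in> carrier (stalk X x)" and c: "c \<in> carrier (stalk X x)"
    by (auto simp: cube_def)
  have x: "x \<in> X" using openX_subset[OF S(1)] S(2) by blast
  obtain U f g h where U: "openX X U" "x \<in> U" "U \<subseteq> S" and s: "f \<in> sections U" "g \<in> sections U" "h \<in> sections U"
    and e: "a = germ X x f" "b = germ X x g" "c = germ X x h"
    by (rule stalk_rep3[OF openX_X x S a b c])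
  note ops = stalk_mult[OF openX_X x] stalk_add[OF openX_X x] stalk_smult[OF openX_X x]
  note diff = stalk_diff[OF openX_X x U(1,2)] and jac = stalk_bracket[OF x U(1,2)] and bs = bracket_sections[OF U(1)]
  have G: "gerstenhaber_square (stalk X x) (stalk_map X P x) (germ X x f, germ X x g, germ X x h)
      = germ X x (P U (P U f h) g)"
    if s: "f \<in> sections U" "g \<in> sections U" "h \<in> sections U" for f g h
  proof -
    have "(germ X x f, germ X x g, germ X x h) \<in> cube (stalk X x)"
      using stalk_germ[OF openX_X x U(1,2)] s by (simp add: cube_def)
    then show ?thesis
      by (simp add: gerstenhaber_square_def jac bs s diff bracket_square[OF U(1) s])
  qed
  have "harr_e1 (stalk X x) (gerstenhaber_square (stalk X x) (stalk_map X P x)) t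
      = germ X x (\<lambda>z. 1/6 * (2 * P U (P U f h) g z - 2 * P U (P U h f) g z + P U (P U f g) h z
          - P U (P U g f) h z + P U (P U g h) f z - P U (P U h g) f z))"
    using t unfolding abc e
    by (simp add: harr_e1_def G s ops diff bs sections_scale sections_add sections_diff)
  also have "\<dots> = germ X x (P U (P U f h) g)"
  proof (rule germ_eqI[OF openX_X x U(1,2)])
    fix z
    \<comment> \<open>Write T for the left-hand side. The first two terms of the projector give 4 T
      and, by this relation and skew symmetry, the other four give 2 T; the factor 1/6 restores
      T.\<close>
    have "P U (P U f h) g z = P U (P U f g) h z + P U (P U g h) f z"
      using bracket_square[OF U(1) s, of z] fun_cong[OF bracket_skew[OF U(1) s(1) bs[OF s(2,3)]], of z] by simp
    then show "1/6 * (2 * P U (P U f h) g z - 2 * P U (P U h f) g z + P U (P U f g) h z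
          - P U (P U g f) h z + P U (P U g h) f z - P U (P U h g) f z) = P U (P U f h) g z"
      using bracket_flip[OF U(1) s(3,1,2), of z] bracket_flip[OF U(1) s(2,1,3), of z] bracket_flip[OF U(1) s(3,2,1), of z]
      by simp
  qed
  also have "\<dots> = germ X x (hochschild_d q U f g h)"
    by (rule germ_eqI[OF openX_X x U(1,2)])
      (simp add: local_solutionD(2)[OF q U(1,3) s, symmetric] bracket_square[OF U(1) s])
  also have "\<dots> = hoch_d2 (stalk X x) (local_stalk_map X S q x) t"
  proof -
    note bil = local_solutionD(1)[OF q]
    note lsm = local_stalk_map_germ[OF openX_X x bil U] and qs = bilinear_map_onD(1)[OF bil U(1,3)]
    show ?thesis
      using t unfolding abc e hochschild_d_def
      by (simp add: hoch_d2_def lsm s ops diff qs sections_mult sections_add sections_diff)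
  qed
  finally show "harr_e1 (stalk X x) (gerstenhaber_square (stalk X x) (stalk_map X P x)) t
    = hoch_d2 (stalk X x) (local_stalk_map X S q x) t" .
qed (simp_all add: harr_e1_def hoch_d2_def)

theorem ob0_zero:
  assumes x: "x \<in> X" shows "ob0 X P x = one (Harr3 (stalk X x))"
proof (rule symmetric_local_solution[OF x])
  fix S q
  assume S: "openX X S" "x \<in> S" and q: "local_solution X P S q" and sym: "\<And>U a b. q U a b = q U b a"
  note bil = local_solutionD(1)[OF q]
  have "local_stalk_map X S q x a b = local_stalk_map X S q x b a"
    if a: "a \<in> carrier (stalk X x)" and b: "b \<in> carrier (stalk X x)" for a b
  proof -
    obtain U f g where U: "openX X U" "x \<in> U" "U \<subseteq> S" and s: "f \<in> sections U" "g \<in> sections U"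
      and e: "a = germ X x f" "b = germ X x g"
      by (rule stalk_rep3[OF openX_X x S a b b])
    show ?thesis unfolding e local_stalk_map_germ[OF openX_X x bil U s] local_stalk_map_germ[OF openX_X x bil U s(2,1)]
      by (simp add: sym[of U g])
  qed
  then have "hoch_d2 (stalk X x) (local_stalk_map X S q x) \<in> harr_B3 (stalk X x)"
    using local_stalk_map_cochain[OF S bil] unfolding harr_B3_def by blast
  then show ?thesis
    unfolding ob0_def
    by (intro born_cring.harrison_obstruction_zero[OF stalk_born_cring[OF openX_X x]]) (simp only: stalk_obstruction[OF S q])
qed

end

section \<open>Tyurina cohomology\<close>

lemma convergent_series_lin:
  assumes c: "c \<in> convergent_series n" and d: "d \<in> convergent_series n"
  shows "(\<lambda>\<alpha>. t * c \<alpha> + d \<alpha>) \<in> convergent_series n"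
proof -
  obtain r M where r: "r > 0" and M: "\<And>\<alpha>. cmod (c \<alpha>) * r ^ (\<Sum>i<n. \<alpha> i) \<le> M"
    using c unfolding convergent_series_def by auto
  obtain s N where s: "s > 0" and N: "\<And>\<alpha>. cmod (d \<alpha>) * s ^ (\<Sum>i<n. \<alpha> i) \<le> N"
    using d unfolding convergent_series_def by auto
  have "cmod (t * c \<alpha> + d \<alpha>) * min r s ^ (\<Sum>i<n. \<alpha> i) \<le> cmod t * M + N" for \<alpha>
  proof -
    let ?k = "\<Sum>i<n. \<alpha> i"
    have p: "min r s ^ ?k \<le> r ^ ?k" "min r s ^ ?k \<le> s ^ ?k" using r s by (intro power_mono; simp)+
    have "cmod (t * c \<alpha> + d \<alpha>) * min r s ^ ?k \<le> (cmod t * cmod (c \<alpha>) + cmod (d \<alpha>)) * min r s ^ ?k"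
      using r s by (intro mult_right_mono order_trans[OF norm_triangle_ineq]) (simp_all add: norm_mult)
    also have "\<dots> = cmod t * (cmod (c \<alpha>) * min r s ^ ?k) + cmod (d \<alpha>) * min r s ^ ?k"
      by (simp add: algebra_simps)
    also have "\<dots> \<le> cmod t * (cmod (c \<alpha>) * r ^ ?k) + cmod (d \<alpha>) * s ^ ?k"
      by (intro add_mono mult_left_mono p) simp_all
    also have "\<dots> \<le> cmod t * M + N" by (intro add_mono mult_left_mono M N) simp
    finally show ?thesis .
  qed
  moreover have "\<forall>\<alpha>. t * c \<alpha> + d \<alpha> \<noteq> 0 \<longrightarrow> (\<forall>i\<ge>n. \<alpha> i = 0)"
  proof (intro allI impI)
    fix \<alpha> i assume "t * c \<alpha> + d \<alpha> \<noteq> 0" "n \<le> i"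
    then have "c \<alpha> \<noteq> 0 \<or> d \<alpha> \<noteq> 0" by auto
    then show "\<alpha> i = 0" using c d \<open>n \<le> i\<close> unfolding convergent_series_def by blast
  qed
  ultimately show ?thesis unfolding convergent_series_def using r s
    by (intro CollectI conjI exI[of _ "min r s"] exI[of _ "cmod t * M + N"]) simp_all
qed

lemma convergent_series_zero: "(\<lambda>_. 0) \<in> convergent_series n"
  unfolding convergent_series_def by (intro CollectI conjI exI[of _ "1 :: real"] exI[of _ "0 :: real"], simp_all)

lemma convergent_series_sum:
  assumes "\<And>i. i \<in> I \<Longrightarrow> f i \<in> convergent_series n"
  shows "(\<lambda>\<alpha>. \<Sum>i\<in>I. f i \<alpha>) \<in> convergent_series n"
  using assms
proof (induction I rule: infinite_finite_induct)
  case (insert j I)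
  then show ?case using convergent_series_lin[of "f j" n "\<lambda>\<alpha>. \<Sum>i\<in>I. f i \<alpha>" 1] by simp
qed (simp_all add: convergent_series_zero)

text \<open>Each entry of \<gamma> can be split in \<open>Suc (\<gamma> i)\<close> ways, at most
  \<open>2 ^ \<gamma> i\<close>. The crude bound costs only a factor 2 in the radius of
  convergence.\<close>

lemma card_exponent_splittings:
  fixes \<gamma> :: "nat \<Rightarrow> nat"
  assumes "\<forall>i\<ge>n. \<gamma> i = 0"
  shows "card {(\<alpha>, \<beta>). (\<lambda>i. \<alpha> i + \<beta> i) = \<gamma>} \<le> 2 ^ (\<Sum>i<n. \<gamma> i)"
proof -
  let ?I = "{(\<alpha>, \<beta>). (\<lambda>i. \<alpha> i + \<beta> i) = \<gamma>}" and ?B = "PiE {..<n} (\<lambda>i. {..\<gamma> i})"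
  have "inj_on (\<lambda>(\<alpha>, \<beta>). restrict \<alpha> {..<n}) ?I"
  proof (rule inj_onI, clarify)
    fix \<alpha> \<beta> \<alpha>' \<beta>' :: "nat \<Rightarrow> nat"
    assume g: "\<gamma> = (\<lambda>i. \<alpha> i + \<beta> i)" "(\<lambda>i. \<alpha>' i + \<beta>' i) = (\<lambda>i. \<alpha> i + \<beta> i)" and r: "restrict \<alpha> {..<n} = restrict \<alpha>' {..<n}"
    have "\<alpha> i = \<alpha>' i \<and> \<beta> i = \<beta>' i" for i
    proof (cases "i < n")
      case True
      then have "\<alpha> i = \<alpha>' i" using fun_cong[OF r, of i] by simp
      then show ?thesis using fun_cong[OF g(2), of i] by simp
    next
      case False
      then have "\<gamma> i = 0" using assms by simp
      then show ?thesis using fun_cong[OF g(1), of i] fun_cong[OF g(2), of i] by simp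
    qed
    then show "\<alpha> = \<alpha>' \<and> \<beta> = \<beta>'" by (simp add: fun_eq_iff)
  qed
  moreover have "(\<lambda>(\<alpha>, \<beta>). restrict \<alpha> {..<n}) ` ?I \<subseteq> ?B"
    by (rule image_subsetI, rule PiE_I) auto
  ultimately have "card ?I \<le> card ?B" by (rule card_inj_on_le) (simp add: finite_PiE)
  also have "card ?B = (\<Prod>i<n. Suc (\<gamma> i))" by (simp add: card_PiE)
  also have "\<dots> \<le> (\<Prod>i<n. 2 ^ \<gamma> i)" by (intro prod_mono conjI Suc_leI less_exp) simp
  also have "\<dots> = 2 ^ (\<Sum>i<n. \<gamma> i)" by (simp add: power_sum)
  finally show ?thesis .
qed

text \<open>The coefficient estimate holds for half of the smaller radius: the lost factor 2 pays
  for the number of splittings of an exponent.\<close>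

lemma convergent_series_mult:
  assumes c: "c \<in> convergent_series n" and d: "d \<in> convergent_series n"
  shows "series_mult c d \<in> convergent_series n"
proof -
  obtain r M where r: "r > 0" and M: "\<And>\<alpha>. cmod (c \<alpha>) * r ^ (\<Sum>i<n. \<alpha> i) \<le> M"
    using c unfolding convergent_series_def by auto
  obtain s N where s: "s > 0" and N: "\<And>\<alpha>. cmod (d \<alpha>) * s ^ (\<Sum>i<n. \<alpha> i) \<le> N"
    using d unfolding convergent_series_def by auto
  define q where "q = min r s"
  have q: "q > 0" using r s by (simp add: q_def)
  have nn: "0 \<le> cmod (c (\<lambda>_. 0)) * r ^ (\<Sum>i<n. 0)" "0 \<le> cmod (d (\<lambda>_. 0)) * s ^ (\<Sum>i<n. 0)" by simp_all
  have M0: "0 \<le> M" "0 \<le> N"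
    using order_trans[OF nn(1) M[of "\<lambda>_. 0"]] order_trans[OF nn(2) N[of "\<lambda>_. 0"]] by simp_all
  have supp: "\<forall>i\<ge>n. \<gamma> i = 0" if nz: "series_mult c d \<gamma> \<noteq> 0" for \<gamma>
  proof -
    obtain \<alpha> \<beta> where ab: "(\<lambda>i. \<alpha> i + \<beta> i) = \<gamma>" "c \<alpha> * d \<beta> \<noteq> 0"
      using nz unfolding series_mult_def by (elim sum.not_neutral_contains_not_neutral) auto
    have "\<forall>i\<ge>n. \<alpha> i = 0" "\<forall>i\<ge>n. \<beta> i = 0" using c d ab(2) unfolding convergent_series_def by auto
    then show ?thesis using ab(1) by auto
  qed
  have "cmod (series_mult c d \<gamma>) * (q / 2) ^ (\<Sum>i<n. \<gamma> i) \<le> M * N" for \<gamma>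
  \<comment> \<open>The count of splittings requires that \<gamma> vanishes from \<open>n\<close>
    on, which \<open>supp\<close> provides for nonzero coefficients.\<close>
  proof (cases "series_mult c d \<gamma> = 0")
    case True
    then show ?thesis using M0 by simp
  next
    case False
    let ?I = "{(\<alpha>, \<beta>). (\<lambda>i. \<alpha> i + \<beta> i) = \<gamma>}" and ?k = "\<Sum>i<n. \<gamma> i"
    have t: "cmod (c \<alpha> * d \<beta>) * q ^ ?k \<le> M * N" if "(\<lambda>i. \<alpha> i + \<beta> i) = \<gamma>" for \<alpha> \<beta>
    proof -
      have "?k = (\<Sum>i<n. \<alpha> i) + (\<Sum>i<n. \<beta> i)" using that by (auto simp: sum.distrib)
      then have "cmod (c \<alpha> * d \<beta>) * q ^ ?k = (cmod (c \<alpha>) * q ^ (\<Sum>i<n. \<alpha> i)) * (cmod (d \<beta>) * q ^ (\<Sum>i<n. \<beta> i))"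
        by (simp add: norm_mult power_add)
      also have "\<dots> \<le> (cmod (c \<alpha>) * r ^ (\<Sum>i<n. \<alpha> i)) * (cmod (d \<beta>) * s ^ (\<Sum>i<n. \<beta> i))"
        using q r s by (intro mult_mono mult_left_mono power_mono mult_nonneg_nonneg zero_le_power) (auto simp: q_def)
      also have "\<dots> \<le> M * N" using M0 s by (intro mult_mono M N) simp_all
      finally show ?thesis .
    qed
    have "cmod (series_mult c d \<gamma>) * q ^ ?k \<le> (\<Sum>p\<in>?I. cmod (case p of (\<alpha>, \<beta>) \<Rightarrow> c \<alpha> * d \<beta>)) * q ^ ?k"
      unfolding series_mult_def using q by (intro mult_right_mono norm_sum) simp
    also have "\<dots> = (\<Sum>p\<in>?I. cmod (case p of (\<alpha>, \<beta>) \<Rightarrow> c \<alpha> * d \<beta>) * q ^ ?k)"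
      by (rule sum_distrib_right)
    also have "\<dots> \<le> of_nat (card ?I) * (M * N)"
      by (rule sum_bounded_above) (use t in auto)
    also have "\<dots> \<le> 2 ^ ?k * (M * N)"
      using of_nat_mono[OF card_exponent_splittings[OF supp[OF False]], where 'a = real] M0
      by (intro mult_right_mono) simp_all
    finally have "cmod (series_mult c d \<gamma>) * q ^ ?k / 2 ^ ?k \<le> M * N"
      by (simp add: divide_le_eq mult.commute)
    then show ?thesis by (simp add: power_divide)
  qed
  then show ?thesis
    unfolding convergent_series_def using supp q by (intro CollectI conjI allI impI exI[of _ "q / 2"] exI[of _ "M * N"]) auto
qed

lemma tyu_lin_closed:
  assumes x: "x \<in> tyu_carrier R" and y: "y \<in> tyu_carrier R" shows "tyu_lin t x y \<in> tyu_carrier R"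
proof -
  let ?S = "\<lambda>x :: tyu_elem. {\<mu>. x \<mu> \<noteq> (\<lambda>_. 0)}"
  have S: "?S (tyu_lin t x y) \<subseteq> ?S x \<union> ?S y" by (auto simp: tyu_lin_def)
  have "finite (?S x \<union> ?S y)" "?S x \<union> ?S y \<subseteq> gen_monomials R" using x y by (simp_all add: tyu_carrier_def)
  then have "finite (?S (tyu_lin t x y))" "?S (tyu_lin t x y) \<subseteq> gen_monomials R"
    using finite_subset[OF S] subset_trans[OF S] by simp_all
  moreover have "tyu_lin t x y \<mu> \<in> convergent_series (nvars R)" for \<mu>
    unfolding tyu_lin_def by (rule convergent_series_lin) (use x y in \<open>simp_all add: tyu_carrier_def\<close>)
  ultimately show ?thesis by (simp add: tyu_carrier_def)
qed

text \<open>Derivations are functions restricted to the carrier, and the Leibniz rule for a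
  restricted function presupposes that products stay inside.\<close>

lemma tyu_mult_closed:
  assumes x: "x \<in> tyu_carrier R" and y: "y \<in> tyu_carrier R" shows "tyu_mult R x y \<in> tyu_carrier R"
proof -
  let ?S = "\<lambda>x :: tyu_elem. {\<mu>. x \<mu> \<noteq> (\<lambda>_. 0)}"
  have conv: "tyu_mult R x y \<mu> \<in> convergent_series (nvars R)" for \<mu>
  proof (cases "\<mu> \<in> gen_monomials R")
    case True
    have "(\<lambda>\<gamma>. \<Sum>p\<in>{(\<mu>\<^sub>1, \<mu>\<^sub>2). (\<lambda>i. \<mu>\<^sub>1 i + \<mu>\<^sub>2 i) = \<mu>}.
        case p of (\<mu>\<^sub>1, \<mu>\<^sub>2) \<Rightarrow> koszul_sign R \<mu>\<^sub>1 \<mu>\<^sub>2 * series_mult (x \<mu>\<^sub>1) (y \<mu>\<^sub>2) \<gamma>) \<in> convergent_series (nvars R)"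
    proof (rule convergent_series_sum)
      fix p :: "(nat \<Rightarrow> nat) \<times> (nat \<Rightarrow> nat)"
      obtain \<mu>\<^sub>1 \<mu>\<^sub>2 where p: "p = (\<mu>\<^sub>1, \<mu>\<^sub>2)" by (cases p)
      have "x \<mu>\<^sub>1 \<in> convergent_series (nvars R)" "y \<mu>\<^sub>2 \<in> convergent_series (nvars R)" using x y by (simp_all add: tyu_carrier_def)
      from convergent_series_lin[OF convergent_series_mult[OF this] convergent_series_zero, of "koszul_sign R \<mu>\<^sub>1 \<mu>\<^sub>2"]
      show "(\<lambda>\<gamma>. case p of (\<mu>\<^sub>1, \<mu>\<^sub>2) \<Rightarrow> koszul_sign R \<mu>\<^sub>1 \<mu>\<^sub>2 * series_mult (x \<mu>\<^sub>1) (y \<mu>\<^sub>2) \<gamma>) \<in> convergent_series (nvars R)"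
        by (simp add: p)
    qed
    then show ?thesis using True by (simp add: tyu_mult_def[abs_def])
  next
    case False
    then show ?thesis by (simp add: tyu_mult_def[abs_def] convergent_series_zero)
  qed
  have "?S (tyu_mult R x y) \<subseteq> (\<lambda>(\<mu>\<^sub>1, \<mu>\<^sub>2) i. \<mu>\<^sub>1 i + \<mu>\<^sub>2 i) ` (?S x \<times> ?S y)"
  proof
    fix \<mu> assume "\<mu> \<in> ?S (tyu_mult R x y)"
    then obtain \<gamma> where "tyu_mult R x y \<mu> \<gamma> \<noteq> 0" by auto
    then have "(\<Sum>(\<mu>\<^sub>1, \<mu>\<^sub>2) | (\<lambda>i. \<mu>\<^sub>1 i + \<mu>\<^sub>2 i) = \<mu>. koszul_sign R \<mu>\<^sub>1 \<mu>\<^sub>2 * series_mult (x \<mu>\<^sub>1) (y \<mu>\<^sub>2) \<gamma>) \<noteq> 0"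
      by (auto simp: tyu_mult_def split: if_splits)
    then obtain \<mu>\<^sub>1 \<mu>\<^sub>2 where m: "(\<lambda>i. \<mu>\<^sub>1 i + \<mu>\<^sub>2 i) = \<mu>" "series_mult (x \<mu>\<^sub>1) (y \<mu>\<^sub>2) \<gamma> \<noteq> 0"
      by (elim sum.not_neutral_contains_not_neutral) auto
    from m(2) have "x \<mu>\<^sub>1 \<noteq> (\<lambda>_. 0)" "y \<mu>\<^sub>2 \<noteq> (\<lambda>_. 0)" by (auto simp: series_mult_def)
    then show "\<mu> \<in> (\<lambda>(\<mu>\<^sub>1, \<mu>\<^sub>2) i. \<mu>\<^sub>1 i + \<mu>\<^sub>2 i) ` (?S x \<times> ?S y)"
      using m(1) by (intro image_eqI[of _ _ "(\<mu>\<^sub>1, \<mu>\<^sub>2)"]) auto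
  qed
  then have "finite (?S (tyu_mult R x y))"
    by (rule finite_subset) (use x y in \<open>simp add: tyu_carrier_def\<close>)
  moreover have "?S (tyu_mult R x y) \<subseteq> gen_monomials R" by (auto simp: tyu_mult_def[abs_def])
  ultimately show ?thesis using conv by (simp add: tyu_carrier_def)
qed

text \<open>An element has finitely many monomials, and each of them with its coefficient is
  homogeneous; they are split off one at a time.\<close>

lemma tyu_induct:
  assumes x: "x \<in> tyu_carrier R" and zero: "P (\<lambda>_ _. 0)"
    and lin: "\<And>x y. x \<in> tyu_carrier R \<Longrightarrow> y \<in> tyu_carrier R \<Longrightarrow> P x \<Longrightarrow> P y \<Longrightarrow> P (tyu_lin 1 x y)"
    and part: "\<And>k x. x \<in> tyu_part R k \<Longrightarrow> P x"
  shows "P x"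
proof -
  let ?S = "\<lambda>x :: tyu_elem. {\<mu>. x \<mu> \<noteq> (\<lambda>_. 0)}"
  have "\<forall>x\<in>tyu_carrier R. ?S x \<subseteq> F \<longrightarrow> P x" if "finite F" for F
    using that
  proof induction
    case empty
    show ?case
    proof (intro ballI impI)
      fix x :: tyu_elem assume "?S x \<subseteq> {}"
      then have "x = (\<lambda>_ _. 0)" by (auto simp: fun_eq_iff)
      then show "P x" using zero by simp
    qed
  next
    case (insert \<mu> F)
    show ?case
    proof (intro ballI impI)
      fix x assume x: "x \<in> tyu_carrier R" and S: "?S x \<subseteq> insert \<mu> F"
      let ?y = "\<lambda>\<nu>. if \<nu> = \<mu> then x \<mu> else (\<lambda>_. 0)" and ?z = "x(\<mu> := \<lambda>_. 0)"
      have yS: "?S ?y \<subseteq> ?S x" and zS: "?S ?z \<subseteq> ?S x" "?S ?z \<subseteq> F" using S by auto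
      have fin: "finite (?S x)" "?S x \<subseteq> gen_monomials R" using x by (simp_all add: tyu_carrier_def)
      have y: "?y \<in> tyu_carrier R" and z: "?z \<in> tyu_carrier R"
        unfolding tyu_carrier_def
        using finite_subset[OF yS fin(1)] finite_subset[OF zS(1) fin(1)] subset_trans[OF yS fin(2)] subset_trans[OF zS(1) fin(2)] x
        by (simp_all add: tyu_carrier_def convergent_series_zero)
      have "?y \<in> tyu_part R (monomial_deg R \<mu>)" unfolding tyu_part_def using y by auto
      then have "P ?y" by (rule part)
      moreover have "P ?z" using insert.IH z zS(2) by blast
      ultimately have "P (tyu_lin 1 ?y ?z)" by (rule lin[OF y z])
      moreover have "tyu_lin 1 ?y ?z = x" by (intro ext) (simp add: tyu_lin_def)
      ultimately show "P x" by simp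
    qed
  qed
  then show ?thesis using x by (auto simp: tyu_carrier_def)
qed

section \<open>Derivations of a resolution and isomorphisms with Harrison cohomology\<close>

context born_cring
begin

context
  fixes R :: "'b tyurina_data"
  assumes R: "tyurina_resolution A R"
begin

lemma resolution_simps:
  shows "x \<in> tyu_carrier R \<Longrightarrow> y \<in> tyu_carrier R \<Longrightarrow> rho R (tyu_lin t x y) = tyu_lin t (rho R x) (rho R y)"
    "x \<in> tyu_part R 0 \<Longrightarrow> rho R x = (\<lambda>_ _. 0)"
    "x \<in> tyu_part R (Suc k) \<Longrightarrow> rho R x \<in> tyu_part R k"
    "x \<in> tyu_carrier R \<Longrightarrow> y \<in> tyu_carrier R \<Longrightarrow> aug R (tyu_lin t x y) = (t \<odot> aug R x) \<oplus> aug R y"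
    "x \<in> tyu_part R (Suc k) \<Longrightarrow> aug R x = \<zero>"
    "aug R ` tyu_part R 0 = carrier A"
proof -
  note c = R[unfolded tyurina_resolution_def, THEN conjunct2, THEN conjunct2]
  show "rho R (tyu_lin t x y) = tyu_lin t (rho R x) (rho R y)" if "x \<in> tyu_carrier R" "y \<in> tyu_carrier R"
    using c[THEN conjunct1] that by simp
  show "rho R x = (\<lambda>_ _. 0)" if "x \<in> tyu_part R 0"
    using c[THEN conjunct2, THEN conjunct1] that by simp
  show "rho R x \<in> tyu_part R k" if "x \<in> tyu_part R (Suc k)"
    using c[THEN conjunct2, THEN conjunct2, THEN conjunct1] that by simp
  note d = c[THEN conjunct2, THEN conjunct2, THEN conjunct2, THEN conjunct2, THEN conjunct2, THEN conjunct2]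
  show "aug R (tyu_lin t x y) = (t \<odot> aug R x) \<oplus> aug R y" if "x \<in> tyu_carrier R" "y \<in> tyu_carrier R"
    using d[THEN conjunct1] that by simp
  show "aug R x = \<zero>" if "x \<in> tyu_part R (Suc k)"
    using d[THEN conjunct2, THEN conjunct2, THEN conjunct1, THEN spec, THEN bspec, OF that] .
  show "aug R ` tyu_part R 0 = carrier A"
    using d[THEN conjunct2, THEN conjunct2, THEN conjunct2, THEN conjunct1] .
qed

lemma tyu_zero: "(\<lambda>_ _. 0) \<in> tyu_part R k"
  by (simp add: tyu_part_def tyu_carrier_def convergent_series_zero)

text \<open>The axioms of a resolution locate the values of \<open>rho\<close> and
  \<open>aug\<close> on homogeneous elements; linearity carries the closure over to all
  elements.\<close>

lemma rho_aug_closed: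
  assumes "x \<in> tyu_carrier R" shows "rho R x \<in> tyu_carrier R \<and> aug R x \<in> carrier A"
  using assms
proof (rule tyu_induct)
  have part: "rho R x \<in> tyu_carrier R \<and> aug R x \<in> carrier A" if x: "x \<in> tyu_part R k" for k x
  proof (cases k)
    case 0
    then show ?thesis using x tyu_zero[of 0] resolution_simps(2,6) by (auto simp: tyu_part_def)
  next
    case (Suc l)
    then show ?thesis using x resolution_simps(3)[of x l] resolution_simps(5)[of x l] by (simp add: tyu_part_def)
  qed
  then show "rho R x \<in> tyu_carrier R \<and> aug R x \<in> carrier A" if "x \<in> tyu_part R k" for k x using that .
  show "rho R (\<lambda>_ _. 0) \<in> tyu_carrier R \<and> aug R (\<lambda>_ _. 0) \<in> carrier A" by (rule part[OF tyu_zero])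
  fix x y assume "x \<in> tyu_carrier R" "y \<in> tyu_carrier R"
    "rho R x \<in> tyu_carrier R \<and> aug R x \<in> carrier A" "rho R y \<in> tyu_carrier R \<and> aug R y \<in> carrier A"
  then show "rho R (tyu_lin 1 x y) \<in> tyu_carrier R \<and> aug R (tyu_lin 1 x y) \<in> carrier A"
    by (simp add: resolution_simps(1,4) tyu_lin_closed smult_closed)
qed

lemmas rho_closed = rho_aug_closed[THEN conjunct1] and aug_closed = rho_aug_closed[THEN conjunct2]

lemma tyu_derD:
  assumes "D \<in> tyu_der A R i"
  shows "x \<in> tyu_carrier R \<Longrightarrow> D x \<in> carrier A"
    "k \<noteq> i \<Longrightarrow> x \<in> tyu_part R k \<Longrightarrow> D x = \<zero>"
    "x \<in> tyu_carrier R \<Longrightarrow> y \<in> tyu_carrier R \<Longrightarrow> D (tyu_lin t x y) = (t \<odot> D x) \<oplus> D y"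
    "x \<in> tyu_carrier R \<Longrightarrow> y \<in> tyu_carrier R \<Longrightarrow> D (tyu_mult R x y) = (D x \<otimes> aug R y) \<oplus> (aug R x \<otimes> D y)"
  using assms unfolding tyu_der_def by auto

lemma tyu_derI:
  assumes "\<And>x. x \<in> tyu_carrier R \<Longrightarrow> D x \<in> carrier A"
    "\<And>k x. k \<noteq> i \<Longrightarrow> x \<in> tyu_part R k \<Longrightarrow> D x = \<zero>"
    "\<And>x y t. x \<in> tyu_carrier R \<Longrightarrow> y \<in> tyu_carrier R \<Longrightarrow> D (tyu_lin t x y) = (t \<odot> D x) \<oplus> D y"
    "\<And>x y. x \<in> tyu_carrier R \<Longrightarrow> y \<in> tyu_carrier R \<Longrightarrow> D (tyu_mult R x y) = (D x \<otimes> aug R y) \<oplus> (aug R x \<otimes> D y)"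
  shows "restrict D (tyu_carrier R) \<in> tyu_der A R i"
  unfolding tyu_der_def
proof (intro CollectI conjI allI impI ballI)
  show "restrict D (tyu_carrier R) \<in> tyu_carrier R \<rightarrow>\<^sub>E carrier A" using assms(1) by auto
  show "restrict D (tyu_carrier R) x = \<zero>" if "k \<noteq> i" "x \<in> tyu_part R k" for k x
    using assms(2)[OF that] that(2) by (simp add: tyu_part_def)
qed (simp_all add: tyu_lin_closed tyu_mult_closed assms(3,4))

lemma tyu_der_zero: "restrict (\<lambda>_. \<zero>) (tyu_carrier R) \<in> tyu_der A R i"
  by (rule tyu_derI) (simp_all add: smult_zero aug_closed)

lemma tyu_der_add:
  assumes D: "D \<in> tyu_der A R i" and E: "E \<in> tyu_der A R i"
  shows "restrict (\<lambda>x. D x \<oplus> E x) (tyu_carrier R) \<in> tyu_der A R i"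
proof (rule tyu_derI)
  note c = tyu_derD(1)[OF D] tyu_derD(1)[OF E]
  show "D x \<oplus> E x \<in> carrier A" if "x \<in> tyu_carrier R" for x using c that by simp
  show "D x \<oplus> E x = \<zero>" if "k \<noteq> i" "x \<in> tyu_part R k" for k x
    using tyu_derD(2)[OF D that] tyu_derD(2)[OF E that] by simp
  fix x y assume xy: "x \<in> tyu_carrier R" "y \<in> tyu_carrier R"
  note v = c(1)[OF xy(1)] c(1)[OF xy(2)] c(2)[OF xy(1)] c(2)[OF xy(2)] aug_closed[OF xy(1)] aug_closed[OF xy(2)]
  show "D (tyu_lin t x y) \<oplus> E (tyu_lin t x y) = (t \<odot> (D x \<oplus> E x)) \<oplus> (D y \<oplus> E y)" for t
    unfolding tyu_derD(3)[OF D xy] tyu_derD(3)[OF E xy] smult_add[OF v(1,3)]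
    using v smult_closed[OF v(1), of t] smult_closed[OF v(3), of t] by (simp add: a_ac)
  show "D (tyu_mult R x y) \<oplus> E (tyu_mult R x y) = ((D x \<oplus> E x) \<otimes> aug R y) \<oplus> (aug R x \<otimes> (D y \<oplus> E y))"
    unfolding tyu_derD(4)[OF D xy] tyu_derD(4)[OF E xy] using v by (simp add: l_distr r_distr a_ac)
qed

lemma tyu_der_neg:
  assumes D: "D \<in> tyu_der A R i"
  shows "restrict (\<lambda>x. \<ominus> D x) (tyu_carrier R) \<in> tyu_der A R i"
proof (rule tyu_derI)
  note c = tyu_derD(1)[OF D]
  show "\<ominus> D x \<in> carrier A" if "x \<in> tyu_carrier R" for x using c that by simp
  show "\<ominus> D x = \<zero>" if "k \<noteq> i" "x \<in> tyu_part R k" for k x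
    using tyu_derD(2)[OF D that] by simp
  fix x y assume xy: "x \<in> tyu_carrier R" "y \<in> tyu_carrier R"
  note v = c(1)[OF xy(1)] c(1)[OF xy(2)] aug_closed[OF xy(1)] aug_closed[OF xy(2)]
  show "\<ominus> D (tyu_lin t x y) = (t \<odot> (\<ominus> D x)) \<oplus> (\<ominus> D y)" for t
    unfolding tyu_derD(3)[OF D xy] smult_neg[OF v(1)]
    using v smult_closed[OF v(1), of t] by (simp add: minus_add)
  show "\<ominus> D (tyu_mult R x y) = ((\<ominus> D x) \<otimes> aug R y) \<oplus> (aug R x \<otimes> (\<ominus> D y))"
    unfolding tyu_derD(4)[OF D xy] using v by (simp add: minus_add l_minus r_minus)
qed

lemma tyu_B2I: "D \<in> tyu_der A R 1 \<Longrightarrow> f = restrict (\<lambda>x. D (rho R x)) (tyu_carrier R) \<Longrightarrow> f \<in> tyu_B2 A R"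
  unfolding tyu_B2_def by blast

lemma tyu_B2_subgroup: "pointwise_subgroup A (tyu_carrier R) (tyu_B2 A R)"
  unfolding pointwise_subgroup_def
proof (intro conjI ballI subsetI)
  fix f assume "f \<in> tyu_B2 A R"
  then obtain D where D: "D \<in> tyu_der A R 1" "f = restrict (\<lambda>x. D (rho R x)) (tyu_carrier R)"
    unfolding tyu_B2_def by blast
  show "f \<in> tyu_carrier R \<rightarrow>\<^sub>E carrier A" unfolding D(2) using tyu_derD(1)[OF D(1) rho_closed] by auto
  show "restrict (\<lambda>x. \<ominus> f x) (tyu_carrier R) \<in> tyu_B2 A R"
    by (rule tyu_B2I[OF tyu_der_neg[OF D(1)]]) (auto simp: D(2) rho_closed)
next
  show "restrict (\<lambda>_. \<zero>) (tyu_carrier R) \<in> tyu_B2 A R"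
    by (rule tyu_B2I[OF tyu_der_zero]) (auto simp: rho_closed)
next
  fix f g assume "f \<in> tyu_B2 A R" "g \<in> tyu_B2 A R"
  then obtain D E where D: "D \<in> tyu_der A R 1" "f = restrict (\<lambda>x. D (rho R x)) (tyu_carrier R)"
    and E: "E \<in> tyu_der A R 1" "g = restrict (\<lambda>x. E (rho R x)) (tyu_carrier R)"
    unfolding tyu_B2_def by blast
  show "restrict (\<lambda>x. f x \<oplus> g x) (tyu_carrier R) \<in> tyu_B2 A R"
    by (rule tyu_B2I[OF tyu_der_add[OF D(1) E(1)]]) (auto simp: D(2) E(2) rho_closed)
qed

text \<open>A homomorphism sends the idempotent \<open>one\<close> to an idempotent coset, and this is the only one.\<close>

lemma Tyurina2_iso_one:
  assumes \<Phi>: "\<Phi> \<in> iso (Harr3 A) (Tyurina2 A R)"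
  shows "\<Phi> (one (Harr3 A)) = one (Tyurina2 A R)"
proof -
  have hom: "\<Phi> \<in> hom (Harr3 A) (Tyurina2 A R)" using \<Phi> by (simp add: iso_def)
  have "\<Phi> (harr_B3 A) \<in> carrier (Tyurina2 A R)" by (rule hom_in_carrier[OF hom Harr3_one_closed])
  then obtain D where D: "D \<in> carrier (tyu_Z2 A R)" and u: "\<Phi> (harr_B3 A) = tyu_B2 A R #>\<^bsub>tyu_Z2 A R\<^esub> D"
    by (auto simp: Tyurina2_def FactGroup_def RCOSETS_def)
  have "mult (Tyurina2 A R) (\<Phi> (harr_B3 A)) (\<Phi> (harr_B3 A)) = \<Phi> (harr_B3 A)"
    using hom_mult[OF hom Harr3_one_closed Harr3_one_closed] by (simp add: Harr3_one_idem)
  then have id: "(tyu_B2 A R #>\<^bsub>tyu_Z2 A R\<^esub> D) <#>\<^bsub>tyu_Z2 A R\<^esub> (tyu_B2 A R #>\<^bsub>tyu_Z2 A R\<^esub> D) = tyu_B2 A R #>\<^bsub>tyu_Z2 A R\<^esub> D"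
    unfolding u by (simp add: Tyurina2_def FactGroup_def)
  have m: "mult (tyu_Z2 A R) f g = restrict (\<lambda>t. f t \<oplus> g t) (tyu_carrier R)" for f g by (simp add: tyu_Z2_def)
  have "D \<in> tyu_carrier R \<rightarrow>\<^sub>E carrier A" using D by (simp add: tyu_Z2_def tyu_der_def)
  then have "\<Phi> (harr_B3 A) = tyu_B2 A R"
    unfolding u using id by (rule pointwise_idempotent[OF tyu_B2_subgroup m])
  then show ?thesis by (simp add: Harr3_one Tyurina2_def FactGroup_def)
qed

end

end

theorem corollary6p2:
  fixes Fs :: "(complex^'n \<Rightarrow> complex) list" and degs :: "nat list" and \<iota> :: "nat \<Rightarrow> 'n"
    and X :: "(complex^'n) set" and p :: "'n sheaf_map"
  assumes type: "(CARD('n), degs) \<in> {(4, [4]), (5, [3, 2]), (6, [2, 2, 2])}"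
    and coords: "bij_betw \<iota> {..<CARD('n)} UNIV"
    and polys: "list_all2 homogeneous_poly degs Fs"
    and K3: "K3_complete_intersection Fs"
  defines "X \<equiv> proj_zero_set Fs"
    and "p \<equiv> jacobian_bracket \<iota> Fs"
  shows "poisson_bracket X p \<and> ob0_vanishes X p \<and> ob1 X p = cech_H1_zero X"
proof -
  interpret jacobian_variety Fs degs \<iota>
  proof
    show card: "CARD('n) = length Fs + 3" and "smooth_complete_intersection Fs"
      using K3 by (simp_all add: K3_complete_intersection_def)
    \<comment> \<open>In each type the degrees add up to the number of homogeneous coordinates: 4, 3
      + 2 and 2 + 2 + 2.\<close>
    show "sum_list degs = length Fs + 3" "\<And>d. d \<in> set degs \<Longrightarrow> d \<ge> 1"
      unfolding card[symmetric] using type by auto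
  qed (fact coords polys)+
  have "ob0_vanishes (proj_zero_set Fs) (jacobian_bracket \<iota> Fs)"
    unfolding ob0_vanishes_def
  proof (intro ballI conjI allI impI, goal_cases)
    case (1 x)
    then show ?case by (rule ob0_zero)
  next
    case (2 x R \<Phi>)
    then show ?case
      unfolding ob0_zero[OF 2(1)]
      by (intro born_cring.Tyurina2_iso_one[OF stalk_born_cring[OF openX_X 2(1)]]) simp_all
  qed
  moreover have "ob1 (proj_zero_set Fs) (jacobian_bracket \<iota> Fs) = cech_H1_zero (proj_zero_set Fs)"
  proof (rule ob1_eq_zero[OF openX_X])
    fix z assume "z \<in> proj_zero_set Fs"
    then show "\<exists>S q. openX (proj_zero_set Fs) S \<and> z \<in> S \<and>
        local_solution (proj_zero_set Fs) (jacobian_bracket \<iota> Fs) S q \<and> (\<forall>U a b. q U a b = q U b a)"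
      by (rule symmetric_local_solution) (rule exI, rule exI, intro conjI allI)
  qed
  ultimately show ?thesis unfolding X_def p_def by (intro conjI bracket_poisson)
qed

end
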